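(* For $1<p<\infty$ and $n\in\mathbb N=\{0,1,2,\dots\}$, $$W_n^p(\mathbb R)={}^{+}H_n^p(\mathbb R)\oplus{}^{-}H_n^p(\mathbb R)$$ (direct sum of subspaces). Moreover, when $p=2$, this decomposition is orthogonal with respect to the $W_n^2$ inner product $\langle f,g\rangle_{W_n^2}=\sum_{k=0}^n\langle D^{(k)}f,D^{(k)}g\rangle_{L^2(\mathbb R)}$.
   Context: $\mathbb C^+$ and $\mathbb C^-$ are the open upper and lower half-planes. $H^p(\mathbb C^\pm)$ is the Hardy space of holomorphic $F$ on $\mathbb C^\pm$ with $\sup_{y>0}\int_{\mathbb R}|F(x\pm iy)|^p\,dx<\infty$; such $F$ have nontangential boundary values a.e. on $\mathbb R$. ${}^{\pm}H^p(\mathbb R)\subset L^p(\mathbb R)$ denotes the set of nontangential boundary values of functions in $H^p(\mathbb C^\pm)$. $W_n^p(\mathbb R)$ is the Sobolev space of $f\in L^p(\mathbb R)$ whose weak derivatives $D^{(k)}f$, $k=1,\dots,n$, exist and lie in $L^p(\mathbb R)$, with norm $\left(\sum_{k=0}^n\|D^{(k)}f\|_{L^p}^p\right)^{1/p}$; $W_0^p(\mathbb R)=L^p(\mathbb R)$ and $D^{(0)}f=f$. ${}^{\pm}H_n^p(\mathbb R)={}^{\pm}H^p(\mathbb R)\cap W_n^p(\mathbb R)$. *)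

theory Defs
  imports "HOL-Complex_Analysis.Complex_Analysis"
    "HOL-Library.Function_Algebras" "HOL-Library.Set_Algebras"
begin

text \<open>
  Elements of \<open>L\<^sup>p(\<real>)\<close> are represented by Lebesgue measurable functions. Every space below is
  closed under almost-everywhere equality, so it is a union of equivalence classes, and the zero
  vector is represented by \<open>ae_zero\<close>.
\<close>

definition Lp :: "real \<Rightarrow> (real \<Rightarrow> complex) set" where
  "Lp p = {f. f \<in> borel_measurable lebesgue \<and> integrable lebesgue (\<lambda>x. norm (f x) powr p)}"

definition ae_zero :: "(real \<Rightarrow> complex) set" where
  "ae_zero = {f. AE x in lebesgue. f x = 0}"


text \<open>The parameter \<open>s\<close> is the sign \<open>1\<close> (upper half-plane) or \<open>-1\<close> (lower half-plane).\<close>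

definition half_plane :: "real \<Rightarrow> complex set" where
  "half_plane s = {z. 0 < s * Im z}"

definition hardy :: "real \<Rightarrow> real \<Rightarrow> (complex \<Rightarrow> complex) set" where
  "hardy s p = {F. F holomorphic_on half_plane s \<and>
     (SUP y\<in>{0<..}. \<integral>\<^sup>+ x. ennreal (norm (F (Complex x (s * y))) powr p) \<partial>lebesgue) < \<infinity>}"

definition stolz_cone :: "real \<Rightarrow> real \<Rightarrow> real \<Rightarrow> complex set" where
  "stolz_cone s \<alpha> x = {z \<in> half_plane s. \<bar>Re z - x\<bar> < \<alpha> * \<bar>Im z\<bar>}"

definition has_nontangential_limit :: "real \<Rightarrow> (complex \<Rightarrow> complex) \<Rightarrow> real \<Rightarrow> complex \<Rightarrow> bool" where
  "has_nontangential_limit s F x l \<longleftrightarrow>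
     (\<forall>\<alpha>>0. (F \<longlongrightarrow> l) (at (complex_of_real x) within stolz_cone s \<alpha> x))"

definition hardy_boundary :: "real \<Rightarrow> real \<Rightarrow> (real \<Rightarrow> complex) set" where
  "hardy_boundary s p =
     {f \<in> Lp p. \<exists>F \<in> hardy s p. AE x in lebesgue. has_nontangential_limit s F x (f x)}"


definition test_function :: "(real \<Rightarrow> real) \<Rightarrow> bool" where
  "test_function \<phi> \<longleftrightarrow>
     (\<forall>k x. (deriv ^^ k) \<phi> differentiable (at x)) \<and> compact (closure {x. \<phi> x \<noteq> 0})"

definition locally_integrable :: "(real \<Rightarrow> complex) \<Rightarrow> bool" where
  "locally_integrable f \<longleftrightarrow> (\<forall>K. compact K \<longrightarrow> set_integrable lebesgue K f)"

definition has_weak_deriv :: "nat \<Rightarrow> (real \<Rightarrow> complex) \<Rightarrow> (real \<Rightarrow> complex) \<Rightarrow> bool" where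
  "has_weak_deriv k f g \<longleftrightarrow> locally_integrable f \<and> locally_integrable g \<and>
     (\<forall>\<phi>. test_function \<phi> \<longrightarrow>
        (LINT x|lebesgue. f x * complex_of_real ((deriv ^^ k) \<phi> x)) =
        (-1) ^ k * (LINT x|lebesgue. g x * complex_of_real (\<phi> x)))"

text \<open>Weak derivatives are unique up to null sets; \<open>weak_deriv\<close> picks some representative.\<close>

definition weak_deriv :: "nat \<Rightarrow> (real \<Rightarrow> complex) \<Rightarrow> (real \<Rightarrow> complex)" where
  "weak_deriv k f = (if k = 0 then f else (SOME g. has_weak_deriv k f g))"

definition sobolev :: "nat \<Rightarrow> real \<Rightarrow> (real \<Rightarrow> complex) set" where
  "sobolev n p = {f \<in> Lp p. \<forall>k\<in>{1..n}. \<exists>g \<in> Lp p. has_weak_deriv k f g}"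

definition sobolev_inner :: "nat \<Rightarrow> (real \<Rightarrow> complex) \<Rightarrow> (real \<Rightarrow> complex) \<Rightarrow> complex" where
  "sobolev_inner n f g =
     (\<Sum>k\<le>n. LINT x|lebesgue. weak_deriv k f x * cnj (weak_deriv k g x))"

definition hardy_sobolev :: "real \<Rightarrow> nat \<Rightarrow> real \<Rightarrow> (real \<Rightarrow> complex) set" where
  "hardy_sobolev s n p = hardy_boundary s p \<inter> sobolev n p"


definition fun_scale :: "complex \<Rightarrow> (real \<Rightarrow> complex) \<Rightarrow> (real \<Rightarrow> complex)" where
  "fun_scale c f = (\<lambda>x. c * f x)"

global_interpretation fun_space: vector_space fun_scale
  defines fun_subspace = fun_space.subspace
  by unfold_locales (auto simp: fun_scale_def algebra_simps)

text \<open>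
  Here \<open>A + B\<close> is the elementwise sum of sets of functions. Modulo null functions, the
  conditions say that \<open>V\<close> is the internal direct sum of the subspaces \<open>A\<close> and \<open>B\<close>.
\<close>

definition ae_direct_sum ::
  "(real \<Rightarrow> complex) set \<Rightarrow> (real \<Rightarrow> complex) set \<Rightarrow> (real \<Rightarrow> complex) set \<Rightarrow> bool" where
  "ae_direct_sum V A B \<longleftrightarrow> fun_subspace A \<and> fun_subspace B \<and> V = A + B \<and> A \<inter> B = ae_zero"

end

theory Submission
  imports Defs
begin

text \<open>
  The Cauchy integral of \<open>f \<in> L\<^sup>p\<close> splits the Poisson integral of \<open>f\<close> into a function on the upper
  and one on the lower half-plane. By the theorem of M. Riesz both lie in \<open>H\<^sup>p\<close>: for \<open>1 < p \<le> 2\<close>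
  and \<open>f \<ge> 0\<close>, the function \<open>\<Phi> = 2 cauchy f\<close> has positive real part, so \<open>\<bar>\<Phi>\<bar>\<^sup>p \<le> a (Re \<Phi>)\<^sup>p - b Re (\<Phi>\<^sup>p)\<close>
  pointwise, \<open>\<Phi>\<^sup>p\<close> integrates to \<open>0\<close> along horizontal lines, and \<open>Re \<Phi>\<close> is the Poisson integral of
  \<open>f\<close>; for \<open>p > 2\<close> one argues by duality. Conversely, every function in \<open>H\<^sup>p\<close> of the upper half-plane
  is the Cauchy integral of its boundary values, and that integral vanishes on the lower half-plane.
  Hence the boundary values of \<open>H\<^sup>p\<close> are exactly the \<open>h \<in> L\<^sup>p\<close> whose Cauchy integral vanishes on the
  other half-plane, which makes the sum direct and, by Fubini, the two summands orthogonal for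
  \<open>p = 2\<close>. Finally the Cauchy integral commutes with weak derivatives, so it respects the Sobolev
  spaces, and all derivatives of a Hardy--Sobolev function are again Hardy functions.
\<close>

section \<open>Lebesgue spaces on the line\<close>

text \<open>The Cauchy kernel is not integrable up to the line, so an L^p bound for
  \<open>cauchy f\<close> on horizontal lines does not by itself yield a boundary function. It has
  to be constructed: differences of two horizontal traces of \<open>cauchy f\<close> are controlled
  by differences of Poisson integrals, which tend to 0 in norm. Nontangential limits are proved for
  Poisson integrals only; the Poisson kernel is dominated by a sum of interval averages, so a
  covering argument controls it. All estimates concern p-th powers of norms: pairings are bounded by
  Young's inequality with a free scale, and sums cost a factor 2^p. In the M. Riesz step p \<le> 2
  keeps the argument of the p-th power within [-pi, pi] and makes its real part negative near the
  imaginary axis, exactly where Re \<Phi> fails to control the modulus of \<Phi>. Bounded support of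
  f supplies the decay that makes the p-th power integrable along lines.\<close>

definition pnorm :: "real \<Rightarrow> (real \<Rightarrow> complex) \<Rightarrow> ennreal" where
  "pnorm p f = (\<integral>\<^sup>+ x. ennreal (norm (f x) powr p) \<partial>lborel)"

text \<open>Borel functions rather than Lebesgue measurable ones, so that Fubini on
  \<open>lborel\<close> applies directly. \<open>Lp_iff\<close> connects \<open>lp\<close> with
  \<open>Lp\<close>.\<close>

definition lp :: "real \<Rightarrow> (real \<Rightarrow> complex) \<Rightarrow> bool" where
  "lp p f \<longleftrightarrow> f \<in> borel_measurable borel \<and> pnorm p f < \<infinity>"

section \<open>Elementary inequalities for real powers\<close>

lemma young:
  fixes a b :: real
  assumes "1 < p" "1 < q" "1/p + 1/q = 1" "0 \<le> a" "0 \<le> b"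
  shows "a * b \<le> a powr p + b powr q"
proof -
  have "a * b \<le> a powr p / p + b powr q / q"
    using Youngs_inequality[of p q a b] assms by auto
  also have "\<dots> \<le> a powr p + b powr q"
    using assms by (intro add_mono) (auto simp: divide_le_eq intro!: mult_left_le mult_le_cancel_left1[THEN iffD2])
  finally show ?thesis .
qed

text \<open>Convexity of the p-th power: its graph lies above the tangent at \<open>m\<close>. The
  source is Young's inequality for \<open>a\<close> and \<open>m powr (p - 1)\<close>, with equality
  at a = m. Integrated against a probability density it becomes Jensen's inequality in
  \<open>poisson_pointwise\<close>.\<close>

lemma powr_tangent:
  fixes a m :: real
  assumes "1 < p" "0 \<le> a" "0 \<le> m"
  shows "m powr p + p * m powr (p - 1) * (a - m) \<le> a powr p"
proof -
  define q where "q = p / (p - 1)"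
  have q: "1 < q" "1/p + 1/q = 1" using assms by (auto simp: q_def field_simps)
  have e: "(m powr (p-1)) powr q = m powr p"
    using assms by (simp add: powr_powr q_def)
  have "a * m powr (p-1) \<le> a powr p / p + m powr p / q"
    using Youngs_inequality[of p q a "m powr (p-1)"] assms q e by auto
  then have "p * (a * m powr (p-1)) \<le> p * (a powr p / p + m powr p / q)"
    using assms by (intro mult_left_mono) auto
  also have "\<dots> = a powr p + (p - 1) * m powr p"
    using assms by (simp add: q_def field_simps)
  finally have "p * m powr (p-1) * a \<le> a powr p + (p - 1) * m powr p" by (simp add: ac_simps)
  moreover have "m powr (p - 1) * m = m powr p"
    using assms by (cases "m = 0") (auto simp: powr_diff)
  ultimately show ?thesis by (simp add: algebra_simps)
qed

lemma powr_add_le: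
  fixes a b :: real
  assumes "0 \<le> p" "0 \<le> a" "0 \<le> b"
  shows "(a + b) powr p \<le> 2 powr p * (a powr p + b powr p)"
proof -
  have "(a + b) powr p \<le> (2 * max a b) powr p"
    using assms by (intro powr_mono2) auto
  also have "\<dots> = 2 powr p * max a b powr p" using assms by (simp add: powr_mult)
  also have "max a b powr p \<le> a powr p + b powr p" by (auto simp: max_def)
  finally show ?thesis by simp
qed

lemma norm_add_powr_le:
  fixes a b :: "'a::real_normed_vector"
  assumes "0 \<le> p"
  shows "norm (a + b) powr p \<le> 2 powr p * (norm a powr p + norm b powr p)"
proof -
  have "norm (a + b) powr p \<le> (norm a + norm b) powr p"
    using assms by (intro powr_mono2 norm_triangle_ineq) auto
  also have "\<dots> \<le> 2 powr p * (norm a powr p + norm b powr p)"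
    using assms by (intro powr_add_le) auto
  finally show ?thesis .
qed

section \<open>Calculus of p-th power integrals\<close>

lemma pnorm_mono:
  assumes "0 \<le> p" "\<And>x. norm (f x) \<le> norm (g x)"
  shows "pnorm p f \<le> pnorm p g"
  unfolding pnorm_def using assms by (intro nn_integral_mono ennreal_leI powr_mono2) auto

lemma pnorm_cmult:
  assumes [measurable]: "f \<in> borel_measurable borel"
  shows "pnorm p (\<lambda>x. c * f x) = ennreal (norm c powr p) * pnorm p f"
  unfolding pnorm_def by (simp add: norm_mult powr_mult ennreal_mult' nn_integral_cmult)

text \<open>No root is taken in \<open>pnorm\<close>, so the triangle inequality holds in the form
  inherited from \<open>norm_add_powr_le\<close>, with the constant 2^p.\<close>

lemma pnorm_add:
  assumes [measurable]: "f \<in> borel_measurable borel" "g \<in> borel_measurable borel" and p: "0 \<le> p"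
  shows "pnorm p (\<lambda>x. f x + g x) \<le> ennreal (2 powr p) * (pnorm p f + pnorm p g)"
proof -
  have "pnorm p (\<lambda>x. f x + g x) \<le> (\<integral>\<^sup>+ x. ennreal (2 powr p) * (ennreal (norm (f x) powr p) + ennreal (norm (g x) powr p)) \<partial>lborel)"
    unfolding pnorm_def using norm_add_powr_le[OF p]
    by (intro nn_integral_mono) (auto simp flip: ennreal_plus ennreal_mult' intro!: ennreal_leI)
  also have "\<dots> = ennreal (2 powr p) * (pnorm p f + pnorm p g)"
    unfolding pnorm_def by (simp add: nn_integral_cmult nn_integral_add)
  finally show ?thesis .
qed

lemma pnorm_cnj [simp]: "pnorm p (\<lambda>x. cnj (f x)) = pnorm p f"
  by (simp add: pnorm_def)

lemma pnorm_minus [simp]: "pnorm p (\<lambda>x. - f x) = pnorm p f"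
  by (simp add: pnorm_def)

lemma pnorm_diff:
  assumes [measurable]: "f \<in> borel_measurable borel" "g \<in> borel_measurable borel" and p: "0 \<le> p"
  shows "pnorm p (\<lambda>x. f x - g x) \<le> ennreal (2 powr p) * (pnorm p f + pnorm p g)"
  using pnorm_add[of f "\<lambda>x. - g x" p] p by simp

lemma lp_measurable [measurable_dest]: "lp p f \<Longrightarrow> f \<in> borel_measurable borel"
  by (simp add: lp_def)

lemma lp_pnorm: "lp p f \<Longrightarrow> pnorm p f < \<infinity>"
  by (simp add: lp_def)

lemma lp_integrable:
  "lp p f \<longleftrightarrow> f \<in> borel_measurable borel \<and> integrable lborel (\<lambda>x. norm (f x) powr p)"
  by (auto simp: lp_def pnorm_def integrable_iff_bounded)

lemma lp_mono:
  assumes "lp p g" "f \<in> borel_measurable borel" "0 \<le> p" "\<And>x. norm (f x) \<le> norm (g x)"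
  shows "lp p f"
  using pnorm_mono[of p f g] assms by (auto simp: lp_def intro: le_less_trans)

lemma lp_cmult: "lp p f \<Longrightarrow> lp p (\<lambda>x. c * f x)"
  by (auto simp: lp_def pnorm_cmult ennreal_mult_less_top)

lemma lp_add: "0 \<le> p \<Longrightarrow> lp p f \<Longrightarrow> lp p g \<Longrightarrow> lp p (\<lambda>x. f x + g x)"
  by (auto simp: lp_def ennreal_mult_less_top intro!: le_less_trans[OF pnorm_add])

lemma lp_cnj: "lp p f \<Longrightarrow> lp p (\<lambda>x. cnj (f x))"
  by (auto simp: lp_def intro!: borel_measurable_continuous_on[of cnj f] continuous_intros)

lemma lp_minus: "lp p f \<Longrightarrow> lp p (\<lambda>x. - f x)"
  by (auto simp: lp_def)

lemma lp_diff: "0 \<le> p \<Longrightarrow> lp p f \<Longrightarrow> lp p g \<Longrightarrow> lp p (\<lambda>x. f x - g x)"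
  using lp_add[of p f "\<lambda>x. - g x"] lp_minus by auto

lemma lp_mult_integrable:
  assumes "lp p f" "lp q g" "1 < p" "1 < q" "1/p + 1/q = 1"
  shows "integrable lborel (\<lambda>x. f x * g x)"
proof (rule Bochner_Integration.integrable_bound)
  show "integrable lborel (\<lambda>x. norm (f x) powr p + norm (g x) powr q)"
    using assms by (auto simp: lp_integrable)
  show "AE x in lborel. norm (f x * g x) \<le> norm (norm (f x) powr p + norm (g x) powr q)"
    using young[OF assms(3-5)] by (auto simp: norm_mult)
qed (use assms in measurable)

text \<open>On the positive half-line the primitive (1 + t)^(1 - q) / (1 - q) tends to 0 because q >
  1; the negative half-line is its mirror image. Counting the point 0 twice is harmless in an upper
  bound.\<close>

lemma decay_nn_integral:
  fixes q :: real
  assumes "1 < q"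
  shows "(\<integral>\<^sup>+ t. ennreal ((1 + \<bar>t\<bar>) powr (-q)) \<partial>lborel) < \<infinity>"
proof -
  have pos: "(\<integral>\<^sup>+ t. ennreal ((1 + \<bar>t\<bar>) powr (-q)) * indicator {0..} t \<partial>lborel) < \<infinity>"
  proof -
    have "((\<lambda>t::real. (1 + t) powr (1 - q)) \<longlongrightarrow> 0) at_top"
      by (rule tendsto_neg_powr) (use assms in \<open>auto intro!: filterlim_tendsto_add_at_top tendsto_const filterlim_ident\<close>)
    then have "((\<lambda>t::real. (1 + t) powr (1 - q) / (1 - q)) \<longlongrightarrow> 0 / (1 - q)) at_top"
      using assms by (intro tendsto_divide tendsto_const) auto
    then have l: "((\<lambda>t::real. (1 + t) powr (1 - q) / (1 - q)) \<longlongrightarrow> 0) at_top" by simp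
    have D: "((\<lambda>t. (1 + t) powr (1 - q) / (1 - q)) has_real_derivative (1 + \<bar>t\<bar>) powr (-q)) (at t)" if "0 \<le> t" for t
    proof -
      have "((\<lambda>t. (1 + t) powr (1 - q)) has_real_derivative (1 - q) * (1 + t) powr (1 - q - of_nat 1) * 1) (at t)"
        by (rule DERIV_fun_powr) (use that in \<open>auto intro!: derivative_eq_intros\<close>)
      from DERIV_cdivide[OF this, of "1 - q"] show ?thesis using assms that by simp
    qed
    have "(\<integral>\<^sup>+ t. ennreal ((1 + \<bar>t\<bar>) powr (-q)) * indicator {0..} t \<partial>lborel)
        = ennreal (0 - (1 + 0) powr (1 - q) / (1 - q))"
      by (rule nn_integral_FTC_atLeast[where F = "\<lambda>t. (1 + t) powr (1 - q) / (1 - q)"])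
         (use assms l D in auto)
    then show ?thesis by simp
  qed
  have neg: "(\<integral>\<^sup>+ t. ennreal ((1 + \<bar>t\<bar>) powr (-q)) * indicator {..0} t \<partial>lborel) < \<infinity>"
  proof -
    have "(\<integral>\<^sup>+ t. ennreal ((1 + \<bar>t\<bar>) powr (-q)) * indicator {..0} t \<partial>lborel)
       = (\<integral>\<^sup>+ t. ennreal ((1 + \<bar>- t\<bar>) powr (-q)) * indicator {..0} (- t) \<partial>lborel)"
      using nn_integral_real_affine[of "\<lambda>t. ennreal ((1 + \<bar>t\<bar>) powr (-q)) * indicator {..0} t" "-1" 0] by simp
    also have "\<dots> = (\<integral>\<^sup>+ t. ennreal ((1 + \<bar>t\<bar>) powr (-q)) * indicator {0..} t \<partial>lborel)"
      by (intro nn_integral_cong) (auto simp: indicator_def)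
    finally show ?thesis using pos by simp
  qed
  have "(\<integral>\<^sup>+ t. ennreal ((1 + \<bar>t\<bar>) powr (-q)) \<partial>lborel)
     \<le> (\<integral>\<^sup>+ t. ennreal ((1 + \<bar>t\<bar>) powr (-q)) * indicator {0..} t + ennreal ((1 + \<bar>t\<bar>) powr (-q)) * indicator {..0} t \<partial>lborel)"
    by (intro nn_integral_mono) (auto simp: indicator_def)
  also have "\<dots> = (\<integral>\<^sup>+ t. ennreal ((1 + \<bar>t\<bar>) powr (-q)) * indicator {0..} t \<partial>lborel)
     + (\<integral>\<^sup>+ t. ennreal ((1 + \<bar>t\<bar>) powr (-q)) * indicator {..0} t \<partial>lborel)"
    by (rule nn_integral_add) auto
  also have "\<dots> < \<infinity>" using pos neg by simp
  finally show ?thesis .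
qed

lemma decay_integrable:
  "1 < q \<Longrightarrow> integrable lborel (\<lambda>t::real. (1 + \<bar>t\<bar>) powr (-q))"
  using decay_nn_integral[of q] by (auto simp: integrable_iff_bounded)

lemma lp_decay:
  assumes q: "1 < q" and [measurable]: "k \<in> borel_measurable borel"
    and C: "\<And>t. norm (k t) \<le> C / (1 + \<bar>t\<bar>)"
  shows "lp q k"
  unfolding lp_integrable
proof (rule conjI, fact, rule Bochner_Integration.integrable_bound)
  show "integrable lborel (\<lambda>t. C powr q * (1 + \<bar>t\<bar>) powr (-q))"
    by (intro integrable_mult_right decay_integrable q)
  have C0: "0 \<le> C" using order_trans[OF norm_ge_zero C[of 0]] by simp
  have "norm (k t) powr q \<le> C powr q * (1 + \<bar>t\<bar>) powr - q" for t
  proof -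
    have "norm (k t) powr q \<le> (C / (1 + \<bar>t\<bar>)) powr q"
      using q C by (intro powr_mono2) auto
    then show ?thesis using C0 by (simp add: powr_divide powr_minus divide_simps)
  qed
  then show "AE t in lborel. norm (norm (k t) powr q) \<le> norm (C powr q * (1 + \<bar>t\<bar>) powr - q)"
    by auto
qed measurable

text \<open>For small |t| the bound by |Im z| decides, for large |t| the triangle inequality;
  \<open>d\<close> collects both constants. Hence the Cauchy kernel decays like 1 / (1 + |t|) and
  lies in every L^q with q > 1.\<close>

lemma kernel_lower_bound:
  fixes z :: complex
  assumes "Im z \<noteq> 0"
  obtains c where "0 < c" "\<And>t. c * (1 + \<bar>t\<bar>) \<le> norm (of_real t - z)"
proof
  define d where "d = (1 + norm z) / \<bar>Im z\<bar> + 1"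
  have d: "0 < d" using assms by (auto simp: d_def intro!: add_nonneg_pos)
  then show "0 < 1 / d" by simp
  fix t :: real
  have a: "\<bar>Im z\<bar> \<le> norm (of_real t - z)"
    using abs_Im_le_cmod[of "of_real t - z"] by simp
  have "\<bar>t\<bar> \<le> norm (of_real t - z) + norm z"
    using norm_triangle_ineq[of "of_real t - z" z] by simp
  then have "1 + \<bar>t\<bar> \<le> 1 + norm z + norm (of_real t - z)" by simp
  also have "1 + norm z \<le> (1 + norm z) / \<bar>Im z\<bar> * norm (of_real t - z)"
    using mult_left_mono[OF a, of "(1 + norm z) / \<bar>Im z\<bar>"] assms by simp
  finally have "1 + \<bar>t\<bar> \<le> d * norm (of_real t - z)" by (simp add: d_def algebra_simps)
  then show "1 / d * (1 + \<bar>t\<bar>) \<le> norm (of_real t - z)" using d by (simp add: field_simps)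
qed

lemma lp_kernel:
  assumes "Im z \<noteq> 0" "1 < q"
  shows "lp q (\<lambda>t. 1 / (of_real t - z))"
proof -
  obtain c where c: "0 < c" "\<And>t. c * (1 + \<bar>t\<bar>) \<le> norm (of_real t - z)"
    using kernel_lower_bound[OF assms(1)] by blast
  show ?thesis
  proof (rule lp_decay[OF assms(2), of _ "1 / c"])
    fix t :: real
    have "norm (1 / (of_real t - z)) = 1 / norm (of_real t - z)" by (simp add: norm_divide)
    also have "\<dots> \<le> 1 / (c * (1 + \<bar>t\<bar>))"
      using c by (intro divide_left_mono) (auto intro!: mult_pos_pos less_le_trans[OF _ c(2)])
    finally show "norm (1 / (of_real t - z)) \<le> 1 / c / (1 + \<bar>t\<bar>)" by simp
  qed measurable
qed

lemma kernel_nonzero: "Im z \<noteq> 0 \<Longrightarrow> of_real t - z \<noteq> 0"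
  by (auto simp: complex_eq_iff)

section \<open>Almost everywhere limits of bounded sequences\<close>

text \<open>Fatou's lemma for p-th powers. This is how uniform norm bounds survive when truncations
  are removed or heights tend to 0.\<close>

lemma pnorm_fatou:
  assumes [measurable]: "\<And>j::nat. f j \<in> borel_measurable borel"
    and lim: "AE x in lborel. (\<lambda>j. f j x) \<longlonglongrightarrow> g x"
    and p: "0 < p" and M: "\<And>j. pnorm p (f j) \<le> M"
  shows "pnorm p g \<le> M"
proof -
  have "pnorm p g = (\<integral>\<^sup>+ x. liminf (\<lambda>j. ennreal (norm (f j x) powr p)) \<partial>lborel)"
    unfolding pnorm_def
  proof (intro nn_integral_cong_AE, use lim in eventually_elim)
    fix x assume "(\<lambda>j. f j x) \<longlonglongrightarrow> g x"
    then have "(\<lambda>j. ennreal (norm (f j x) powr p)) \<longlonglongrightarrow> ennreal (norm (g x) powr p)"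
      using p by (intro tendsto_ennrealI tendsto_powr' tendsto_norm tendsto_const) auto
    then show "ennreal (norm (g x) powr p) = liminf (\<lambda>j. ennreal (norm (f j x) powr p))"
      by (rule lim_imp_Liminf[OF sequentially_bot, symmetric])
  qed
  also have "\<dots> \<le> liminf (\<lambda>j. pnorm p (f j))"
    unfolding pnorm_def by (intro nn_integral_liminf) auto
  also have "\<dots> \<le> M"
    using Liminf_mono[of "\<lambda>j. pnorm p (f j)" "\<lambda>_. M" sequentially] M by (simp add: Liminf_const)
  finally show ?thesis .
qed

text \<open>
  With \<open>h = f j - g\<close>, the part of \<open>\<bar>h k\<bar>\<close> where \<open>\<bar>h\<bar> \<le> l \<bar>k\<bar>\<^sup>q\<^sup>-\<^sup>1\<close> is dominated by \<open>l \<bar>k\<bar>\<^sup>q\<close>; on the rest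
  \<open>\<bar>h k\<bar> \<le> l\<^sup>1\<^sup>-\<^sup>p \<bar>h\<bar>\<^sup>p\<close>, which is small for large \<open>l\<close>.
\<close>

lemma lp_weak_convergence:
  assumes pq: "1 < p" "1 < q" "1/p + 1/q = 1"
    and f[measurable]: "\<And>j::nat. f j \<in> borel_measurable borel" and g[measurable]: "g \<in> borel_measurable borel"
    and lim: "AE x in lborel. (\<lambda>j. f j x) \<longlonglongrightarrow> g x"
    and M: "\<And>j. pnorm p (f j) \<le> M" "M < \<infinity>" and k: "lp q k"
  shows "(\<lambda>j. \<integral>x. f j x * k x \<partial>lborel) \<longlonglongrightarrow> (\<integral>x. g x * k x \<partial>lborel)"
proof -
  have km[measurable]: "k \<in> borel_measurable borel" using k by (rule lp_measurable)
  have lpf: "lp p (f j)" for j using M(1)[of j] M(2) by (auto simp: lp_def)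
  have "pnorm p g \<le> M" by (rule pnorm_fatou[OF f lim _ M(1)]) (use pq in auto)
  then have lpg: "lp p g" using M by (auto simp: lp_def)
  define h where "h = (\<lambda>j x. f j x - g x)"
  have [measurable]: "h j \<in> borel_measurable borel" for j by (simp add: h_def)
  define M' where "M' = enn2real (2 powr p * (M + M))"
  have M'0: "0 \<le> M'" by (simp add: M'_def)
  have hM: "pnorm p (h j) \<le> ennreal M'" for j
  proof -
    have "pnorm p (h j) \<le> 2 powr p * (pnorm p (f j) + pnorm p g)"
      unfolding h_def using pq by (intro pnorm_diff) auto
    also have "\<dots> \<le> 2 powr p * (M + M)"
      using M(1) \<open>pnorm p g \<le> M\<close> by (intro mult_left_mono add_mono) auto
    also have "\<dots> = ennreal M'" using M(2) by (simp add: M'_def ennreal_mult_less_top)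
    finally show ?thesis .
  qed
  have lph: "lp p (h j)" for j using hM[of j] by (auto simp: lp_def intro: le_less_trans)
  have hint: "integrable lborel (\<lambda>x. norm (h j x) powr p)" for j using lph by (simp add: lp_integrable)
  have hMr: "(\<integral>x. norm (h j x) powr p \<partial>lborel) \<le> M'" for j
  proof -
    have "ennreal (\<integral>x. norm (h j x) powr p \<partial>lborel) = pnorm p (h j)"
      unfolding pnorm_def by (intro nn_integral_eq_integral[symmetric] hint) auto
    then show ?thesis using hM[of j] M'0 ennreal_le_iff[of M'] by metis
  qed
  have kint: "integrable lborel (\<lambda>x. norm (k x) powr q)" using k by (simp add: lp_integrable)
  have hk: "integrable lborel (\<lambda>x. h j x * k x)" for j by (rule lp_mult_integrable[OF lph k pq])
  have key: "(\<lambda>j. \<integral>x. norm (h j x * k x) \<partial>lborel) \<longlonglongrightarrow> 0"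
  proof (rule LIMSEQ_I)
    fix e :: real assume e: "0 < e"
    \<comment> \<open>The exponent \<open>1 - p\<close> is negative, so this is a large threshold;
      it makes \<open>M' * l powr (1 - p)\<close> less than e/2. Adding 1 keeps the divisor positive
      when \<open>M' = 0\<close>.\<close>
    define l where "l = (e / 2 / (M' + 1)) powr (1 / (1 - p))"
    have l: "0 < l" using e M'0 by (simp add: l_def)
    have "l powr (1 - p) = e / 2 / (M' + 1)" using pq e M'0 by (simp add: l_def powr_powr)
    then have "(M' + 1) * l powr (1 - p) = e / 2"
      using nonzero_mult_div_cancel_left[of "M' + 1" "e / 2"] M'0 by (simp only: times_divide_eq_right)
    moreover have "0 < l powr (1 - p)" using l by simp
    ultimately have lM: "M' * l powr (1 - p) < e / 2"
      unfolding distrib_right by linarith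
    \<comment> \<open>The product with |h| cut off at the threshold, so that dominated convergence
      applies with the bound l |k|^q.\<close>
    define b where "b = (\<lambda>j x. min (norm (h j x)) (l * norm (k x) powr (q - 1)) * norm (k x))"
    have [measurable]: "b j \<in> borel_measurable borel" for j by (simp add: b_def)
    have kk: "norm (k x) powr (q - 1) * norm (k x) = norm (k x) powr q" for x
      using pq by (cases "k x = 0") (auto simp: powr_diff)
    have dom: "norm (b j x) \<le> l * norm (k x) powr q" for j x
    proof -
      have "b j x \<le> l * norm (k x) powr (q - 1) * norm (k x)" unfolding b_def by (intro mult_right_mono) auto
      also have "\<dots> = l * norm (k x) powr q" using kk[of x] by simp
      finally show ?thesis using l by (simp add: b_def abs_mult)
    qed
    have "(\<lambda>j. \<integral>x. b j x \<partial>lborel) \<longlonglongrightarrow> (\<integral>x. 0 \<partial>(lborel::real measure))"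
    proof (rule integral_dominated_convergence[where w = "\<lambda>x. l * norm (k x) powr q"])
      show "AE x in lborel. (\<lambda>j. b j x) \<longlonglongrightarrow> 0"
        using lim
      proof eventually_elim
        fix x assume "(\<lambda>j. f j x) \<longlonglongrightarrow> g x"
        then have "(\<lambda>j. norm (h j x)) \<longlonglongrightarrow> 0" unfolding h_def by (simp add: LIM_zero tendsto_norm_zero)
        then have "(\<lambda>j. norm (h j x) * norm (k x)) \<longlonglongrightarrow> 0 * norm (k x)" by (intro tendsto_mult tendsto_const)
        then have 1: "(\<lambda>j. norm (h j x) * norm (k x)) \<longlonglongrightarrow> 0" by simp
        show "(\<lambda>j. b j x) \<longlonglongrightarrow> 0"
        proof (rule tendsto_sandwich[OF _ _ tendsto_const 1])
          show "\<forall>\<^sub>F j in sequentially. 0 \<le> b j x" using l by (simp add: b_def)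
          show "\<forall>\<^sub>F j in sequentially. b j x \<le> norm (h j x) * norm (k x)"
            unfolding b_def by (intro always_eventually allI mult_right_mono) auto
        qed
      qed
      show "\<And>i. AE x in lborel. norm (b i x) \<le> l * norm (k x) powr q" using dom by auto
      show "integrable lborel (\<lambda>x. l * norm (k x) powr q)" using kint by simp
    qed measurable
    then have "(\<lambda>j. \<integral>x. b j x \<partial>lborel) \<longlonglongrightarrow> 0" by simp
    from order_tendstoD(2)[OF this, of "e / 2"] e
    have "\<forall>\<^sub>F j in sequentially. (\<integral>x. b j x \<partial>lborel) < e / 2" by auto
    then obtain N where N: "\<And>j. j \<ge> N \<Longrightarrow> (\<integral>x. b j x \<partial>lborel) < e / 2" by (auto simp: eventually_sequentially)
    have bint: "integrable lborel (b j)" for j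
    proof (rule Bochner_Integration.integrable_bound[where f = "\<lambda>x. l * norm (k x) powr q"])
      show "AE x in lborel. norm (b j x) \<le> norm (l * norm (k x) powr q)"
        using order_trans[OF dom abs_ge_self] by (intro AE_I2) simp
    qed (use kint in auto)
    have pt: "norm (h j x * k x) \<le> b j x + l powr (1 - p) * norm (h j x) powr p" for j x
    proof (cases "norm (h j x) \<le> l * norm (k x) powr (q - 1)")
      case True
      then show ?thesis by (simp add: b_def norm_mult min_def)
    next
      case False
      then have *: "norm (k x) powr (q - 1) < norm (h j x) / l" using l by (simp add: field_simps)
      \<comment> \<open>This relation between conjugate exponents isolates |k|: the inequality
        |k|^(q-1) < |h| / l is raised to the power p - 1.\<close>
      have qp: "(q - 1) * (p - 1) = 1" using pq by (simp add: field_simps)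
      have "norm (k x) = (norm (k x) powr (q - 1)) powr (p - 1)"
        using qp by (simp add: powr_powr)
      also have "\<dots> \<le> (norm (h j x) / l) powr (p - 1)" using * pq by (intro powr_mono2) auto
      finally have "norm (h j x) * norm (k x) \<le> norm (h j x) * (norm (h j x) / l) powr (p - 1)"
        by (intro mult_left_mono) auto
      also have "\<dots> = l powr (1 - p) * norm (h j x) powr p"
        using l pq by (cases "h j x = 0") (auto simp: powr_divide powr_diff field_simps)
      finally show ?thesis using l by (simp add: norm_mult b_def add_increasing)
    qed
    have bd: "(\<integral>x. norm (h j x * k x) \<partial>lborel) \<le> (\<integral>x. b j x \<partial>lborel) + l powr (1 - p) * M'" for j
    proof -
      have "(\<integral>x. norm (h j x * k x) \<partial>lborel) \<le> (\<integral>x. b j x + l powr (1 - p) * norm (h j x) powr p \<partial>lborel)"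
        using pt hk bint hint by (intro integral_mono Bochner_Integration.integrable_add integrable_mult_right) auto
      also have "\<dots> = (\<integral>x. b j x \<partial>lborel) + l powr (1 - p) * (\<integral>x. norm (h j x) powr p \<partial>lborel)"
        using bint hint by simp
      also have "\<dots> \<le> (\<integral>x. b j x \<partial>lborel) + l powr (1 - p) * M'"
        using hMr by (intro add_left_mono mult_left_mono) auto
      finally show ?thesis .
    qed
    show "\<exists>N. \<forall>j\<ge>N. norm ((\<integral>x. norm (h j x * k x) \<partial>lborel) - 0) < e"
    proof (intro exI allI impI)
      fix j assume "N \<le> j"
      have "0 \<le> (\<integral>x. norm (h j x * k x) \<partial>lborel)" by simp
      moreover have "(\<integral>x. norm (h j x * k x) \<partial>lborel) < e"
        using bd[of j] N[OF \<open>N \<le> j\<close>] lM by (simp add: mult.commute)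
      ultimately show "norm ((\<integral>x. norm (h j x * k x) \<partial>lborel) - 0) < e" by simp
    qed
  qed
  have "(\<lambda>j. (\<integral>x. f j x * k x \<partial>lborel) - (\<integral>x. g x * k x \<partial>lborel)) \<longlonglongrightarrow> 0"
  proof (rule Lim_null_comparison[OF _ key])
    show "\<forall>\<^sub>F j in sequentially. norm ((\<integral>x. f j x * k x \<partial>lborel) - (\<integral>x. g x * k x \<partial>lborel)) \<le> (\<integral>x. norm (h j x * k x) \<partial>lborel)"
    proof (intro always_eventually allI)
      fix j
      have "(\<integral>x. f j x * k x \<partial>lborel) - (\<integral>x. g x * k x \<partial>lborel) = (\<integral>x. h j x * k x \<partial>lborel)"
        using lp_mult_integrable[OF lpf k pq] lp_mult_integrable[OF lpg k pq]
        by (simp add: h_def left_diff_distrib)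
      then show "norm ((\<integral>x. f j x * k x \<partial>lborel) - (\<integral>x. g x * k x \<partial>lborel)) \<le> (\<integral>x. norm (h j x * k x) \<partial>lborel)"
        using integral_norm_bound[of lborel "\<lambda>x. h j x * k x"] by simp
    qed
  qed
  then show ?thesis by (simp add: LIM_zero_iff)
qed

text \<open>Fatou's lemma applied to \<open>2\<^sup>p (\<bar>f j\<bar>\<^sup>p + \<bar>g\<bar>\<^sup>p) - \<bar>f j - g\<bar>\<^sup>p \<ge> 0\<close>.\<close>

lemma lp_strong_convergence:
  assumes p: "1 \<le> p"
    and f[measurable]: "\<And>j::nat. f j \<in> borel_measurable borel" and g: "lp p g"
    and lim: "AE x in lborel. (\<lambda>j. f j x) \<longlonglongrightarrow> g x"
    and le: "\<And>j. pnorm p (f j) \<le> pnorm p g"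
  shows "(\<lambda>j. pnorm p (\<lambda>x. f j x - g x)) \<longlonglongrightarrow> 0"
proof -
  have [measurable]: "g \<in> borel_measurable borel" using g by (rule lp_measurable)
  define c where "c = 2 powr p"
  define r where "r = (\<lambda>j x. c * (norm (f j x) powr p + norm (g x) powr p) - norm (f j x - g x) powr p)"
  have r0: "0 \<le> r j x" for j x
    using norm_add_powr_le[of p "f j x" "- g x"] p by (simp add: r_def c_def)
  have [measurable]: "r j \<in> borel_measurable borel" for j by (simp add: r_def)
  define X where "X = ennreal c * (pnorm p g + pnorm p g)"
  have Xf: "X < \<infinity>" using lp_pnorm[OF g] by (simp add: X_def ennreal_mult_less_top)
  have sum: "(\<integral>\<^sup>+x. r j x \<partial>lborel) + pnorm p (\<lambda>x. f j x - g x) \<le> X" for j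
  proof -
    have "(\<integral>\<^sup>+x. r j x \<partial>lborel) + pnorm p (\<lambda>x. f j x - g x)
        = (\<integral>\<^sup>+x. ennreal (r j x) + ennreal (norm (f j x - g x) powr p) \<partial>lborel)"
      unfolding pnorm_def by (intro nn_integral_add[symmetric]) auto
    also have "\<dots> = (\<integral>\<^sup>+x. ennreal c * (ennreal (norm (f j x) powr p) + ennreal (norm (g x) powr p)) \<partial>lborel)"
      using r0 by (intro nn_integral_cong) (auto simp flip: ennreal_plus ennreal_mult' simp: r_def c_def)
    also have "\<dots> = ennreal c * (pnorm p (f j) + pnorm p g)"
      unfolding pnorm_def by (simp add: nn_integral_cmult nn_integral_add)
    also have "\<dots> \<le> X" unfolding X_def using le by (intro mult_left_mono add_mono) auto
    finally show ?thesis .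
  qed
  have "X = (\<integral>\<^sup>+x. ennreal c * (ennreal (norm (g x) powr p) + ennreal (norm (g x) powr p)) \<partial>lborel)"
    unfolding X_def pnorm_def by (subst nn_integral_cmult, measurable, subst nn_integral_add) auto
  also have "\<dots> = (\<integral>\<^sup>+x. ennreal (c * (norm (g x) powr p + norm (g x) powr p)) \<partial>lborel)"
    by (intro nn_integral_cong) (auto simp flip: ennreal_plus ennreal_mult' simp: c_def)
  also have "\<dots> = (\<integral>\<^sup>+x. liminf (\<lambda>j. ennreal (r j x)) \<partial>lborel)"
  proof (intro nn_integral_cong_AE, use lim in eventually_elim)
    fix x assume *: "(\<lambda>j. f j x) \<longlonglongrightarrow> g x"
    have "(\<lambda>j. r j x) \<longlonglongrightarrow> c * (norm (g x) powr p + norm (g x) powr p) - norm (g x - g x) powr p"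
      unfolding r_def using * p
      by (intro tendsto_diff tendsto_mult tendsto_add tendsto_powr' tendsto_norm tendsto_const) auto
    then have "(\<lambda>j. ennreal (r j x)) \<longlonglongrightarrow> ennreal (c * (norm (g x) powr p + norm (g x) powr p))"
      by (intro tendsto_ennrealI) simp
    then show "ennreal (c * (norm (g x) powr p + norm (g x) powr p)) = liminf (\<lambda>j. ennreal (r j x))"
      by (rule lim_imp_Liminf[OF sequentially_bot, symmetric])
  qed
  also have "\<dots> \<le> liminf (\<lambda>j. \<integral>\<^sup>+x. r j x \<partial>lborel)" by (intro nn_integral_liminf) auto
  finally have XL: "X \<le> liminf (\<lambda>j. \<integral>\<^sup>+x. r j x \<partial>lborel)" .
  show ?thesis
  proof (rule order_tendstoI)
    fix e :: ennreal assume e: "0 < e"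
    show "\<forall>\<^sub>F j in sequentially. pnorm p (\<lambda>x. f j x - g x) < e"
    proof (cases "X = 0")
      case True
      then have "pnorm p (\<lambda>x. f j x - g x) = 0" for j using sum[of j] by simp
      then show ?thesis using e by simp
    next
      case False
      \<comment> \<open>Cancellation in \<open>ennreal\<close> requires a finite summand, hence the
        cap at 1. The strict inequality \<open>X - e' < X\<close> fails for X = 0, which is why that
        case was split off.\<close>
      define e' where "e' = min e 1"
      have "e' \<le> 1" by (simp add: e'_def)
      then have "e' < \<infinity>" using le_less_trans[OF _ ennreal_one_less_top] by simp
      then have e': "0 < e'" "e' < \<infinity>" "e' \<le> e" using e by (auto simp: e'_def)
      have "X - e' < X" using False Xf e' by (intro ennreal_between) (auto simp: zero_less_iff_neq_zero)
      with XL have "\<forall>\<^sub>F j in sequentially. X - e' < (\<integral>\<^sup>+x. r j x \<partial>lborel)"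
        unfolding le_Liminf_iff by blast
      then show ?thesis
      proof eventually_elim
        fix j assume *: "X - e' < (\<integral>\<^sup>+x. r j x \<partial>lborel)"
        let ?I = "\<integral>\<^sup>+x. r j x \<partial>lborel" and ?d = "pnorm p (\<lambda>x. f j x - g x)"
        have "?I \<le> X" using sum[of j] by (rule order_trans[rotated]) simp
        then have If: "?I < \<infinity>" using Xf by (rule le_less_trans)
        have "X < e' + ?I"
        proof (rule ccontr)
          assume "\<not> X < e' + ?I"
          then have "(e' + ?I) - e' \<le> X - e'" by (intro ennreal_minus_mono) auto
          then show False using * e'(2) by (simp add: ennreal_add_diff_cancel_left)
        qed
        then have "?I + ?d < ?I + e'"
          using le_less_trans[OF sum[of j], of "e' + ?I"] by (simp only: add.commute[of e'])
        then have "?d < e'" using If by (simp add: ennreal_add_left_cancel_less)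
        then show "?d < e" using e'(3) by simp
      qed
    qed
  qed simp
qed

section \<open>The Poisson and Cauchy kernels\<close>

definition poisson_ker :: "complex \<Rightarrow> real \<Rightarrow> real" where
  "poisson_ker z t = Im z / (pi * (norm (of_real t - z))\<^sup>2)"

text \<open>One formula serves both half-planes. Its values at z and \<open>cnj z\<close> differ by
  the Poisson integral, see \<open>poisson_cauchy\<close>.\<close>

definition cauchy :: "(real \<Rightarrow> complex) \<Rightarrow> complex \<Rightarrow> complex" where
  "cauchy f z = 1 / (2 * pi * \<i>) * (\<integral>t. f t * (1 / (of_real t - z)) \<partial>lborel)"

definition poisson :: "(real \<Rightarrow> complex) \<Rightarrow> complex \<Rightarrow> complex" where
  "poisson f z = (\<integral>t. f t * of_real (poisson_ker z t) \<partial>lborel)"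

lemma poisson_ker_Complex: "poisson_ker (Complex x y) t = y / (pi * ((t - x)\<^sup>2 + y\<^sup>2))"
  by (simp add: poisson_ker_def cmod_def)

lemma poisson_ker_eq: "poisson_ker z t = Im z / (pi * ((t - Re z)\<^sup>2 + (Im z)\<^sup>2))"
  by (simp add: poisson_ker_def cmod_def)

lemma poisson_ker_measurable [measurable]: "poisson_ker z \<in> borel_measurable borel"
  unfolding poisson_ker_def by measurable

lemma poisson_ker_nonneg: "0 \<le> Im z \<Longrightarrow> 0 \<le> poisson_ker z t"
  by (simp add: poisson_ker_def)

lemma poisson_ker_pos: "0 < Im z \<Longrightarrow> 0 < poisson_ker z t"
  using kernel_nonzero[of z t] by (auto simp: poisson_ker_def)

lemma poisson_ker_sym: "poisson_ker (Complex x y) t = poisson_ker (Complex t y) x"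
  by (simp add: poisson_ker_Complex power2_commute)

text \<open>The primitive arctan ((t - x) / y) / pi gives mass 1/2 to the right of x = Re z;
  reflection at x gives the other half.\<close>

lemma poisson_ker_nn_integral:
  assumes z: "0 < Im z"
  shows "(\<integral>\<^sup>+t. ennreal (poisson_ker z t) \<partial>lborel) = 1"
proof -
  define x y where "x = Re z" and "y = Im z"
  have y: "0 < y" using z by (simp add: y_def)
  have half: "(\<integral>\<^sup>+t. ennreal (poisson_ker z t) * indicator {x..} t \<partial>lborel) = ennreal (1/2)"
  proof -
    have "((\<lambda>t. arctan ((t - x) / y)) \<longlongrightarrow> pi / 2) at_top"
    proof (rule filterlim_compose[OF tendsto_arctan_at_top])
      have "LIM t at_top. (1 / y) * (- x + t) :> at_top"
        using y by (intro filterlim_tendsto_pos_mult_at_top[OF tendsto_const]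
             filterlim_tendsto_add_at_top[OF tendsto_const] filterlim_ident) auto
      then show "LIM t at_top. (t - x) / y :> at_top" by simp
    qed
    then have lim: "((\<lambda>t. arctan ((t - x) / y) / pi) \<longlongrightarrow> (pi / 2) / pi) at_top"
      by (intro tendsto_divide tendsto_const) auto
    have D: "((\<lambda>t. arctan ((t - x) / y) / pi) has_real_derivative poisson_ker z t) (at t)" for t
    proof -
      have "((\<lambda>t. arctan ((t - x) / y) / pi) has_real_derivative (inverse (1 + ((t - x) / y)\<^sup>2) * (1 / y)) / pi) (at t)"
        using y by (auto intro!: derivative_eq_intros)
      moreover have "(inverse (1 + ((t - x) / y)\<^sup>2) * (1 / y)) / pi = poisson_ker z t"
        using y by (simp add: poisson_ker_eq x_def[symmetric] y_def[symmetric] field_simps power2_eq_square)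
      ultimately show ?thesis by simp
    qed
    have "(\<integral>\<^sup>+t. ennreal (poisson_ker z t) * indicator {x..} t \<partial>lborel) = ennreal ((pi / 2) / pi - arctan ((x - x) / y) / pi)"
      by (rule nn_integral_FTC_atLeast) (use D lim z in \<open>auto intro: poisson_ker_nonneg\<close>)
    then show ?thesis by simp
  qed
  have half': "(\<integral>\<^sup>+t. ennreal (poisson_ker z t) * indicator {..<x} t \<partial>lborel) = ennreal (1/2)"
  proof -
    have "(\<integral>\<^sup>+t. ennreal (poisson_ker z t) * indicator {..<x} t \<partial>lborel)
       = (\<integral>\<^sup>+t. ennreal (poisson_ker z (2 * x - t)) * indicator {..<x} (2 * x - t) \<partial>lborel)"
      using nn_integral_real_affine[of "\<lambda>t. ennreal (poisson_ker z t) * indicator {..<x} t" "-1" "2 * x"] by simp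
    also have "\<dots> = (\<integral>\<^sup>+t. ennreal (poisson_ker z t) * indicator {x..} t \<partial>lborel)"
    proof (rule nn_integral_cong_AE)
      have "AE t in lborel. t \<noteq> x" by (rule AE_lborel_singleton)
      then show "AE t in lborel. ennreal (poisson_ker z (2 * x - t)) * indicator {..<x} (2 * x - t)
           = ennreal (poisson_ker z t) * indicator {x..} t"
      proof eventually_elim
        fix t assume "t \<noteq> x"
        moreover have "poisson_ker z (2 * x - t) = poisson_ker z t" by (simp add: poisson_ker_eq x_def power2_commute)
        ultimately show "ennreal (poisson_ker z (2 * x - t)) * indicator {..<x} (2 * x - t)
           = ennreal (poisson_ker z t) * indicator {x..} t" by (auto simp: indicator_def)
      qed
    qed
    finally show ?thesis using half by simp
  qed
  have "(\<integral>\<^sup>+t. ennreal (poisson_ker z t) \<partial>lborel)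
      = (\<integral>\<^sup>+t. ennreal (poisson_ker z t) * indicator {x..} t + ennreal (poisson_ker z t) * indicator {..<x} t \<partial>lborel)"
    by (intro nn_integral_cong) (auto simp: indicator_def)
  also have "\<dots> = ennreal (1/2) + ennreal (1/2)"
    using half half' by (subst nn_integral_add) auto
  also have "\<dots> = 1" by (subst ennreal_plus[symmetric]) auto
  finally show ?thesis .
qed

lemma poisson_ker_integrable: "0 < Im z \<Longrightarrow> integrable lborel (poisson_ker z)"
  using poisson_ker_nn_integral[of z] poisson_ker_nonneg[of z] by (simp add: integrable_iff_bounded)

lemma poisson_ker_integral: "0 < Im z \<Longrightarrow> (\<integral>t. poisson_ker z t \<partial>lborel) = 1"
  using poisson_ker_nn_integral[of z] poisson_ker_nonneg[of z] by (simp add: integral_eq_nn_integral)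

lemma poisson_ker_le: "0 < Im z \<Longrightarrow> poisson_ker z t \<le> 1 / (pi * Im z)"
proof -
  assume z: "0 < Im z"
  have "poisson_ker z t \<le> Im z / (pi * (Im z)\<^sup>2)"
    unfolding poisson_ker_eq using z by (intro divide_left_mono mult_left_mono mult_pos_pos add_nonneg_pos) auto
  then show ?thesis using z by (simp add: power2_eq_square)
qed

text \<open>Partial fractions: 1/(t - z) - 1/(t - cnj z) equals 2 i Im z / |t - z|^2. This expresses
  Poisson integrals through Cauchy integrals and puts the Poisson kernel into every L^q with q >
  1.\<close>

lemma poisson_ker_kernel:
  assumes "Im z \<noteq> 0"
  shows "complex_of_real (poisson_ker z t) = 1 / (2 * pi * \<i>) * (1 / (of_real t - z) - 1 / (of_real t - cnj z))"
proof -
  have n: "of_real t - z \<noteq> 0" "of_real t - cnj z \<noteq> 0"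
    using kernel_nonzero[of z] kernel_nonzero[of "cnj z"] assms by auto
  have e: "complex_of_real ((norm (of_real t - z))\<^sup>2) = (of_real t - z) * (of_real t - cnj z)"
    using complex_norm_square[of "of_real t - z"] by simp
  have "1 / (of_real t - z) - 1 / (of_real t - cnj z) = (z - cnj z) / complex_of_real ((norm (of_real t - z))\<^sup>2)"
    unfolding e using n by (simp add: divide_simps)
  also have "z - cnj z = 2 * \<i> * Im z" by (simp add: complex_eq_iff)
  finally show ?thesis using n by (simp add: poisson_ker_def)
qed

lemma lp_poisson_ker:
  assumes "0 < Im z" "1 < q"
  shows "lp q (\<lambda>t. complex_of_real (poisson_ker z t))"
proof -
  have "lp q (\<lambda>t. 1 / (2 * pi * \<i>) * (1 / (of_real t - z) - 1 / (of_real t - cnj z)))"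
    using assms by (intro lp_cmult lp_diff lp_kernel) auto
  then show ?thesis using assms by (simp add: poisson_ker_kernel)
qed

definition conj_exp :: "real \<Rightarrow> real" where "conj_exp p = p / (p - 1)"

lemma conj_exp:
  assumes "1 < p"
  shows "1 < conj_exp p" "1 / p + 1 / conj_exp p = 1"
  using assms by (auto simp: conj_exp_def field_simps)

lemma cauchy_integrable:
  assumes "lp p f" "1 < p" "Im z \<noteq> 0"
  shows "integrable lborel (\<lambda>t. f t * (1 / (of_real t - z)))"
  using conj_exp[OF assms(2)] assms by (intro lp_mult_integrable[OF assms(1) lp_kernel]) auto

lemma poisson_integrable:
  assumes "lp p f" "1 < p" "0 < Im z"
  shows "integrable lborel (\<lambda>t. f t * of_real (poisson_ker z t))"
  using conj_exp[OF assms(2)] assms by (intro lp_mult_integrable[OF assms(1) lp_poisson_ker]) auto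

lemma poisson_cauchy:
  assumes "lp p f" "1 < p" "0 < Im z"
  shows "poisson f z = cauchy f z - cauchy f (cnj z)"
proof -
  have "poisson f z = (\<integral>t. 1 / (2 * pi * \<i>) * (f t * (1 / (of_real t - z)) - f t * (1 / (of_real t - cnj z))) \<partial>lborel)"
    unfolding poisson_def using assms by (simp add: poisson_ker_kernel right_diff_distrib mult_ac)
  also have "\<dots> = cauchy f z - cauchy f (cnj z)"
    unfolding cauchy_def using cauchy_integrable[OF assms(1,2), of z] cauchy_integrable[OF assms(1,2), of "cnj z"] assms(3)
    by (subst Bochner_Integration.integral_mult_right) (auto simp: right_diff_distrib)
  finally show ?thesis .
qed

text \<open>Jensen's inequality for the probability density \<open>poisson_ker z\<close>: the
  tangent-line bound at the mean \<open>m\<close> of |f| is integrated.\<close>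

lemma poisson_pointwise:
  assumes f: "lp p f" and p: "1 < p" and z: "0 < Im z"
  shows "ennreal (norm (poisson f z) powr p) \<le> (\<integral>\<^sup>+t. ennreal (norm (f t) powr p * poisson_ker z t) \<partial>lborel)"
proof -
  have [measurable]: "f \<in> borel_measurable borel" using f by (rule lp_measurable)
  define m where "m = (\<integral>t. norm (f t) * poisson_ker z t \<partial>lborel)"
  have i1: "integrable lborel (\<lambda>t. norm (f t) * poisson_ker z t)"
    using integrable_norm[OF poisson_integrable[OF f p z]] z poisson_ker_nonneg[of z] by (simp add: norm_mult abs_of_nonneg)
  have i2: "integrable lborel (\<lambda>t. norm (f t) powr p * poisson_ker z t)"
  proof (rule Bochner_Integration.integrable_bound)
    show "integrable lborel (\<lambda>t. 1 / (pi * Im z) * norm (f t) powr p)"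
      using f by (simp add: lp_integrable)
    show "AE t in lborel. norm (norm (f t) powr p * poisson_ker z t) \<le> norm (1 / (pi * Im z) * norm (f t) powr p)"
      using mult_right_mono[OF poisson_ker_le[OF z] powr_ge_zero] poisson_ker_nonneg[of z] z
      by (intro AE_I2) (simp add: abs_mult mult.commute)
  qed measurable
  have m0: "0 \<le> m" unfolding m_def using poisson_ker_nonneg[of z] z by (intro integral_nonneg_AE) auto
  have nm: "norm (poisson f z) \<le> m"
    unfolding poisson_def m_def using integral_norm_bound[of lborel "\<lambda>t. f t * of_real (poisson_ker z t)"] poisson_ker_nonneg[of z] z
    by (simp add: norm_mult abs_of_nonneg)
  \<comment> \<open>The term linear in |f| - m integrates to 0, because the kernel has mass 1 and
    \<open>m\<close> is the mean.\<close>
  have "m powr p = (\<integral>t. m powr p * poisson_ker z t + p * m powr (p - 1) * (norm (f t) * poisson_ker z t - m * poisson_ker z t) \<partial>lborel)"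
    using i1 poisson_ker_integrable[OF z] poisson_ker_integral[OF z] by (simp add: m_def[symmetric])
  also have "\<dots> \<le> (\<integral>t. norm (f t) powr p * poisson_ker z t \<partial>lborel)"
  proof (rule integral_mono)
    fix t :: real
    show "m powr p * poisson_ker z t + p * m powr (p - 1) * (norm (f t) * poisson_ker z t - m * poisson_ker z t) \<le> norm (f t) powr p * poisson_ker z t"
      using mult_right_mono[OF powr_tangent[OF p norm_ge_zero m0, of "f t"], of "poisson_ker z t"] poisson_ker_nonneg[of z] z
      by (simp add: algebra_simps)
  qed (use i1 i2 poisson_ker_integrable[OF z] in auto)
  finally have "m powr p \<le> (\<integral>t. norm (f t) powr p * poisson_ker z t \<partial>lborel)" .
  moreover have "norm (poisson f z) powr p \<le> m powr p" using nm p by (intro powr_mono2) auto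
  ultimately have "ennreal (norm (poisson f z) powr p) \<le> ennreal (\<integral>t. norm (f t) powr p * poisson_ker z t \<partial>lborel)"
    by (intro ennreal_leI) linarith
  also have "\<dots> = (\<integral>\<^sup>+t. ennreal (norm (f t) powr p * poisson_ker z t) \<partial>lborel)"
    using poisson_ker_nonneg[of z] z by (intro nn_integral_eq_integral[symmetric] i2) auto
  finally show ?thesis .
qed

text \<open>After integration of the pointwise bound in x, Fubini and the symmetry of the kernel in
  x and t leave an inner integral equal to 1.\<close>

lemma poisson_contraction:
  assumes f: "lp p f" and p: "1 < p" and y: "0 < y"
  shows "pnorm p (\<lambda>x. poisson f (Complex x y)) \<le> pnorm p f"
proof -
  have [measurable]: "f \<in> borel_measurable borel" using f by (rule lp_measurable)
  have "pnorm p (\<lambda>x. poisson f (Complex x y)) \<le> (\<integral>\<^sup>+x. \<integral>\<^sup>+t. ennreal (norm (f t) powr p * poisson_ker (Complex x y) t) \<partial>lborel \<partial>lborel)"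
    unfolding pnorm_def using poisson_pointwise[OF f p] y by (intro nn_integral_mono) auto
  also have "\<dots> = (\<integral>\<^sup>+t. \<integral>\<^sup>+x. ennreal (norm (f t) powr p * poisson_ker (Complex x y) t) \<partial>lborel \<partial>lborel)"
    unfolding poisson_ker_Complex by (rule lborel_pair.Fubini') measurable
  also have "\<dots> = (\<integral>\<^sup>+t. ennreal (norm (f t) powr p) * (\<integral>\<^sup>+x. ennreal (poisson_ker (Complex t y) x) \<partial>lborel) \<partial>lborel)"
    using y by (intro nn_integral_cong) (simp add: ennreal_mult' nn_integral_cmult poisson_ker_sym[of _ y])
  also have "\<dots> = pnorm p f" using y by (simp add: poisson_ker_nn_integral pnorm_def)
  finally show ?thesis .
qed

section \<open>Maximal functions and Lebesgue points\<close>

text \<open>Vitali's covering lemma picks disjoint balls among all balls on which the average of h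
  exceeds \<open>l\<close>; \<open>B\<close> is the union of their fivefold enlargements. A chosen
  ball of radius r adds at most 10 r to the length of \<open>B\<close> and carries mass above 2 r l,
  whence 5 / l. The explicit Borel set takes the role of a level set of the maximal
  function.\<close>

lemma maximal_weak_type:
  fixes h :: "real \<Rightarrow> ennreal"
  assumes [measurable]: "h \<in> borel_measurable borel"
    and fin: "(\<integral>\<^sup>+t. h t \<partial>lborel) < \<infinity>" and l: "0 < l"
  obtains B where "B \<in> sets borel" "emeasure lborel B \<le> ennreal (5 / l) * (\<integral>\<^sup>+t. h t \<partial>lborel)"
    "\<And>x r. x \<notin> B \<Longrightarrow> 0 < r \<Longrightarrow> (\<integral>\<^sup>+t. h t * indicator (cball x r) t \<partial>lborel) \<le> ennreal (2 * r * l)"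
proof -
  define I where "I = enn2real (\<integral>\<^sup>+t. h t \<partial>lborel)"
  have I: "(\<integral>\<^sup>+t. h t \<partial>lborel) = ennreal I" using fin by (simp add: I_def)
  have I0: "0 \<le> I" by (simp add: I_def)
  define K where "K = {i :: real \<times> real. 0 < snd i \<and>
    ennreal (2 * snd i * l) < (\<integral>\<^sup>+t. h t * indicator (cball (fst i) (snd i)) t \<partial>lborel)}"
  \<comment> \<open>Vitali's lemma asks for bounded radii. A bad ball of radius r carries mass above
    2 r l, so the finite total mass bounds r.\<close>
  have r: "0 < snd i \<and> snd i \<le> I / (2 * l)" if "i \<in> K" for i
  proof -
    have "ennreal (2 * snd i * l) < (\<integral>\<^sup>+t. h t * indicator (cball (fst i) (snd i)) t \<partial>lborel)"
      using that by (simp add: K_def)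
    also have "\<dots> \<le> (\<integral>\<^sup>+t. h t \<partial>lborel)" by (intro nn_integral_mono) (auto simp: indicator_def)
    finally have "2 * snd i * l < I" using that l by (simp add: I K_def ennreal_less_iff)
    then show ?thesis using that l by (auto simp: K_def field_simps)
  qed
  obtain C where C: "countable C" "C \<subseteq> K"
    "pairwise (\<lambda>i j. disjnt (cball (fst i) (snd i)) (cball (fst j) (snd j))) C"
    "(\<Union>i\<in>K. cball (fst i) (snd i)) \<subseteq> (\<Union>i\<in>C. cball (fst i) (5 * snd i))"
  proof (rule Vitali_covering_lemma_cballs[where S = "\<Union>i\<in>K. cball (fst i) (snd i)" and K = K and a = fst and r = snd and B = "I / (2 * l)"])
    fix C assume "countable C" "C \<subseteq> K"
      "pairwise (\<lambda>i j. disjnt (cball (fst i) (snd i)) (cball (fst j) (snd j))) C"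
      "(\<Union>i\<in>K. cball (fst i) (snd i)) \<subseteq> (\<Union>i\<in>C. cball (fst i) (5 * snd i))"
    then show thesis by (rule that)
  qed (use r in auto)
  define B where "B = (\<Union>i\<in>C. cball (fst i) (5 * snd i))"
  define N where "N = density lborel h"
  have N: "emeasure N (cball (fst i) (snd i)) = (\<integral>\<^sup>+t. h t * indicator (cball (fst i) (snd i)) t \<partial>lborel)" for i
    unfolding N_def by (rule emeasure_density) auto
  show thesis
  proof
    show B: "B \<in> sets borel" unfolding B_def using C(1) by (intro sets.countable_UN') auto
    have "emeasure lborel B = (\<integral>\<^sup>+x. indicator B x \<partial>lborel)" using B by simp
    \<comment> \<open>Countable subadditivity, written as an integral over
      \<open>count_space C\<close> so that the two integrals can be interchanged.\<close>
    also have "\<dots> \<le> (\<integral>\<^sup>+x. (\<integral>\<^sup>+i. indicator (cball (fst i) (5 * snd i)) x \<partial>count_space C) \<partial>lborel)"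
    proof (intro nn_integral_mono)
      fix x
      show "(indicator B x :: ennreal) \<le> (\<integral>\<^sup>+i. indicator (cball (fst i) (5 * snd i)) x \<partial>count_space C)"
      proof (cases "x \<in> B")
        case True
        then obtain i where "i \<in> C" "x \<in> cball (fst i) (5 * snd i)" by (auto simp: B_def)
        then show ?thesis
          using nn_integral_ge_point[of i C "\<lambda>i. indicator (cball (fst i) (5 * snd i)) x"] by (auto simp: indicator_def)
      qed simp
    qed
    also have "\<dots> = (\<integral>\<^sup>+i. (\<integral>\<^sup>+x. indicator (cball (fst i) (5 * snd i)) x \<partial>lborel) \<partial>count_space C)"
      using C(1) by (intro nn_integral_count_space_nn_integral borel_measurable_indicator) auto
    also have "\<dots> \<le> (\<integral>\<^sup>+i. ennreal (5 / l) * emeasure N (cball (fst i) (snd i)) \<partial>count_space C)"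
    proof (intro nn_integral_mono)
      fix i assume "i \<in> space (count_space C)"
      then have i: "i \<in> K" using C(2) by auto
      then have s: "0 < snd i" by (simp add: K_def)
      have "(\<integral>\<^sup>+x. indicator (cball (fst i) (5 * snd i)) x \<partial>lborel) = emeasure lborel (cball (fst i) (5 * snd i))"
        by (intro nn_integral_indicator) auto
      also have "\<dots> = ennreal (10 * snd i)" using s by (simp add: cball_eq_atLeastAtMost)
      also have "\<dots> = ennreal (5 / l) * ennreal (2 * snd i * l)" using l s by (simp flip: ennreal_mult')
      also have "\<dots> \<le> ennreal (5 / l) * emeasure N (cball (fst i) (snd i))"
        using i unfolding N by (intro mult_left_mono) (auto simp: K_def)
      finally show "(\<integral>\<^sup>+x. indicator (cball (fst i) (5 * snd i)) x \<partial>lborel) \<le> ennreal (5 / l) * emeasure N (cball (fst i) (snd i))" .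
    qed
    also have "\<dots> = ennreal (5 / l) * (\<integral>\<^sup>+i. emeasure N (cball (fst i) (snd i)) \<partial>count_space C)"
      by (rule nn_integral_cmult) simp
    also have "(\<integral>\<^sup>+i. emeasure N (cball (fst i) (snd i)) \<partial>count_space C) = emeasure N (\<Union>i\<in>C. cball (fst i) (snd i))"
    proof (rule emeasure_UN_countable[symmetric])
      show "disjoint_family_on (\<lambda>i. cball (fst i) (snd i)) C"
        using C(3) by (auto simp: disjoint_family_on_def pairwise_def disjnt_def)
    qed (use C(1) in \<open>auto simp: N_def\<close>)
    also have "\<dots> \<le> emeasure N (space N)" by (rule emeasure_space)
    also have "\<dots> = (\<integral>\<^sup>+t. h t \<partial>lborel)"
      unfolding N_def by (subst emeasure_density) (auto intro!: nn_integral_cong)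
    finally show "emeasure lborel B \<le> ennreal (5 / l) * (\<integral>\<^sup>+t. h t \<partial>lborel)" by (simp add: mult_left_mono)
    fix x r :: real assume x: "x \<notin> B" "0 < r"
    show "(\<integral>\<^sup>+t. h t * indicator (cball x r) t \<partial>lborel) \<le> ennreal (2 * r * l)"
    proof (rule ccontr)
      assume "\<not> ?thesis"
      then have "(x, r) \<in> K" using x by (simp add: K_def)
      then have "x \<in> (\<Union>i\<in>K. cball (fst i) (snd i))" using x(2) by force
      from subsetD[OF C(4) this] x(1) show False unfolding B_def by blast
    qed
  qed
qed

text \<open>Take the least n with |t - x| \<le> 2^n y. For n > 0 minimality gives |t - x| > 2^(n-1)
  y, so the kernel is at most y / (pi 4^(n-1) y^2); for n = 0 its maximum 1 / (pi y) is used. The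
  n-th term alone dominates the kernel.\<close>

lemma poisson_ker_le_dyadic:
  assumes y: "0 < y"
  shows "ennreal (poisson_ker (Complex x y) t) \<le> (\<Sum>n. ennreal (4 / (pi * y) * (1/4) ^ n) * indicator (cball x (2 ^ n * y)) t)"
proof -
  have "\<exists>n. \<bar>t - x\<bar> \<le> 2 ^ n * y"
    using real_arch_pow[of 2 "\<bar>t - x\<bar> / y"] y by (auto simp: field_simps intro: less_imp_le)
  define n where "n = (LEAST n. \<bar>t - x\<bar> \<le> 2 ^ n * y)"
  have n: "\<bar>t - x\<bar> \<le> 2 ^ n * y" unfolding n_def by (rule LeastI_ex) fact
  have "poisson_ker (Complex x y) t \<le> 4 / (pi * y) * (1/4) ^ n"
  proof (cases n)
    case 0
    have "poisson_ker (Complex x y) t \<le> 1 / (pi * y)" using poisson_ker_le[of "Complex x y" t] y by simp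
    also have "\<dots> \<le> 4 / (pi * y)" using y by (intro divide_right_mono) auto
    finally show ?thesis using 0 by simp
  next
    case (Suc m)
    then have "\<not> \<bar>t - x\<bar> \<le> 2 ^ m * y" using not_less_Least[of m "\<lambda>n. \<bar>t - x\<bar> \<le> 2 ^ n * y"] by (simp add: n_def)
    then have "(2 ^ m * y)\<^sup>2 \<le> (t - x)\<^sup>2" using y by (intro abs_le_square_iff[THEN iffD1]) auto
    moreover have "(2 ^ m * y)\<^sup>2 = 4 ^ m * y\<^sup>2" by (simp add: power2_eq_square mult_ac flip: power_mult_distrib)
    ultimately have *: "4 ^ m * y\<^sup>2 \<le> (t - x)\<^sup>2 + y\<^sup>2" by (simp add: add_increasing2)
    have "poisson_ker (Complex x y) t \<le> y / (pi * (4 ^ m * y\<^sup>2))"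
      unfolding poisson_ker_Complex using y * by (intro divide_left_mono mult_left_mono mult_pos_pos) (auto intro!: add_nonneg_pos)
    also have "\<dots> = 4 / (pi * y) * (1/4) ^ n" using y Suc by (simp add: field_simps power2_eq_square)
    finally show ?thesis .
  qed
  then have "ennreal (poisson_ker (Complex x y) t) \<le> (\<Sum>k\<in>{n}. ennreal (4 / (pi * y) * (1/4) ^ k) * indicator (cball x (2 ^ k * y)) t)"
    using n by (auto simp: dist_real_def indicator_def abs_minus_commute intro: ennreal_leI)
  also have "\<dots> \<le> (\<Sum>n. ennreal (4 / (pi * y) * (1/4) ^ n) * indicator (cball x (2 ^ n * y)) t)"
    by (rule sum_le_suminf) auto
  finally show ?thesis .
qed

text \<open>The n-th dyadic ball contributes at most (8 l / pi) 2^(-n). The sum 16 l / pi is at most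
  8 l since pi \<ge> 2.\<close>

lemma maximal_poisson:
  fixes h :: "real \<Rightarrow> ennreal"
  assumes [measurable]: "h \<in> borel_measurable borel" and y: "0 < y" and l: "0 \<le> l"
    and le: "\<And>r. 0 < r \<Longrightarrow> (\<integral>\<^sup>+t. h t * indicator (cball x r) t \<partial>lborel) \<le> ennreal (2 * r * l)"
  shows "(\<integral>\<^sup>+t. h t * ennreal (poisson_ker (Complex x y) t) \<partial>lborel) \<le> ennreal (8 * l)"
proof -
  have [measurable]: "cball x r \<in> sets borel" for r by simp
  have "(\<integral>\<^sup>+t. h t * ennreal (poisson_ker (Complex x y) t) \<partial>lborel)
     \<le> (\<integral>\<^sup>+t. h t * (\<Sum>n. ennreal (4 / (pi * y) * (1/4) ^ n) * indicator (cball x (2 ^ n * y)) t) \<partial>lborel)"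
    using poisson_ker_le_dyadic[OF y] by (intro nn_integral_mono mult_left_mono) auto
  also have "\<dots> = (\<integral>\<^sup>+t. (\<Sum>n. ennreal (4 / (pi * y) * (1/4) ^ n) * (h t * indicator (cball x (2 ^ n * y)) t)) \<partial>lborel)"
    by (intro nn_integral_cong) (simp only: ennreal_suminf_cmult[symmetric] mult.left_commute)
  also have "\<dots> = (\<Sum>n. (\<integral>\<^sup>+t. ennreal (4 / (pi * y) * (1/4) ^ n) * (h t * indicator (cball x (2 ^ n * y)) t) \<partial>lborel))"
    by (rule nn_integral_suminf) measurable
  also have "\<dots> = (\<Sum>n. ennreal (4 / (pi * y) * (1/4) ^ n) * (\<integral>\<^sup>+t. h t * indicator (cball x (2 ^ n * y)) t \<partial>lborel))"
    by (intro suminf_cong nn_integral_cmult) measurable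
  also have "\<dots> \<le> (\<Sum>n. ennreal (8 * l / pi * (1/2) ^ n))"
  proof (intro suminf_le)
    fix n :: nat
    have "ennreal (4 / (pi * y) * (1/4) ^ n) * (\<integral>\<^sup>+t. h t * indicator (cball x (2 ^ n * y)) t \<partial>lborel)
       \<le> ennreal (4 / (pi * y) * (1/4) ^ n) * ennreal (2 * (2 ^ n * y) * l)"
      using y by (intro mult_left_mono le) auto
    also have "\<dots> = ennreal (4 / (pi * y) * (1/4) ^ n * (2 * (2 ^ n * y) * l))"
      using y by (intro ennreal_mult'[symmetric]) auto
    also have "4 / (pi * y) * (1/4) ^ n * (2 * (2 ^ n * y) * l) = 8 * l / pi * (1/2) ^ n"
    proof -
      have "(1/4::real) ^ n * 2 ^ n = (1/2) ^ n" by (simp flip: power_mult_distrib)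
      then have "4 / (pi * y) * (1/4) ^ n * (2 * (2 ^ n * y) * l) = 8 * l / pi * (1/2) ^ n * (y / y)"
        by (simp add: field_simps)
      then show ?thesis using y by simp
    qed
    finally show "ennreal (4 / (pi * y) * (1/4) ^ n) * (\<integral>\<^sup>+t. h t * indicator (cball x (2 ^ n * y)) t \<partial>lborel)
       \<le> ennreal (8 * l / pi * (1/2) ^ n)" .
  qed auto
  also have "\<dots> = ennreal (8 * l / pi * 2)"
  proof (rule suminf_ennreal_eq)
    show "(\<lambda>n. 8 * l / pi * (1/2) ^ n) sums (8 * l / pi * 2)"
      using geometric_sums[of "1/2::real"] by (intro sums_mult) auto
  qed (use l in auto)
  also have "\<dots> \<le> ennreal (8 * l)"
    using l mult_right_mono[OF pi_ge_two l] by (intro ennreal_leI) (simp add: field_simps)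
  finally show ?thesis .
qed

text \<open>Exceptional sets of measure at most 1 / (n + 1) intersect in a Borel null set that
  contains every point where \<open>Q\<close> fails, whether or not \<open>Q\<close> is
  measurable.\<close>

lemma AE_small_exceptional_sets:
  assumes "\<And>e::real. 0 < e \<Longrightarrow> \<exists>B\<in>sets borel. emeasure lborel B \<le> ennreal e \<and> (\<forall>x. x \<notin> B \<longrightarrow> Q x)"
  shows "AE x in (lborel :: real measure). Q x"
proof -
  have "\<forall>n. \<exists>B\<in>sets borel. emeasure lborel B \<le> ennreal (1 / real (Suc n)) \<and> (\<forall>x. x \<notin> B \<longrightarrow> Q x)"
    using assms by simp
  then obtain B where B: "\<And>n. B n \<in> sets borel" "\<And>n. emeasure lborel (B n) \<le> ennreal (1 / real (Suc n))"
    "\<And>n x. x \<notin> B n \<Longrightarrow> Q x" by metis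
  have "emeasure lborel (\<Inter>n. B n) \<le> ennreal e" if "0 < e" for e
  proof -
    obtain n where "1 / real (Suc n) < e" using nat_approx_posE[OF \<open>0 < e\<close>] by auto
    have "emeasure lborel (\<Inter>n. B n) \<le> emeasure lborel (B n)" using B(1) by (intro emeasure_mono) auto
    also have "\<dots> \<le> ennreal (1 / real (Suc n))" by (rule B)
    also have "\<dots> \<le> ennreal e" using \<open>1 / real (Suc n) < e\<close> by (intro ennreal_leI) auto
    finally show ?thesis .
  qed
  then have "emeasure lborel (\<Inter>n. B n) = 0"
    using ennreal_le_epsilon[of 0 "emeasure lborel (\<Inter>n. B n)"] by (metis add.left_neutral le_zero_eq)
  then have "(\<Inter>n. B n) \<in> null_sets lborel" using B(1) by (intro null_setsI) auto
  then show ?thesis by (rule AE_I') (use B(3) in auto)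
qed

text \<open>With s = (t - x)^2 the kernel is at most y / (pi s), and 1/s = (1 + 1/s) / (s + 1)
  compares this with height 1. The factor \<open>y\<close> makes contributions from afar vanish in
  the limit.\<close>

lemma poisson_ker_tail:
  assumes "0 < y" "0 < d" "d \<le> \<bar>t - x\<bar>"
  shows "poisson_ker (Complex x y) t \<le> y * (1 + 1 / d\<^sup>2) * poisson_ker (Complex x 1) t"
proof -
  define s where "s = (t - x)\<^sup>2"
  have d: "d\<^sup>2 \<le> s" using assms by (auto simp: s_def intro!: abs_le_square_iff[THEN iffD1])
  have s: "0 < s" using d assms by (auto intro: less_le_trans[OF _ d])
  have "y / (pi * (s + y\<^sup>2)) \<le> y / (pi * s)" using assms s by (intro divide_left_mono mult_left_mono mult_pos_pos add_pos_nonneg) auto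
  also have "\<dots> = y * ((1 + 1 / s) * (1 / (pi * (s + 1))))"
  proof -
    have "1 + 1 / s = (s + 1) / s" using s by (simp add: add_divide_distrib)
    then show ?thesis using s by simp
  qed
  also have "\<dots> \<le> y * ((1 + 1 / d\<^sup>2) * (1 / (pi * (s + 1))))"
    using assms s d by (intro mult_left_mono mult_right_mono add_left_mono divide_left_mono) auto
  finally show ?thesis by (simp add: poisson_ker_Complex s_def)
qed

text \<open>
  Near a point of \<open>A \<subseteq> U\<close>, with \<open>U\<close> open, only \<open>U - A\<close> contributes to the Poisson integral of the
  complement; choosing \<open>U\<close> close to \<open>A\<close>, the maximal inequality makes that contribution small off a small set.
\<close>

lemma density_point:
  assumes [measurable]: "A \<in> sets (borel :: real measure)"
  shows "AE x in lborel. x \<in> A \<longrightarrow> ((\<lambda>y. \<integral>\<^sup>+t. indicator (- A) t * ennreal (poisson_ker (Complex x y) t) \<partial>lborel) \<longlongrightarrow> 0) (at_right 0)"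
proof -
  have main: "AE x in lborel. x \<in> A \<longrightarrow> (\<forall>\<^sub>F y in at_right 0. (\<integral>\<^sup>+t. indicator (- A) t * ennreal (poisson_ker (Complex x y) t) \<partial>lborel) \<le> ennreal (1 / real (Suc k)))" for k
  proof (rule AE_small_exceptional_sets)
    fix e :: real assume e: "0 < e"
    define c where "c = 1 / real (Suc k)"
    \<comment> \<open>The maximal bound \<open>8 * l\<close> then uses half of \<open>c\<close>, and
      the other half is left for the tail \<open>y * C\<close>.\<close>
    define l where "l = c / 16"
    have c: "0 < c" by (simp add: c_def)
    then have l: "0 < l" by (simp add: l_def)
    have "A \<in> sets lebesgue" using assms by (simp add: sets_completionI_sets)
    \<comment> \<open>The bound \<open>e * l / 5\<close> is adjusted to the factor 5 / l in
      \<open>maximal_weak_type\<close>, so that the exceptional set has measure at most e.\<close>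
    then obtain U where U: "open U" "A \<subseteq> U" "U - A \<in> lmeasurable" "emeasure lebesgue (U - A) < ennreal (e * l / 5)"
      using sets_lebesgue_outer_open[of A "e * l / 5"] e l by auto
    have [measurable]: "U \<in> sets borel" using U(1) by simp
    have UA: "emeasure lborel (U - A) < ennreal (e * l / 5)" using U(4) by (simp add: emeasure_completion)
    define h where "h = (\<lambda>t. indicator (U - A) t :: ennreal)"
    have [measurable]: "h \<in> borel_measurable borel" by (simp add: h_def)
    have hi: "(\<integral>\<^sup>+t. h t \<partial>lborel) < ennreal (e * l / 5)" using UA by (simp add: h_def)
    then have "(\<integral>\<^sup>+t. h t \<partial>lborel) < \<infinity>" by (rule less_trans) simp
    from maximal_weak_type[OF _ this l] obtain B where B: "B \<in> sets borel"
        "emeasure lborel B \<le> ennreal (5 / l) * (\<integral>\<^sup>+t. h t \<partial>lborel)"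
        "\<And>x r. x \<notin> B \<Longrightarrow> 0 < r \<Longrightarrow> (\<integral>\<^sup>+t. h t * indicator (cball x r) t \<partial>lborel) \<le> ennreal (2 * r * l)"
      by auto
    show "\<exists>B\<in>sets borel. emeasure lborel B \<le> ennreal e \<and> (\<forall>x. x \<notin> B \<longrightarrow> x \<in> A \<longrightarrow> (\<forall>\<^sub>F y in at_right 0. (\<integral>\<^sup>+t. indicator (- A) t * ennreal (poisson_ker (Complex x y) t) \<partial>lborel) \<le> ennreal (1 / real (Suc k))))"
    proof (intro bexI[OF _ B(1)] conjI allI impI)
      have "emeasure lborel B \<le> ennreal (5 / l) * ennreal (e * l / 5)"
        by (rule order_trans[OF B(2) mult_left_mono[OF less_imp_le[OF hi]]]) simp
      also have "\<dots> = ennreal e" using e l by (simp flip: ennreal_mult)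
      finally show "emeasure lborel B \<le> ennreal e" .
      fix x assume x: "x \<notin> B" "x \<in> A"
      then obtain d where d: "0 < d" "ball x d \<subseteq> U" using U(1,2) openE by blast
      define C where "C = 1 + 1 / d\<^sup>2"
      have C: "0 < C" using d by (simp add: C_def add_pos_nonneg)
      have bd: "(\<integral>\<^sup>+t. indicator (- A) t * ennreal (poisson_ker (Complex x y) t) \<partial>lborel) \<le> ennreal (8 * l + y * C)" if y: "0 < y" for y
      proof -
        have "(\<integral>\<^sup>+t. indicator (- A) t * ennreal (poisson_ker (Complex x y) t) \<partial>lborel)
          \<le> (\<integral>\<^sup>+t. h t * ennreal (poisson_ker (Complex x y) t) + ennreal (y * C) * ennreal (poisson_ker (Complex x 1) t) \<partial>lborel)"
        proof (intro nn_integral_mono)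
          fix t
          show "indicator (- A) t * ennreal (poisson_ker (Complex x y) t) \<le> h t * ennreal (poisson_ker (Complex x y) t) + ennreal (y * C) * ennreal (poisson_ker (Complex x 1) t)"
          proof (cases "t \<in> U")
            case True
            then have "indicator (- A) t = h t" by (auto simp: h_def indicator_def)
            then show ?thesis by simp
          next
            case False
            then have "d \<le> \<bar>t - x\<bar>" using d by (auto simp: dist_real_def subset_iff) (smt (verit))
            then have "ennreal (poisson_ker (Complex x y) t) \<le> ennreal (y * C) * ennreal (poisson_ker (Complex x 1) t)"
              using poisson_ker_tail[OF y d(1), of t x] y C by (auto simp: C_def simp flip: ennreal_mult' intro!: ennreal_leI)
            then show ?thesis by (auto simp: indicator_def intro: order_trans add_increasing)
          qed
        qed
        also have "\<dots> = (\<integral>\<^sup>+t. h t * ennreal (poisson_ker (Complex x y) t) \<partial>lborel) + ennreal (y * C) * (\<integral>\<^sup>+t. ennreal (poisson_ker (Complex x 1) t) \<partial>lborel)"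
          by (subst nn_integral_add) (auto simp: nn_integral_cmult)
        also have "\<dots> \<le> ennreal (8 * l) + ennreal (y * C)"
          using maximal_poisson[of h y l x] y l B(3)[OF x(1)] by (intro add_mono) (auto simp: poisson_ker_nn_integral)
        also have "\<dots> = ennreal (8 * l + y * C)" using l C y by (intro ennreal_plus[symmetric]) auto
        finally show ?thesis .
      qed
      have "\<forall>\<^sub>F y in at_right 0. 0 < y \<and> y < c / (2 * C)"
        using c C by (intro eventually_conj eventually_at_right_less) (auto simp: eventually_at_right_field intro!: exI[of _ "c / (2 * C)"])
      then show "\<forall>\<^sub>F y in at_right 0. (\<integral>\<^sup>+t. indicator (- A) t * ennreal (poisson_ker (Complex x y) t) \<partial>lborel) \<le> ennreal (1 / real (Suc k))"
      proof eventually_elim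
        fix y assume y: "0 < y \<and> y < c / (2 * C)"
        then have "8 * l + y * C \<le> c" using C by (simp add: l_def field_simps)
        then show "(\<integral>\<^sup>+t. indicator (- A) t * ennreal (poisson_ker (Complex x y) t) \<partial>lborel) \<le> ennreal (1 / real (Suc k))"
          using order_trans[OF bd[of y] ennreal_leI] y unfolding c_def[symmetric] by blast
      qed
    qed
  qed
  have "AE x in lborel. \<forall>k. x \<in> A \<longrightarrow> (\<forall>\<^sub>F y in at_right 0. (\<integral>\<^sup>+t. indicator (- A) t * ennreal (poisson_ker (Complex x y) t) \<partial>lborel) \<le> ennreal (1 / real (Suc k)))"
    using main by (subst AE_all_countable) blast
  then show ?thesis
  proof eventually_elim
    fix x assume *: "\<forall>k. x \<in> A \<longrightarrow> (\<forall>\<^sub>F y in at_right 0. (\<integral>\<^sup>+t. indicator (- A) t * ennreal (poisson_ker (Complex x y) t) \<partial>lborel) \<le> ennreal (1 / real (Suc k)))"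
    show "x \<in> A \<longrightarrow> ((\<lambda>y. \<integral>\<^sup>+t. indicator (- A) t * ennreal (poisson_ker (Complex x y) t) \<partial>lborel) \<longlongrightarrow> 0) (at_right 0)"
    proof (intro impI order_tendstoI)
      fix e :: ennreal assume "x \<in> A" "0 < e"
      obtain r where r: "0 < r" "ennreal r < e"
      proof -
        obtain z where "0 < z" "z < e" using dense[OF \<open>0 < e\<close>] by blast
        then show ?thesis using that[of "enn2real z"] by (cases z) (auto simp: ennreal_less_iff)
      qed
      obtain k where "1 / real (Suc k) < r" using nat_approx_posE[OF r(1)] by auto
      then have "ennreal (1 / real (Suc k)) < e" using r(2) ennreal_leI[of "1 / real (Suc k)" r] by (meson le_less_trans less_imp_le)
      with *[rule_format, OF \<open>x \<in> A\<close>, of k]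
      show "\<forall>\<^sub>F y in at_right 0. (\<integral>\<^sup>+t. indicator (- A) t * ennreal (poisson_ker (Complex x y) t) \<partial>lborel) < e"
        by (auto elim!: eventually_mono)
    qed simp
  qed
qed

lemma poisson_ker_scaleR_integrable:
  fixes f :: "real \<Rightarrow> 'a::{banach, second_countable_topology}"
  assumes f: "integrable lborel f" and z: "0 < Im z"
  shows "integrable lborel (\<lambda>t. poisson_ker z t *\<^sub>R f t)"
proof (rule Bochner_Integration.integrable_bound)
  show "integrable lborel (\<lambda>t. (1 / (pi * Im z)) *\<^sub>R f t)" using f by (rule integrable_scaleR_right)
  show "AE t in lborel. norm (poisson_ker z t *\<^sub>R f t) \<le> norm ((1 / (pi * Im z)) *\<^sub>R f t)"
    using mult_right_mono[OF poisson_ker_le[OF z] norm_ge_zero] poisson_ker_nonneg[of z] z by (intro AE_I2) simp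
qed (use f in measurable)

lemma norm_poisson_ker_integral_le:
  fixes f :: "real \<Rightarrow> 'a::{banach, second_countable_topology}"
  assumes f: "integrable lborel f" and z: "0 < Im z"
  shows "ennreal (norm (\<integral>t. poisson_ker z t *\<^sub>R f t \<partial>lborel)) \<le> (\<integral>\<^sup>+t. ennreal (norm (f t)) * ennreal (poisson_ker z t) \<partial>lborel)"
proof -
  have "ennreal (norm (\<integral>t. poisson_ker z t *\<^sub>R f t \<partial>lborel)) \<le> (\<integral>\<^sup>+t. ennreal (norm (poisson_ker z t *\<^sub>R f t)) \<partial>lborel)"
    by (rule integral_norm_bound_ennreal[OF poisson_ker_scaleR_integrable[OF f z]])
  also have "\<dots> = (\<integral>\<^sup>+t. ennreal (norm (f t)) * ennreal (poisson_ker z t) \<partial>lborel)"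
    using z poisson_ker_nonneg[of z] by (intro nn_integral_cong) (simp add: ennreal_mult mult.commute)
  finally show ?thesis .
qed

text \<open>Outside \<open>A\<close> this is \<open>density_point\<close> for the complement of
  \<open>A\<close>; on \<open>A\<close> the integral over the complement tends to 0 and is
  subtracted from the total mass 1.\<close>

lemma poisson_ker_integral_indicator_tendsto:
  assumes [measurable]: "A \<in> sets (borel :: real measure)"
  shows "AE x in lborel. ((\<lambda>y. \<integral>t. poisson_ker (Complex x y) t * indicator A t \<partial>lborel) \<longlongrightarrow> indicator A x) (at_right 0)"
proof -
  have i: "integrable lborel (\<lambda>t. poisson_ker z t * indicator B t)" if "0 < Im z" and [measurable]: "B \<in> sets borel" for z B
    by (rule Bochner_Integration.integrable_bound[OF poisson_ker_integrable[OF that(1)]])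
       (auto simp: indicator_def)
  have e: "(\<integral>\<^sup>+t. indicator B t * ennreal (poisson_ker z t) \<partial>lborel) = ennreal (\<integral>t. poisson_ker z t * indicator B t \<partial>lborel)"
    if "0 < Im z" and "B \<in> sets borel" for z B
  proof -
    have "(\<integral>\<^sup>+t. ennreal (poisson_ker z t * indicator B t) \<partial>lborel) = ennreal (\<integral>t. poisson_ker z t * indicator B t \<partial>lborel)"
      using poisson_ker_nonneg[of z] that(1) by (intro nn_integral_eq_integral i that) (auto simp: indicator_def)
    moreover have "(\<integral>\<^sup>+t. indicator B t * ennreal (poisson_ker z t) \<partial>lborel) = (\<integral>\<^sup>+t. ennreal (poisson_ker z t * indicator B t) \<partial>lborel)"
      by (intro nn_integral_cong) (auto simp: indicator_def)
    ultimately show ?thesis by simp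
  qed
  have lim: "((\<lambda>y. \<integral>t. poisson_ker (Complex x y) t * indicator B t \<partial>lborel) \<longlongrightarrow> 0) (at_right 0)"
    if "((\<lambda>y. \<integral>\<^sup>+t. indicator B t * ennreal (poisson_ker (Complex x y) t) \<partial>lborel) \<longlongrightarrow> 0) (at_right 0)" "B \<in> sets borel" for x B
  proof -
    have ev: "\<forall>\<^sub>F y in at_right (0::real). 0 < y" by (simp add: eventually_at_right_less)
    have "((\<lambda>y. ennreal (\<integral>t. poisson_ker (Complex x y) t * indicator B t \<partial>lborel)) \<longlongrightarrow> ennreal 0) (at_right 0)"
      using that(1)
      by (rule Lim_transform_eventually[THEN iffD1[OF arg_cong[where f = "\<lambda>u. (_ \<longlongrightarrow> u) _"], rotated]])
         (use ev in \<open>eventually_elim, simp add: e that(2)\<close>, simp)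
    then show ?thesis
    proof (rule tendsto_ennrealD)
      show "\<forall>\<^sub>F y in at_right 0. 0 \<le> (\<integral>t. poisson_ker (Complex x y) t * indicator B t \<partial>lborel)"
        using ev by eventually_elim (auto intro!: integral_nonneg_AE simp: poisson_ker_nonneg)
    qed simp
  qed
  have "AE x in lborel. x \<in> - A \<longrightarrow> ((\<lambda>y. \<integral>\<^sup>+t. indicator (- (- A)) t * ennreal (poisson_ker (Complex x y) t) \<partial>lborel) \<longlongrightarrow> 0) (at_right 0)"
    by (rule density_point) simp
  with density_point[OF assms] show ?thesis
  proof eventually_elim
    case (elim x)
    show ?case
    proof (cases "x \<in> A")
      case True
      with elim have "((\<lambda>y. \<integral>t. poisson_ker (Complex x y) t * indicator (- A) t \<partial>lborel) \<longlongrightarrow> 0) (at_right 0)"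
        by (intro lim) auto
      then have "((\<lambda>y. 1 - (\<integral>t. poisson_ker (Complex x y) t * indicator (- A) t \<partial>lborel)) \<longlongrightarrow> 1 - 0) (at_right 0)"
        by (intro tendsto_diff tendsto_const)
      moreover have "\<forall>\<^sub>F y in at_right 0. 1 - (\<integral>t. poisson_ker (Complex x y) t * indicator (- A) t \<partial>lborel)
          = (\<integral>t. poisson_ker (Complex x y) t * indicator A t \<partial>lborel)"
        using eventually_at_right_less[of 0]
      proof eventually_elim
        fix y :: real assume y: "0 < y"
        have "(\<integral>t. poisson_ker (Complex x y) t * indicator A t \<partial>lborel) + (\<integral>t. poisson_ker (Complex x y) t * indicator (- A) t \<partial>lborel)
           = (\<integral>t. poisson_ker (Complex x y) t * indicator A t + poisson_ker (Complex x y) t * indicator (- A) t \<partial>lborel)"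
          using y by (intro Bochner_Integration.integral_add[symmetric] i) auto
        also have "\<dots> = (\<integral>t. poisson_ker (Complex x y) t \<partial>lborel)"
          by (intro Bochner_Integration.integral_cong) (auto simp: indicator_def)
        finally show "1 - (\<integral>t. poisson_ker (Complex x y) t * indicator (- A) t \<partial>lborel)
          = (\<integral>t. poisson_ker (Complex x y) t * indicator A t \<partial>lborel)" using y by (simp add: poisson_ker_integral)
      qed
      ultimately show ?thesis using True by (auto intro: Lim_transform_eventually)
    next
      case False
      with elim show ?thesis using lim[of A x] by simp
    qed
  qed
qed

text \<open>Lebesgue differentiation with Poisson averages. The property passes to dominated limits
  because, off a small set, the maximal inequality bounds the Poisson integral of the error
  uniformly in the height.\<close>

lemma poisson_ker_integral_tendsto_AE:
  fixes f :: "real \<Rightarrow> 'a::{banach, second_countable_topology}"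
  assumes "integrable lborel f"
  shows "AE x in lborel. ((\<lambda>y. \<integral>t. poisson_ker (Complex x y) t *\<^sub>R f t \<partial>lborel) \<longlongrightarrow> f x) (at_right 0)"
  using assms
proof (induction f rule: integrable_induct)
  case (base A c)
  have "AE x in lborel. ((\<lambda>y. \<integral>t. poisson_ker (Complex x y) t * indicator A t \<partial>lborel) \<longlongrightarrow> indicator A x) (at_right 0)"
    using base by (intro poisson_ker_integral_indicator_tendsto) auto
  then show ?case
  proof eventually_elim
    case (elim x)
    then have "((\<lambda>y. (\<integral>t. poisson_ker (Complex x y) t * indicator A t \<partial>lborel) *\<^sub>R c) \<longlongrightarrow> indicator A x *\<^sub>R c) (at_right 0)"
      by (intro tendsto_scaleR tendsto_const)
    moreover have "\<forall>\<^sub>F y in at_right 0. (\<integral>t. poisson_ker (Complex x y) t * indicator A t \<partial>lborel) *\<^sub>R c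
       = (\<integral>t. poisson_ker (Complex x y) t *\<^sub>R (indicator A t *\<^sub>R c) \<partial>lborel)"
      using eventually_at_right_less[of 0]
    proof eventually_elim
      fix y :: real assume y: "0 < y"
      have "integrable lborel (\<lambda>t. poisson_ker (Complex x y) t * indicator A t)"
        by (rule Bochner_Integration.integrable_bound[OF poisson_ker_integrable[of "Complex x y"]])
           (use y base in \<open>auto simp: indicator_def\<close>)
      then show "(\<integral>t. poisson_ker (Complex x y) t * indicator A t \<partial>lborel) *\<^sub>R c = (\<integral>t. poisson_ker (Complex x y) t *\<^sub>R (indicator A t *\<^sub>R c) \<partial>lborel)"
        by simp
    qed
    ultimately show ?case by (rule Lim_transform_eventually)
  qed
next
  case (add f g)
  from add(3,4) show ?case
  proof eventually_elim
    case (elim x)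
    then have "((\<lambda>y. (\<integral>t. poisson_ker (Complex x y) t *\<^sub>R f t \<partial>lborel) + (\<integral>t. poisson_ker (Complex x y) t *\<^sub>R g t \<partial>lborel)) \<longlongrightarrow> f x + g x) (at_right 0)"
      by (intro tendsto_add)
    moreover have "\<forall>\<^sub>F y in at_right 0. (\<integral>t. poisson_ker (Complex x y) t *\<^sub>R f t \<partial>lborel) + (\<integral>t. poisson_ker (Complex x y) t *\<^sub>R g t \<partial>lborel)
       = (\<integral>t. poisson_ker (Complex x y) t *\<^sub>R (f t + g t) \<partial>lborel)"
      using eventually_at_right_less[of 0]
      by eventually_elim (simp add: scaleR_add_right poisson_ker_scaleR_integrable add(1,2))
    ultimately show ?case by (rule Lim_transform_eventually)
  qed
next
  case (lim f s)
  note [measurable] = borel_measurable_integrable[OF lim(1)] borel_measurable_integrable[OF lim(4)]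
  have D: "(\<lambda>i. \<integral>\<^sup>+t. ennreal (norm (s i t - f t)) \<partial>lborel) \<longlonglongrightarrow> 0"
  proof -
    have "(\<lambda>i. \<integral>t. norm (s i t - f t) \<partial>lborel) \<longlonglongrightarrow> (\<integral>t. 0 \<partial>(lborel :: real measure))"
    proof (rule integral_dominated_convergence[where w = "\<lambda>t. 3 * norm (f t)"])
      show "AE t in lborel. (\<lambda>i. norm (s i t - f t)) \<longlonglongrightarrow> 0"
        using lim(2) by (intro AE_I2) (simp add: LIM_zero tendsto_norm_zero)
      show "AE t in lborel. norm (norm (s i t - f t)) \<le> 3 * norm (f t)" for i
      proof (intro AE_I2)
        fix t
        have "norm (s i t - f t) \<le> norm (s i t) + norm (f t)" by (rule norm_triangle_ineq4)
        with lim(3)[of t i] show "norm (norm (s i t - f t)) \<le> 3 * norm (f t)" by simp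
      qed
    qed (use lim(4) in auto)
    then have "(\<lambda>i. ennreal (\<integral>t. norm (s i t - f t) \<partial>lborel)) \<longlonglongrightarrow> ennreal 0"
      by (intro tendsto_ennrealI) simp
    moreover have "(\<integral>\<^sup>+t. ennreal (norm (s i t - f t)) \<partial>lborel) = ennreal (\<integral>t. norm (s i t - f t) \<partial>lborel)" for i
      using lim(1,4) by (intro nn_integral_eq_integral) auto
    ultimately show ?thesis by simp
  qed
  have main: "AE x in lborel. \<forall>\<^sub>F y in at_right 0. norm ((\<integral>t. poisson_ker (Complex x y) t *\<^sub>R f t \<partial>lborel) - f x) \<le> 3 * (1 / real (Suc k))" for k
  proof (rule AE_small_exceptional_sets)
    fix e :: real assume e: "0 < e"
    define c where "c = 1 / real (Suc k)"
    have c: "0 < c" by (simp add: c_def)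
    \<comment> \<open>The set \<open>B\<close> will cost 5 / (c/8) * d = 40 d / c and the set
      \<open>S\<close> another d / c; together this is e.\<close>
    define d where "d = e * c / 41"
    have d: "0 < d" using e c by (simp add: d_def)
    obtain i where i: "(\<integral>\<^sup>+t. ennreal (norm (s i t - f t)) \<partial>lborel) < ennreal d"
      using order_tendstoD(2)[OF D, of "ennreal d"] d by (auto simp: eventually_sequentially)
    define h where "h = (\<lambda>t. ennreal (norm (s i t - f t)))"
    have [measurable]: "h \<in> borel_measurable borel" unfolding h_def by measurable
    have hd: "(\<integral>\<^sup>+t. h t \<partial>lborel) < ennreal d" using i by (simp add: h_def)
    then have "(\<integral>\<^sup>+t. h t \<partial>lborel) < \<infinity>" by (rule less_trans) simp
    from maximal_weak_type[OF _ this, of "c / 8"] c obtain B where B: "B \<in> sets borel"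
        "emeasure lborel B \<le> ennreal (5 / (c / 8)) * (\<integral>\<^sup>+t. h t \<partial>lborel)"
        "\<And>x r. x \<notin> B \<Longrightarrow> 0 < r \<Longrightarrow> (\<integral>\<^sup>+t. h t * indicator (cball x r) t \<partial>lborel) \<le> ennreal (2 * r * (c / 8))"
      by auto
    \<comment> \<open>Chebyshev's inequality bounds this set; outside it the approximant is within
      \<open>c\<close> of f at the point itself.\<close>
    define S where "S = {x. c < norm (s i x - f x)}"
    have S[measurable]: "S \<in> sets borel" unfolding S_def by measurable
    have Sm: "emeasure lborel S \<le> ennreal (1 / c) * (\<integral>\<^sup>+t. h t \<partial>lborel)"
    proof -
      have "emeasure lborel S = (\<integral>\<^sup>+t. indicator S t \<partial>lborel)" by simp
      also have "\<dots> \<le> (\<integral>\<^sup>+t. ennreal (1 / c) * h t \<partial>lborel)"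
      proof (intro nn_integral_mono)
        fix t
        show "(indicator S t :: ennreal) \<le> ennreal (1 / c) * h t"
        proof (cases "t \<in> S")
          case True
          then have "1 \<le> 1 / c * norm (s i t - f t)" using c by (simp add: S_def field_simps)
          then have "ennreal 1 \<le> ennreal (1 / c * norm (s i t - f t))" by (rule ennreal_leI)
          also have "\<dots> = ennreal (1 / c) * h t" unfolding h_def using c by (intro ennreal_mult) auto
          finally show ?thesis using True by simp
        qed simp
      qed
      also have "\<dots> = ennreal (1 / c) * (\<integral>\<^sup>+t. h t \<partial>lborel)" by (rule nn_integral_cmult) measurable
      finally show ?thesis .
    qed
    \<comment> \<open>A Borel null set that covers the points where convergence fails for
      \<open>s i\<close>; it joins the exceptional set.\<close>
    from lim(5)[of i] obtain N where N:
      "{x \<in> space lborel. \<not> ((\<lambda>y. \<integral>t. poisson_ker (Complex x y) t *\<^sub>R s i t \<partial>lborel) \<longlongrightarrow> s i x) (at_right 0)} \<subseteq> N"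
      "emeasure lborel N = 0" "N \<in> sets lborel" by (rule AE_E)
    show "\<exists>B\<in>sets borel. emeasure lborel B \<le> ennreal e \<and>
      (\<forall>x. x \<notin> B \<longrightarrow> (\<forall>\<^sub>F y in at_right 0. norm ((\<integral>t. poisson_ker (Complex x y) t *\<^sub>R f t \<partial>lborel) - f x) \<le> 3 * (1 / real (Suc k))))"
    proof (intro bexI[of _ "B \<union> S \<union> N"] conjI allI impI)
      show "B \<union> S \<union> N \<in> sets borel" using B(1) N(3) S by auto
      have "emeasure lborel (B \<union> S \<union> N) \<le> emeasure lborel (B \<union> S) + emeasure lborel N"
        using B(1) S N(3) by (intro emeasure_subadditive) auto
      also have "\<dots> \<le> emeasure lborel B + emeasure lborel S"
        using B(1) S by (simp add: N(2) emeasure_subadditive)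
      also have "\<dots> \<le> ennreal (5 / (c / 8)) * ennreal d + ennreal (1 / c) * ennreal d"
        by (intro add_mono order_trans[OF B(2) mult_left_mono[OF less_imp_le[OF hd]]] order_trans[OF Sm mult_left_mono[OF less_imp_le[OF hd]]]) simp_all
      also have "\<dots> = ennreal (5 / (c / 8) * d + 1 / c * d)"
        using c d by (simp flip: ennreal_mult ennreal_plus)
      also have "5 / (c / 8) * d + 1 / c * d = e" using c by (simp add: d_def field_simps)
      finally show "emeasure lborel (B \<union> S \<union> N) \<le> ennreal e" .
      fix x assume x: "x \<notin> B \<union> S \<union> N"
      then have "((\<lambda>y. \<integral>t. poisson_ker (Complex x y) t *\<^sub>R s i t \<partial>lborel) \<longlongrightarrow> s i x) (at_right 0)" using N(1) by auto
      from tendstoD[OF this c]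
      have 1: "\<forall>\<^sub>F y in at_right 0. dist (\<integral>t. poisson_ker (Complex x y) t *\<^sub>R s i t \<partial>lborel) (s i x) < c" .
      have 2: "norm (s i x - f x) \<le> c" using x by (simp add: S_def)
      show "\<forall>\<^sub>F y in at_right 0. norm ((\<integral>t. poisson_ker (Complex x y) t *\<^sub>R f t \<partial>lborel) - f x) \<le> 3 * (1 / real (Suc k))"
        using eventually_at_right_less[of 0] 1
      proof eventually_elim
        fix y :: real assume y: "0 < y" and a: "dist (\<integral>t. poisson_ker (Complex x y) t *\<^sub>R s i t \<partial>lborel) (s i x) < c"
        have "ennreal (norm (\<integral>t. poisson_ker (Complex x y) t *\<^sub>R (s i t - f t) \<partial>lborel)) \<le> (\<integral>\<^sup>+t. h t * ennreal (poisson_ker (Complex x y) t) \<partial>lborel)"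
          unfolding h_def using lim(1,4) y by (intro norm_poisson_ker_integral_le) auto
        also have "\<dots> \<le> ennreal (8 * (c / 8))"
          using y c B(3)[of x] x by (intro maximal_poisson) auto
        finally have 3: "norm (\<integral>t. poisson_ker (Complex x y) t *\<^sub>R (s i t - f t) \<partial>lborel) \<le> c"
          using c by (simp add: ennreal_le_iff)
        have "(\<integral>t. poisson_ker (Complex x y) t *\<^sub>R (s i t - f t) \<partial>lborel)
          = (\<integral>t. poisson_ker (Complex x y) t *\<^sub>R s i t \<partial>lborel) - (\<integral>t. poisson_ker (Complex x y) t *\<^sub>R f t \<partial>lborel)"
          using y lim(1,4) by (simp add: scaleR_diff_right poisson_ker_scaleR_integrable)
        with 3 have 4: "dist (\<integral>t. poisson_ker (Complex x y) t *\<^sub>R s i t \<partial>lborel) (\<integral>t. poisson_ker (Complex x y) t *\<^sub>R f t \<partial>lborel) \<le> c"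
          by (simp add: dist_norm)
        from 2 have 5: "dist (s i x) (f x) \<le> c" by (simp add: dist_norm)
        have "dist (\<integral>t. poisson_ker (Complex x y) t *\<^sub>R f t \<partial>lborel) (f x) \<le> 3 * c"
          using dist_triangle[of "\<integral>t. poisson_ker (Complex x y) t *\<^sub>R f t \<partial>lborel" "f x" "\<integral>t. poisson_ker (Complex x y) t *\<^sub>R s i t \<partial>lborel"]
            dist_triangle[of "\<integral>t. poisson_ker (Complex x y) t *\<^sub>R s i t \<partial>lborel" "f x" "s i x"] 4 5 a
          by (simp add: dist_commute)
        then show "norm ((\<integral>t. poisson_ker (Complex x y) t *\<^sub>R f t \<partial>lborel) - f x) \<le> 3 * (1 / real (Suc k))"
          by (simp add: dist_norm c_def)
      qed
    qed
  qed
  have "AE x in lborel. \<forall>k. \<forall>\<^sub>F y in at_right 0. norm ((\<integral>t. poisson_ker (Complex x y) t *\<^sub>R f t \<partial>lborel) - f x) \<le> 3 * (1 / real (Suc k))"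
    using main by (subst AE_all_countable) blast
  then show ?case
  proof eventually_elim
    fix x assume *: "\<forall>k. \<forall>\<^sub>F y in at_right 0. norm ((\<integral>t. poisson_ker (Complex x y) t *\<^sub>R f t \<partial>lborel) - f x) \<le> 3 * (1 / real (Suc k))"
    show "((\<lambda>y. \<integral>t. poisson_ker (Complex x y) t *\<^sub>R f t \<partial>lborel) \<longlongrightarrow> f x) (at_right 0)"
    proof (rule tendstoI)
      fix e :: real assume "0 < e"
      then obtain k where "1 / real (Suc k) < e / 3" using nat_approx_posE[of "e / 3"] by auto
      then have "3 * (1 / real (Suc k)) < e" by simp
      with *[rule_format, of k] show "\<forall>\<^sub>F y in at_right 0. dist (\<integral>t. poisson_ker (Complex x y) t *\<^sub>R f t \<partial>lborel) (f x) < e"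
        by (auto simp: dist_norm elim!: eventually_mono)
    qed
  qed
qed

section \<open>Lebesgue points and nontangential limits\<close>

text \<open>Mean oscillation around the value at x. Its vanishing as y tends to 0 is the notion of
  Lebesgue point used here; the absolute value inside makes it stable under replacing the kernel by
  any other that it dominates.\<close>

definition poisson_osc :: "(real \<Rightarrow> complex) \<Rightarrow> real \<Rightarrow> real \<Rightarrow> ennreal" where
  "poisson_osc f x y = (\<integral>\<^sup>+t. ennreal (norm (f t - f x)) * ennreal (poisson_ker (Complex x y) t) \<partial>lborel)"

lemma le_one_plus_powr:
  fixes a :: real
  assumes "0 \<le> a" "1 \<le> p"
  shows "a \<le> 1 + a powr p"
proof (cases "a \<le> 1")
  case False
  then have "a powr 1 \<le> a powr p" using assms by (intro powr_mono) auto
  then show ?thesis using False by simp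
qed (simp add: add_increasing2)

text \<open>
  Almost every \<open>x\<close> is good for all \<open>\<bar>f - c\<bar>\<close> with \<open>c\<close> in a countable dense set; then take \<open>c\<close> near \<open>f x\<close>.
\<close>

lemma poisson_osc_tendsto_AE:
  assumes f: "lp p f" and p: "1 \<le> p"
  shows "AE x in lborel. (poisson_osc f x \<longlongrightarrow> 0) (at_right 0)"
proof -
  have [measurable]: "f \<in> borel_measurable borel" using f by (rule lp_measurable)
  obtain D :: "complex set" where D: "countable D" "\<And>X. open X \<Longrightarrow> X \<noteq> {} \<Longrightarrow> \<exists>d\<in>D. d \<in> X"
    by (rule countable_dense_setE) blast
  \<comment> \<open>The cutoff makes |f - c| integrable, as
    \<open>poisson_ker_integral_tendsto_AE\<close> requires; an L^p function need not be integrable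
    over the line.\<close>
  define g where "g = (\<lambda>(N::nat) c t. indicator (cball 0 (real N)) t * norm (f t - c))"
  have [measurable]: "cball (0::real) r \<in> sets borel" for r by simp
  have gm[measurable]: "g N c \<in> borel_measurable borel" for N c unfolding g_def by measurable
  have gi: "integrable lborel (g N c)" for N c
  proof (rule Bochner_Integration.integrable_bound)
    show "integrable lborel (\<lambda>t. (1 + norm c) * indicator (cball 0 (real N)) t + norm (f t) powr p)"
      using f by (intro Bochner_Integration.integrable_add integrable_mult_right)
        (auto simp: lp_integrable cball_eq_atLeastAtMost)
    show "AE t in lborel. norm (g N c t) \<le> norm ((1 + norm c) * indicator (cball 0 (real N)) t + norm (f t) powr p)"
    proof (intro AE_I2)
      fix t
      have "norm (f t - c) \<le> norm (f t) + norm c" by (rule norm_triangle_ineq4)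
      also have "\<dots> \<le> 1 + norm (f t) powr p + norm c" using le_one_plus_powr[of "norm (f t)" p] p by simp
      finally have "g N c t \<le> (1 + norm c) * indicator (cball 0 (real N)) t + norm (f t) powr p"
        by (simp add: g_def indicator_def)
      moreover have "0 \<le> g N c t" by (simp add: g_def)
      ultimately show "norm (g N c t) \<le> norm ((1 + norm c) * indicator (cball 0 (real N)) t + norm (f t) powr p)" by simp
    qed
  qed measurable
  have "AE x in lborel. ((\<lambda>y. \<integral>t. poisson_ker (Complex x y) t *\<^sub>R g N c t \<partial>lborel) \<longlongrightarrow> g N c x) (at_right 0)" for N c
    by (rule poisson_ker_integral_tendsto_AE[OF gi])
  then have "AE x in lborel. \<forall>N. \<forall>c\<in>D. ((\<lambda>y. \<integral>t. poisson_ker (Complex x y) t *\<^sub>R g N c t \<partial>lborel) \<longlongrightarrow> g N c x) (at_right 0)"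
    using D(1) by (subst AE_all_countable, intro allI, subst AE_ball_countable) auto
  then show ?thesis
  proof eventually_elim
    fix x assume lim: "\<forall>N. \<forall>c\<in>D. ((\<lambda>y. \<integral>t. poisson_ker (Complex x y) t *\<^sub>R g N c t \<partial>lborel) \<longlongrightarrow> g N c x) (at_right 0)"
    have main: "\<forall>\<^sub>F y in at_right 0. poisson_osc f x y \<le> ennreal (4 * e)" if e: "0 < e" for e
    proof -
      obtain c where c: "c \<in> D" "dist (f x) c < e" using D(2)[of "ball (f x) e"] e by auto
      define N where "N = nat \<lceil>\<bar>x\<bar> + 1\<rceil>"
      have N: "\<bar>x\<bar> + 1 \<le> real N" unfolding N_def by linarith
      have gx: "g N c x < e" using c N by (auto simp: g_def indicator_def dist_norm)
      have ev1: "\<forall>\<^sub>F y in at_right 0. (\<integral>t. poisson_ker (Complex x y) t *\<^sub>R g N c t \<partial>lborel) < 2 * e"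
        by (rule order_tendstoD(2)[OF lim[rule_format, OF c(1), of N]]) (use gx e in linarith)
      \<comment> \<open>Controls |f - c| outside the cutoff. It is finite because |f - c| \<le>
        |f|^p + 1 + |c| and the kernel at height 1 is at most 1 and has mass 1.\<close>
      define K where "K = (\<integral>\<^sup>+t. ennreal (norm (f t - c)) * ennreal (poisson_ker (Complex x 1) t) \<partial>lborel)"
      have "K \<le> (\<integral>\<^sup>+t. ennreal (norm (f t) powr p) + ennreal (1 + norm c) * ennreal (poisson_ker (Complex x 1) t) \<partial>lborel)"
        unfolding K_def
      proof (intro nn_integral_mono)
        fix t
        have a: "norm (f t - c) \<le> norm (f t) powr p + (1 + norm c)"
          using norm_triangle_ineq4[of "f t" c] le_one_plus_powr[of "norm (f t)" p] p by simp
        have b: "0 \<le> poisson_ker (Complex x 1) t" "poisson_ker (Complex x 1) t \<le> 1"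
          using poisson_ker_nonneg[of "Complex x 1"] order_trans[OF poisson_ker_le[of "Complex x 1" t], of 1] pi_ge_two by auto
        have "norm (f t - c) * poisson_ker (Complex x 1) t \<le> norm (f t) powr p * poisson_ker (Complex x 1) t + (1 + norm c) * poisson_ker (Complex x 1) t"
          using mult_right_mono[OF a b(1)] by (simp add: algebra_simps)
        also have "norm (f t) powr p * poisson_ker (Complex x 1) t \<le> norm (f t) powr p" using b by (simp add: mult_left_le)
        finally show "ennreal (norm (f t - c)) * ennreal (poisson_ker (Complex x 1) t) \<le> ennreal (norm (f t) powr p) + ennreal (1 + norm c) * ennreal (poisson_ker (Complex x 1) t)"
          using b by (simp flip: ennreal_mult ennreal_plus add: ennreal_leI)
      qed
      also have "\<dots> = pnorm p f + ennreal (1 + norm c)"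
        unfolding pnorm_def by (subst nn_integral_add) (auto simp: nn_integral_cmult poisson_ker_nn_integral)
      also have "\<dots> < \<infinity>" using lp_pnorm[OF f] by simp
      finally have K: "K < \<infinity>" .
      define K' where "K' = enn2real K"
      have K': "K = ennreal K'" "0 \<le> K'" using K by (auto simp: K'_def)
      have bd: "poisson_osc f x y \<le> ennreal ((\<integral>t. poisson_ker (Complex x y) t *\<^sub>R g N c t \<partial>lborel) + 2 * y * K' + e)" if y: "0 < y" for y
      proof -
        have "poisson_osc f x y \<le> (\<integral>\<^sup>+t. ennreal (poisson_ker (Complex x y) t *\<^sub>R g N c t) + ennreal (2 * y) * (ennreal (norm (f t - c)) * ennreal (poisson_ker (Complex x 1) t)) + ennreal e * ennreal (poisson_ker (Complex x y) t) \<partial>lborel)"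
          unfolding poisson_osc_def
        proof (intro nn_integral_mono)
          fix t
          have p0: "0 \<le> poisson_ker (Complex x y) t" "0 \<le> poisson_ker (Complex x 1) t" using y by (auto intro: poisson_ker_nonneg)
          have "norm (f t - f x) \<le> norm (f t - c) + e"
            using norm_triangle_ineq4[of "f t - c" "f x - c"] c by (simp add: dist_norm)
          from mult_right_mono[OF this p0(1)]
          have 1: "norm (f t - f x) * poisson_ker (Complex x y) t \<le> norm (f t - c) * poisson_ker (Complex x y) t + e * poisson_ker (Complex x y) t"
            by (simp add: algebra_simps)
          have 2: "norm (f t - c) * poisson_ker (Complex x y) t \<le> poisson_ker (Complex x y) t *\<^sub>R g N c t + 2 * y * (norm (f t - c) * poisson_ker (Complex x 1) t)"
          proof (cases "t \<in> cball 0 (real N)")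
            case True
            then show ?thesis using p0 y by (simp add: g_def)
          next
            case False
            then have "1 \<le> \<bar>t - x\<bar>" using N by (simp add: dist_real_def)
            \<comment> \<open>The factor 2 is 1 + 1/d^2 with d = 1: N was chosen so that points
              beyond the cutoff are at distance at least 1 from x.\<close>
            from poisson_ker_tail[OF y _ this] have "poisson_ker (Complex x y) t \<le> 2 * y * poisson_ker (Complex x 1) t" by simp
            from mult_left_mono[OF this, of "norm (f t - c)"] show ?thesis using False by (simp add: g_def mult_ac)
          qed
          have "norm (f t - f x) * poisson_ker (Complex x y) t \<le> poisson_ker (Complex x y) t *\<^sub>R g N c t + 2 * y * (norm (f t - c) * poisson_ker (Complex x 1) t) + e * poisson_ker (Complex x y) t"
            using 1 2 by linarith
          moreover have "0 \<le> g N c t" by (simp add: g_def)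
          ultimately show "ennreal (norm (f t - f x)) * ennreal (poisson_ker (Complex x y) t) \<le> ennreal (poisson_ker (Complex x y) t *\<^sub>R g N c t) + ennreal (2 * y) * (ennreal (norm (f t - c)) * ennreal (poisson_ker (Complex x 1) t)) + ennreal e * ennreal (poisson_ker (Complex x y) t)"
            using p0 y e by (simp flip: ennreal_mult ennreal_plus add: ennreal_leI)
        qed
        also have "\<dots> = (\<integral>\<^sup>+t. ennreal (poisson_ker (Complex x y) t *\<^sub>R g N c t) \<partial>lborel) + ennreal (2 * y) * K + ennreal e"
          unfolding K_def by (subst nn_integral_add, measurable, subst nn_integral_add, measurable)
            (use y in \<open>simp add: nn_integral_cmult poisson_ker_nn_integral\<close>)
        also have "(\<integral>\<^sup>+t. ennreal (poisson_ker (Complex x y) t *\<^sub>R g N c t) \<partial>lborel) = ennreal (\<integral>t. poisson_ker (Complex x y) t *\<^sub>R g N c t \<partial>lborel)"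
          using y by (intro nn_integral_eq_integral poisson_ker_scaleR_integrable gi) (auto simp: g_def intro!: mult_nonneg_nonneg poisson_ker_nonneg)
        also have "ennreal (\<integral>t. poisson_ker (Complex x y) t *\<^sub>R g N c t \<partial>lborel) + ennreal (2 * y) * K + ennreal e
           = ennreal ((\<integral>t. poisson_ker (Complex x y) t *\<^sub>R g N c t \<partial>lborel) + 2 * y * K' + e)"
        proof -
          have "0 \<le> (\<integral>t. poisson_ker (Complex x y) t *\<^sub>R g N c t \<partial>lborel)"
            using y by (intro integral_nonneg_AE AE_I2) (auto simp: g_def intro!: mult_nonneg_nonneg poisson_ker_nonneg)
          then show ?thesis using K' y e by (simp flip: ennreal_mult ennreal_plus)
        qed
        finally show ?thesis .
      qed
      have "0 < e / (2 * (K' + 1))" using e K' by simp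
      from eventually_at_right_less[of 0] eventually_at_right_real[OF this] ev1
      show ?thesis
      proof eventually_elim
        fix y assume y: "0 < y" "y \<in> {0<..<e / (2 * (K' + 1))}" and a: "(\<integral>t. poisson_ker (Complex x y) t *\<^sub>R g N c t \<partial>lborel) < 2 * e"
        have "2 * y * K' \<le> 2 * y * (K' + 1)" using y by simp
        also have "\<dots> \<le> e" using y K' by (simp add: pos_less_divide_eq mult_ac)
        finally have "2 * y * K' \<le> e" .
        then have "(\<integral>t. poisson_ker (Complex x y) t *\<^sub>R g N c t \<partial>lborel) + 2 * y * K' + e \<le> 4 * e" using a by linarith
        with bd[OF y(1)] show "poisson_osc f x y \<le> ennreal (4 * e)" by (meson ennreal_leI order_trans)
      qed
    qed
    show "(poisson_osc f x \<longlongrightarrow> 0) (at_right 0)"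
    proof (rule order_tendstoI)
      fix e :: ennreal assume "0 < e"
      obtain r where r: "0 < r" "ennreal r < e"
      proof -
        obtain z where "0 < z" "z < e" using dense[OF \<open>0 < e\<close>] by blast
        then show ?thesis using that[of "enn2real z"] by (cases z) (auto simp: ennreal_less_iff)
      qed
      from main[of "r / 4"] r show "\<forall>\<^sub>F y in at_right 0. poisson_osc f x y < e"
        by (auto elim!: eventually_mono)
    qed simp
  qed
qed

lemma poisson_minus_const:
  assumes f: "lp p f" "1 < p" and z: "0 < Im z"
  shows "ennreal (norm (poisson f z - c)) \<le> (\<integral>\<^sup>+t. ennreal (norm (f t - c)) * ennreal (poisson_ker z t) \<partial>lborel)"
proof -
  have i: "integrable lborel (\<lambda>t. c * of_real (poisson_ker z t))" using poisson_ker_integrable[OF z] by (intro integrable_mult_right integrable_of_real)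
  have "(\<integral>t. c * of_real (poisson_ker z t) \<partial>lborel) = c"
    using poisson_ker_integral[OF z] by (simp only: integral_mult_right_zero integral_of_real) simp
  then have e: "poisson f z - c = (\<integral>t. (f t - c) * of_real (poisson_ker z t) \<partial>lborel)"
    unfolding poisson_def using poisson_integrable[OF f z] i by (simp add: left_diff_distrib)
  have "integrable lborel (\<lambda>t. (f t - c) * of_real (poisson_ker z t))"
    using poisson_integrable[OF f z] i by (simp add: left_diff_distrib)
  from integral_norm_bound_ennreal[OF this]
  show ?thesis unfolding e using poisson_ker_nonneg[of z] z by (simp add: norm_mult ennreal_mult)
qed

text \<open>From (t - x)^2 \<le> 2 (t - Re z)^2 + 2 (Re z - x)^2 and the cone condition. A point of
  the cone may thus be moved to the vertical line through x at a cost depending only on the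
  aperture.\<close>

lemma poisson_ker_cone:
  assumes "\<bar>Re z - x\<bar> \<le> \<alpha> * Im z" "0 < Im z"
  shows "poisson_ker z t \<le> (2 + 2 * \<alpha>\<^sup>2) * poisson_ker (Complex x (Im z)) t"
proof -
  define y where "y = Im z"
  have y: "0 < y" using assms by (simp add: y_def)
  have "(Re z - x)\<^sup>2 \<le> (\<alpha> * y)\<^sup>2"
    using assms by (intro abs_le_square_iff[THEN iffD1]) (auto simp: y_def)
  moreover have "(t - x)\<^sup>2 \<le> 2 * (t - Re z)\<^sup>2 + 2 * (Re z - x)\<^sup>2"
    using zero_le_power2[of "(t - Re z) - (Re z - x)"] by (simp add: power2_eq_square algebra_simps)
  moreover have "0 \<le> \<alpha>\<^sup>2 * (t - Re z)\<^sup>2" "0 \<le> y\<^sup>2" by (intro mult_nonneg_nonneg zero_le_power2)+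
  ultimately have *: "(t - x)\<^sup>2 + y\<^sup>2 \<le> (2 + 2 * \<alpha>\<^sup>2) * ((t - Re z)\<^sup>2 + y\<^sup>2)"
    unfolding power_mult_distrib distrib_left distrib_right by linarith
  have pos: "0 < (t - x)\<^sup>2 + y\<^sup>2" "0 < (t - Re z)\<^sup>2 + y\<^sup>2" using y by (auto intro: add_nonneg_pos)
  have "1 / ((t - Re z)\<^sup>2 + y\<^sup>2) \<le> (2 + 2 * \<alpha>\<^sup>2) / ((t - x)\<^sup>2 + y\<^sup>2)"
    using * pos by (simp add: field_simps)
  from mult_left_mono[OF this, of "y / pi"] y show ?thesis
    by (simp add: poisson_ker_eq y_def[symmetric] mult_ac)
qed

text \<open>By \<open>poisson_ker_cone\<close> the deviation from f x inside a cone is at most a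
  constant times \<open>poisson_osc\<close> at the same height, so the oscillation along the
  vertical line governs the whole cone.\<close>

lemma poisson_nontangential_limit:
  assumes f: "lp p f" "1 < p" and poisson_osc: "(poisson_osc f x \<longlongrightarrow> 0) (at_right 0)"
  shows "has_nontangential_limit 1 (poisson f) x (f x)"
  unfolding has_nontangential_limit_def
proof (intro allI impI tendstoI)
  fix \<alpha> e :: real assume a: "0 < \<alpha>" and e: "0 < e"
  have [measurable]: "f \<in> borel_measurable borel" using f by (auto simp: lp_def)
  define C where "C = 2 + 2 * \<alpha>\<^sup>2"
  have C: "0 < C" by (simp add: C_def add_pos_nonneg)
  have "\<forall>\<^sub>F y in at_right 0. poisson_osc f x y < ennreal (e / C)"
    by (rule order_tendstoD(2)[OF poisson_osc]) (use e C in auto)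
  then obtain d where d: "0 < d" "\<And>y. 0 < y \<Longrightarrow> y < d \<Longrightarrow> poisson_osc f x y < ennreal (e / C)"
    by (auto simp: eventually_at_right_field)
  show "\<forall>\<^sub>F z in at (complex_of_real x) within stolz_cone 1 \<alpha> x. dist (poisson f z) (f x) < e"
    unfolding eventually_at
  proof (intro exI[of _ d] conjI ballI impI)
    fix z assume z: "z \<in> stolz_cone 1 \<alpha> x" and "z \<noteq> complex_of_real x \<and> dist z (complex_of_real x) < d"
    then have zd: "dist z (complex_of_real x) < d" by simp
    have y: "0 < Im z" "\<bar>Re z - x\<bar> \<le> \<alpha> * Im z" using z by (auto simp: stolz_cone_def half_plane_def)
    have "Im z < d" using zd abs_Im_le_cmod[of "z - complex_of_real x"] by (simp add: dist_norm)
    then have o: "poisson_osc f x (Im z) < ennreal (e / C)" using d y by auto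
    have "ennreal (norm (poisson f z - f x)) \<le> (\<integral>\<^sup>+t. ennreal (norm (f t - f x)) * ennreal (poisson_ker z t) \<partial>lborel)"
      by (rule poisson_minus_const[OF f y(1)])
    also have "\<dots> \<le> (\<integral>\<^sup>+t. ennreal C * (ennreal (norm (f t - f x)) * ennreal (poisson_ker (Complex x (Im z)) t)) \<partial>lborel)"
    proof (intro nn_integral_mono)
      fix t
      have "poisson_ker z t \<le> C * poisson_ker (Complex x (Im z)) t" using poisson_ker_cone[OF y(2,1), of t] by (simp add: C_def)
      then have "ennreal (poisson_ker z t) \<le> ennreal C * ennreal (poisson_ker (Complex x (Im z)) t)"
        using C y by (simp add: ennreal_leI poisson_ker_nonneg flip: ennreal_mult)
      from mult_left_mono[OF this, of "ennreal (norm (f t - f x))"]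
      show "ennreal (norm (f t - f x)) * ennreal (poisson_ker z t) \<le> ennreal C * (ennreal (norm (f t - f x)) * ennreal (poisson_ker (Complex x (Im z)) t))"
        by (simp add: mult_ac)
    qed
    also have "\<dots> = ennreal C * poisson_osc f x (Im z)" unfolding poisson_osc_def by (rule nn_integral_cmult) measurable
    also have "\<dots> < ennreal C * ennreal (e / C)" using o C by (intro ennreal_mult_strict_left_mono) auto
    also have "\<dots> = ennreal e" using C e by (simp flip: ennreal_mult)
    finally show "dist (poisson f z) (f x) < e" using e by (simp add: ennreal_less_iff dist_norm)
  qed (rule d)
qed

lemma poisson_nontangential_AE:
  assumes "lp p f" "1 < p"
  shows "AE x in lborel. has_nontangential_limit 1 (poisson f) x (f x)"
  using poisson_osc_tendsto_AE[OF assms(1)] assms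
  by (auto elim!: eventually_mono intro: poisson_nontangential_limit)

lemma nontangential_vertical:
  assumes "has_nontangential_limit 1 F x l"
  shows "((\<lambda>y. F (Complex x y)) \<longlongrightarrow> l) (at_right 0)"
proof -
  have l: "(F \<longlongrightarrow> l) (at (complex_of_real x) within stolz_cone 1 1 x)"
    using assms by (simp add: has_nontangential_limit_def)
  have "filterlim (\<lambda>y. Complex x y) (at (complex_of_real x) within stolz_cone 1 1 x) (at_right 0)"
    unfolding filterlim_at
  proof
    have "((\<lambda>y. Complex x y) \<longlongrightarrow> Complex x 0) (at_right 0)" by (intro tendsto_intros)
    then show "((\<lambda>y. Complex x y) \<longlongrightarrow> complex_of_real x) (at_right 0)" by (simp add: complex_of_real_def)
    show "\<forall>\<^sub>F y in at_right 0. Complex x y \<in> stolz_cone 1 1 x \<and> Complex x y \<noteq> complex_of_real x"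
      using eventually_at_right_less[of 0]
      by eventually_elim (auto simp: stolz_cone_def half_plane_def complex_eq_iff)
  qed
  then show ?thesis by (rule filterlim_compose[OF l])
qed

lemma nontangential_cong:
  assumes "has_nontangential_limit s F x l" "\<And>z. z \<in> half_plane s \<Longrightarrow> F z = G z"
  shows "has_nontangential_limit s G x l"
  unfolding has_nontangential_limit_def
proof (intro allI impI)
  fix \<alpha> :: real assume "0 < \<alpha>"
  then have "(F \<longlongrightarrow> l) (at (complex_of_real x) within stolz_cone s \<alpha> x)"
    using assms(1) by (simp add: has_nontangential_limit_def)
  then show "(G \<longlongrightarrow> l) (at (complex_of_real x) within stolz_cone s \<alpha> x)"
    by (rule Lim_transform_eventually) (auto simp: eventually_at_filter stolz_cone_def assms(2))
qed

section \<open>Hardy functions are Cauchy integrals\<close>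

lemma integral_FTC_bound:
  fixes P g :: "real \<Rightarrow> complex"
  assumes "a \<le> b" "\<And>y. a \<le> y \<Longrightarrow> y \<le> b \<Longrightarrow> (P has_vector_derivative g y) (at y)" "continuous_on {a..b} g"
  shows "ennreal (norm (P b - P a)) \<le> (\<integral>\<^sup>+y. indicator {a..b} y * ennreal (norm (g y)) \<partial>lborel)"
proof -
  have e: "(\<integral>x. indicator {a..b} x *\<^sub>R g x \<partial>lborel) = P b - P a"
    using assms by (intro integral_FTC_Icc) (auto intro: has_vector_derivative_at_within)
  have "set_integrable lborel {a..b} g" by (rule borel_integrable_atLeastAtMost'[OF assms(3)])
  then have "integrable lborel (\<lambda>x. indicator {a..b} x *\<^sub>R g x)" by (simp add: set_integrable_def)
  from integral_norm_bound_ennreal[OF this] have "ennreal (norm (P b - P a)) \<le> (\<integral>\<^sup>+x. ennreal (norm (indicator {a..b} x *\<^sub>R g x)) \<partial>lborel)"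
    by (simp add: e)
  also have "\<dots> = (\<integral>\<^sup>+y. indicator {a..b} y * ennreal (norm (g y)) \<partial>lborel)"
    by (intro nn_integral_cong) (auto simp: indicator_def)
  finally show ?thesis .
qed

lemma horizontal_deriv:
  assumes "(F has_field_derivative F') (at (Complex x y))"
  shows "((\<lambda>x. F (Complex x y)) has_vector_derivative F') (at x)"
proof -
  have "((\<lambda>x. Complex x y) has_vector_derivative 1) (at x)"
    unfolding Complex_eq by (auto intro!: derivative_eq_intros simp: has_vector_derivative_def scaleR_conv_of_real)
  from field_vector_diff_chain_at[OF this, of F F'] assms show ?thesis by (simp add: o_def)
qed

lemma vertical_deriv:
  assumes "(F has_field_derivative F') (at (Complex x y))"
  shows "((\<lambda>y. F (Complex x y)) has_vector_derivative \<i> * F') (at y)"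
proof -
  have "((\<lambda>y. Complex x y) has_vector_derivative \<i>) (at y)"
    unfolding Complex_eq by (auto intro!: derivative_eq_intros simp: has_vector_derivative_def scaleR_conv_of_real mult.commute)
  from field_vector_diff_chain_at[OF this, of F F'] assms show ?thesis by (simp add: o_def)
qed

definition upper :: "real \<Rightarrow> complex set" where "upper s = {z. s < Im z}"

lemma open_upper: "open (upper s)" and convex_upper: "convex (upper s)"
  unfolding upper_def by (auto simp: open_halfspace_Im_gt convex_halfspace_Im_gt)

text \<open>Cauchy's theorem on rectangles, by means of a primitive on the convex half-plane. The
  vertical sides are assumed small only for some arbitrarily large R, because for Hardy functions
  smallness there is available only on average over R.\<close>

lemma line_shift:
  assumes G: "G holomorphic_on upper s" and ab: "s < a" "a \<le> b"
    and int: "integrable lborel (\<lambda>x. G (Complex x a))" "integrable lborel (\<lambda>x. G (Complex x b))"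
    and small: "\<And>R0 e. 0 < e \<Longrightarrow> \<exists>R\<ge>R0. (\<integral>\<^sup>+y. indicator {a..b} y * ennreal (norm (G (Complex R y))) \<partial>lborel) \<le> ennreal e
      \<and> (\<integral>\<^sup>+y. indicator {a..b} y * ennreal (norm (G (Complex (- R) y))) \<partial>lborel) \<le> ennreal e"
  shows "(\<integral>x. G (Complex x a) \<partial>lborel) = (\<integral>x. G (Complex x b) \<partial>lborel)"
proof -
  obtain P where P: "\<And>w. w \<in> upper s \<Longrightarrow> (P has_field_derivative G w) (at w within upper s)"
    using holomorphic_convex_primitive'[OF convex_upper open_upper G] by blast
  have P': "(P has_field_derivative G w) (at w)" if "s < Im w" for w
    using P[of w] that at_within_open[OF _ open_upper, of w s] by (simp add: upper_def)
  have Gc: "isCont G w" if "s < Im w" for w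
    using that holomorphic_on_imp_continuous_on[OF G] open_upper
    by (auto simp: continuous_on_eq_continuous_at upper_def)
  have cv: "continuous_on A (\<lambda>y. G (Complex x y))" if "A \<subseteq> {a..}" for x A
  proof (intro continuous_at_imp_continuous_on ballI)
    fix y assume "y \<in> A"
    then have "s < Im (Complex x y)" using that ab by auto
    from Gc[OF this] show "isCont (\<lambda>y. G (Complex x y)) y"
      by (rule isCont_o2[rotated]) (simp add: Complex_eq)
  qed
  have ch: "continuous_on A (\<lambda>x. G (Complex x y))" if "s < y" for y A
  proof (intro continuous_at_imp_continuous_on ballI)
    fix x
    from that have "s < Im (Complex x y)" by auto
    from Gc[OF this] show "isCont (\<lambda>x. G (Complex x y)) x"
      by (rule isCont_o2[rotated]) (simp add: Complex_eq)
  qed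
  have hor: "(\<integral>x. indicator {- R..R} x *\<^sub>R G (Complex x y) \<partial>lborel) = P (Complex R y) - P (Complex (- R) y)"
    if "0 \<le> R" "s < y" for R y
    using that by (intro integral_FTC_Icc ch has_vector_derivative_at_within[OF horizontal_deriv] P') auto
  have ver: "ennreal (norm (P (Complex x b) - P (Complex x a))) \<le> (\<integral>\<^sup>+y. indicator {a..b} y * ennreal (norm (G (Complex x y))) \<partial>lborel)" for x
  proof -
    have "ennreal (norm (P (Complex x b) - P (Complex x a))) \<le> (\<integral>\<^sup>+y. indicator {a..b} y * ennreal (norm (\<i> * G (Complex x y))) \<partial>lborel)"
      using ab by (intro integral_FTC_bound vertical_deriv P' continuous_on_mult_left cv) auto
    then show ?thesis by (simp add: norm_mult)
  qed
  have "\<forall>n::nat. \<exists>R\<ge>real n. (\<integral>\<^sup>+y. indicator {a..b} y * ennreal (norm (G (Complex R y))) \<partial>lborel) \<le> ennreal (1 / real (Suc n))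
      \<and> (\<integral>\<^sup>+y. indicator {a..b} y * ennreal (norm (G (Complex (- R) y))) \<partial>lborel) \<le> ennreal (1 / real (Suc n))"
    by (intro allI small) simp
  from choice[OF this] obtain R where "\<forall>n. real n \<le> R n \<and> (\<integral>\<^sup>+y. indicator {a..b} y * ennreal (norm (G (Complex (R n) y))) \<partial>lborel) \<le> ennreal (1 / real (Suc n)) \<and> (\<integral>\<^sup>+y. indicator {a..b} y * ennreal (norm (G (Complex (- R n) y))) \<partial>lborel) \<le> ennreal (1 / real (Suc n))"
    by blast
  then have R: "\<And>n. real n \<le> R n" "\<And>n. (\<integral>\<^sup>+y. indicator {a..b} y * ennreal (norm (G (Complex (R n) y))) \<partial>lborel) \<le> ennreal (1 / real (Suc n))" "\<And>n. (\<integral>\<^sup>+y. indicator {a..b} y * ennreal (norm (G (Complex (- R n) y))) \<partial>lborel) \<le> ennreal (1 / real (Suc n))"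
    by blast+
  have R0: "0 \<le> R n" for n using R(1)[of n] by linarith
  have cvg: "(\<lambda>n. \<integral>x. indicator {- R n..R n} x *\<^sub>R G (Complex x y) \<partial>lborel) \<longlonglongrightarrow> (\<integral>x. G (Complex x y) \<partial>lborel)"
    if "integrable lborel (\<lambda>x. G (Complex x y))" for y
  proof (rule integral_dominated_convergence[where w = "\<lambda>x. norm (G (Complex x y))"])
    show "AE x in lborel. (\<lambda>n. indicator {- R n..R n} x *\<^sub>R G (Complex x y)) \<longlonglongrightarrow> G (Complex x y)"
    proof (intro AE_I2 tendsto_eventually)
      fix x :: real
      obtain N :: nat where "\<bar>x\<bar> \<le> real N" using real_arch_simple by blast
      then show "\<forall>\<^sub>F n in sequentially. indicator {- R n..R n} x *\<^sub>R G (Complex x y) = G (Complex x y)"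
      proof (intro eventually_sequentiallyI[of N])
        fix n assume "\<bar>x\<bar> \<le> real N" "N \<le> n"
        then have "\<bar>x\<bar> \<le> R n" using R(1)[of n] by linarith
        then show "indicator {- R n..R n} x *\<^sub>R G (Complex x y) = G (Complex x y)" by (auto simp: indicator_def)
      qed
    qed
  qed (use that in \<open>auto simp: indicator_def\<close>)
  have diff: "norm ((\<integral>x. indicator {- R n..R n} x *\<^sub>R G (Complex x b) \<partial>lborel) - (\<integral>x. indicator {- R n..R n} x *\<^sub>R G (Complex x a) \<partial>lborel)) \<le> 2 * (1 / real (Suc n))" for n
  proof -
    have "norm (P (Complex (R n) b) - P (Complex (R n) a)) \<le> 1 / real (Suc n)"
      using order_trans[OF ver R(2)[of n]] by (subst (asm) ennreal_le_iff) auto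
    moreover have "norm (P (Complex (- R n) b) - P (Complex (- R n) a)) \<le> 1 / real (Suc n)"
      using order_trans[OF ver R(3)[of n]] by (subst (asm) ennreal_le_iff) auto
    ultimately have "norm ((P (Complex (R n) b) - P (Complex (R n) a)) - (P (Complex (- R n) b) - P (Complex (- R n) a))) \<le> 2 * (1 / real (Suc n))"
      by (intro order_trans[OF norm_triangle_ineq4]) linarith
    then show ?thesis using ab R0[of n] by (simp add: hor algebra_simps)
  qed
  have "(\<lambda>n. (\<integral>x. indicator {- R n..R n} x *\<^sub>R G (Complex x b) \<partial>lborel) - (\<integral>x. indicator {- R n..R n} x *\<^sub>R G (Complex x a) \<partial>lborel)) \<longlonglongrightarrow> 0"
  proof (rule Lim_null_comparison)
    show "\<forall>\<^sub>F n in sequentially. norm ((\<integral>x. indicator {- R n..R n} x *\<^sub>R G (Complex x b) \<partial>lborel) - (\<integral>x. indicator {- R n..R n} x *\<^sub>R G (Complex x a) \<partial>lborel)) \<le> 2 * (1 / real (Suc n))"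
      using diff by (intro always_eventually) blast
    have "(\<lambda>n. 2 * (1 / real (Suc n))) \<longlonglongrightarrow> 2 * 0"
      using LIMSEQ_inverse_real_of_nat by (intro tendsto_mult tendsto_const) (simp add: inverse_eq_divide)
    then show "(\<lambda>n. 2 * (1 / real (Suc n))) \<longlonglongrightarrow> 0" by simp
  qed
  moreover have "(\<lambda>n. (\<integral>x. indicator {- R n..R n} x *\<^sub>R G (Complex x b) \<partial>lborel) - (\<integral>x. indicator {- R n..R n} x *\<^sub>R G (Complex x a) \<partial>lborel))
    \<longlonglongrightarrow> (\<integral>x. G (Complex x b) \<partial>lborel) - (\<integral>x. G (Complex x a) \<partial>lborel)"
    by (intro tendsto_diff cvg int)
  ultimately show ?thesis using LIMSEQ_unique by fastforce
qed

text \<open>Otherwise the integrals over the vertical segments satisfy I x + I (-x) \<ge> 1 for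
  every x \<ge> R0 and have infinite total, while Fubini bounds the integral of \<open>I\<close> by
  M times the length of [a, b].\<close>

lemma good_radius:
  assumes F: "continuous_on (upper 0) F" and a: "0 < a" and p: "0 < p"
    and M: "\<And>y. a \<le> y \<Longrightarrow> pnorm p (\<lambda>x. F (Complex x y)) \<le> M" "M < \<infinity>"
  shows "\<exists>R\<ge>R0. (\<integral>\<^sup>+y. indicator {a..b} y * ennreal (norm (F (Complex R y)) powr p) \<partial>lborel) \<le> 1
      \<and> (\<integral>\<^sup>+y. indicator {a..b} y * ennreal (norm (F (Complex (- R) y)) powr p) \<partial>lborel) \<le> 1"
proof (rule ccontr)
  assume neg: "\<not> ?thesis"
  \<comment> \<open>Extension by 0 makes the function Borel on the whole plane, as Fubini requires;
    on the strip it agrees with \<open>F\<close>.\<close>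
  define H where "H = (\<lambda>w. indicator (upper 0) w *\<^sub>R F w)"
  have [measurable]: "H \<in> borel_measurable borel"
    unfolding H_def using F open_upper by (intro borel_measurable_continuous_on_indicator) auto
  have FH: "indicator {a..b} y * ennreal (norm (F (Complex x y)) powr p) = indicator {a..b} y * ennreal (norm (H (Complex x y)) powr p)" for x y
    using a by (auto simp: H_def indicator_def upper_def)
  define I where "I = (\<lambda>x. \<integral>\<^sup>+y. indicator {a..b} y * ennreal (norm (H (Complex x y)) powr p) \<partial>lborel)"
  have m[measurable]: "(\<lambda>(x, y). indicator {a..b} y * ennreal (norm (H (Complex x y)) powr p)) \<in> borel_measurable (borel \<Otimes>\<^sub>M borel)"
    unfolding Complex_eq by measurable
  have [measurable]: "I \<in> borel_measurable borel"
    unfolding I_def Complex_eq by measurable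
  have one: "(1 :: ennreal) \<le> I x + I (- x)" if "R0 \<le> x" for x
  proof -
    from neg that have "\<not> (I x \<le> 1 \<and> I (- x) \<le> 1)" by (auto simp: I_def FH)
    then show ?thesis by (auto simp: not_le intro: add_increasing add_increasing2 less_imp_le)
  qed
  have fin: "(\<integral>\<^sup>+x. I x \<partial>lborel) < \<infinity>"
  proof -
    have "(\<integral>\<^sup>+x. I x \<partial>lborel) = (\<integral>\<^sup>+y. \<integral>\<^sup>+x. indicator {a..b} y * ennreal (norm (H (Complex x y)) powr p) \<partial>lborel \<partial>lborel)"
      unfolding I_def by (rule lborel_pair.Fubini'[symmetric]) (use m in simp)
    also have "\<dots> \<le> (\<integral>\<^sup>+y. indicator {a..b} y * M \<partial>lborel)"
    proof (intro nn_integral_mono)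
      fix y
      show "(\<integral>\<^sup>+x. indicator {a..b} y * ennreal (norm (H (Complex x y)) powr p) \<partial>lborel) \<le> indicator {a..b} y * M"
        unfolding FH[symmetric] using M(1)[of y] by (auto simp: indicator_def pnorm_def)
    qed
    also have "\<dots> = M * emeasure lborel {a..b}"
      by (simp add: nn_integral_cmult mult.commute[of _ M])
    also have "\<dots> < \<infinity>" using M(2) by (auto simp: ennreal_mult_less_top emeasure_lborel_Icc_eq)
    finally show ?thesis .
  qed
  have "of_nat n \<le> emeasure lborel {R0..}" for n
    using emeasure_mono[of "{R0..R0 + real n}" "{R0..}" lborel] by (auto simp: ennreal_of_nat_eq_real_of_nat)
  then have "emeasure lborel {R0..} = \<infinity>" by (metis ennreal_Ex_less_of_nat infinity_ennreal_def leD less_top)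
  then have "\<infinity> = (\<integral>\<^sup>+x. indicator {R0..} x \<partial>lborel)" by simp
  also have "\<dots> \<le> (\<integral>\<^sup>+x. I x + I (- x) \<partial>lborel)"
    using one by (intro nn_integral_mono) (auto simp: indicator_def)
  also have "\<dots> = (\<integral>\<^sup>+x. I x \<partial>lborel) + (\<integral>\<^sup>+x. I (- x) \<partial>lborel)" by (rule nn_integral_add) auto
  also have "(\<integral>\<^sup>+x. I (- x) \<partial>lborel) = (\<integral>\<^sup>+x. I x \<partial>lborel)"
    using nn_integral_real_affine[of I "-1" 0] by simp
  finally have "(\<integral>\<^sup>+x. I x \<partial>lborel) + (\<integral>\<^sup>+x. I x \<partial>lborel) = top" by (simp add: top_unique)
  then show False using fin by (auto simp: less_top)
qed

lemma lp_kernel_power: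
  assumes z: "Im z \<noteq> 0" and q: "1 < q"
  shows "lp q (\<lambda>t. (1 / (of_real t - z)) ^ Suc n)"
proof (rule lp_mono[OF lp_cmult[OF lp_kernel[OF z q], of "of_real ((1 / \<bar>Im z\<bar>) ^ n)"]])
  fix t :: real
  have a: "\<bar>Im z\<bar> \<le> norm (of_real t - z)"
    using abs_Im_le_cmod[of "of_real t - z"] by simp
  have "norm (1 / (of_real t - z)) \<le> 1 / \<bar>Im z\<bar>"
    using a z by (simp add: norm_divide frac_le)
  then have "norm (1 / (of_real t - z)) ^ n \<le> (1 / \<bar>Im z\<bar>) ^ n" by (intro power_mono) auto
  then have "norm (1 / (of_real t - z)) ^ n * norm (1 / (of_real t - z)) \<le> (1 / \<bar>Im z\<bar>) ^ n * norm (1 / (of_real t - z))"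
    by (rule mult_right_mono) simp
  then show "norm ((1 / (of_real t - z)) ^ Suc n) \<le> norm (of_real ((1 / \<bar>Im z\<bar>) ^ n) * (1 / (of_real t - z)))"
    by (simp add: norm_mult norm_power norm_divide mult.commute)
qed (use q in auto)

section \<open>Holomorphy and symmetries of the Cauchy integral\<close>

text \<open>With k the Cauchy kernel, the difference quotient minus the candidate is exactly w - z
  times the integral of f k(w) k(z)^2, up to 1 / (2 pi i). For |w - z| < |Im z| / 2 one has |k(w)|
  \<le> 2 |k(z)|, so this integral stays bounded and the error tends to 0.\<close>

lemma cauchy_has_derivative:
  assumes f: "lp p f" and p: "1 < p" and z: "Im z \<noteq> 0"
  shows "(cauchy f has_field_derivative (1 / (2 * pi * \<i>) * (\<integral>t. f t * (1 / (of_real t - z))\<^sup>2 \<partial>lborel))) (at z)"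
proof -
  have [measurable]: "f \<in> borel_measurable borel" using f by (rule lp_measurable)
  define k where "k = (\<lambda>(w::complex) t. 1 / (complex_of_real t - w))"
  have i1: "integrable lborel (\<lambda>t. f t * k w t)" if "Im w \<noteq> 0" for w
    unfolding k_def by (rule cauchy_integrable[OF f p that])
  have ip: "integrable lborel (\<lambda>t. f t * k z t ^ Suc n)" for n
    unfolding k_def by (rule lp_mult_integrable[OF f lp_kernel_power[OF z conj_exp(1)[OF p]] p conj_exp[OF p]])
  have i2: "integrable lborel (\<lambda>t. f t * (k z t)\<^sup>2)" using ip[of 1] by (simp add: power2_eq_square)
  define K where "K = (\<integral>t. 2 * norm (f t * k z t ^ 3) \<partial>lborel)"
  have i3: "integrable lborel (\<lambda>t. 2 * norm (f t * k z t ^ 3))"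
    using ip[of 2] by (intro integrable_mult_right integrable_norm) (simp add: numeral_3_eq_3)
  define D where "D = 1 / (2 * pi * \<i>) * (\<integral>t. f t * (k z t)\<^sup>2 \<partial>lborel)"
  have bd: "norm ((cauchy f w - cauchy f z) / (w - z) - D) \<le> norm (w - z) * (K / (2 * pi))"
    if w: "w \<noteq> z" "norm (w - z) < \<bar>Im z\<bar> / 2" for w
  proof -
    have "\<bar>Im w - Im z\<bar> \<le> norm (w - z)" using abs_Im_le_cmod[of "w - z"] by simp
    then have Iw: "Im w \<noteq> 0" using w z by auto
    have eq: "(f t * k w t - f t * k z t) / (w - z) - f t * (k z t)\<^sup>2 = (w - z) * (f t * (k w t * (k z t)\<^sup>2))" for t
    proof -
      have "of_real t - w \<noteq> 0" "of_real t - z \<noteq> 0" using kernel_nonzero[OF Iw] kernel_nonzero[OF z] by auto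
      then have "(k w t - k z t) = (w - z) * (k w t * k z t)" unfolding k_def by (simp add: divide_simps)
      moreover from this have "(w - z) * (k w t * k z t) - (w - z) * (k z t)\<^sup>2 = (w - z) * ((w - z) * (k w t * k z t)) * k z t"
        by (metis (no_types, opaque_lifting) mult.assoc mult.commute power2_eq_square right_diff_distrib)
      ultimately have 1: "k w t - k z t = (w - z) * (k w t * k z t)"
        and 2: "(w - z) * (k w t * k z t) - (w - z) * (k z t)\<^sup>2 = (w - z) * ((w - z) * (k w t * (k z t)\<^sup>2))"
        by (auto simp: power2_eq_square mult_ac)
      have "k w t * k z t - (k z t)\<^sup>2 = (w - z) * (k w t * (k z t)\<^sup>2)"
        using 2 w(1) unfolding right_diff_distrib[symmetric] by simp
      moreover have "(f t * k w t - f t * k z t) / (w - z) = f t * (k w t * k z t)"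
        using 1 w(1) unfolding right_diff_distrib[symmetric] by simp
      ultimately show ?thesis by (simp add: right_diff_distrib[symmetric] mult_ac)
    qed
    have "(cauchy f w - cauchy f z) / (w - z) - D
       = 1 / (2 * pi * \<i>) * (((\<integral>t. f t * k w t \<partial>lborel) - (\<integral>t. f t * k z t \<partial>lborel)) / (w - z) - (\<integral>t. f t * (k z t)\<^sup>2 \<partial>lborel))"
      unfolding cauchy_def D_def k_def by (simp add: diff_divide_distrib right_diff_distrib)
    also have "((\<integral>t. f t * k w t \<partial>lborel) - (\<integral>t. f t * k z t \<partial>lborel)) / (w - z) - (\<integral>t. f t * (k z t)\<^sup>2 \<partial>lborel)
       = (\<integral>t. (f t * k w t - f t * k z t) / (w - z) - f t * (k z t)\<^sup>2 \<partial>lborel)"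
      using i1[OF Iw] i1[OF z] i2 by simp
    also have "\<dots> = (w - z) * (\<integral>t. f t * (k w t * (k z t)\<^sup>2) \<partial>lborel)" unfolding eq by simp
    finally have e: "(cauchy f w - cauchy f z) / (w - z) - D = 1 / (2 * pi * \<i>) * ((w - z) * (\<integral>t. f t * (k w t * (k z t)\<^sup>2) \<partial>lborel))" .
    have dom: "norm (f t * (k w t * (k z t)\<^sup>2)) \<le> 2 * norm (f t * k z t ^ 3)" for t
    proof -
      have a: "\<bar>Im z\<bar> \<le> norm (of_real t - z)" using abs_Im_le_cmod[of "of_real t - z"] by simp
      have "norm (of_real t - z) \<le> norm (of_real t - w) + norm (w - z)"
        using norm_triangle_ineq[of "of_real t - w" "w - z"] by simp
      then have "norm (of_real t - z) / 2 \<le> norm (of_real t - w)" using a w(2) by linarith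
      then have "norm (k w t) \<le> 2 * norm (k z t)"
        unfolding k_def using a z kernel_nonzero[OF z, of t] frac_le[of 1 1 "norm (of_real t - z) / 2" "norm (of_real t - w)"] by (simp add: norm_divide)
      from mult_right_mono[OF this, of "norm (f t) * norm (k z t) ^ 2"]
      show ?thesis by (simp add: norm_mult norm_power power2_eq_square power3_eq_cube mult_ac)
    qed
    have "norm (\<integral>t. f t * (k w t * (k z t)\<^sup>2) \<partial>lborel) \<le> K"
      unfolding K_def
    proof (rule order_trans[OF integral_norm_bound integral_mono])
      have "integrable lborel (\<lambda>t. f t * (k w t * (k z t)\<^sup>2))"
        by (rule Bochner_Integration.integrable_bound[OF i3]) (use dom in \<open>auto simp: k_def\<close>)
      then show "integrable lborel (\<lambda>t. norm (f t * (k w t * (k z t)\<^sup>2)))" by (rule integrable_norm)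
    qed (use i3 dom in auto)
    then have "norm (w - z) * norm (\<integral>t. f t * (k w t * (k z t)\<^sup>2) \<partial>lborel) / (2 * pi) \<le> norm (w - z) * K / (2 * pi)"
      by (intro divide_right_mono mult_left_mono) auto
    then show ?thesis unfolding e by (simp add: norm_mult norm_divide)
  qed
  have "((\<lambda>w. (cauchy f w - cauchy f z) / (w - z) - D) \<longlongrightarrow> 0) (at z)"
  proof (rule Lim_null_comparison)
    have "0 < \<bar>Im z\<bar> / 2" using z by simp
    then show "\<forall>\<^sub>F w in at z. norm ((cauchy f w - cauchy f z) / (w - z) - D) \<le> norm (w - z) * (K / (2 * pi))"
      unfolding eventually_at by (intro exI[of _ "\<bar>Im z\<bar> / 2"] conjI ballI impI bd) (auto simp: dist_norm)
    have "((\<lambda>w. norm (w - z) * (K / (2 * pi))) \<longlongrightarrow> norm (z - z) * (K / (2 * pi))) (at z)" by (intro tendsto_intros)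
    then show "((\<lambda>w. norm (w - z) * (K / (2 * pi))) \<longlongrightarrow> 0) (at z)" by simp
  qed
  then show ?thesis unfolding has_field_derivative_iff D_def k_def by (simp add: LIM_zero_iff)
qed

lemma cauchy_holomorphic: "lp p f \<Longrightarrow> 1 < p \<Longrightarrow> cauchy f holomorphic_on upper 0"
  unfolding holomorphic_on_open[OF open_upper]
  by (intro ballI exI, rule cauchy_has_derivative) (auto simp: upper_def)

text \<open>Conjugation moves the pole to the conjugate point and turns 1 / (2 pi i) into its
  negative. Through this identity values on the lower half-plane become values on the upper
  one.\<close>

lemma cauchy_cnj: "cauchy (\<lambda>t. cnj (f t)) z = - cnj (cauchy f (cnj z))"
proof -
  have "(\<integral>t. cnj (f t) * (1 / (of_real t - z)) \<partial>lborel) = cnj (\<integral>t. f t * (1 / (of_real t - cnj z)) \<partial>lborel)"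
    by (subst Bochner_Integration.integral_cnj[symmetric]) simp
  then show ?thesis by (simp add: cauchy_def)
qed

lemma cauchy_add:
  assumes "lp p f" "lp p g" "1 < p" "Im z \<noteq> 0"
  shows "cauchy (\<lambda>t. f t + g t) z = cauchy f z + cauchy g z"
  using cauchy_integrable[of p f z] cauchy_integrable[of p g z] assms
  by (simp add: cauchy_def distrib_right add_divide_distrib del: times_divide_eq_right)

lemma cauchy_diff:
  assumes "lp p f" "lp p g" "1 < p" "Im z \<noteq> 0"
  shows "cauchy (\<lambda>t. f t - g t) z = cauchy f z - cauchy g z"
  using cauchy_integrable[of p f z] cauchy_integrable[of p g z] assms
  by (simp add: cauchy_def left_diff_distrib diff_divide_distrib del: times_divide_eq_right)

lemma cauchy_cmult: "cauchy (\<lambda>t. c * f t) z = c * cauchy f z"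
  unfolding cauchy_def mult.assoc[of c] integral_mult_right_zero by (simp only: mult.left_commute)

lemma cauchy_minus: "cauchy (\<lambda>t. - f t) z = - cauchy f z"
  using cauchy_cmult[of "-1" f z] by simp

lemma cauchy_cong_AE:
  assumes "AE t in lborel. f t = g t" "f \<in> borel_measurable borel" "g \<in> borel_measurable borel"
  shows "cauchy f z = cauchy g z"
proof -
  note [measurable] = assms(2,3)
  have "(\<integral>t. f t * (1 / (of_real t - z)) \<partial>lborel) = (\<integral>t. g t * (1 / (of_real t - z)) \<partial>lborel)"
    by (rule integral_cong_AE) (use assms(1) in \<open>auto elim!: eventually_mono\<close>)
  then show ?thesis by (simp add: cauchy_def)
qed

text \<open>Young's inequality for s |f| and |k| / s with a free scale \<open>s\<close> takes the
  role of Hoelder's inequality.\<close>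

lemma lp_pairing_tendsto_0:
  assumes pq: "1 < p" "1 < q" "1/p + 1/q = 1"
    and f: "\<And>n::nat. f n \<in> borel_measurable borel" "\<And>n. pnorm p (f n) \<le> M" "M < \<infinity>"
    and k: "\<And>n. k n \<in> borel_measurable borel" "(\<lambda>n. pnorm q (k n)) \<longlonglongrightarrow> 0"
  shows "(\<lambda>n. \<integral>t. f n t * k n t \<partial>lborel) \<longlonglongrightarrow> 0"
proof -
  note [measurable] = f(1) k(1)
  have young': "ennreal (norm (\<integral>t. f n t * k n t \<partial>lborel)) \<le> ennreal (s powr p) * pnorm p (f n) + ennreal (s powr (-q)) * pnorm q (k n)"
    if s: "0 < s" for n s
  proof (cases "integrable lborel (\<lambda>t. f n t * k n t)")
    case True
    have "ennreal (norm (\<integral>t. f n t * k n t \<partial>lborel)) \<le> (\<integral>\<^sup>+t. ennreal (norm (f n t * k n t)) \<partial>lborel)"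
      by (rule integral_norm_bound_ennreal[OF True])
    also have "\<dots> \<le> (\<integral>\<^sup>+t. ennreal (s powr p) * ennreal (norm (f n t) powr p) + ennreal (s powr (-q)) * ennreal (norm (k n t) powr q) \<partial>lborel)"
    proof (intro nn_integral_mono)
      fix t
      have "norm (f n t * k n t) = (s * norm (f n t)) * (norm (k n t) / s)" using s by (simp add: norm_mult)
      also have "\<dots> \<le> (s * norm (f n t)) powr p + (norm (k n t) / s) powr q" using s by (intro young pq) auto
      also have "\<dots> = s powr p * norm (f n t) powr p + s powr (-q) * norm (k n t) powr q"
        using s by (simp add: powr_mult powr_divide powr_minus divide_inverse inverse_powr mult.commute)
      finally show "ennreal (norm (f n t * k n t)) \<le> ennreal (s powr p) * ennreal (norm (f n t) powr p) + ennreal (s powr (-q)) * ennreal (norm (k n t) powr q)"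
        by (simp flip: ennreal_mult ennreal_plus add: ennreal_leI)
    qed
    also have "\<dots> = ennreal (s powr p) * pnorm p (f n) + ennreal (s powr (-q)) * pnorm q (k n)"
      unfolding pnorm_def by (simp add: nn_integral_add nn_integral_cmult)
    finally show ?thesis .
  qed (simp add: not_integrable_integral_eq)
  define M' where "M' = enn2real M"
  have M': "M = ennreal M'" "0 \<le> M'" using f(3) by (auto simp: M'_def)
  show ?thesis
  proof (rule LIMSEQ_I)
    fix e :: real assume e: "0 < e"
    \<comment> \<open>The scale makes the term with s^p less than e/2; only then is n taken large,
      for the other term with its now fixed factor s^(-q).\<close>
    define s where "s = (e / 2 / (M' + 1)) powr (1 / p)"
    have s: "0 < s" using e M' by (simp add: s_def)
    have "s powr p = e / 2 / (M' + 1)" using pq e M' by (simp add: s_def powr_powr)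
    moreover have "M' + 1 \<noteq> 0" using M' by linarith
    ultimately have "s powr p * (M' + 1) = e / 2"
      using nonzero_eq_divide_eq[of "M' + 1"] by blast
    moreover have "s powr p * M' < s powr p * (M' + 1)" using s by (intro mult_strict_left_mono) auto
    ultimately have sM: "s powr p * M' < e / 2" by simp
    have "(\<lambda>n. ennreal (s powr (-q)) * pnorm q (k n)) \<longlonglongrightarrow> ennreal (s powr (-q)) * 0"
      by (intro ennreal_tendsto_cmult k(2)) simp
    then have "(\<lambda>n. ennreal (s powr (-q)) * pnorm q (k n)) \<longlonglongrightarrow> 0" by simp
    from order_tendstoD(2)[OF this, of "ennreal (e / 2)"] e
    obtain N where N: "\<And>n. N \<le> n \<Longrightarrow> ennreal (s powr (-q)) * pnorm q (k n) < ennreal (e / 2)"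
      by (auto simp: eventually_sequentially)
    show "\<exists>N. \<forall>n\<ge>N. norm ((\<integral>t. f n t * k n t \<partial>lborel) - 0) < e"
    proof (intro exI allI impI)
      fix n assume n: "N \<le> n"
      have "ennreal (norm (\<integral>t. f n t * k n t \<partial>lborel)) \<le> ennreal (s powr p) * pnorm p (f n) + ennreal (s powr (-q)) * pnorm q (k n)"
        by (rule young'[OF s])
      also have "\<dots> \<le> ennreal (s powr p) * ennreal M' + ennreal (e / 2)"
        using f(2)[of n] N[OF n] M'(1) by (intro add_mono mult_left_mono) auto
      also have "\<dots> = ennreal (s powr p * M' + e / 2)" using M' e by (simp flip: ennreal_mult ennreal_plus)
      finally have "norm (\<integral>t. f n t * k n t \<partial>lborel) \<le> s powr p * M' + e / 2"
        using M' e by (subst (asm) ennreal_le_iff) auto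
      then show "norm ((\<integral>t. f n t * k n t \<partial>lborel) - 0) < e" using sM by simp
    qed
  qed
qed

lemma kernel_norm_mono:
  assumes "Im w < 0" "0 \<le> s"
  shows "norm (1 / (of_real t - (w - \<i> * of_real s))) \<le> norm (1 / (of_real t - w))"
proof -
  have n: "of_real t - w \<noteq> 0" using assms by (intro kernel_nonzero) auto
  have "(Im w)\<^sup>2 \<le> (Im w - s)\<^sup>2" using assms by (intro abs_le_square_iff[THEN iffD1]) auto
  then have "norm (of_real t - w) \<le> norm (of_real t - (w - \<i> * of_real s))"
    by (auto simp: cmod_def power2_commute)
  then show ?thesis using n by (simp add: norm_divide frac_le)
qed

lemma pnorm_kernel_le:
  assumes "Im w < 0" "0 \<le> s" "0 \<le> q"
  shows "pnorm q (\<lambda>t. 1 / (of_real t - (w - \<i> * of_real s))) \<le> pnorm q (\<lambda>t. 1 / (of_real t - w))"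
  using assms by (intro pnorm_mono kernel_norm_mono)

text \<open>Lowering the pole shrinks the kernel, so the kernel with pole \<open>w\<close> dominates
  all later ones; pointwise they are at most 1/n.\<close>

lemma pnorm_kernel_tendsto_0:
  assumes w: "Im w < 0" and q: "1 < q"
  shows "(\<lambda>n. pnorm q (\<lambda>t. 1 / (of_real t - (w - \<i> * of_real (real n))))) \<longlonglongrightarrow> 0"
proof -
  define k where "k = (\<lambda>n t. 1 / (of_real t - (w - \<i> * complex_of_real (real n))))"
  have [measurable]: "k n \<in> borel_measurable borel" for n unfolding k_def by measurable
  have i0: "integrable lborel (\<lambda>t. norm (1 / (of_real t - w)) powr q)"
    using lp_kernel[OF _ q, of w] w by (simp add: lp_integrable)
  have dom: "norm (k n t) powr q \<le> norm (1 / (of_real t - w)) powr q" for n t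
    unfolding k_def using q w by (intro powr_mono2 kernel_norm_mono) auto
  have i: "integrable lborel (\<lambda>t. norm (k n t) powr q)" for n
    by (rule Bochner_Integration.integrable_bound[OF i0]) (use dom in auto)
  have "(\<lambda>n. \<integral>t. norm (k n t) powr q \<partial>lborel) \<longlonglongrightarrow> (\<integral>t. 0 \<partial>(lborel :: real measure))"
  proof (rule integral_dominated_convergence[where w = "\<lambda>t. norm (1 / (of_real t - w)) powr q"])
    show "AE t in lborel. (\<lambda>n. norm (k n t) powr q) \<longlonglongrightarrow> 0"
    proof (intro AE_I2)
      fix t :: real
      have "(\<lambda>n. k n t) \<longlonglongrightarrow> 0"
      proof (rule Lim_null_comparison[OF _ lim_inverse_n])
        show "\<forall>\<^sub>F n in sequentially. norm (k n t) \<le> inverse (of_nat n)"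
        proof (rule eventually_sequentiallyI[of 1])
          fix n :: nat assume "1 \<le> n"
          have "real n \<le> \<bar>Im (of_real t - (w - \<i> * of_real (real n)))\<bar>" using w by simp
          also have "\<dots> \<le> norm (of_real t - (w - \<i> * of_real (real n)))" by (rule abs_Im_le_cmod)
          finally show "norm (k n t) \<le> inverse (of_nat n)"
            using \<open>1 \<le> n\<close> by (simp add: k_def norm_divide inverse_eq_divide frac_le)
        qed
      qed
      then have "(\<lambda>n. norm (k n t) powr q) \<longlonglongrightarrow> norm (0 :: complex) powr q"
        using q by (intro tendsto_powr' tendsto_norm tendsto_const) auto
      then show "(\<lambda>n. norm (k n t) powr q) \<longlonglongrightarrow> 0" by simp
    qed
  qed (use i0 dom in auto)
  then have "(\<lambda>n. ennreal (\<integral>t. norm (k n t) powr q \<partial>lborel)) \<longlonglongrightarrow> ennreal 0"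
    by (intro tendsto_ennrealI) simp
  moreover have "pnorm q (k n) = ennreal (\<integral>t. norm (k n t) powr q \<partial>lborel)" for n
    unfolding pnorm_def using i by (intro nn_integral_eq_integral) auto
  ultimately show ?thesis by (simp add: k_def)
qed

text \<open>
  For \<open>c = F u\<close> the pole at \<open>u\<close> cancels; subtracting \<open>1 / (w - v)\<close> makes the correction term
  integrable along horizontal lines. For \<open>c = 0\<close> this is Cauchy's theorem with \<open>u\<close> below the line.
\<close>

lemma hardy_line_integral:
  assumes F: "F holomorphic_on upper 0" and p: "1 < p"
    and M: "\<And>y. 0 < y \<Longrightarrow> pnorm p (\<lambda>x. F (Complex x y)) \<le> M" "M < \<infinity>"
    and s: "0 \<le> s" "s < a"
    and G: "G holomorphic_on upper s"
      "\<And>w. s < Im w \<Longrightarrow> w \<noteq> u \<Longrightarrow> G w = F w * (1 / (w - u)) - c * (1 / (w - u) - 1 / (w - v))"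
    and u: "Im u \<noteq> a" and v: "Im v < a"
  shows "(\<integral>x. F (Complex x a) * (1 / (of_real x - (u - \<i> * of_real a))) \<partial>lborel)
    = c * (\<integral>x. 1 / (of_real x - (u - \<i> * of_real a)) - 1 / (of_real x - (v - \<i> * of_real a)) \<partial>lborel)"
proof -
  define q where "q = conj_exp p"
  have q: "1 < q" "1 / p + 1 / q = 1" using conj_exp[OF p] by (auto simp: q_def)
  have q': "1 / q + 1 / p = 1" using q by simp
  have Fc: "continuous_on (upper 0) F" using F by (rule holomorphic_on_imp_continuous_on)
  have Fm[measurable]: "(\<lambda>x. F (Complex x y)) \<in> borel_measurable borel" if "0 < y" for y
  proof (rule borel_measurable_continuous_onI)
    show "continuous_on UNIV (\<lambda>x. F (Complex x y))"
      by (rule continuous_on_compose2[OF Fc]) (use that in \<open>auto simp: upper_def Complex_eq intro!: continuous_intros\<close>)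
  qed
  have lpF: "lp p (\<lambda>x. F (Complex x y))" if "0 < y" for y
    using Fm[OF that] le_less_trans[OF M(1)[OF that] M(2)] by (simp add: lp_def)
  have Ce: "Complex x y - w = of_real x - (w - \<i> * of_real y)" for x y w by (simp add: Complex_eq)
  define k where "k = (\<lambda>w b x. 1 / (complex_of_real x - (w - \<i> * complex_of_real b)))"
  have km[measurable]: "k w b \<in> borel_measurable borel" for w b unfolding k_def by measurable
  have lpk: "lp r (k w b)" if "Im w \<noteq> b" "1 < r" for w b r unfolding k_def using that by (intro lp_kernel) auto
  have i1: "integrable lborel (\<lambda>x. F (Complex x b) * k u b x)" if "0 < b" "Im u \<noteq> b" for b
    by (rule lp_mult_integrable[OF lpF lpk]) (use that p q in auto)
  \<comment> \<open>A single kernel decays like 1/|x| and is not integrable. The difference of two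
    is a product of kernels, one taken in L^p and the other in L^q.\<close>
  have kd: "k u b x - k v b x = (u - v) * (k v b x * k u b x)" if "Im u \<noteq> b" "Im v \<noteq> b" for b x
  proof -
    have "of_real x - (u - \<i> * of_real b) \<noteq> 0" using that by (intro kernel_nonzero) simp
    moreover have "of_real x - (v - \<i> * of_real b) \<noteq> 0" using that by (intro kernel_nonzero) simp
    ultimately show ?thesis unfolding k_def by (simp add: divide_simps)
  qed
  have i2: "integrable lborel (\<lambda>x. k u b x - k v b x)" if "Im u \<noteq> b" "Im v \<noteq> b" for b
    unfolding kd[OF that] by (intro integrable_mult_right lp_mult_integrable[OF lpk lpk _ _ q(2)]) (use that p q in auto)
  have Gk: "G (Complex x b) = F (Complex x b) * k u b x - c * (k u b x - k v b x)" if "s < b" "Im u \<noteq> b" for x b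
  proof -
    have "Complex x b \<noteq> u" using that by auto
    with that have "G (Complex x b) = F (Complex x b) * (1 / (Complex x b - u)) - c * (1 / (Complex x b - u) - 1 / (Complex x b - v))"
      by (intro G(2)) auto
    then show ?thesis by (simp only: k_def Ce)
  qed
  define J where "J = (\<lambda>b. (\<integral>x. F (Complex x b) * k u b x \<partial>lborel) - c * (\<integral>x. k u b x - k v b x \<partial>lborel))"
  have iG: "integrable lborel (\<lambda>x. G (Complex x b))" and GJ: "(\<integral>x. G (Complex x b) \<partial>lborel) = J b"
    if "s < b" "Im u \<noteq> b" "Im v \<noteq> b" for b
    using i1[of b] i2[of b] that s by (auto simp: Gk J_def)
  have shift: "J a = J b" if b: "a \<le> b" "Im u < b" for b
  proof -
    have "(\<integral>x. G (Complex x a) \<partial>lborel) = (\<integral>x. G (Complex x b) \<partial>lborel)"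
    proof (rule line_shift[OF G(1) s(2) b(1)])
      fix R0 e :: real assume e: "0 < e"
      define c0 where "c0 = \<bar>Re u\<bar> + \<bar>Re v\<bar>"
      \<comment> \<open>A vertical side at horizontal distance at least d from both poles
        contributes at most T / d; hence R is taken beyond \<open>c0 + T / e\<close>.\<close>
      define T where "T = (b - a) * (1 + 2 * norm c) + 1"
      have T: "0 < T" using b by (auto simp: T_def intro!: add_nonneg_pos mult_nonneg_nonneg)
      obtain R where R: "R \<ge> max R0 (c0 + T / e)"
        "(\<integral>\<^sup>+y. indicator {a..b} y * ennreal (norm (F (Complex R y)) powr p) \<partial>lborel) \<le> 1"
        "(\<integral>\<^sup>+y. indicator {a..b} y * ennreal (norm (F (Complex (- R) y)) powr p) \<partial>lborel) \<le> 1"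
        using good_radius[OF Fc, of a p M "max R0 (c0 + T / e)" b] s p M by auto
      define d where "d = R - c0"
      have "0 < T / e" using T e by simp
      then have d: "T / e \<le> d" "0 < d" using R(1) unfolding d_def by linarith+
      have bd: "(\<integral>\<^sup>+y. indicator {a..b} y * ennreal (norm (G (Complex X y))) \<partial>lborel) \<le> ennreal e"
        if X: "\<bar>X\<bar> = R" and X1: "(\<integral>\<^sup>+y. indicator {a..b} y * ennreal (norm (F (Complex X y)) powr p) \<partial>lborel) \<le> 1" for X
      proof -
        have kb: "norm (1 / (Complex X y - w)) \<le> 1 / d" "Complex X y \<noteq> w" if "w = u \<or> w = v" for y w
        proof -
          have "d \<le> \<bar>Re (Complex X y - w)\<bar>" using X that by (auto simp: d_def c0_def)
          also have "\<dots> \<le> norm (Complex X y - w)" by (rule abs_Re_le_cmod)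
          finally have "d \<le> norm (Complex X y - w)" .
          then show "norm (1 / (Complex X y - w)) \<le> 1 / d" "Complex X y \<noteq> w"
            using d(2) by (auto simp: norm_divide intro: frac_le)
        qed
        have Gb: "norm (G (Complex X y)) \<le> (1 + 2 * norm c) / d + 1 / d * norm (F (Complex X y)) powr p" if "s < y" for y
        proof -
          have "norm (G (Complex X y)) \<le> norm (F (Complex X y) * (1 / (Complex X y - u))) + norm (c * (1 / (Complex X y - u) - 1 / (Complex X y - v)))"
            using G(2)[of "Complex X y"] that kb(2)[of u y] by (auto intro: norm_triangle_ineq4)
          also have "\<dots> \<le> norm (F (Complex X y)) * (1 / d) + norm c * (1 / d + 1 / d)"
            unfolding norm_mult
            by (intro add_mono mult_left_mono order_trans[OF norm_triangle_ineq4] kb(1)) auto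
          \<comment> \<open>The inequality r \<le> 1 + r^p turns the p-th power bound of
            \<open>good_radius\<close> into control of the integral of |F|.\<close>
          also have "\<dots> \<le> (1 + norm (F (Complex X y)) powr p) * (1 / d) + norm c * (1 / d + 1 / d)"
            using d p by (intro add_right_mono mult_right_mono le_one_plus_powr) auto
          finally show ?thesis by (simp add: add_divide_distrib algebra_simps)
        qed
        have "(\<integral>\<^sup>+y. indicator {a..b} y * ennreal (norm (G (Complex X y))) \<partial>lborel)
          \<le> (\<integral>\<^sup>+y. ennreal ((1 + 2 * norm c) / d) * indicator {a..b} y + ennreal (1 / d) * (indicator {a..b} y * ennreal (norm (F (Complex X y)) powr p)) \<partial>lborel)"
        proof (intro nn_integral_mono)
          fix y
          show "indicator {a..b} y * ennreal (norm (G (Complex X y))) \<le> ennreal ((1 + 2 * norm c) / d) * indicator {a..b} y + ennreal (1 / d) * (indicator {a..b} y * ennreal (norm (F (Complex X y)) powr p))"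
          proof (cases "y \<in> {a..b}")
            case True
            then have "ennreal (norm (G (Complex X y))) \<le> ennreal ((1 + 2 * norm c) / d + 1 / d * norm (F (Complex X y)) powr p)"
              using s by (intro ennreal_leI Gb) auto
            also have "\<dots> = ennreal ((1 + 2 * norm c) / d) + ennreal (1 / d) * ennreal (norm (F (Complex X y)) powr p)"
              using d by (subst ennreal_plus) (auto simp flip: ennreal_mult)
            finally show ?thesis using True by simp
          qed simp
        qed
        also have "\<dots> = ennreal ((1 + 2 * norm c) / d) * ennreal (b - a) + ennreal (1 / d) * (\<integral>\<^sup>+y. indicator {a..b} y * ennreal (norm (F (Complex X y)) powr p) \<partial>lborel)"
        proof -
          have "(\<lambda>y. indicator {a..b} y *\<^sub>R F (Complex X y)) \<in> borel_measurable borel"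
          proof (rule borel_measurable_continuous_on_indicator)
            show "continuous_on {a..b} (\<lambda>y. F (Complex X y))"
              by (rule continuous_on_compose2[OF Fc]) (use s in \<open>auto simp: upper_def Complex_eq intro!: continuous_intros\<close>)
          qed simp
          note [measurable] = this
          have "(\<lambda>y. indicator {a..b} y * ennreal (norm (F (Complex X y)) powr p)) = (\<lambda>y. indicator {a..b} y * ennreal (norm (indicator {a..b} y *\<^sub>R F (Complex X y)) powr p))"
            by (auto simp: indicator_def)
          also have "\<dots> \<in> borel_measurable borel" by measurable
          finally have [measurable]: "(\<lambda>y. indicator {a..b} y * ennreal (norm (F (Complex X y)) powr p)) \<in> borel_measurable borel" .
          show ?thesis
            using b by (subst nn_integral_add) (auto simp: nn_integral_cmult)
        qed
        also have "\<dots> \<le> ennreal ((1 + 2 * norm c) / d) * ennreal (b - a) + ennreal (1 / d) * 1"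
          using X1 by (intro add_left_mono mult_left_mono) auto
        also have "\<dots> = ennreal (T / d)"
        proof -
          have "T / d = (1 + 2 * norm c) / d * (b - a) + 1 / d"
            by (simp only: T_def add_divide_distrib[of _ 1] mult.commute[of "b - a"] times_divide_eq_left)
          moreover have "ennreal ((1 + 2 * norm c) / d) * ennreal (b - a) = ennreal ((1 + 2 * norm c) / d * (b - a))"
            using d b by (intro ennreal_mult[symmetric]) auto
          moreover have "ennreal ((1 + 2 * norm c) / d * (b - a) + 1 / d) = ennreal ((1 + 2 * norm c) / d * (b - a)) + ennreal (1 / d)"
            using d b by (intro ennreal_plus) auto
          ultimately show ?thesis by simp
        qed
        also have "\<dots> \<le> ennreal e" using d e by (intro ennreal_leI) (simp add: field_simps)
        finally show ?thesis .
      qed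
      have "0 \<le> R" using d T e by (auto simp: d_def c0_def)
      then show "\<exists>R\<ge>R0. (\<integral>\<^sup>+y. indicator {a..b} y * ennreal (norm (G (Complex R y))) \<partial>lborel) \<le> ennreal e
         \<and> (\<integral>\<^sup>+y. indicator {a..b} y * ennreal (norm (G (Complex (- R) y))) \<partial>lborel) \<le> ennreal e"
        using R by (intro exI[of _ R] conjI bd) auto
    qed (use iG u v s b in auto)
    then show ?thesis using GJ[of a] GJ[of b] u v s b by auto
  qed
  \<comment> \<open>A starting height above the line \<open>a\<close> and above both poles, so that
    on all higher lines the kernels only get smaller.\<close>
  define b0 where "b0 = \<bar>Im u\<bar> + a + 1"
  have b0: "Im u < b0" "Im v < b0" "a < b0" "0 < b0" using v s by (auto simp: b0_def)
  define u0 v0 where "u0 = u - \<i> * of_real b0" and "v0 = v - \<i> * of_real b0"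
  have uv0: "Im u0 < 0" "Im v0 < 0" using b0 by (auto simp: u0_def v0_def)
  have ke: "k u (b0 + real n) = (\<lambda>t. 1 / (of_real t - (u0 - \<i> * of_real (real n))))"
           "k v (b0 + real n) = (\<lambda>t. 1 / (of_real t - (v0 - \<i> * of_real (real n))))" for n
    unfolding k_def u0_def v0_def by (simp_all add: algebra_simps)
  have k0: "(\<lambda>n. pnorm r (k u (b0 + real n))) \<longlonglongrightarrow> 0" if "1 < r" for r
    unfolding ke by (rule pnorm_kernel_tendsto_0[OF uv0(1) that])
  have l1: "(\<lambda>n. \<integral>x. F (Complex x (b0 + real n)) * k u (b0 + real n) x \<partial>lborel) \<longlonglongrightarrow> 0"
  proof (rule lp_pairing_tendsto_0[OF p q _ _ M(2) _ k0[OF q(1)]])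
    show "pnorm p (\<lambda>x. F (Complex x (b0 + real n))) \<le> M" for n using b0 by (intro M(1)) auto
    show "(\<lambda>x. F (Complex x (b0 + real n))) \<in> borel_measurable borel" for n using b0 by (intro Fm) auto
  qed (rule km)
  \<comment> \<open>By \<open>kd\<close> the correction term is a pairing in which one kernel stays
    bounded in L^p and the other tends to 0 in L^q.\<close>
  have l2: "(\<lambda>n. \<integral>x. k v (b0 + real n) x * k u (b0 + real n) x \<partial>lborel) \<longlonglongrightarrow> 0"
  proof (rule lp_pairing_tendsto_0[OF p q _ _ _ _ k0[OF q(1)]])
    show "pnorm p (k v (b0 + real n)) \<le> pnorm p (\<lambda>t. 1 / (of_real t - v0))" for n
      unfolding ke using uv0 p by (intro pnorm_kernel_le) auto
    show "pnorm p (\<lambda>t. 1 / (of_real t - v0)) < \<infinity>" using uv0 p by (intro lp_pnorm lp_kernel) auto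
  qed (rule km)+
  have "(\<lambda>n. (\<integral>x. F (Complex x (b0 + real n)) * k u (b0 + real n) x \<partial>lborel) - c * ((u - v) * (\<integral>x. k v (b0 + real n) x * k u (b0 + real n) x \<partial>lborel))) \<longlonglongrightarrow> 0 - c * ((u - v) * 0)"
    by (intro tendsto_diff tendsto_mult tendsto_const l1 l2)
  moreover have "(\<integral>x. F (Complex x (b0 + real n)) * k u (b0 + real n) x \<partial>lborel) - c * ((u - v) * (\<integral>x. k v (b0 + real n) x * k u (b0 + real n) x \<partial>lborel)) = J a" for n
  proof -
    have "J (b0 + real n) = (\<integral>x. F (Complex x (b0 + real n)) * k u (b0 + real n) x \<partial>lborel) - c * ((u - v) * (\<integral>x. k v (b0 + real n) x * k u (b0 + real n) x \<partial>lborel))"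
      unfolding J_def using b0 by (subst kd) auto
    then show ?thesis using shift[of "b0 + real n"] b0 by simp
  qed
  ultimately have "(\<lambda>n::nat. J a) \<longlonglongrightarrow> 0" by simp
  then have "J a = 0" by (simp add: LIMSEQ_const_iff)
  then show ?thesis by (simp add: J_def k_def)
qed

text \<open>Shifting by \<open>a\<close> puts the pole \<open>u\<close> above the line at height
  \<open>a\<close> and its mirror image \<open>v\<close> below it. With c = F u,
  \<open>hardy_line_integral\<close> leaves an explicit integral, equal to 2 pi i by the mass of the
  Poisson kernel.\<close>

lemma hardy_cauchy_upper:
  assumes F: "F holomorphic_on upper 0" and p: "1 < p"
    and M: "\<And>y. 0 < y \<Longrightarrow> pnorm p (\<lambda>x. F (Complex x y)) \<le> M" "M < \<infinity>"
    and a: "0 < a" and w: "0 < Im w"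
  shows "cauchy (\<lambda>x. F (Complex x a)) w = F (w + \<i> * of_real a)"
proof -
  define u v where "u = w + \<i> * of_real a" and "v = cnj w + \<i> * of_real a"
  \<comment> \<open>The half-plane above \<open>s\<close> lies in the domain of \<open>F\<close> and
    excludes the pole \<open>v\<close>, yet still contains the line at height
    \<open>a\<close>.\<close>
  define s where "s = max 0 (Im v)"
  have s: "0 \<le> s" "s < a" "Im v \<le> s" using a w by (auto simp: s_def v_def)
  \<comment> \<open>The singularity of the quotient at \<open>u\<close> is removable, and
    \<open>deriv F u\<close> fills it; away from \<open>u\<close> this is the form required in
    \<open>Ge\<close>.\<close>
  define G where "G = (\<lambda>z. (if z = u then deriv F u else (F z - F u) / (z - u)) + F u * (1 / (z - v)))"
  have "F holomorphic_on upper s" using F by (rule holomorphic_on_subset) (use s in \<open>auto simp: upper_def\<close>)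
  then have "(\<lambda>z. if z = u then deriv F u else (F z - F u) / (z - u)) holomorphic_on upper s"
    by (rule pole_lemma_open[OF _ open_upper])
  then have G: "G holomorphic_on upper s"
    unfolding G_def by (intro holomorphic_intros) (use s in \<open>auto simp: upper_def\<close>)
  have Ge: "G z = F z * (1 / (z - u)) - F u * (1 / (z - u) - 1 / (z - v))" if "s < Im z" "z \<noteq> u" for z
    using that by (simp add: G_def diff_divide_distrib right_diff_distrib)
  have "(\<integral>x. F (Complex x a) * (1 / (of_real x - (u - \<i> * of_real a))) \<partial>lborel)
    = F u * (\<integral>x. 1 / (of_real x - (u - \<i> * of_real a)) - 1 / (of_real x - (v - \<i> * of_real a)) \<partial>lborel)"
    using s a w by (intro hardy_line_integral[OF F p M s(1,2) G Ge]) (auto simp: u_def v_def)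
  moreover have "u - \<i> * of_real a = w" "v - \<i> * of_real a = cnj w" by (auto simp: u_def v_def)
  ultimately have e: "(\<integral>x. F (Complex x a) * (1 / (of_real x - w)) \<partial>lborel) = F u * (\<integral>x. 1 / (of_real x - w) - 1 / (of_real x - cnj w) \<partial>lborel)"
    by simp
  have "(\<integral>x. complex_of_real (poisson_ker w x) \<partial>lborel) = 1" using poisson_ker_integral[OF w] by simp
  then have "1 / (2 * pi * \<i>) * (\<integral>x. 1 / (of_real x - w) - 1 / (of_real x - cnj w) \<partial>lborel) = 1"
    using w by (simp only: poisson_ker_kernel integral_mult_right_zero)
  then show ?thesis unfolding cauchy_def e by (simp add: u_def mult.left_commute)
qed

lemma hardy_cauchy_lower:
  assumes F: "F holomorphic_on upper 0" and p: "1 < p"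
    and M: "\<And>y. 0 < y \<Longrightarrow> pnorm p (\<lambda>x. F (Complex x y)) \<le> M" "M < \<infinity>"
    and a: "0 < a" and w: "Im w < 0"
  shows "cauchy (\<lambda>x. F (Complex x a)) w = 0"
proof -
  define u where "u = w + \<i> * of_real a"
  \<comment> \<open>The pole \<open>u\<close> may lie above the real axis, but it always lies below
    the line at height \<open>a\<close>.\<close>
  define s where "s = max 0 (Im u)"
  have s: "0 \<le> s" "s < a" "Im u \<le> s" using a w by (auto simp: s_def u_def)
  have F': "F holomorphic_on upper s" using F by (rule holomorphic_on_subset) (use s in \<open>auto simp: upper_def\<close>)
  have G: "(\<lambda>z. F z * (1 / (z - u))) holomorphic_on upper s"
    by (intro holomorphic_intros F') (use s in \<open>auto simp: upper_def\<close>)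
  have "(\<integral>x. F (Complex x a) * (1 / (of_real x - (u - \<i> * of_real a))) \<partial>lborel)
    = 0 * (\<integral>x. 1 / (of_real x - (u - \<i> * of_real a)) - 1 / (of_real x - (u - \<i> * of_real a)) \<partial>lborel)"
    using s a w by (intro hardy_line_integral[OF F p M s(1,2) G]) (auto simp: u_def)
  moreover have "u - \<i> * of_real a = w" by (auto simp: u_def)
  ultimately show ?thesis by (simp add: cauchy_def)
qed

section \<open>The M. Riesz theorem\<close>

text \<open>For small angles the cosine is bounded below and a large \<open>a\<close> wins. Near
  pi/2 the angle p \<theta> lies between pi/2 and pi, where cos (p \<theta>) is negative and the
  term with \<open>b\<close> wins; p \<le> 2 keeps p \<theta> in the range where the cosine
  decreases.\<close>

lemma riesz_trig:
  fixes p :: real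
  assumes p: "1 < p" "p \<le> 2"
  obtains a b where "0 \<le> a" "0 \<le> b" "\<And>\<theta>. \<bar>\<theta>\<bar> < pi / 2 \<Longrightarrow> 1 \<le> a * cos \<theta> powr p - b * cos (p * \<theta>)"
proof -
  \<comment> \<open>Chosen so that p \<theta>0 is the midpoint of pi/2 and p pi/2, which makes cos
    (p \<theta>0) strictly negative.\<close>
  define \<theta>0 where "\<theta>0 = pi * (p + 1) / (4 * p)"
  have "pi * (p + 1) < pi * (2 * p)" using p by (intro mult_strict_left_mono) auto
  then have t0: "0 < \<theta>0" "\<theta>0 < pi / 2"
    using p by (auto simp: \<theta>0_def pos_divide_less_eq intro!: divide_pos_pos mult_pos_pos)
  have pt0: "p * \<theta>0 = pi * (p - 1) / 4 + pi / 2" using p by (simp add: \<theta>0_def field_simps)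
  define s where "s = sin (pi * (p - 1) / 4)"
  have "pi * (p - 1) \<le> pi * 1" using p by (intro mult_left_mono) auto
  then have "pi * (p - 1) / 4 < pi" using pi_gt_zero by linarith
  have s: "0 < s" unfolding s_def using p \<open>pi * (p - 1) / 4 < pi\<close> by (intro sin_gt_zero) auto
  have ct0: "cos (p * \<theta>0) = - s" unfolding pt0 s_def by (simp add: cos_add)
  \<comment> \<open>\<open>b\<close> lifts -b cos (p \<theta>) to at least 1 beyond \<theta>0. Up to
    \<theta>0 the same term may cost as much as \<open>b\<close>, so \<open>a\<close> is made to
    supply 1 + b there.\<close>
  define b where "b = 1 / s"
  define a where "a = (1 + b) / cos \<theta>0 powr p"
  have c0: "0 < cos \<theta>0" using t0 by (intro cos_gt_zero) auto
  show thesis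
  proof (rule that[of a b])
    show b: "0 \<le> b" using s by (simp add: b_def)
    show a: "0 \<le> a" using b by (simp add: a_def)
    fix \<theta> :: real assume t: "\<bar>\<theta>\<bar> < pi / 2"
    show "1 \<le> a * cos \<theta> powr p - b * cos (p * \<theta>)"
    proof (cases "\<bar>\<theta>\<bar> \<le> \<theta>0")
      case True
      have "cos \<theta>0 \<le> cos \<bar>\<theta>\<bar>" using True t0 t by (intro cos_monotone_0_pi_le) auto
      then have "cos \<theta>0 powr p \<le> cos \<theta> powr p" using c0 p by (intro powr_mono2) (auto simp: abs_if split: if_splits)
      then have "a * cos \<theta>0 powr p \<le> a * cos \<theta> powr p" using a by (rule mult_left_mono)
      moreover have "a * cos \<theta>0 powr p = 1 + b" using c0 by (simp add: a_def)
      moreover have "b * cos (p * \<theta>) \<le> b" using b by (intro mult_left_le) auto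
      ultimately show ?thesis by linarith
    next
      case False
      have "p * \<bar>\<theta>\<bar> \<le> 2 * (pi / 2)" using p t by (intro mult_mono) auto
      moreover have "p * \<theta>0 \<le> p * \<bar>\<theta>\<bar>" using False p by (intro mult_left_mono) auto
      moreover have "0 \<le> p * \<theta>0" using t0 p by simp
      ultimately have "cos (p * \<bar>\<theta>\<bar>) \<le> cos (p * \<theta>0)" by (intro cos_monotone_0_pi_le) auto
      moreover have "cos (p * \<bar>\<theta>\<bar>) = cos (p * \<theta>)" by (cases "0 \<le> \<theta>") auto
      ultimately have "cos (p * \<theta>) \<le> - s" by (simp add: ct0)
      then have "b * cos (p * \<theta>) \<le> b * (- s)" using b by (rule mult_left_mono)
      moreover have "b * (- s) = - 1" using s by (simp add: b_def)
      moreover have "0 \<le> a * cos \<theta> powr p" using a by simp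
      ultimately show ?thesis by linarith
    qed
  qed
qed

definition cpow :: "complex \<Rightarrow> real \<Rightarrow> complex" where "cpow z p = exp (of_real p * Ln z)"

lemma norm_cpow: "z \<noteq> 0 \<Longrightarrow> norm (cpow z p) = norm z powr p"
  by (simp add: cpow_def norm_exp_eq_Re powr_def)

lemma Re_cpow: "z \<noteq> 0 \<Longrightarrow> Re (cpow z p) = norm z powr p * cos (p * Arg z)"
  by (simp add: cpow_def Re_exp powr_def Arg_eq_Im_Ln)

text \<open>After division by |z|^p this is \<open>riesz_trig\<close> at \<theta> = Arg z, which is
  below pi/2 in modulus on the right half-plane.\<close>

lemma riesz_pointwise:
  assumes p: "1 < p" "p \<le> 2"
  obtains a b where "0 \<le> a" "0 \<le> b" "\<And>z. 0 < Re z \<Longrightarrow> norm z powr p \<le> a * Re z powr p - b * Re (cpow z p)"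
proof -
  obtain a b where ab: "0 \<le> a" "0 \<le> b" "\<And>\<theta>. \<bar>\<theta>\<bar> < pi / 2 \<Longrightarrow> 1 \<le> a * cos \<theta> powr p - b * cos (p * \<theta>)"
    using riesz_trig[OF p] by blast
  show thesis
  proof (rule that[OF ab(1,2)])
    fix z assume z: "0 < Re z"
    then have z0: "z \<noteq> 0" by auto
    have t: "\<bar>Arg z\<bar> < pi / 2" using z z0 Re_Ln_pos_lt[OF z0] by (simp add: Arg_eq_Im_Ln)
    have "Re z = norm z * cos (Arg z)" by (metis Re_rcis rcis_cmod_Arg)
    then have "Re z powr p = norm z powr p * cos (Arg z) powr p"
      using cos_gt_zero_pi[of "Arg z"] t by (simp add: powr_mult)
    then have "a * Re z powr p - b * Re (cpow z p) = norm z powr p * (a * cos (Arg z) powr p - b * cos (p * Arg z))"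
      by (simp add: Re_cpow[OF z0] algebra_simps)
    moreover have "norm z powr p * 1 \<le> norm z powr p * (a * cos (Arg z) powr p - b * cos (p * Arg z))"
      by (intro mult_left_mono ab(3) t) auto
    ultimately show "norm z powr p \<le> a * Re z powr p - b * Re (cpow z p)" by simp
  qed
qed

text \<open>For f in L^p bounded support gives integrability and decay of \<open>cauchy f\<close>
  like 1/|x| along lines, which is what shifting the contour for its p-th power relies on.
  \<open>riesz\<close> removes it by truncation.\<close>

definition compact_supp :: "(real \<Rightarrow> complex) \<Rightarrow> bool" where
  "compact_supp f \<longleftrightarrow> (\<exists>N::nat. \<forall>t. real N < \<bar>t\<bar> \<longrightarrow> f t = 0)"

lemma compact_supp_integrable:
  assumes f: "lp p f" and p: "1 \<le> p" and c: "compact_supp f"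
  shows "integrable lborel f"
proof -
  obtain N :: nat where N: "\<And>t. real N < \<bar>t\<bar> \<Longrightarrow> f t = 0" using c by (auto simp: compact_supp_def)
  show ?thesis
  proof (rule Bochner_Integration.integrable_bound)
    show "integrable lborel (\<lambda>t. indicator {- real N..real N} t + norm (f t) powr p)"
      using f by (auto simp: lp_integrable)
    have "norm (f t) \<le> indicator {- real N..real N} t + norm (f t) powr p" for t
      using N[of t] le_one_plus_powr[of "norm (f t)" p] p by (auto simp: indicator_def abs_le_iff not_le)
    then show "AE t in lborel. norm (f t) \<le> norm (indicator {- real N..real N} t + norm (f t) powr p)"
      by (intro AE_I2) (simp add: order_trans[OF _ abs_ge_self])
  qed (use f in \<open>auto simp: lp_def\<close>)
qed

text \<open>The kernel is bounded only where f lives, so that bounded support can be exploited for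
  decay in z; the factor 1 / (2 pi) is estimated by 1.\<close>

lemma cauchy_norm_le:
  assumes "integrable lborel f" "Im z \<noteq> 0" "\<And>t. f t \<noteq> 0 \<Longrightarrow> norm (1 / (of_real t - z)) \<le> K"
  shows "norm (cauchy f z) \<le> K * (\<integral>t. norm (f t) \<partial>lborel)"
proof -
  note [measurable] = borel_measurable_integrable[OF assms(1), simplified]
  have K: "norm (f t * (1 / (of_real t - z))) \<le> K * norm (f t)" for t
    using mult_left_mono[OF assms(3)[of t], of "norm (f t)"]
    by (cases "f t = 0") (auto simp: norm_mult mult.commute simp del: times_divide_eq_right)
  have i: "integrable lborel (\<lambda>t. K * norm (f t))" using assms(1) by simp
  have "norm (\<integral>t. f t * (1 / (of_real t - z)) \<partial>lborel) \<le> (\<integral>t. K * norm (f t) \<partial>lborel)"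
  proof (rule order_trans[OF integral_norm_bound integral_mono])
    show "integrable lborel (\<lambda>t. norm (f t * (1 / (of_real t - z))))"
      by (rule Bochner_Integration.integrable_bound[OF i]) (use K in \<open>auto intro!: AE_I2 order_trans[OF K abs_ge_self] simp del: times_divide_eq_right\<close>)
  qed (use i K in auto)
  moreover have "norm (cauchy f z) \<le> norm (\<integral>t. f t * (1 / (of_real t - z)) \<partial>lborel)"
  proof -
    have "1 \<le> 2 * pi" using pi_ge_two by linarith
    then have "1 / (2 * pi) * norm (\<integral>t. f t * (1 / (of_real t - z)) \<partial>lborel) \<le> 1 * norm (\<integral>t. f t * (1 / (of_real t - z)) \<partial>lborel)"
      by (intro mult_right_mono) (auto simp: divide_le_eq)
    then show ?thesis by (simp only: cauchy_def norm_mult norm_divide) simp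
  qed
  ultimately show ?thesis by simp
qed

lemma riesz_positive:
  assumes p: "1 < p" "p \<le> 2"
  obtains A where "0 \<le> A" "\<And>g y. lp p (\<lambda>t. of_real (g t)) \<Longrightarrow> (\<And>t. 0 \<le> g t) \<Longrightarrow> compact_supp (\<lambda>t. of_real (g t)) \<Longrightarrow> 0 < y \<Longrightarrow>
     pnorm p (\<lambda>x. cauchy (\<lambda>t. of_real (g t)) (Complex x y)) \<le> ennreal A * pnorm p (\<lambda>t. of_real (g t))"
proof -
  obtain a b where ab: "0 \<le> a" "0 \<le> b" "\<And>z. 0 < Re z \<Longrightarrow> norm z powr p \<le> a * Re z powr p - b * Re (cpow z p)"
    using riesz_pointwise[OF p] by blast
  show thesis
  proof (rule that[OF ab(1)])
    fix g :: "real \<Rightarrow> real" and y :: real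
    define f where "f = (\<lambda>t. complex_of_real (g t))"
    assume "lp p (\<lambda>t. of_real (g t))" and g0: "\<And>t. 0 \<le> g t" and "compact_supp (\<lambda>t. of_real (g t))" and y: "0 < y"
    then have f: "lp p f" "compact_supp f" by (auto simp: f_def)
    have fm[measurable]: "f \<in> borel_measurable borel" using f by (auto simp: lp_def)
    have gm[measurable]: "g \<in> borel_measurable borel"
    proof -
      have "(\<lambda>t. Re (f t)) \<in> borel_measurable borel" by measurable
      then show ?thesis by (simp add: f_def)
    qed
    have fi: "integrable lborel f" using compact_supp_integrable[OF f(1) _ f(2)] p by simp
    have gi: "integrable lborel g" using integrable_Re[OF fi] by (simp add: f_def)
    have "pnorm p (\<lambda>x. cauchy f (Complex x y)) \<le> ennreal a * pnorm p f"
    \<comment> \<open>Null functions are set apart: for the others Re \<Phi> is strictly positive,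
      which keeps \<Phi> off the branch cut of \<open>Ln\<close>.\<close>
    proof (cases "AE t in lborel. f t = 0")
      case True
      then have "cauchy f z = cauchy (\<lambda>t. 0) z" for z by (intro cauchy_cong_AE) auto
      then show ?thesis by (simp add: cauchy_def pnorm_def)
    next
      case False
      \<comment> \<open>For real f the values of \<open>cauchy f\<close> at z and
        \<open>cnj z\<close> are negative conjugates, so their difference is twice a real part; the
        factor 2 makes Re \<Phi> the Poisson integral.\<close>
      define \<Phi> where "\<Phi> = (\<lambda>z. 2 * cauchy f z)"
      have Re\<Phi>: "complex_of_real (Re (\<Phi> z)) = poisson f z" if "0 < Im z" for z
      proof -
        have "(\<lambda>t. cnj (f t)) = f" by (simp add: f_def)
        then have "cauchy f (cnj z) = - cnj (cauchy f z)" using cauchy_cnj[of f "cnj z"] by simp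
        then have "poisson f z = cauchy f z + cnj (cauchy f z)" using poisson_cauchy[OF f(1) p(1) that] by simp
        then show ?thesis by (simp add: \<Phi>_def complex_add_cnj)
      qed
      have pos: "0 < Re (\<Phi> z)" if z: "0 < Im z" for z
      proof -
        have i: "integrable lborel (\<lambda>t. g t * poisson_ker z t)"
          using integrable_Re[OF poisson_integrable[OF f(1) p(1) z]] by (simp add: f_def)
        have e: "complex_of_real (Re (\<Phi> z)) = complex_of_real (\<integral>t. g t * poisson_ker z t \<partial>lborel)"
          unfolding Re\<Phi>[OF z] poisson_def f_def by (simp flip: of_real_mult)
        have "0 \<le> (\<integral>t. g t * poisson_ker z t \<partial>lborel)" using g0 poisson_ker_nonneg[of z] z by (intro integral_nonneg_AE) auto
        moreover have "(\<integral>t. g t * poisson_ker z t \<partial>lborel) \<noteq> 0"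
        proof
          assume "(\<integral>t. g t * poisson_ker z t \<partial>lborel) = 0"
          then have "AE t in lborel. g t * poisson_ker z t = 0"
            using integral_nonneg_eq_0_iff_AE[OF i] g0 poisson_ker_nonneg[of z] z by auto
          then have "AE t in lborel. f t = 0"
          proof eventually_elim
            case (elim t)
            then show ?case using poisson_ker_pos[OF z, of t] by (auto simp: f_def)
          qed
          with False show False by simp
        qed
        ultimately show ?thesis using e by (simp only: of_real_eq_iff)
      qed
      obtain N :: nat where N: "\<And>t. real N < \<bar>t\<bar> \<Longrightarrow> f t = 0" using f(2) by (auto simp: compact_supp_def)
      define I where "I = (\<integral>t. norm (f t) \<partial>lborel)"
      have I0: "0 \<le> I" by (simp add: I_def)
      \<comment> \<open>For |t| \<le> N and heights at least y, 1 + |x| is at most ((1 + N) / y + 1)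
        times the distance from t to the point; the leading 2 is that of \<Phi>.\<close>
      define D where "D = 2 * (((1 + real N) / y + 1) * I)"
      have D0: "0 \<le> D" unfolding D_def using y I0 by (intro mult_nonneg_nonneg add_nonneg_nonneg divide_nonneg_nonneg) auto
      have \<Phi>D: "norm (\<Phi> (Complex x b)) \<le> D / (1 + \<bar>x\<bar>)" if "y \<le> b" for x b
      proof -
        have "norm (cauchy f (Complex x b)) \<le> ((1 + real N) / y + 1) / (1 + \<bar>x\<bar>) * (\<integral>t. norm (f t) \<partial>lborel)"
        proof (rule cauchy_norm_le[OF fi])
          fix t assume "f t \<noteq> 0"
          then have t: "\<bar>t\<bar> \<le> real N" using N[of t] by force
          define d where "d = norm (of_real t - Complex x b)"
          have "y \<le> \<bar>Im (of_real t - Complex x b)\<bar>" using that y by simp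
          also have "\<dots> \<le> d" unfolding d_def by (rule abs_Im_le_cmod)
          finally have d: "y \<le> d" .
          have "\<bar>Re (of_real t - Complex x b)\<bar> \<le> d" unfolding d_def by (rule abs_Re_le_cmod)
          then have "1 + \<bar>x\<bar> \<le> (1 + real N) * 1 + d" using t by simp
          also have "(1 + real N) * 1 \<le> (1 + real N) * (d / y)" using d y by (intro mult_left_mono) auto
          finally have "1 + \<bar>x\<bar> \<le> ((1 + real N) / y + 1) * d" by (simp add: algebra_simps add_divide_distrib)
          then show "norm (1 / (of_real t - Complex x b)) \<le> ((1 + real N) / y + 1) / (1 + \<bar>x\<bar>)"
            using d y unfolding norm_divide d_def[symmetric] by (simp add: divide_simps mult.commute)
        qed (use that y in auto)
        then show ?thesis by (simp add: \<Phi>_def D_def I_def norm_mult)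
      qed
      have \<Phi>b: "norm (\<Phi> (Complex x b)) \<le> 2 * I / b" if "0 < b" for x b
      proof -
        have "norm (cauchy f (Complex x b)) \<le> 1 / b * (\<integral>t. norm (f t) \<partial>lborel)"
        proof (rule cauchy_norm_le[OF fi])
          fix t
          have "b \<le> \<bar>Im (of_real t - Complex x b)\<bar>" using that by simp
          also have "\<dots> \<le> norm (of_real t - Complex x b)" by (rule abs_Im_le_cmod)
          finally show "norm (1 / (of_real t - Complex x b)) \<le> 1 / b"
            using that by (simp add: norm_divide frac_le)
        qed (use that in auto)
        then show ?thesis by (simp add: \<Phi>_def I_def norm_mult)
      qed
      define G where "G = (\<lambda>z. cpow (\<Phi> z) p)"
      have \<Phi>0: "\<Phi> z \<noteq> 0" if "0 < Im z" for z using pos[OF that] by auto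
      have nG: "norm (G z) = norm (\<Phi> z) powr p" if "0 < Im z" for z
        unfolding G_def by (rule norm_cpow[OF \<Phi>0[OF that]])
      have \<Phi>h: "\<Phi> holomorphic_on upper 0" unfolding \<Phi>_def
        by (intro holomorphic_intros cauchy_holomorphic[OF f(1) p(1)])
      have Gh: "G holomorphic_on upper 0"
        unfolding G_def cpow_def
        by (intro holomorphic_intros \<Phi>h) (use pos in \<open>auto simp: upper_def complex_nonpos_Reals_iff not_le dest: less_imp_neq\<close>)
      have hc: "continuous_on UNIV (\<lambda>x. F (Complex x c))" if "F holomorphic_on upper 0" "0 < c" for F c
        by (rule continuous_on_compose2[OF holomorphic_on_imp_continuous_on[OF that(1)]])
           (use that in \<open>auto simp: upper_def Complex_eq intro!: continuous_intros\<close>)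
      have [measurable]: "(\<lambda>x. G (Complex x c)) \<in> borel_measurable borel" "(\<lambda>x. \<Phi> (Complex x c)) \<in> borel_measurable borel" if "0 < c" for c
        using hc[OF Gh that] hc[OF \<Phi>h that] by (auto intro: borel_measurable_continuous_onI)
      have GD: "norm (G (Complex x c)) \<le> D powr p * (1 + \<bar>x\<bar>) powr (- p)" if "y \<le> c" for x c
      proof -
        have "norm (G (Complex x c)) \<le> (D / (1 + \<bar>x\<bar>)) powr p"
          using that y p \<Phi>D[OF that] by (subst nG) (auto intro!: powr_mono2)
        then show ?thesis using D0 by (simp add: powr_mult inverse_powr powr_minus divide_inverse)
      qed
      have di: "integrable lborel (\<lambda>x. D powr p * (1 + \<bar>x\<bar>) powr (- p))"
        by (intro integrable_mult_right decay_integrable p)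
      have Gi: "integrable lborel (\<lambda>x. G (Complex x c))" if "y \<le> c" for c
        by (rule Bochner_Integration.integrable_bound[OF di])
           (use GD[OF that] that y in auto)
      \<comment> \<open>The vertical sides are small by the uniform decay \<open>GD\<close>, so that
        every large radius is a good one.\<close>
      have shift: "(\<integral>x. G (Complex x y) \<partial>lborel) = (\<integral>x. G (Complex x c) \<partial>lborel)" if c: "y \<le> c" for c
      proof (rule line_shift[OF Gh y c Gi Gi])
        fix R0 e :: real assume e: "0 < e"
        have "((\<lambda>R. (c - y) * (D powr p * (1 + R) powr (- p))) \<longlongrightarrow> (c - y) * (D powr p * 0)) at_top"
          by (intro tendsto_mult tendsto_const tendsto_neg_powr filterlim_tendsto_add_at_top[OF tendsto_const] filterlim_ident) (use p in auto)
        then have "((\<lambda>R. (c - y) * (D powr p * (1 + R) powr (- p))) \<longlongrightarrow> 0) at_top" by simp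
        from eventually_conj[OF order_tendstoD(2)[OF this e] eventually_ge_at_top[of "max 0 R0"]]
        obtain R where R: "(c - y) * (D powr p * (1 + R) powr (- p)) < e" "max 0 R0 \<le> R"
          by (auto simp: eventually_at_top_linorder)
        have bd: "(\<integral>\<^sup>+t. indicator {y..c} t * ennreal (norm (G (Complex X t))) \<partial>lborel) \<le> ennreal e" if "\<bar>X\<bar> = R" for X
        proof -
          have "(\<integral>\<^sup>+t. indicator {y..c} t * ennreal (norm (G (Complex X t))) \<partial>lborel)
             \<le> (\<integral>\<^sup>+t. ennreal (D powr p * (1 + R) powr (- p)) * indicator {y..c} t \<partial>lborel)"
            using GD[of _ X] that by (intro nn_integral_mono) (auto simp: indicator_def intro!: ennreal_leI)
          also have "\<dots> = ennreal (D powr p * (1 + R) powr (- p)) * ennreal (c - y)"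
            using c by (simp add: nn_integral_cmult)
          also have "\<dots> = ennreal ((c - y) * (D powr p * (1 + R) powr (- p)))"
            using c by (subst ennreal_mult[symmetric]) (auto simp: mult.commute)
          also have "\<dots> \<le> ennreal e" using R by (intro ennreal_leI) auto
          finally show ?thesis .
        qed
        show "\<exists>R\<ge>R0. (\<integral>\<^sup>+t. indicator {y..c} t * ennreal (norm (G (Complex R t))) \<partial>lborel) \<le> ennreal e \<and>
            (\<integral>\<^sup>+t. indicator {y..c} t * ennreal (norm (G (Complex (- R) t))) \<partial>lborel) \<le> ennreal e"
          using R by (intro exI[of _ R] conjI bd) auto
      qed (use c in auto)
      \<comment> \<open>On rising lines \<open>G\<close> tends to 0 pointwise by
        \<open>\<Phi>b\<close>, under the fixed integrable bound \<open>di\<close>. Since the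
        integral does not depend on the height, it is 0.\<close>
      have "(\<lambda>n. \<integral>x. G (Complex x (y + real n)) \<partial>lborel) \<longlonglongrightarrow> (\<integral>x. 0 \<partial>(lborel :: real measure))"
      proof (rule integral_dominated_convergence[OF _ _ di])
        show "AE x in lborel. (\<lambda>n. G (Complex x (y + real n))) \<longlonglongrightarrow> 0"
        proof (intro AE_I2)
          fix x :: real
          show "(\<lambda>n. G (Complex x (y + real n))) \<longlonglongrightarrow> 0"
          proof (rule Lim_null_comparison)
            show "\<forall>\<^sub>F n in sequentially. norm (G (Complex x (y + real n))) \<le> (2 * I / (y + real n)) powr p"
              using y p \<Phi>b by (intro always_eventually allI, subst nG) (auto intro!: powr_mono2)
            have "filterlim (\<lambda>n. y + real n) at_top sequentially"
              by (intro filterlim_tendsto_add_at_top[OF tendsto_const] filterlim_real_sequentially)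
            then have "(\<lambda>n. 2 * I / (y + real n)) \<longlonglongrightarrow> 0"
              by (intro real_tendsto_divide_at_top[OF tendsto_const])
            then have "(\<lambda>n. (2 * I / (y + real n)) powr p) \<longlonglongrightarrow> 0 powr p"
              using p y I0 by (intro tendsto_powr' tendsto_const) auto
            then show "(\<lambda>n. (2 * I / (y + real n)) powr p) \<longlonglongrightarrow> 0" by simp
          qed
        qed
      qed (use GD y in auto)
      moreover have "(\<integral>x. G (Complex x (y + real n)) \<partial>lborel) = (\<integral>x. G (Complex x y) \<partial>lborel)" for n
        by (rule shift[symmetric]) simp
      ultimately have "(\<lambda>n::nat. \<integral>x. G (Complex x y) \<partial>lborel) \<longlonglongrightarrow> 0" by simp
      then have G0: "(\<integral>x. G (Complex x y) \<partial>lborel) = 0" by (simp add: LIMSEQ_const_iff)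
      have i1: "integrable lborel (\<lambda>x. norm (\<Phi> (Complex x y)) powr p)"
        using integrable_norm[OF Gi[of y]] y by (simp add: nG)
      have i2: "integrable lborel (\<lambda>x. Re (\<Phi> (Complex x y)) powr p)"
      proof (rule Bochner_Integration.integrable_bound[OF i1])
        show "AE x in lborel. norm (Re (\<Phi> (Complex x y)) powr p) \<le> norm (norm (\<Phi> (Complex x y)) powr p)"
        proof (intro AE_I2)
          fix x
          have "0 < Re (\<Phi> (Complex x y))" using pos[of "Complex x y"] y by simp
          then show "norm (Re (\<Phi> (Complex x y)) powr p) \<le> norm (norm (\<Phi> (Complex x y)) powr p)"
            using powr_mono2[of p "Re (\<Phi> (Complex x y))" "norm (\<Phi> (Complex x y))"] p complex_Re_le_cmod by auto
        qed
      qed (use y in measurable)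
      have "(\<integral>x. norm (\<Phi> (Complex x y)) powr p \<partial>lborel) \<le> (\<integral>x. a * Re (\<Phi> (Complex x y)) powr p - b * Re (G (Complex x y)) \<partial>lborel)"
      proof (rule integral_mono[OF i1])
        show "integrable lborel (\<lambda>x. a * Re (\<Phi> (Complex x y)) powr p - b * Re (G (Complex x y)))"
          using i2 integrable_Re[OF Gi[of y]] by simp
        show "norm (\<Phi> (Complex x y)) powr p \<le> a * Re (\<Phi> (Complex x y)) powr p - b * Re (G (Complex x y))" for x
          unfolding G_def using y by (intro ab(3) pos) simp
      qed
      also have "\<dots> = a * (\<integral>x. Re (\<Phi> (Complex x y)) powr p \<partial>lborel) - b * Re (\<integral>x. G (Complex x y) \<partial>lborel)"
        using i2 Gi[of y] by simp
      also have "\<dots> = a * (\<integral>x. Re (\<Phi> (Complex x y)) powr p \<partial>lborel)" using G0 by simp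
      finally have le: "(\<integral>x. norm (\<Phi> (Complex x y)) powr p \<partial>lborel) \<le> a * (\<integral>x. Re (\<Phi> (Complex x y)) powr p \<partial>lborel)" .
      have "pnorm p (\<lambda>x. cauchy f (Complex x y)) \<le> pnorm p (\<lambda>x. \<Phi> (Complex x y))"
        using p by (intro pnorm_mono) (auto simp: \<Phi>_def norm_mult)
      also have "\<dots> = ennreal (\<integral>x. norm (\<Phi> (Complex x y)) powr p \<partial>lborel)"
        unfolding pnorm_def by (intro nn_integral_eq_integral i1) auto
      also have "\<dots> \<le> ennreal (a * (\<integral>x. Re (\<Phi> (Complex x y)) powr p \<partial>lborel))" by (intro ennreal_leI le)
      also have "\<dots> = ennreal a * ennreal (\<integral>x. Re (\<Phi> (Complex x y)) powr p \<partial>lborel)"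
        using ab by (intro ennreal_mult integral_nonneg_AE) auto
      also have "ennreal (\<integral>x. Re (\<Phi> (Complex x y)) powr p \<partial>lborel) = (\<integral>\<^sup>+x. ennreal (Re (\<Phi> (Complex x y)) powr p) \<partial>lborel)"
        by (intro nn_integral_eq_integral[symmetric] i2) auto
      also have "\<dots> = pnorm p (\<lambda>x. poisson f (Complex x y))"
        unfolding pnorm_def using y pos by (intro nn_integral_cong) (simp add: Re\<Phi>[symmetric] less_imp_le abs_of_pos)
      also have "ennreal a * \<dots> \<le> ennreal a * pnorm p f"
        by (intro mult_left_mono poisson_contraction f p y) auto
      finally show ?thesis .
    qed
    then show "pnorm p (\<lambda>x. cauchy (\<lambda>t. of_real (g t)) (Complex x y)) \<le> ennreal a * pnorm p (\<lambda>t. of_real (g t))"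
      by (simp add: f_def)
  qed
qed

section \<open>From nonnegative to complex functions, and duality\<close>

text \<open>\<open>A\<close> bounds p-th powers, so it stands for the p-th power of an operator
  norm, uniform in the height.\<close>

definition riesz_bound :: "real \<Rightarrow> real \<Rightarrow> bool" where
  "riesz_bound p A \<longleftrightarrow> 0 \<le> A \<and> (\<forall>f y. lp p f \<longrightarrow> compact_supp f \<longrightarrow> 0 < y \<longrightarrow>
     pnorm p (\<lambda>x. cauchy f (Complex x y)) \<le> ennreal A * pnorm p f)"

lemma cauchy_line_measurable:
  assumes "lp p f" "1 < p" "0 < y"
  shows "(\<lambda>x. cauchy f (Complex x y)) \<in> borel_measurable borel"
proof (rule borel_measurable_continuous_onI)
  show "continuous_on UNIV (\<lambda>x. cauchy f (Complex x y))"
    by (rule continuous_on_compose2[OF holomorphic_on_imp_continuous_on[OF cauchy_holomorphic[OF assms(1,2)]]])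
       (use assms(3) in \<open>auto simp: upper_def Complex_eq intro!: continuous_intros\<close>)
qed

text \<open>f is split into real and imaginary part and these into positive and negative parts. Each
  of the two splittings costs a factor 2 * 2^p.\<close>

lemma riesz_bound_small:
  assumes p: "1 < p" "p \<le> 2"
  shows "\<exists>A. riesz_bound p A"
proof -
  obtain A where A: "0 \<le> A" "\<And>g y. lp p (\<lambda>t. of_real (g t)) \<Longrightarrow> (\<And>t. 0 \<le> g t) \<Longrightarrow> compact_supp (\<lambda>t. of_real (g t)) \<Longrightarrow> 0 < y \<Longrightarrow>
     pnorm p (\<lambda>x. cauchy (\<lambda>t. of_real (g t)) (Complex x y)) \<le> ennreal A * pnorm p (\<lambda>t. of_real (g t))"
    using riesz_positive[OF p] by blast
  define c where "c = (2::real) powr p"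
  have c: "0 \<le> c" by (simp add: c_def)
  have real_case: "lp p (\<lambda>t. of_real (h t)) \<and>
      pnorm p (\<lambda>x. cauchy (\<lambda>t. of_real (h t)) (Complex x y)) \<le> ennreal (c * (2 * A)) * pnorm p f"
    if f: "lp p f" "compact_supp f" and y: "0 < y" and h: "\<And>t. \<bar>h t\<bar> \<le> norm (f t)" and [measurable]: "h \<in> borel_measurable borel" for f h y
  proof -
    define g1 g2 where "g1 = (\<lambda>t. max (h t) 0)" and "g2 = (\<lambda>t. max (- h t) 0)"
    have g: "lp p (\<lambda>t. of_real (g t))" "compact_supp (\<lambda>t. of_real (g t))"
       "pnorm p (\<lambda>x. cauchy (\<lambda>t. of_real (g t)) (Complex x y)) \<le> ennreal A * pnorm p f"
      if "g = g1 \<or> g = g2" for g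
    proof -
      have [measurable]: "g \<in> borel_measurable borel" using that by (auto simp: g1_def g2_def)
      have le: "\<bar>g t\<bar> \<le> norm (f t)" and g0: "0 \<le> g t" for t
        using that h[of t] by (auto simp: g1_def g2_def)
      show l: "lp p (\<lambda>t. of_real (g t))" by (rule lp_mono[OF f(1)]) (use p le in auto)
      show cs: "compact_supp (\<lambda>t. of_real (g t))"
        using f(2) le unfolding compact_supp_def by (metis abs_le_zero_iff norm_zero of_real_0)
      have "pnorm p (\<lambda>x. cauchy (\<lambda>t. of_real (g t)) (Complex x y)) \<le> ennreal A * pnorm p (\<lambda>t. of_real (g t))"
        by (rule A(2)[OF l g0 cs y])
      also have "\<dots> \<le> ennreal A * pnorm p f" using p le by (intro mult_left_mono pnorm_mono) auto
      finally show "pnorm p (\<lambda>x. cauchy (\<lambda>t. of_real (g t)) (Complex x y)) \<le> ennreal A * pnorm p f" .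
    qed
    have h_eq: "(\<lambda>t. complex_of_real (h t)) = (\<lambda>t. of_real (g1 t) - of_real (g2 t))"
      by (auto simp: g1_def g2_def max_def)
    have e: "cauchy (\<lambda>t. of_real (h t)) (Complex x y) = cauchy (\<lambda>t. of_real (g1 t)) (Complex x y) - cauchy (\<lambda>t. of_real (g2 t)) (Complex x y)" for x
      unfolding h_eq using g p y by (intro cauchy_diff) auto
    have "pnorm p (\<lambda>x. cauchy (\<lambda>t. of_real (h t)) (Complex x y))
      \<le> ennreal c * (pnorm p (\<lambda>x. cauchy (\<lambda>t. of_real (g1 t)) (Complex x y)) + pnorm p (\<lambda>x. cauchy (\<lambda>t. of_real (g2 t)) (Complex x y)))"
      unfolding e c_def using p y g(1) by (intro pnorm_diff cauchy_line_measurable[of p]) auto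
    also have "\<dots> \<le> ennreal c * (ennreal A * pnorm p f + ennreal A * pnorm p f)"
      using g(3) by (intro mult_left_mono add_mono) auto
    also have "\<dots> = ennreal (c * (2 * A)) * pnorm p f"
      using A(1) c by (simp add: ennreal_mult distrib_right[symmetric] mult_ac flip: mult_2)
    finally show ?thesis using lp_mono[OF f(1), of "\<lambda>t. of_real (h t)"] h p by auto
  qed
  have "riesz_bound p (c * (2 * (c * (2 * A))))"
    unfolding riesz_bound_def
  proof (intro conjI allI impI)
    show "0 \<le> c * (2 * (c * (2 * A)))" using A(1) c by simp
    fix f and y :: real assume f: "lp p f" "compact_supp f" and y: "0 < y"
    have [measurable]: "f \<in> borel_measurable borel" using f by (auto simp: lp_def)
    have R: "lp p (\<lambda>t. of_real (Re (f t)))" "pnorm p (\<lambda>x. cauchy (\<lambda>t. of_real (Re (f t))) (Complex x y)) \<le> ennreal (c * (2 * A)) * pnorm p f"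
      using real_case[OF f y, of "\<lambda>t. Re (f t)"] abs_Re_le_cmod by auto
    have I: "lp p (\<lambda>t. of_real (Im (f t)))" "pnorm p (\<lambda>x. cauchy (\<lambda>t. of_real (Im (f t))) (Complex x y)) \<le> ennreal (c * (2 * A)) * pnorm p f"
      using real_case[OF f y, of "\<lambda>t. Im (f t)"] abs_Im_le_cmod by auto
    have "f = (\<lambda>t. of_real (Re (f t)) + \<i> * of_real (Im (f t)))" by (auto simp: complex_eq_iff)
    then have "cauchy f (Complex x y) = cauchy (\<lambda>t. of_real (Re (f t)) + \<i> * of_real (Im (f t))) (Complex x y)" for x by simp
    also have "\<dots> x = cauchy (\<lambda>t. of_real (Re (f t))) (Complex x y) + \<i> * cauchy (\<lambda>t. of_real (Im (f t))) (Complex x y)" for x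
      using R I p y by (subst cauchy_add[OF R(1) lp_cmult[OF I(1)]]) (auto simp: cauchy_cmult)
    finally have e: "cauchy f (Complex x y) = cauchy (\<lambda>t. of_real (Re (f t))) (Complex x y) + \<i> * cauchy (\<lambda>t. of_real (Im (f t))) (Complex x y)" for x .
    have [measurable]: "(\<lambda>x. cauchy (\<lambda>t. of_real (Re (f t))) (Complex x y)) \<in> borel_measurable borel"
      "(\<lambda>x. cauchy (\<lambda>t. of_real (Im (f t))) (Complex x y)) \<in> borel_measurable borel"
      using R I p y by (auto intro: cauchy_line_measurable)
    have "pnorm p (\<lambda>x. cauchy f (Complex x y)) \<le> ennreal c * (pnorm p (\<lambda>x. cauchy (\<lambda>t. of_real (Re (f t))) (Complex x y)) + pnorm p (\<lambda>x. \<i> * cauchy (\<lambda>t. of_real (Im (f t))) (Complex x y)))"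
      unfolding e c_def using p by (intro pnorm_add) auto
    also have "pnorm p (\<lambda>x. \<i> * cauchy (\<lambda>t. of_real (Im (f t))) (Complex x y)) = pnorm p (\<lambda>x. cauchy (\<lambda>t. of_real (Im (f t))) (Complex x y))"
      by (simp add: pnorm_def norm_mult)
    also have "ennreal c * (pnorm p (\<lambda>x. cauchy (\<lambda>t. of_real (Re (f t))) (Complex x y)) + \<dots>) \<le> ennreal c * (ennreal (c * (2 * A)) * pnorm p f + ennreal (c * (2 * A)) * pnorm p f)"
      by (intro mult_left_mono add_mono R I) auto
    also have "\<dots> = ennreal (c * (2 * (c * (2 * A)))) * pnorm p f"
    proof -
      define B where "B = c * (2 * A)"
      have "0 \<le> B" using A(1) c by (simp add: B_def)
      then show ?thesis unfolding B_def[symmetric] using c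
        by (simp add: ennreal_mult distrib_right[symmetric] mult_ac flip: mult_2)
    qed
    finally show "pnorm p (\<lambda>x. cauchy f (Complex x y)) \<le> ennreal (c * (2 * (c * (2 * A)))) * pnorm p f" .
  qed
  then show ?thesis by blast
qed

text \<open>Fubini. Seen as a function of x, the kernel is up to sign the Cauchy kernel with pole at
  t - i y, so the transposed operator evaluates on the lower line; the conjugations bring it back to
  the upper half-plane, where \<open>riesz_bound\<close> applies.\<close>

lemma cauchy_duality:
  assumes f: "integrable lborel f" and g: "integrable lborel g" and y: "0 < y"
  shows "(\<integral>x. cauchy f (Complex x y) * g x \<partial>lborel) = (\<integral>t. f t * cnj (cauchy (\<lambda>x. cnj (g x)) (Complex t y)) \<partial>lborel)"
proof -
  note [measurable] = borel_measurable_integrable[OF f, simplified] borel_measurable_integrable[OF g, simplified]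
  define k where "k = (\<lambda>x t. 1 / (complex_of_real t - Complex x y))"
  have [measurable]: "(\<lambda>(x, t). k x t) \<in> borel_measurable (borel \<Otimes>\<^sub>M borel)" unfolding k_def Complex_eq by measurable
  have kb: "norm (k x t) \<le> 1 / y" for x t
  proof -
    have "y \<le> \<bar>Im (of_real t - Complex x y)\<bar>" using y by simp
    also have "\<dots> \<le> norm (of_real t - Complex x y)" by (rule abs_Im_le_cmod)
    finally show ?thesis using y by (simp add: k_def norm_divide frac_le)
  qed
  have int: "integrable (lborel \<Otimes>\<^sub>M lborel) (\<lambda>(x, t). g x * f t * k x t)"
  proof (rule lborel_pair.Fubini_integrable)
    show "(\<lambda>(x, t). g x * f t * k x t) \<in> borel_measurable (lborel \<Otimes>\<^sub>M lborel)" by measurable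
    have fk: "integrable lborel (\<lambda>t. f t * k x t)" for x
    proof (rule Bochner_Integration.integrable_bound)
      show "integrable lborel (\<lambda>t. (1 / y) * norm (f t))" using f by simp
      show "AE t in lborel. norm (f t * k x t) \<le> norm ((1 / y) * norm (f t))"
        using mult_left_mono[OF kb norm_ge_zero] y by (intro AE_I2) (simp add: norm_mult)
    qed (simp add: k_def)
    show "AE x in lborel. integrable lborel (\<lambda>t. case (x, t) of (x, t) \<Rightarrow> g x * f t * k x t)"
      using fk by (simp add: mult.assoc)
    show "integrable lborel (\<lambda>x. \<integral>t. norm (case (x, t) of (x, t) \<Rightarrow> g x * f t * k x t) \<partial>lborel)"
    proof (rule Bochner_Integration.integrable_bound)
      show "integrable lborel (\<lambda>x. norm (g x) * ((1 / y) * (\<integral>t. norm (f t) \<partial>lborel)))" using g by simp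
      show "AE x in lborel. norm (\<integral>t. norm (case (x, t) of (x, t) \<Rightarrow> g x * f t * k x t) \<partial>lborel) \<le> norm (norm (g x) * ((1 / y) * (\<integral>t. norm (f t) \<partial>lborel)))"
      proof (intro AE_I2)
        fix x
        have "(\<integral>t. norm (f t * k x t) \<partial>lborel) \<le> (\<integral>t. (1 / y) * norm (f t) \<partial>lborel)"
        proof (rule integral_mono[OF integrable_norm[OF fk]])
          show "norm (f t * k x t) \<le> (1 / y) * norm (f t)" for t
            using mult_left_mono[OF kb norm_ge_zero, of "f t" x t] by (simp add: norm_mult)
        qed (use f in simp)
        then have "norm (g x) * (\<integral>t. norm (f t * k x t) \<partial>lborel) \<le> norm (g x) * ((1 / y) * (\<integral>t. norm (f t) \<partial>lborel))"
          by (intro mult_left_mono) auto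
        then show "norm (\<integral>t. norm (case (x, t) of (x, t) \<Rightarrow> g x * f t * k x t) \<partial>lborel) \<le> norm (norm (g x) * ((1 / y) * (\<integral>t. norm (f t) \<partial>lborel)))"
          using y by (simp add: norm_mult mult.assoc)
      qed
    qed measurable
  qed
  define c0 where "c0 = 1 / (2 * complex_of_real pi * \<i>)"
  have cau: "cauchy f (Complex x y) = c0 * (\<integral>t. f t * k x t \<partial>lborel)" for x
    by (simp add: cauchy_def c0_def k_def)
  have "(\<integral>x. cauchy f (Complex x y) * g x \<partial>lborel) = (\<integral>x. c0 * (\<integral>t. g x * f t * k x t \<partial>lborel) \<partial>lborel)"
  proof (intro Bochner_Integration.integral_cong refl)
    fix x
    have "(\<integral>t. g x * f t * k x t \<partial>lborel) = g x * (\<integral>t. f t * k x t \<partial>lborel)"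
      by (simp add: mult.assoc)
    then show "cauchy f (Complex x y) * g x = c0 * (\<integral>t. g x * f t * k x t \<partial>lborel)"
      by (simp add: cau mult_ac)
  qed
  also have "\<dots> = c0 * (\<integral>x. \<integral>t. g x * f t * k x t \<partial>lborel \<partial>lborel)" by simp
  also have "(\<integral>x. \<integral>t. g x * f t * k x t \<partial>lborel \<partial>lborel) = (\<integral>t. \<integral>x. g x * f t * k x t \<partial>lborel \<partial>lborel)"
    by (rule lborel_pair.Fubini_integral[OF int, symmetric])
  also have "c0 * (\<integral>t. \<integral>x. g x * f t * k x t \<partial>lborel \<partial>lborel) = (\<integral>t. f t * (c0 * (\<integral>x. g x * k x t \<partial>lborel)) \<partial>lborel)"
    by (simp add: mult_ac del: times_divide_eq_right)
  also have "(\<lambda>t. c0 * (\<integral>x. g x * k x t \<partial>lborel)) = (\<lambda>t. cnj (cauchy (\<lambda>x. cnj (g x)) (Complex t y)))"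
  proof
    fix t
    have k: "k x t = - (1 / (of_real x - cnj (Complex t y)))" for x
    proof -
      have "of_real t - Complex x y = - (of_real x - cnj (Complex t y))" by (simp add: complex_eq_iff)
      then show ?thesis unfolding k_def by (simp del: minus_diff_eq)
    qed
    have "cnj (cauchy (\<lambda>x. cnj (g x)) (Complex t y)) = - cauchy g (cnj (Complex t y))" by (simp add: cauchy_cnj)
    also have "\<dots> = c0 * (\<integral>x. g x * k x t \<partial>lborel)" unfolding cauchy_def k by (simp add: c0_def)
    finally show "c0 * (\<integral>x. g x * k x t \<partial>lborel) = cnj (cauchy (\<lambda>x. cnj (g x)) (Complex t y))" by simp
  qed
  finally show ?thesis .
qed

text \<open>The trace h of \<open>cauchy f\<close> is tested against g with h g = |h|^p on a bounded
  interval. Duality moves the operator to g, where the bound for the conjugate exponent is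
  available.\<close>

lemma riesz_bound_dual:
  assumes p: "2 < p" and q: "riesz_bound (conj_exp p) A"
  shows "\<exists>A. riesz_bound p A"
proof -
  define q where "q = conj_exp p"
  have pq: "1 < p" "1 < q" "1 / p + 1 / q = 1" using p conj_exp[of p] by (auto simp: q_def)
  have pq1: "(p - 1) * q = p" using p by (simp add: q_def conj_exp_def)
  have A: "0 \<le> A" using assms(2) by (simp add: riesz_bound_def)
  \<comment> \<open>A scale for Young's inequality that gives the term with \<open>X\<close> a
    coefficient of at most 1/2, so that it can be absorbed on the left.\<close>
  define s where "s = (1 / (2 * (A + 1))) powr (1 / q)"
  have s: "0 < s" using A by (simp add: s_def)
  have sA: "s powr q * A \<le> 1 / 2"
  proof -
    have "s powr q = 1 / (2 * (A + 1))" using A pq by (simp add: s_def powr_powr)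
    moreover have "1 / (2 * (A + 1)) * A \<le> 1 / 2" using A by (simp add: divide_simps)
    ultimately show ?thesis by (simp only:)
  qed
  define B where "B = 2 * s powr (- p)"
  have "riesz_bound p B"
    unfolding riesz_bound_def
  proof (intro conjI allI impI)
    show "0 \<le> B" by (simp add: B_def)
    fix f and y :: real assume f: "lp p f" "compact_supp f" and y: "0 < y"
    have fm[measurable]: "f \<in> borel_measurable borel" using f by (auto simp: lp_def)
    have fi: "integrable lborel f" using compact_supp_integrable[OF f(1) _ f(2)] pq by simp
    define h where "h = (\<lambda>x. cauchy f (Complex x y))"
    have hm[measurable]: "h \<in> borel_measurable borel" unfolding h_def by (rule cauchy_line_measurable[OF f(1) pq(1) y])
    define H where "H = 1 / y * (\<integral>t. norm (f t) \<partial>lborel)"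
    have hb: "norm (h x) \<le> H" for x
      unfolding h_def H_def
    proof (rule cauchy_norm_le[OF fi])
      fix t
      have "y \<le> \<bar>Im (of_real t - Complex x y)\<bar>" using y by simp
      also have "\<dots> \<le> norm (of_real t - Complex x y)" by (rule abs_Im_le_cmod)
      finally show "norm (1 / (of_real t - Complex x y)) \<le> 1 / y" using y by (simp add: norm_divide frac_le)
    qed (use y in auto)
    have main: "(\<integral>\<^sup>+x. indicator {- real K..real K} x * ennreal (norm (h x) powr p) \<partial>lborel) \<le> ennreal B * pnorm p f" for K :: nat
    proof -
      \<comment> \<open>The cutoff makes \<open>X\<close> finite, which the absorption requires; the
        intervals exhaust the line at the end.\<close>
      define J where "J = {- real K..real K}"
      have [measurable]: "J \<in> sets borel" by (simp add: J_def)
      \<comment> \<open>The extremal function of Hoelder's inequality: on \<open>J\<close> both h g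
        and |g|^q equal |h|^p, because (p - 1) q = p.\<close>
      define g where "g = (\<lambda>x. indicator J x * (cnj (h x) * of_real (norm (h x) powr (p - 2))))"
      have [measurable]: "(\<lambda>x. cnj (h x)) \<in> borel_measurable borel"
        by (rule borel_measurable_continuous_on[of cnj h]) (auto intro: continuous_intros)
      have [measurable]: "g \<in> borel_measurable borel" unfolding g_def by measurable
      have ng: "norm (g x) = indicator J x * norm (h x) powr (p - 1)" for x
      proof -
        have "norm (g x) = indicator J x * (norm (h x) * norm (h x) powr (p - 2))"
          by (simp add: g_def norm_mult indicator_def)
        then show ?thesis by (simp add: powr_mult_base)
      qed
      have hg: "h x * g x = of_real (indicator J x * norm (h x) powr p)" for x
      proof -
        have "h x * cnj (h x) = of_real ((norm (h x))\<^sup>2)" by (rule complex_norm_square[symmetric])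
        then have "h x * g x = of_real (indicator J x * ((norm (h x))\<^sup>2 * norm (h x) powr (p - 2)))"
          by (simp add: g_def mult_ac indicator_def)
        also have "(norm (h x))\<^sup>2 * norm (h x) powr (p - 2) = norm (h x) powr p"
          using p by (cases "h x = 0") (auto simp: powr_diff power2_eq_square)
        finally show ?thesis .
      qed
      have gq: "norm (g x) powr q = indicator J x * norm (h x) powr p" for x
        using pq1 by (simp add: ng indicator_def powr_powr)
      have Ji: "integrable lborel (\<lambda>x. c * indicator J x)" for c :: real by (auto simp: J_def)
      have gi: "integrable lborel g"
      proof (rule Bochner_Integration.integrable_bound[OF Ji[of "H powr (p - 1)"]])
        show "AE x in lborel. norm (g x) \<le> norm (H powr (p - 1) * indicator J x)"
          using hb p by (intro AE_I2) (auto simp: ng indicator_def intro!: powr_mono2)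
      qed measurable
      have hi: "integrable lborel (\<lambda>x. indicator J x * norm (h x) powr p)"
      proof (rule Bochner_Integration.integrable_bound[OF Ji[of "H powr p"]])
        show "AE x in lborel. norm (indicator J x * norm (h x) powr p) \<le> norm (H powr p * indicator J x)"
          using hb p by (intro AE_I2) (auto simp: indicator_def intro!: powr_mono2)
      qed measurable
      define X where "X = (\<integral>\<^sup>+x. indicator J x * ennreal (norm (h x) powr p) \<partial>lborel)"
      have Xe: "X = (\<integral>\<^sup>+x. ennreal (indicator J x * norm (h x) powr p) \<partial>lborel)"
        unfolding X_def by (intro nn_integral_cong) (auto simp: indicator_def)
      also have "\<dots> = ennreal (\<integral>x. indicator J x * norm (h x) powr p \<partial>lborel)"
        by (intro nn_integral_eq_integral hi) auto
      finally have Xr: "X = ennreal (\<integral>x. indicator J x * norm (h x) powr p \<partial>lborel)" .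
      have Xg: "X = pnorm q g" unfolding Xe pnorm_def gq ..
      have lg: "lp q (\<lambda>x. cnj (g x))" "compact_supp (\<lambda>x. cnj (g x))"
      proof -
        have "pnorm q g < \<infinity>" using Xr unfolding Xg[symmetric] by simp
        then have "lp q g" unfolding lp_def by simp
        then show "lp q (\<lambda>x. cnj (g x))" by (rule lp_cnj)
        show "compact_supp (\<lambda>x. cnj (g x))" unfolding compact_supp_def
          by (intro exI[of _ K]) (auto simp: g_def J_def indicator_def)
      qed
      define C where "C = (\<lambda>t. cnj (cauchy (\<lambda>x. cnj (g x)) (Complex t y)))"
      have lc: "(\<lambda>t. cauchy (\<lambda>x. cnj (g x)) (Complex t y)) \<in> borel_measurable borel"
        by (rule cauchy_line_measurable[OF lg(1) pq(2) y])
      have CA: "pnorm q C \<le> ennreal A * X"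
      proof -
        have "pnorm q C = pnorm q (\<lambda>t. cauchy (\<lambda>x. cnj (g x)) (Complex t y))" by (simp add: C_def)
        also have "\<dots> \<le> ennreal A * pnorm q (\<lambda>x. cnj (g x))"
          using assms(2) lg y unfolding riesz_bound_def q_def by blast
        finally show ?thesis by (simp add: Xg)
      qed
      have Cm[measurable]: "C \<in> borel_measurable borel"
        unfolding C_def by (intro borel_measurable_continuous_on[of cnj] continuous_intros lc)
      have lC: "lp q C" unfolding lp_def using CA Xr by (auto simp: ennreal_mult_less_top intro: le_less_trans)
      have "complex_of_real (\<integral>x. indicator J x * norm (h x) powr p \<partial>lborel) = (\<integral>x. h x * g x \<partial>lborel)"
        unfolding hg by (rule integral_complex_of_real[symmetric])
      also have "\<dots> = (\<integral>t. f t * C t \<partial>lborel)" unfolding h_def C_def by (rule cauchy_duality[OF fi gi y])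
      finally have eq: "complex_of_real (\<integral>x. indicator J x * norm (h x) powr p \<partial>lborel) = (\<integral>t. f t * C t \<partial>lborel)" .
      have "X = ennreal (norm (\<integral>t. f t * C t \<partial>lborel))"
        unfolding Xr eq[symmetric] by (simp add: integral_nonneg_AE)
      also have "\<dots> \<le> (\<integral>\<^sup>+t. ennreal (norm (f t * C t)) \<partial>lborel)"
        by (rule integral_norm_bound_ennreal[OF lp_mult_integrable[OF f(1) lC pq]])
      also have "\<dots> \<le> (\<integral>\<^sup>+t. ennreal (s powr (- p)) * ennreal (norm (f t) powr p) + ennreal (s powr q) * ennreal (norm (C t) powr q) \<partial>lborel)"
      proof (intro nn_integral_mono)
        fix t
        have "norm (f t * C t) = (norm (f t) / s) * (s * norm (C t))" using s by (simp add: norm_mult)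
        also have "\<dots> \<le> (norm (f t) / s) powr p + (s * norm (C t)) powr q" using s by (intro young pq) auto
        also have "\<dots> = s powr (- p) * norm (f t) powr p + s powr q * norm (C t) powr q"
          using s by (simp add: powr_mult powr_divide powr_minus divide_inverse inverse_powr mult.commute)
        finally show "ennreal (norm (f t * C t)) \<le> ennreal (s powr (- p)) * ennreal (norm (f t) powr p) + ennreal (s powr q) * ennreal (norm (C t) powr q)"
          by (simp flip: ennreal_mult ennreal_plus add: ennreal_leI)
      qed
      also have "\<dots> = ennreal (s powr (- p)) * pnorm p f + ennreal (s powr q) * pnorm q C"
        unfolding pnorm_def by (simp add: nn_integral_add nn_integral_cmult)
      also have "\<dots> \<le> ennreal (s powr (- p)) * pnorm p f + ennreal (s powr q) * (ennreal A * X)"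
        by (intro add_left_mono mult_left_mono CA) auto
      also have "ennreal (s powr q) * (ennreal A * X) = ennreal (s powr q * A) * X"
        using A by (simp add: ennreal_mult mult.assoc)
      also have "\<dots> \<le> ennreal (1 / 2) * X" by (intro mult_right_mono ennreal_leI sA) auto
      finally have fin: "X \<le> ennreal (s powr (- p)) * pnorm p f + ennreal (1 / 2) * X"
        by (simp add: add_left_mono)
      \<comment> \<open>Absorbing half of \<open>X\<close> is a subtraction, so the inequality
        \<open>fin\<close> is first moved from \<open>ennreal\<close> to the reals.\<close>
      define x m where "x = (\<integral>x. indicator J x * norm (h x) powr p \<partial>lborel)" and "m = enn2real (pnorm p f)"
      have m: "pnorm p f = ennreal m" "0 \<le> m" using lp_pnorm[OF f(1)] by (auto simp: m_def)
      have x: "X = ennreal x" "0 \<le> x" using Xr by (auto simp: x_def integral_nonneg_AE)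
      have "ennreal x \<le> ennreal (s powr (- p) * m + 1 / 2 * x)"
      proof -
        have "ennreal (s powr (- p)) * ennreal m = ennreal (s powr (- p) * m)" using m by (intro ennreal_mult[symmetric]) auto
        moreover have "ennreal (1 / 2) * ennreal x = ennreal (1 / 2 * x)" using x by (intro ennreal_mult[symmetric]) auto
        moreover have "ennreal (s powr (- p) * m) + ennreal (1 / 2 * x) = ennreal (s powr (- p) * m + 1 / 2 * x)"
          using x m by (intro ennreal_plus[symmetric]) auto
        ultimately show ?thesis using fin unfolding x(1) m(1) by (simp only:)
      qed
      then have "x \<le> s powr (- p) * m + 1 / 2 * x" using x m by (subst (asm) ennreal_le_iff) auto
      then have "x \<le> B * m" by (simp add: B_def)
      then have "ennreal x \<le> ennreal B * ennreal m" using m by (simp add: B_def ennreal_leI flip: ennreal_mult)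
      then show ?thesis using x m by (simp add: X_def J_def)
    qed
    have "pnorm p h = (\<integral>\<^sup>+x. (SUP K::nat. indicator {- real K..real K} x * ennreal (norm (h x) powr p)) \<partial>lborel)"
      unfolding pnorm_def
    proof (intro nn_integral_cong)
      fix x :: real
      show "ennreal (norm (h x) powr p) = (SUP K::nat. indicator {- real K..real K} x * ennreal (norm (h x) powr p))"
      proof (rule antisym)
        obtain K :: nat where "\<bar>x\<bar> \<le> real K" using real_arch_simple by blast
        then show "ennreal (norm (h x) powr p) \<le> (SUP K::nat. indicator {- real K..real K} x * ennreal (norm (h x) powr p))"
          by (intro SUP_upper2[of K]) (auto simp: indicator_def)
      qed (auto intro!: SUP_least simp: indicator_def)
    qed
    also have "\<dots> = (SUP K::nat. \<integral>\<^sup>+x. indicator {- real K..real K} x * ennreal (norm (h x) powr p) \<partial>lborel)"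
    proof (rule nn_integral_monotone_convergence_SUP)
      show "incseq (\<lambda>(K::nat) x. indicator {- real K..real K} x * ennreal (norm (h x) powr p))"
        by (auto simp: incseq_def le_fun_def indicator_def)
    qed measurable
    also have "\<dots> \<le> ennreal B * pnorm p f" by (intro SUP_least main)
    finally show "pnorm p (\<lambda>x. cauchy f (Complex x y)) \<le> ennreal B * pnorm p f" by (simp add: h_def)
  qed
  then show ?thesis by blast
qed

section \<open>Truncation and the M. Riesz theorem on all of L^p\<close>

definition trunc :: "nat \<Rightarrow> (real \<Rightarrow> complex) \<Rightarrow> real \<Rightarrow> complex" where
  "trunc n f t = indicator {- real n..real n} t * f t"

lemma trunc_measurable: "f \<in> borel_measurable borel \<Longrightarrow> trunc n f \<in> borel_measurable borel"
  unfolding trunc_def[abs_def] by measurable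

lemma norm_trunc_le: "norm (trunc n f t) \<le> norm (f t)"
  by (simp add: trunc_def indicator_def)

lemma compact_supp_trunc: "compact_supp (trunc n f)"
  unfolding compact_supp_def by (intro exI[of _ n]) (auto simp: trunc_def indicator_def)

lemma lp_trunc: "lp p f \<Longrightarrow> 0 \<le> p \<Longrightarrow> lp p (trunc n f)"
  by (rule lp_mono) (auto intro: trunc_measurable lp_measurable norm_trunc_le)

lemma pnorm_trunc_le: "0 \<le> p \<Longrightarrow> pnorm p (trunc n f) \<le> pnorm p f"
  by (intro pnorm_mono norm_trunc_le)

lemma trunc_tendsto: "(\<lambda>n. trunc n f t) \<longlonglongrightarrow> f t"
proof (rule tendsto_eventually)
  obtain K :: nat where "\<bar>t\<bar> \<le> real K" using real_arch_simple by blast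
  then show "\<forall>\<^sub>F n in sequentially. trunc n f t = f t"
    by (intro eventually_sequentiallyI[of K]) (auto simp: trunc_def indicator_def)
qed

lemma cauchy_trunc_tendsto:
  assumes f: "lp p f" and p: "1 < p" and z: "Im z \<noteq> 0"
  shows "(\<lambda>n. cauchy (trunc n f) z) \<longlonglongrightarrow> cauchy f z"
proof -
  note [measurable] = lp_measurable[OF f] trunc_measurable[OF lp_measurable[OF f]]
  show ?thesis unfolding cauchy_def
  proof (intro tendsto_mult tendsto_const integral_dominated_convergence[where w = "\<lambda>t. norm (f t * (1 / (of_real t - z)))"])
    show "AE t in lborel. (\<lambda>n. trunc n f t * (1 / (of_real t - z))) \<longlonglongrightarrow> f t * (1 / (of_real t - z))"
      by (intro AE_I2 tendsto_mult tendsto_const trunc_tendsto)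
    show "AE t in lborel. norm (trunc n f t * (1 / (of_real t - z))) \<le> norm (f t * (1 / (of_real t - z)))" for n
      unfolding norm_mult by (intro AE_I2 mult_right_mono norm_trunc_le) auto
    show "integrable lborel (\<lambda>t. norm (f t * (1 / (of_real t - z))))"
      by (intro integrable_norm cauchy_integrable[OF f p z])
  qed measurable
qed

text \<open>For p > 2 the conjugate exponent is at most 2, so direct argument and duality cover all
  p. Cauchy integrals of truncations converge pointwise, and Fatou's lemma transfers the
  bound.\<close>

theorem riesz:
  assumes p: "1 < p"
  obtains A where "0 \<le> A" "\<And>f y. lp p f \<Longrightarrow> 0 < y \<Longrightarrow> pnorm p (\<lambda>x. cauchy f (Complex x y)) \<le> ennreal A * pnorm p f"
proof -
  have "\<exists>A. riesz_bound p A"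
  proof (cases "p \<le> 2")
    case True
    then show ?thesis by (rule riesz_bound_small[OF p])
  next
    case False
    then have "1 < conj_exp p" "conj_exp p \<le> 2" by (auto simp: conj_exp_def field_simps)
    with riesz_bound_small obtain A where "riesz_bound (conj_exp p) A" by blast
    then show ?thesis by (rule riesz_bound_dual[rotated]) (use False in simp)
  qed
  then obtain A where A: "riesz_bound p A" by blast
  show thesis
  proof (rule that)
    show "0 \<le> A" using A by (simp add: riesz_bound_def)
    fix f and y :: real assume f: "lp p f" and y: "0 < y"
    have lg: "lp p (trunc n f)" for n by (rule lp_trunc[OF f]) (use p in simp)
    show "pnorm p (\<lambda>x. cauchy f (Complex x y)) \<le> ennreal A * pnorm p f"
    proof (rule pnorm_fatou[where f = "\<lambda>n x. cauchy (trunc n f) (Complex x y)"])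
      show "(\<lambda>x. cauchy (trunc n f) (Complex x y)) \<in> borel_measurable borel" for n
        by (rule cauchy_line_measurable[OF lg p y])
      show "AE x in lborel. (\<lambda>n. cauchy (trunc n f) (Complex x y)) \<longlonglongrightarrow> cauchy f (Complex x y)"
        using y by (intro AE_I2 cauchy_trunc_tendsto[OF f p]) auto
      show "pnorm p (\<lambda>x. cauchy (trunc n f) (Complex x y)) \<le> ennreal A * pnorm p f" for n
      proof -
        have "pnorm p (\<lambda>x. cauchy (trunc n f) (Complex x y)) \<le> ennreal A * pnorm p (trunc n f)"
          using A lg compact_supp_trunc y unfolding riesz_bound_def by blast
        also have "\<dots> \<le> ennreal A * pnorm p f" using p by (intro mult_left_mono pnorm_trunc_le) auto
        finally show ?thesis .
      qed
    qed (use p in simp)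
  qed
qed

section \<open>Boundary values of Cauchy integrals\<close>

text \<open>Weighted by 2^(p j), the p-th powers of the increments still have integrals of order
  2^(-j), so their sum is finite a.e. There the j-th increment is at most a constant times 2^(-j),
  and the increments are summable.\<close>

lemma AE_convergent_of_fast_Cauchy:
  assumes f[measurable]: "\<And>j::nat. f j \<in> borel_measurable borel" and p: "0 < p" and C: "0 \<le> C"
    and le: "\<And>j. pnorm p (\<lambda>x. f (Suc j) x - f j x) \<le> ennreal (C / (2 * 2 powr p) ^ j)"
  shows "AE x in lborel. convergent (\<lambda>j. f j x)"
proof -
  define c where "c = 2 powr p"
  have c: "0 < c" by (simp add: c_def)
  define S where "S = (\<lambda>x. \<Sum>j. ennreal (c ^ j) * ennreal (norm (f (Suc j) x - f j x) powr p))"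
  have "(\<integral>\<^sup>+x. S x \<partial>lborel) = (\<Sum>j. \<integral>\<^sup>+x. ennreal (c ^ j) * ennreal (norm (f (Suc j) x - f j x) powr p) \<partial>lborel)"
    unfolding S_def by (rule nn_integral_suminf) measurable
  also have "\<dots> = (\<Sum>j. ennreal (c ^ j) * pnorm p (\<lambda>x. f (Suc j) x - f j x))"
    unfolding pnorm_def by (intro suminf_cong nn_integral_cmult) measurable
  also have "\<dots> \<le> (\<Sum>j. ennreal (C * (1 / 2) ^ j))"
  proof (intro suminf_le)
    fix j
    have "ennreal (c ^ j) * pnorm p (\<lambda>x. f (Suc j) x - f j x) \<le> ennreal (c ^ j) * ennreal (C / (2 * c) ^ j)"
      unfolding c_def by (intro mult_left_mono le) auto
    also have "\<dots> = ennreal (c ^ j * (C / (2 * c) ^ j))" using c C by (intro ennreal_mult[symmetric]) auto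
    also have "c ^ j * (C / (2 * c) ^ j) = C * (1 / 2) ^ j" using c by (simp add: power_mult_distrib power_divide)
    finally show "ennreal (c ^ j) * pnorm p (\<lambda>x. f (Suc j) x - f j x) \<le> ennreal (C * (1 / 2) ^ j)" .
  qed auto
  also have "\<dots> = ennreal (C * 2)"
  proof (rule suminf_ennreal_eq)
    show "(\<lambda>j. C * (1 / 2) ^ j) sums (C * 2)"
      using geometric_sums[of "1 / 2 :: real"] by (intro sums_mult) auto
  qed (use C in auto)
  finally have "(\<integral>\<^sup>+x. S x \<partial>lborel) \<noteq> \<infinity>" by (auto simp: top_unique)
  moreover have "S \<in> borel_measurable lborel" unfolding S_def by measurable
  ultimately have "AE x in lborel. S x \<noteq> \<infinity>" by (intro nn_integral_PInf_AE)
  then show ?thesis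
  proof eventually_elim
    fix x assume S: "S x \<noteq> \<infinity>"
    define B where "B = enn2real (S x)"
    have B: "S x = ennreal B" "0 \<le> B" using S by (auto simp: B_def less_top)
    have bd: "norm (f (Suc j) x - f j x) \<le> B powr (1 / p) * (1 / 2) ^ j" for j
    proof -
      have "(\<Sum>i\<in>{j}. ennreal (c ^ i) * ennreal (norm (f (Suc i) x - f i x) powr p)) \<le> S x"
        unfolding S_def by (rule sum_le_suminf) auto
      then have "ennreal (c ^ j * norm (f (Suc j) x - f j x) powr p) \<le> ennreal B"
        using c B by (simp add: ennreal_mult)
      then have "c ^ j * norm (f (Suc j) x - f j x) powr p \<le> B" using B by (simp add: ennreal_le_iff)
      moreover have "c ^ j * norm (f (Suc j) x - f j x) powr p = (2 ^ j * norm (f (Suc j) x - f j x)) powr p"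
        by (simp add: c_def powr_mult powr_power powr_powr mult.commute flip: powr_realpow)
      ultimately have "((2 ^ j * norm (f (Suc j) x - f j x)) powr p) powr (1 / p) \<le> B powr (1 / p)"
        using p by (intro powr_mono2) auto
      then have "2 ^ j * norm (f (Suc j) x - f j x) \<le> B powr (1 / p)" using p by (simp add: powr_powr)
      then show ?thesis by (simp add: field_simps power_divide)
    qed
    have "summable (\<lambda>j. f (Suc j) x - f j x)"
    proof (rule summable_comparison_test')
      show "summable (\<lambda>j. B powr (1 / p) * (1 / 2 :: real) ^ j)" by (intro summable_mult summable_geometric) auto
    qed (use bd in auto)
    then have "convergent (\<lambda>n. \<Sum>j<n. f (Suc j) x - f j x)" by (simp add: summable_iff_convergent)
    then have "convergent (\<lambda>n. f n x - f 0 x)" unfolding sum_lessThan_telescope[of "\<lambda>j. f j x"] .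
    then show "convergent (\<lambda>j. f j x)" by (simp add: convergent_diff_const_right_iff)
  qed
qed

lemma vertical_seq:
  assumes "((\<lambda>y. F (Complex x y)) \<longlongrightarrow> l) (at_right 0)" "filterlim e (at_right 0) sequentially"
  shows "(\<lambda>n. F (Complex x (e n))) \<longlonglongrightarrow> l"
  by (rule filterlim_compose[OF assms])

lemma inverse_Suc_at_right: "filterlim (\<lambda>n. inverse (real (Suc n))) (at_right 0) sequentially"
  unfolding filterlim_at using LIMSEQ_inverse_real_of_nat by auto

lemma upper_isCont:
  assumes "F holomorphic_on upper 0" "0 < Im z"
  shows "isCont F z"
  using holomorphic_on_imp_continuous_on[OF assms(1)] assms(2) open_upper[of 0]
  by (auto simp: continuous_on_eq_continuous_at upper_def)

lemma upper_line_measurable: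
  assumes "F holomorphic_on upper 0" "0 < y"
  shows "(\<lambda>x. F (Complex x y)) \<in> borel_measurable borel"
proof (rule borel_measurable_continuous_onI)
  show "continuous_on UNIV (\<lambda>x. F (Complex x y))"
    by (rule continuous_on_compose2[OF holomorphic_on_imp_continuous_on[OF assms(1)]])
       (use assms(2) in \<open>auto simp: upper_def Complex_eq intro!: continuous_intros\<close>)
qed

lemma upper_shift_tendsto:
  assumes "F holomorphic_on upper 0" "0 < Im z"
  shows "(\<lambda>n. F (z + \<i> * of_real (inverse (real (Suc n))))) \<longlonglongrightarrow> F z"
proof (rule isCont_tendsto_compose[OF upper_isCont[OF assms]])
  have "(\<lambda>n. z + \<i> * of_real (inverse (real (Suc n)))) \<longlonglongrightarrow> z + \<i> * of_real 0"
    by (intro tendsto_intros LIMSEQ_inverse_real_of_nat)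
  then show "(\<lambda>n. z + \<i> * of_real (inverse (real (Suc n)))) \<longlonglongrightarrow> z" by simp
qed

text \<open>At height 1 / (n + 1) the trace of F reproduces F shifted by that height, and gives 0
  below. The traces are bounded and converge a.e., so \<open>lp_weak_convergence\<close> lets the
  height tend to 0 in the pairing with the kernel.\<close>

lemma hardy_representation:
  assumes F: "F holomorphic_on upper 0" and p: "1 < p"
    and M: "\<And>y. 0 < y \<Longrightarrow> pnorm p (\<lambda>x. F (Complex x y)) \<le> M" "M < \<infinity>"
    and f: "lp p f" and lim: "AE x in lborel. ((\<lambda>y. F (Complex x y)) \<longlongrightarrow> f x) (at_right 0)"
  shows "0 < Im w \<Longrightarrow> cauchy f w = F w" and "Im w < 0 \<Longrightarrow> cauchy f w = 0"
proof -
  define e where "e = (\<lambda>n. inverse (real (Suc n)))"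
  have e: "0 < e n" for n by (simp add: e_def)
  have conv: "(\<lambda>n. cauchy (\<lambda>x. F (Complex x (e n))) w) \<longlonglongrightarrow> cauchy f w" if w: "Im w \<noteq> 0"
    unfolding cauchy_def
  proof (intro tendsto_mult tendsto_const lp_weak_convergence[OF p conj_exp[OF p] _ _ _ _ M(2) lp_kernel[OF w conj_exp(1)[OF p]]])
    show "(\<lambda>x. F (Complex x (e n))) \<in> borel_measurable borel" for n by (rule upper_line_measurable[OF F e])
    show "pnorm p (\<lambda>x. F (Complex x (e n))) \<le> M" for n by (rule M(1)[OF e])
    show "AE x in lborel. (\<lambda>n. F (Complex x (e n))) \<longlonglongrightarrow> f x"
      using lim
    proof eventually_elim
      case (elim x)
      then show ?case unfolding e_def by (rule vertical_seq[OF _ inverse_Suc_at_right])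
    qed
    show "f \<in> borel_measurable borel" using f by (rule lp_measurable)
  qed
  show "cauchy f w = F w" if w: "0 < Im w"
  proof (rule LIMSEQ_unique)
    show "(\<lambda>n. cauchy (\<lambda>x. F (Complex x (e n))) w) \<longlonglongrightarrow> cauchy f w" using w by (intro conv) auto
    show "(\<lambda>n. cauchy (\<lambda>x. F (Complex x (e n))) w) \<longlonglongrightarrow> F w"
    proof -
      have eq: "cauchy (\<lambda>x. F (Complex x (e n))) w = F (w + \<i> * of_real (e n))" for n
        by (rule hardy_cauchy_upper[OF F p M e w])
      show ?thesis unfolding eq unfolding e_def by (rule upper_shift_tendsto[OF F w])
    qed
  qed
  show "cauchy f w = 0" if w: "Im w < 0"
  proof (rule LIMSEQ_unique)
    show "(\<lambda>n. cauchy (\<lambda>x. F (Complex x (e n))) w) \<longlonglongrightarrow> cauchy f w" using w by (intro conv) auto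
    show "(\<lambda>n. cauchy (\<lambda>x. F (Complex x (e n))) w) \<longlonglongrightarrow> 0"
      by (simp add: hardy_cauchy_lower[OF F p M e w])
  qed
qed

text \<open>
  With \<open>P a\<close> the Poisson integral of \<open>f\<close> at height \<open>a\<close>, the Cauchy integral of \<open>P a\<close> is that of \<open>f\<close>
  shifted up by \<open>a\<close>. As \<open>P a\<close> converges to \<open>f\<close> in \<open>L\<^sup>p\<close>, the M. Riesz theorem makes the restrictions of
  \<open>cauchy f\<close> to horizontal lines an \<open>L\<^sup>p\<close>-Cauchy family; \<open>h\<close> is its limit along a subsequence.
\<close>

lemma cauchy_boundary:
  assumes f: "lp p f" and p: "1 < p"
  obtains h where "lp p h" "\<And>z. 0 < Im z \<Longrightarrow> cauchy f z = poisson h z"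
proof -
  have fm[measurable]: "f \<in> borel_measurable borel" using f by (rule lp_measurable)
  obtain A where A: "0 \<le> A" "\<And>f y. lp p f \<Longrightarrow> 0 < y \<Longrightarrow> pnorm p (\<lambda>x. cauchy f (Complex x y)) \<le> ennreal A * pnorm p f"
    using riesz[OF p] by blast
  have hol: "cauchy g holomorphic_on upper 0" if "lp p g" for g by (rule cauchy_holomorphic[OF that p])
  have fin: "ennreal A * pnorm p g < \<infinity>" if "lp p g" for g
    using lp_pnorm[OF that] by (simp add: ennreal_mult_less_top)
  have lpc: "lp p (\<lambda>x. cauchy g (Complex x y))" if "lp p g" "0 < y" for g y
    unfolding lp_def using upper_line_measurable[OF hol[OF that(1)] that(2)] le_less_trans[OF A(2)[OF that] fin[OF that(1)]] by auto
  define P where "P = (\<lambda>a x. poisson f (Complex x a))"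
  have fc: "lp p (\<lambda>t. cnj (f t))" by (rule lp_cnj[OF f])
  \<comment> \<open>On each line the Poisson integral is a Hardy trace plus the conjugate of
    another. The Cauchy integral of the conjugate part vanishes on the upper half-plane, which gives
    \<open>semigroup\<close>.\<close>
  have P_eq: "P a = (\<lambda>x. cauchy f (Complex x a) - - cnj (cauchy (\<lambda>t. cnj (f t)) (Complex x a)))" if "0 < a" for a
  proof
    fix x
    have "cauchy f (cnj (Complex x a)) = - cnj (cauchy (\<lambda>t. cnj (f t)) (Complex x a))"
      using cauchy_cnj[of "\<lambda>t. cnj (f t)" "cnj (Complex x a)"] by simp
    then show "P a x = cauchy f (Complex x a) - - cnj (cauchy (\<lambda>t. cnj (f t)) (Complex x a))"
      unfolding P_def using poisson_cauchy[OF f p, of "Complex x a"] that by simp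
  qed
  have Plp: "lp p (P a)" if "0 < a" for a
    unfolding P_eq[OF that] using that p by (intro lp_diff lp_minus lp_cnj lpc f fc) auto
  have semigroup: "cauchy (P a) w = cauchy f (w + \<i> * of_real a)" if a: "0 < a" and w: "0 < Im w" for a w
  proof -
    have "cauchy (P a) w = cauchy (\<lambda>x. cauchy f (Complex x a)) w - cauchy (\<lambda>x. - cnj (cauchy (\<lambda>t. cnj (f t)) (Complex x a))) w"
      unfolding P_eq[OF a] using a p w by (intro cauchy_diff[of p] lp_minus lp_cnj lpc f fc) auto
    also have "cauchy (\<lambda>x. - cnj (cauchy (\<lambda>t. cnj (f t)) (Complex x a))) w = cnj (cauchy (\<lambda>x. cauchy (\<lambda>t. cnj (f t)) (Complex x a)) (cnj w))"
      by (simp add: cauchy_minus cauchy_cnj[of "\<lambda>x. cauchy (\<lambda>t. cnj (f t)) (Complex x a)"])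
    also have "\<dots> = 0"
      using hardy_cauchy_lower[OF hol[OF fc] p A(2)[OF fc] fin[OF fc] a, of "cnj w"] w by simp
    finally show ?thesis
      using hardy_cauchy_upper[OF hol[OF f] p A(2)[OF f] fin[OF f] a w] by simp
  qed
  define \<epsilon> where "\<epsilon> = (\<lambda>n. inverse (real (Suc n)))"
  have \<epsilon>0: "0 < \<epsilon> n" for n by (simp add: \<epsilon>_def)
  define F where "F = (\<lambda>n x. cauchy f (Complex x (\<epsilon> n)))"
  have Flp: "lp p (F n)" for n unfolding F_def by (rule lpc[OF f \<epsilon>0])
  have Fm[measurable]: "F n \<in> borel_measurable borel" for n using Flp by (rule lp_measurable)
  have Pm[measurable]: "P (\<epsilon> n) \<in> borel_measurable borel" for n using Plp[OF \<epsilon>0] by (rule lp_measurable)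
  have Pconv: "(\<lambda>n. pnorm p (\<lambda>x. P (\<epsilon> n) x - f x)) \<longlonglongrightarrow> 0"
  proof (rule lp_strong_convergence[OF _ Pm f])
    show "AE x in lborel. (\<lambda>n. P (\<epsilon> n) x) \<longlonglongrightarrow> f x"
      using poisson_nontangential_AE[OF f p]
    proof eventually_elim
      case (elim x)
      then show ?case unfolding P_def \<epsilon>_def
        by (intro vertical_seq[OF nontangential_vertical inverse_Suc_at_right])
    qed
    show "pnorm p (P (\<epsilon> n)) \<le> pnorm p f" for n
      unfolding P_def by (rule poisson_contraction[OF f p \<epsilon>0])
  qed (use p in simp)
  \<comment> \<open>By \<open>semigroup\<close> the difference of traces is the limit, at vanishing
    height, of the Cauchy integral of \<open>P (\<epsilon> n) - P (\<epsilon> m)\<close>. M. Riesz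
    bounds the latter, and Fatou's lemma passes to the limit.\<close>
  have diff: "pnorm p (\<lambda>x. F n x - F m x) \<le> ennreal A * pnorm p (\<lambda>x. P (\<epsilon> n) x - P (\<epsilon> m) x)" for n m
  proof (rule pnorm_fatou)
    define g where "g = (\<lambda>x. P (\<epsilon> n) x - P (\<epsilon> m) x)"
    have glp: "lp p g" unfolding g_def using p by (intro lp_diff Plp \<epsilon>0) auto
    show "(\<lambda>x. cauchy g (Complex x (\<epsilon> k))) \<in> borel_measurable borel" for k
      using lpc[OF glp \<epsilon>0] by (rule lp_measurable)
    show "pnorm p (\<lambda>x. cauchy g (Complex x (\<epsilon> k))) \<le> ennreal A * pnorm p (\<lambda>x. P (\<epsilon> n) x - P (\<epsilon> m) x)" for k
      using A(2)[OF glp \<epsilon>0] by (simp add: g_def)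
    show "AE x in lborel. (\<lambda>k. cauchy g (Complex x (\<epsilon> k))) \<longlonglongrightarrow> F n x - F m x"
    proof (intro AE_I2)
      fix x
      have e: "cauchy g (Complex x (\<epsilon> k)) = cauchy f (Complex x (\<epsilon> n) + \<i> * of_real (\<epsilon> k)) - cauchy f (Complex x (\<epsilon> m) + \<i> * of_real (\<epsilon> k))" for k
      proof -
        have "cauchy g (Complex x (\<epsilon> k)) = cauchy (P (\<epsilon> n)) (Complex x (\<epsilon> k)) - cauchy (P (\<epsilon> m)) (Complex x (\<epsilon> k))"
          unfolding g_def using p \<epsilon>0[of k] by (intro cauchy_diff[of p] Plp \<epsilon>0) auto
        also have "\<dots> = cauchy f (Complex x (\<epsilon> k) + \<i> * of_real (\<epsilon> n)) - cauchy f (Complex x (\<epsilon> k) + \<i> * of_real (\<epsilon> m))"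
          using \<epsilon>0 by (simp add: semigroup)
        also have "Complex x (\<epsilon> k) + \<i> * of_real (\<epsilon> n) = Complex x (\<epsilon> n) + \<i> * of_real (\<epsilon> k)" by (simp add: complex_eq_iff)
        also have "Complex x (\<epsilon> k) + \<i> * of_real (\<epsilon> m) = Complex x (\<epsilon> m) + \<i> * of_real (\<epsilon> k)" by (simp add: complex_eq_iff)
        finally show ?thesis .
      qed
      have "(\<lambda>k. cauchy f (Complex x (\<epsilon> j) + \<i> * of_real (\<epsilon> k))) \<longlonglongrightarrow> F j x" for j
        unfolding F_def \<epsilon>_def by (rule upper_shift_tendsto[OF hol[OF f]]) simp
      then show "(\<lambda>k. cauchy g (Complex x (\<epsilon> k))) \<longlonglongrightarrow> F n x - F m x"
        unfolding e by (intro tendsto_diff)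
    qed
  qed (use p in simp)
  \<comment> \<open>The rate of decay demanded by
    \<open>AE_convergent_of_fast_Cauchy\<close>.\<close>
  define c where "c = 2 * 2 powr p"
  have c: "1 \<le> c" using p ge_one_powr_ge_zero[of 2 p] by (simp add: c_def)
  have "\<exists>n\<ge>j. pnorm p (\<lambda>x. P (\<epsilon> n) x - f x) \<le> ennreal (1 / c ^ j)" for j :: nat
  proof -
    have "\<forall>\<^sub>F n in sequentially. pnorm p (\<lambda>x. P (\<epsilon> n) x - f x) < ennreal (1 / c ^ j)"
      by (rule order_tendstoD(2)[OF Pconv]) (use c in auto)
    from eventually_conj[OF this eventually_ge_at_top[of j]] show ?thesis
      by (auto simp: eventually_sequentially intro: less_imp_le)
  qed
  \<comment> \<open>\<open>r\<close> may fail to be increasing; j \<le> r j makes it tend to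
    infinity, and the limits below are taken along it in that sense.\<close>
  then obtain r where r: "\<And>j. j \<le> r j" "\<And>j. pnorm p (\<lambda>x. P (\<epsilon> (r j)) x - f x) \<le> ennreal (1 / c ^ j)"
    by metis
  define C where "C = A * (2 powr p * 2)"
  have C: "0 \<le> C" using A(1) by (simp add: C_def)
  have "AE x in lborel. convergent (\<lambda>j. F (r j) x)"
  proof (rule AE_convergent_of_fast_Cauchy[OF Fm _ C])
    fix j
    have "pnorm p (\<lambda>x. F (r (Suc j)) x - F (r j) x) \<le> ennreal A * pnorm p (\<lambda>x. (P (\<epsilon> (r (Suc j))) x - f x) - (P (\<epsilon> (r j)) x - f x))"
      using diff[of "r (Suc j)" "r j"] by simp
    also have "\<dots> \<le> ennreal A * (ennreal (2 powr p) * (pnorm p (\<lambda>x. P (\<epsilon> (r (Suc j))) x - f x) + pnorm p (\<lambda>x. P (\<epsilon> (r j)) x - f x)))"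
      using p by (intro mult_left_mono pnorm_diff) auto
    also have "\<dots> \<le> ennreal A * (ennreal (2 powr p) * (ennreal (1 / c ^ j) + ennreal (1 / c ^ j)))"
    proof (intro mult_left_mono add_mono)
      have "1 / c ^ Suc j \<le> 1 / c ^ j" using c by (intro divide_left_mono power_increasing) auto
      then show "pnorm p (\<lambda>x. P (\<epsilon> (r (Suc j))) x - f x) \<le> ennreal (1 / c ^ j)"
        using order_trans[OF r(2)[of "Suc j"] ennreal_leI] by blast
    qed (use r in auto)
    also have "\<dots> = ennreal (C / (2 * 2 powr p) ^ j)"
    proof -
      have "ennreal (1 / c ^ j) + ennreal (1 / c ^ j) = ennreal (2 * (1 / c ^ j))"
        using c by (subst ennreal_plus[symmetric]) auto
      moreover have "C / (2 * 2 powr p) ^ j = A * (2 powr p * (2 * (1 / c ^ j)))" by (simp add: C_def c_def)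
      moreover have "ennreal (A * (2 powr p * (2 * (1 / c ^ j)))) = ennreal A * (ennreal (2 powr p) * ennreal (2 * (1 / c ^ j)))"
        using A(1) c by (subst ennreal_mult, simp, simp, subst ennreal_mult) auto
      ultimately show ?thesis by (simp only:)
    qed
    finally show "pnorm p (\<lambda>x. F (r (Suc j)) x - F (r j) x) \<le> ennreal (C / (2 * 2 powr p) ^ j)" .
  qed (use p in simp)
  then have lim: "AE x in lborel. (\<lambda>j. F (r j) x) \<longlonglongrightarrow> lim (\<lambda>j. F (r j) x)"
    by eventually_elim (simp add: convergent_LIMSEQ_iff)
  define h where "h = (\<lambda>x. lim (\<lambda>j. F (r j) x))"
  have hm[measurable]: "h \<in> borel_measurable borel" unfolding h_def by measurable
  have limh: "AE x in lborel. (\<lambda>j. F (r j) x) \<longlonglongrightarrow> h x" using lim by (simp add: h_def)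
  have FM: "pnorm p (F n) \<le> ennreal A * pnorm p f" for n unfolding F_def by (rule A(2)[OF f \<epsilon>0])
  have "pnorm p h \<le> ennreal A * pnorm p f" by (rule pnorm_fatou[OF Fm limh _ FM]) (use p in simp)
  then have hlp: "lp p h" unfolding lp_def using fin[OF f] hm by (auto intro: le_less_trans)
  \<comment> \<open>Along \<open>r\<close> the Poisson integrals of the traces tend to that of
    \<open>h\<close>. They are also shifted values of \<open>cauchy f\<close>, since the Cauchy
    integral of a trace vanishes below the line.\<close>
  have "cauchy f z = poisson h z" if z: "0 < Im z" for z
  proof (rule LIMSEQ_unique)
    show "(\<lambda>j. poisson (F (r j)) z) \<longlonglongrightarrow> poisson h z"
      unfolding poisson_def
      by (rule lp_weak_convergence[OF p conj_exp[OF p] Fm hm limh FM fin[OF f] lp_poisson_ker[OF z conj_exp(1)[OF p]]])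
    have e: "poisson (F n) z = cauchy f (z + \<i> * of_real (\<epsilon> n))" for n
    proof -
      have "poisson (F n) z = cauchy (F n) z - cauchy (F n) (cnj z)" by (rule poisson_cauchy[OF Flp p z])
      also have "cauchy (F n) (cnj z) = 0"
        unfolding F_def using z by (intro hardy_cauchy_lower[OF hol[OF f] p A(2)[OF f] fin[OF f] \<epsilon>0]) auto
      also have "cauchy (F n) z = cauchy f (z + \<i> * of_real (\<epsilon> n))"
        unfolding F_def by (rule hardy_cauchy_upper[OF hol[OF f] p A(2)[OF f] fin[OF f] \<epsilon>0 z])
      finally show ?thesis by simp
    qed
    have "(\<lambda>n. poisson (F n) z) \<longlonglongrightarrow> cauchy f z"
      unfolding e \<epsilon>_def by (rule upper_shift_tendsto[OF hol[OF f] z])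
    moreover have "filterlim r at_top sequentially"
      by (rule filterlim_at_top_mono[OF filterlim_ident]) (use r in auto)
    ultimately show "(\<lambda>j. poisson (F (r j)) z) \<longlonglongrightarrow> cauchy f z" by (rule filterlim_compose)
  qed
  with hlp show thesis by (rule that)
qed

text \<open>Both sides are vertical limits of the Poisson integral of f. It equals
  \<open>cauchy f z - cauchy f (cnj z)\<close>, and the second value is minus the conjugate of the
  Cauchy integral of cnj f at z.\<close>

lemma cauchy_decomposition:
  assumes f: "lp p f" and p: "1 < p"
    and h1: "lp p h1" "\<And>z. 0 < Im z \<Longrightarrow> cauchy f z = poisson h1 z"
    and h2: "lp p h2" "\<And>z. 0 < Im z \<Longrightarrow> cauchy (\<lambda>t. cnj (f t)) z = poisson h2 z"
  shows "AE x in lborel. f x = h1 x + cnj (h2 x)"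
  using poisson_nontangential_AE[OF f p] poisson_nontangential_AE[OF h1(1) p] poisson_nontangential_AE[OF h2(1) p]
proof eventually_elim
  fix x
  assume l: "has_nontangential_limit 1 (poisson f) x (f x)" "has_nontangential_limit 1 (poisson h1) x (h1 x)"
    "has_nontangential_limit 1 (poisson h2) x (h2 x)"
  have "((\<lambda>y. poisson h1 (Complex x y) + cnj (poisson h2 (Complex x y))) \<longlongrightarrow> h1 x + cnj (h2 x)) (at_right 0)"
    by (intro tendsto_add tendsto_cnj nontangential_vertical l)
  moreover have "\<forall>\<^sub>F y in at_right 0. poisson h1 (Complex x y) + cnj (poisson h2 (Complex x y)) = poisson f (Complex x y)"
    using eventually_at_right_less[of 0]
  proof eventually_elim
    fix y :: real assume y: "0 < y"
    have "cauchy f (cnj (Complex x y)) = - cnj (cauchy (\<lambda>t. cnj (f t)) (Complex x y))"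
      using cauchy_cnj[of "\<lambda>t. cnj (f t)" "cnj (Complex x y)"] by simp
    then show "poisson h1 (Complex x y) + cnj (poisson h2 (Complex x y)) = poisson f (Complex x y)"
      using poisson_cauchy[OF f p, of "Complex x y"] y h1(2) h2(2) by simp
  qed
  ultimately have "((\<lambda>y. poisson f (Complex x y)) \<longlongrightarrow> h1 x + cnj (h2 x)) (at_right 0)" by (rule Lim_transform_eventually)
  from tendsto_unique[OF _ nontangential_vertical[OF l(1)] this] show "f x = h1 x + cnj (h2 x)" by simp
qed

section \<open>Test functions and weak derivatives\<close>

text \<open>The flat function exp (-1/s) divided by powers of s. Differentiation only changes the
  exponent k, so the linear span of the family is closed under it.\<close>

definition flat_exp :: "nat \<Rightarrow> real \<Rightarrow> real" where
  "flat_exp k s = (if 0 < s then exp (- (1 / s)) / s ^ k else 0)"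

lemma flat_exp_tendsto_0: "(flat_exp k \<longlongrightarrow> 0) (at_right 0)"
proof -
  have "((\<lambda>s. inverse s ^ k / exp (inverse s)) \<longlongrightarrow> (0::real)) (at_right 0)"
    by (rule filterlim_compose[OF tendsto_power_div_exp_0 filterlim_inverse_at_top_right])
  moreover have "\<forall>\<^sub>F s in at_right 0. inverse s ^ k / exp (inverse s) = flat_exp k s"
    using eventually_at_right_less[of 0]
    by eventually_elim (simp add: flat_exp_def exp_minus inverse_eq_divide power_divide)
  ultimately show ?thesis by (rule Lim_transform_eventually)
qed

text \<open>The critical point is s = 0: there the right difference quotient is
  \<open>flat_exp (Suc k)\<close>, which tends to 0.\<close>

lemma flat_exp_deriv: "(flat_exp k has_real_derivative flat_exp (k + 2) s - real k * flat_exp (k + 1) s) (at s)"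
proof -
  consider "0 < s" | "s < 0" | "s = 0" by linarith
  then show ?thesis
  proof cases
    case 1
    have "((\<lambda>s. exp (- (1 / s)) * inverse s ^ k) has_real_derivative
       exp (- (1 / s)) * (1 / s\<^sup>2) * inverse s ^ k + exp (- (1 / s)) * (real k * inverse s ^ (k - 1) * (- (1 / s\<^sup>2)))) (at s)"
      using 1 by (auto intro!: derivative_eq_intros simp: power2_eq_square divide_inverse)
    moreover have "exp (- (1 / s)) * (1 / s\<^sup>2) * inverse s ^ k + exp (- (1 / s)) * (real k * inverse s ^ (k - 1) * (- (1 / s\<^sup>2)))
        = flat_exp (k + 2) s - real k * flat_exp (k + 1) s"
    proof (cases k)
      case (Suc j)
      then show ?thesis using 1 by (simp add: flat_exp_def divide_inverse power_inverse power2_eq_square algebra_simps)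
    qed (use 1 in \<open>simp add: flat_exp_def divide_inverse power_inverse power2_eq_square\<close>)
    ultimately have "((\<lambda>s. exp (- (1 / s)) * inverse s ^ k) has_real_derivative flat_exp (k + 2) s - real k * flat_exp (k + 1) s) (at s)" by simp
    moreover have "\<forall>\<^sub>F t in nhds s. exp (- (1 / t)) * inverse t ^ k = flat_exp k t"
      using eventually_nhds_in_open[of "{0<..}" s] 1 by (auto elim!: eventually_mono simp: flat_exp_def divide_inverse power_inverse)
    ultimately show ?thesis by (subst (asm) DERIV_cong_ev[OF refl _ refl]) auto
  next
    case 2
    have "((\<lambda>s. 0) has_real_derivative 0) (at s)" by simp
    moreover have "\<forall>\<^sub>F t in nhds s. 0 = flat_exp k t"
      using eventually_nhds_in_open[of "{..<0}" s] 2 by (auto elim!: eventually_mono simp: flat_exp_def)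
    ultimately have "(flat_exp k has_real_derivative 0) (at s)" by (subst (asm) DERIV_cong_ev[OF refl _ refl]) auto
    then show ?thesis using 2 by (simp add: flat_exp_def)
  next
    case 3
    have "((\<lambda>y. (flat_exp k y - flat_exp k 0) / (y - 0)) \<longlongrightarrow> 0) (at 0)"
    proof (rule filterlim_split_at)
      show "((\<lambda>y. (flat_exp k y - flat_exp k 0) / (y - 0)) \<longlongrightarrow> 0) (at_left 0)"
      proof (rule tendsto_eventually)
        show "\<forall>\<^sub>F y in at_left 0. (flat_exp k y - flat_exp k 0) / (y - 0) = 0"
          by (auto simp: eventually_at_filter flat_exp_def intro!: always_eventually)
      qed
      show "((\<lambda>y. (flat_exp k y - flat_exp k 0) / (y - 0)) \<longlongrightarrow> 0) (at_right 0)"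
        using flat_exp_tendsto_0[of "Suc k"]
      proof (rule Lim_transform_eventually)
        show "\<forall>\<^sub>F y in at_right 0. flat_exp (Suc k) y = (flat_exp k y - flat_exp k 0) / (y - 0)"
          using eventually_at_right_less[of 0] by eventually_elim (simp add: flat_exp_def field_simps)
      qed
    qed
    then show ?thesis unfolding 3 has_field_derivative_iff by (simp add: flat_exp_def)
  qed
qed

text \<open>
  A class of functions closed under differentiation, large enough to contain bump functions and
  their products with the real and imaginary parts of the Cauchy kernel.
\<close>

inductive_set smooth_class :: "(real \<Rightarrow> real) set" where
  const: "(\<lambda>x. c) \<in> smooth_class"
| id: "(\<lambda>x. x) \<in> smooth_class"
| add: "u \<in> smooth_class \<Longrightarrow> v \<in> smooth_class \<Longrightarrow> (\<lambda>x. u x + v x) \<in> smooth_class"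
| mult: "u \<in> smooth_class \<Longrightarrow> v \<in> smooth_class \<Longrightarrow> (\<lambda>x. u x * v x) \<in> smooth_class"
| flat_exp: "u \<in> smooth_class \<Longrightarrow> (\<lambda>x. flat_exp k (u x)) \<in> smooth_class"
| inv: "u \<in> smooth_class \<Longrightarrow> (\<And>x. 0 < u x) \<Longrightarrow> (\<lambda>x. 1 / u x) \<in> smooth_class"

lemma smooth_has_derivative: "u \<in> smooth_class \<Longrightarrow> \<exists>u'\<in>smooth_class. \<forall>x. (u has_real_derivative u' x) (at x)"
proof (induction rule: smooth_class.induct)
  case (const c)
  show ?case by (intro bexI[of _ "\<lambda>x. 0"] allI smooth_class.const) auto
next
  case id
  show ?case by (intro bexI[of _ "\<lambda>x. 1"] allI smooth_class.const) auto
next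
  case (add u v)
  then obtain u' v' where "u' \<in> smooth_class" "v' \<in> smooth_class" "\<And>x. (u has_real_derivative u' x) (at x)" "\<And>x. (v has_real_derivative v' x) (at x)" by blast
  then show ?case by (intro bexI[of _ "\<lambda>x. u' x + v' x"] allI smooth_class.add DERIV_add) auto
next
  case (mult u v)
  then obtain u' v' where uv: "u' \<in> smooth_class" "v' \<in> smooth_class" "\<And>x. (u has_real_derivative u' x) (at x)" "\<And>x. (v has_real_derivative v' x) (at x)" by blast
  show ?case by (intro bexI[of _ "\<lambda>x. u' x * v x + v' x * u x"] allI smooth_class.add smooth_class.mult DERIV_mult uv mult.hyps)
next
  case (flat_exp u k)
  then obtain u' where u: "u' \<in> smooth_class" "\<And>x. (u has_real_derivative u' x) (at x)" by blast
  show ?case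
  proof (intro bexI[of _ "\<lambda>x. (flat_exp (k + 2) (u x) + (- real k) * flat_exp (k + 1) (u x)) * u' x"] allI)
    show "((\<lambda>x. flat_exp k (u x)) has_real_derivative (flat_exp (k + 2) (u x) + (- real k) * flat_exp (k + 1) (u x)) * u' x) (at x)" for x
      using DERIV_chain2[OF flat_exp_deriv u(2), of k x] by simp
  qed (intro smooth_class.intros flat_exp.hyps u)
next
  case (inv u)
  then obtain u' where u: "u' \<in> smooth_class" "\<And>x. (u has_real_derivative u' x) (at x)" by blast
  show ?case
  proof (intro bexI[of _ "\<lambda>x. (- 1) * (u' x * (1 / u x * (1 / u x)))"] allI)
    fix x
    have "u x \<noteq> 0" using inv.hyps(2)[of x] by simp
    then show "((\<lambda>x. 1 / u x) has_real_derivative (- 1) * (u' x * (1 / u x * (1 / u x)))) (at x)"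
      by (auto intro!: derivative_eq_intros u(2))
  qed (intro smooth_class.intros inv.hyps u)
qed

lemma smooth_deriv:
  assumes "u \<in> smooth_class"
  shows "deriv u \<in> smooth_class" "(u has_real_derivative deriv u x) (at x)"
proof -
  obtain u' where u: "u' \<in> smooth_class" "\<And>x. (u has_real_derivative u' x) (at x)" using smooth_has_derivative[OF assms] by blast
  then have "deriv u = u'" by (intro ext DERIV_imp_deriv)
  with u show "deriv u \<in> smooth_class" "(u has_real_derivative deriv u x) (at x)" by auto
qed

lemma smooth_higher_deriv: "u \<in> smooth_class \<Longrightarrow> (deriv ^^ k) u \<in> smooth_class"
  by (induction k) (auto intro: smooth_deriv)

lemma smooth_test_function:
  assumes "u \<in> smooth_class" "\<And>x. R < \<bar>x\<bar> \<Longrightarrow> u x = 0"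
  shows "test_function u"
  unfolding test_function_def
proof (intro conjI allI)
  show "(deriv ^^ k) u differentiable at x" for k x
    using smooth_deriv(2)[OF smooth_higher_deriv[OF assms(1)], of k x] real_differentiable_def by blast
  have "{x. u x \<noteq> 0} \<subseteq> {- R..R}" using assms(2) by (force simp: abs_le_iff not_le)
  then have "bounded {x. u x \<noteq> 0}" by (rule bounded_subset[rotated]) (rule bounded_closed_interval)
  then show "compact (closure {x. u x \<noteq> 0})" by (simp add: compact_closure)
qed

definition bump :: "real \<Rightarrow> real \<Rightarrow> real \<Rightarrow> real" where
  "bump a d t = flat_exp 0 (1 - ((t - a) / d)\<^sup>2)"

lemma bump_smooth: "bump a d \<in> smooth_class"
proof -
  have "(\<lambda>t. flat_exp 0 (1 + (- 1) * ((1 / d * (t + - a)) * (1 / d * (t + - a))))) \<in> smooth_class" by (intro smooth_class.intros)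
  moreover have "bump a d = (\<lambda>t. flat_exp 0 (1 + (- 1) * ((1 / d * (t + - a)) * (1 / d * (t + - a)))))"
    by (simp add: bump_def fun_eq_iff power2_eq_square)
  ultimately show ?thesis by simp
qed

lemma bump_nonneg: "0 \<le> bump a d t"
  by (simp add: bump_def flat_exp_def)

lemma bump_le_1: "bump a d t \<le> 1"
  by (simp add: bump_def flat_exp_def)

lemma bump_eq_0: "0 < d \<Longrightarrow> d \<le> \<bar>t - a\<bar> \<Longrightarrow> bump a d t = 0"
proof -
  assume "0 < d" "d \<le> \<bar>t - a\<bar>"
  then have "1 \<le> \<bar>(t - a) / d\<bar>" by (simp add: abs_divide)
  then have "1 \<le> ((t - a) / d)\<^sup>2" using abs_le_square_iff[of 1 "(t - a) / d"] by simp
  then show ?thesis by (simp add: bump_def flat_exp_def)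
qed

lemma bump_test: "0 < d \<Longrightarrow> test_function (bump a d)"
  by (rule smooth_test_function[OF bump_smooth, of "\<bar>a\<bar> + d"]) (rule bump_eq_0, auto)

text \<open>From exp (1/s) \<ge> (1/s)^2 / 2 follows \<open>flat_exp 2 s\<close> \<le> 2, and the
  inner derivative is at most 2/R on the support. Wide bumps are thus cutoffs with small
  derivative.\<close>

lemma bump_deriv_bound:
  assumes R: "0 < R"
  shows "\<bar>deriv (bump 0 R) t\<bar> \<le> 4 / R"
proof -
  have D: "deriv (bump 0 R) t = flat_exp 2 (1 - (t / R)\<^sup>2) * (- 2 * t / R\<^sup>2)"
  proof (rule DERIV_imp_deriv)
    have "((\<lambda>t. 1 - (t / R)\<^sup>2) has_real_derivative (- 2 * t / R\<^sup>2)) (at t)"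
      using R by (auto intro!: derivative_eq_intros simp: power2_eq_square)
    from DERIV_chain2[OF flat_exp_deriv this, of 0]
    show "(bump 0 R has_real_derivative flat_exp 2 (1 - (t / R)\<^sup>2) * (- 2 * t / R\<^sup>2)) (at t)"
      by (simp add: bump_def[abs_def] numeral_2_eq_2)
  qed
  show ?thesis
  proof (cases "0 < 1 - (t / R)\<^sup>2")
    case True
    define s where "s = 1 - (t / R)\<^sup>2"
    have s: "0 < s" using True by (simp add: s_def)
    have "1 + 1 / s + (1 / s)\<^sup>2 / 2 \<le> exp (1 / s)" using s by (intro exp_lower_Taylor_quadratic) auto
    moreover have "0 \<le> 1 / s" using s by simp
    ultimately have "(1 / s)\<^sup>2 / 2 \<le> exp (1 / s)" by linarith
    then have f: "flat_exp 2 s \<le> 2" "0 \<le> flat_exp 2 s" using s by (auto simp: flat_exp_def exp_minus power_divide field_simps)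
    have "(t / R)\<^sup>2 < 1\<^sup>2" using True by simp
    then have "\<bar>t / R\<bar> < 1" using abs_square_less_1[of "t / R"] by simp
    then have "\<bar>t\<bar> \<le> R" using R by (simp add: abs_divide)
    then have "2 * \<bar>t\<bar> / R\<^sup>2 \<le> 2 * R / R\<^sup>2" by (intro divide_right_mono) auto
    also have "\<dots> = 2 / R" using R by (simp add: power2_eq_square)
    finally have "flat_exp 2 s * (2 * \<bar>t\<bar> / R\<^sup>2) \<le> 2 * (2 / R)" using f R by (intro mult_mono) auto
    then show ?thesis unfolding D using f by (simp add: s_def[symmetric] abs_mult)
  next
    case False
    then show ?thesis unfolding D using R by (simp add: flat_exp_def)
  qed
qed

section \<open>Weak derivatives and the Cauchy kernel\<close>

definition weak_deriv_on_tests :: "(real \<Rightarrow> complex) \<Rightarrow> (real \<Rightarrow> complex) \<Rightarrow> bool" where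
  "weak_deriv_on_tests f g \<longleftrightarrow> (\<forall>\<phi>. test_function \<phi> \<longrightarrow>
     (\<integral>x. f x * of_real (deriv \<phi> x) \<partial>lborel) = - (\<integral>x. g x * of_real (\<phi> x) \<partial>lborel))"

lemma smooth_measurable: "u \<in> smooth_class \<Longrightarrow> u \<in> borel_measurable borel"
  by (intro borel_measurable_continuous_onI continuous_at_imp_continuous_on ballI DERIV_isCont[OF smooth_deriv(2)])

text \<open>The Cauchy kernel is not compactly supported, so \<open>u\<close> is first multiplied by
  bumps of radius n + 1. Their derivatives are O(1/n), and the term with them disappears in the
  limit.\<close>

lemma weak_deriv_smooth_lp:
  assumes f: "lp p f" and g: "lp p g" and p: "1 < p" and w: "weak_deriv_on_tests f g"
    and u: "u \<in> smooth_class" "lp (conj_exp p) (\<lambda>t. of_real (u t))" "lp (conj_exp p) (\<lambda>t. of_real (deriv u t))"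
  shows "(\<integral>x. f x * of_real (deriv u x) \<partial>lborel) = - (\<integral>x. g x * of_real (u x) \<partial>lborel)"
proof -
  note [measurable] = lp_measurable[OF f] lp_measurable[OF g] smooth_measurable[OF u(1)] smooth_measurable[OF smooth_deriv(1)[OF u(1)]]
  define b where "b = (\<lambda>n. bump 0 (real (Suc n)))"
  have bs: "b n \<in> smooth_class" for n unfolding b_def by (rule bump_smooth)
  note [measurable] = smooth_measurable[OF bs] smooth_measurable[OF smooth_deriv(1)[OF bs]]
  have d: "deriv (\<lambda>x. b n x * u x) = (\<lambda>x. deriv (b n) x * u x + deriv u x * b n x)" for n
    by (intro ext DERIV_imp_deriv DERIV_mult smooth_deriv(2) bs u(1))
  have eq: "(\<integral>x. f x * of_real (deriv (b n) x * u x + deriv u x * b n x) \<partial>lborel) = - (\<integral>x. g x * of_real (b n x * u x) \<partial>lborel)" for n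
  proof -
    have t: "test_function (\<lambda>x. b n x * u x)"
    proof (rule smooth_test_function[OF smooth_class.mult[OF bs u(1)]])
      fix x assume "real (Suc n) < \<bar>x\<bar>"
      then have "b n x = 0" unfolding b_def by (intro bump_eq_0) auto
      then show "b n x * u x = 0" by simp
    qed
    from w[unfolded weak_deriv_on_tests_def, rule_format, OF t] show ?thesis unfolding d .
  qed
  \<comment> \<open>The bumps tend to their central value exp (- 1) and not to 1; the factor appears
    on both sides and is cancelled at the end.\<close>
  have limb: "(\<lambda>n. b n x) \<longlonglongrightarrow> exp (- 1)" for x
  proof -
    have "(\<lambda>n. 1 - (x * inverse (real (Suc n)))\<^sup>2) \<longlonglongrightarrow> 1 - (x * 0)\<^sup>2" by (intro tendsto_intros LIMSEQ_inverse_real_of_nat)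
    then have "(\<lambda>n. 1 - (x * inverse (real (Suc n)))\<^sup>2) \<longlonglongrightarrow> 1" by simp
    from isCont_tendsto_compose[OF DERIV_isCont[OF flat_exp_deriv[of 0]] this] show ?thesis
      by (simp add: b_def bump_def flat_exp_def[of 0 1] divide_inverse)
  qed
  have db: "\<bar>deriv (b n) x\<bar> \<le> 4 * inverse (real (Suc n))" for n x
    using bump_deriv_bound[of "real (Suc n)" x] by (simp add: b_def divide_inverse)
  have limb': "(\<lambda>n. deriv (b n) x) \<longlonglongrightarrow> 0" for x
  proof (rule Lim_null_comparison)
    show "\<forall>\<^sub>F n in sequentially. norm (deriv (b n) x) \<le> 4 * inverse (real (Suc n))" using db by simp
    have "(\<lambda>n. 4 * inverse (real (Suc n))) \<longlonglongrightarrow> 4 * 0" by (intro tendsto_mult tendsto_const LIMSEQ_inverse_real_of_nat)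
    then show "(\<lambda>n. 4 * inverse (real (Suc n))) \<longlonglongrightarrow> 0" by simp
  qed
  have q: "1 < conj_exp p" "1 / p + 1 / conj_exp p = 1" using conj_exp[OF p] by auto
  note fu = lp_mult_integrable[OF f u(2) p q] and fu' = lp_mult_integrable[OF f u(3) p q] and gu = lp_mult_integrable[OF g u(2) p q]
  have "(\<lambda>n. \<integral>x. f x * of_real (deriv (b n) x * u x + deriv u x * b n x) \<partial>lborel) \<longlonglongrightarrow> (\<integral>x. f x * of_real (deriv u x) * of_real (exp (- 1)) \<partial>lborel)"
  proof (rule integral_dominated_convergence[where w = "\<lambda>x. 4 * norm (f x * of_real (u x)) + norm (f x * of_real (deriv u x))"])
    show "AE x in lborel. (\<lambda>n. f x * of_real (deriv (b n) x * u x + deriv u x * b n x)) \<longlonglongrightarrow> f x * of_real (deriv u x) * of_real (exp (- 1))"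
    proof (intro AE_I2)
      fix x
      have "(\<lambda>n. f x * of_real (deriv (b n) x * u x + deriv u x * b n x)) \<longlonglongrightarrow> f x * of_real (0 * u x + deriv u x * exp (- 1))"
        by (intro tendsto_intros limb limb')
      then show "(\<lambda>n. f x * of_real (deriv (b n) x * u x + deriv u x * b n x)) \<longlonglongrightarrow> f x * of_real (deriv u x) * of_real (exp (- 1))"
        by (simp add: mult.assoc)
    qed
    show "AE x in lborel. norm (f x * of_real (deriv (b n) x * u x + deriv u x * b n x)) \<le> 4 * norm (f x * of_real (u x)) + norm (f x * of_real (deriv u x))" for n
    proof (intro AE_I2)
      fix x
      have "inverse (real (Suc n)) \<le> 1" by (simp add: inverse_le_1_iff)
      then have "\<bar>deriv (b n) x\<bar> \<le> 4" using db[of n x] by linarith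
      then have 1: "\<bar>deriv (b n) x * u x\<bar> \<le> 4 * \<bar>u x\<bar>" unfolding abs_mult by (intro mult_right_mono) auto
      have "\<bar>b n x\<bar> \<le> 1" using bump_nonneg bump_le_1 by (simp add: b_def)
      then have 2: "\<bar>deriv u x * b n x\<bar> \<le> \<bar>deriv u x\<bar>" unfolding abs_mult by (intro mult_left_le) auto
      have "norm (f x) * \<bar>deriv (b n) x * u x + deriv u x * b n x\<bar> \<le> norm (f x) * (4 * \<bar>u x\<bar> + \<bar>deriv u x\<bar>)"
        using 1 2 by (intro mult_left_mono) auto
      then show "norm (f x * of_real (deriv (b n) x * u x + deriv u x * b n x)) \<le> 4 * norm (f x * of_real (u x)) + norm (f x * of_real (deriv u x))"
        by (simp only: norm_mult norm_of_real) (simp add: algebra_simps)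
    qed
  qed (use fu fu' in auto)
  then have l1: "(\<lambda>n. \<integral>x. f x * of_real (deriv (b n) x * u x + deriv u x * b n x) \<partial>lborel) \<longlonglongrightarrow> (\<integral>x. f x * of_real (deriv u x) \<partial>lborel) * of_real (exp (- 1))"
    by (simp only: integral_mult_left_zero)
  have "(\<lambda>n. \<integral>x. g x * of_real (b n x * u x) \<partial>lborel) \<longlonglongrightarrow> (\<integral>x. g x * of_real (u x) * of_real (exp (- 1)) \<partial>lborel)"
  proof (rule integral_dominated_convergence[where w = "\<lambda>x. norm (g x * of_real (u x))"])
    show "AE x in lborel. (\<lambda>n. g x * of_real (b n x * u x)) \<longlonglongrightarrow> g x * of_real (u x) * of_real (exp (- 1))"
    proof (intro AE_I2)
      fix x
      have "(\<lambda>n. g x * of_real (b n x * u x)) \<longlonglongrightarrow> g x * of_real (exp (- 1) * u x)"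
        by (intro tendsto_intros limb)
      then show "(\<lambda>n. g x * of_real (b n x * u x)) \<longlonglongrightarrow> g x * of_real (u x) * of_real (exp (- 1))"
        by (simp add: mult_ac)
    qed
    show "AE x in lborel. norm (g x * of_real (b n x * u x)) \<le> norm (g x * of_real (u x))" for n
    proof (intro AE_I2)
      fix x
      have "\<bar>b n x\<bar> \<le> 1" using bump_nonneg bump_le_1 by (simp add: b_def)
      then have "\<bar>b n x * u x\<bar> \<le> 1 * \<bar>u x\<bar>" unfolding abs_mult by (intro mult_right_mono) auto
      then show "norm (g x * of_real (b n x * u x)) \<le> norm (g x * of_real (u x))"
        unfolding norm_mult norm_of_real by (intro mult_left_mono) auto
    qed
  qed (use gu in auto)
  then have "(\<lambda>n. - (\<integral>x. g x * of_real (b n x * u x) \<partial>lborel)) \<longlonglongrightarrow> - ((\<integral>x. g x * of_real (u x) \<partial>lborel) * of_real (exp (- 1)))"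
    by (intro tendsto_minus) (simp only: integral_mult_left_zero)
  from LIMSEQ_unique[OF l1 this[folded eq]]
  show ?thesis by (metis (no_types, lifting) exp_not_eq_zero minus_mult_left mult_right_cancel of_real_eq_0_iff)
qed

lemma kernel_Re_Im:
  "Re (1 / (of_real t - z)) = (t - Re z) / ((t - Re z)\<^sup>2 + (Im z)\<^sup>2)"
  "Im (1 / (of_real t - z)) = Im z / ((t - Re z)\<^sup>2 + (Im z)\<^sup>2)"
  by (simp_all add: Re_divide Im_divide)

text \<open>Test functions are real, so the kernel enters through its real and imaginary parts,
  which are polynomials times the reciprocal of a positive polynomial.\<close>

lemma kernel_smooth:
  assumes z: "Im z \<noteq> 0"
  shows "(\<lambda>t. Re (1 / (of_real t - z))) \<in> smooth_class" "(\<lambda>t. Im (1 / (of_real t - z))) \<in> smooth_class"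
proof -
  define r where "r = (\<lambda>t. 1 / ((t + - Re z) * (t + - Re z) + Im z * Im z))"
  have "0 < (t + - Re z) * (t + - Re z) + Im z * Im z" for t
    using z by (intro add_nonneg_pos) (auto simp: zero_less_mult_iff)
  then have r: "r \<in> smooth_class" unfolding r_def by (intro smooth_class.intros)
  have "(\<lambda>t. Re (1 / (of_real t - z))) = (\<lambda>t. (t + - Re z) * r t)"
    unfolding kernel_Re_Im r_def by (simp add: power2_eq_square)
  moreover have "(\<lambda>t. (t + - Re z) * r t) \<in> smooth_class" by (intro smooth_class.intros r)
  ultimately show "(\<lambda>t. Re (1 / (of_real t - z))) \<in> smooth_class" by simp
  have "(\<lambda>t. Im (1 / (of_real t - z))) = (\<lambda>t. Im z * r t)"
    unfolding kernel_Re_Im r_def by (simp add: power2_eq_square)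
  moreover have "(\<lambda>t. Im z * r t) \<in> smooth_class" by (intro smooth_class.intros r)
  ultimately show "(\<lambda>t. Im (1 / (of_real t - z))) \<in> smooth_class" by simp
qed

lemma kernel_vector_derivative:
  assumes z: "Im z \<noteq> 0"
  shows "((\<lambda>t. 1 / (of_real t - z)) has_vector_derivative - (1 / (of_real t - z))\<^sup>2) (at t)"
proof -
  have n: "of_real t - z \<noteq> 0" by (rule kernel_nonzero[OF z])
  have "((\<lambda>w. 1 / (w - z)) has_field_derivative - (1 / (of_real t - z))\<^sup>2) (at (of_real t))"
    using n by (auto intro!: derivative_eq_intros simp: power2_eq_square)
  then show ?thesis by (rule has_vector_derivative_real_field)
qed

lemma kernel_deriv:
  assumes z: "Im z \<noteq> 0"
  shows "deriv (\<lambda>t. Re (1 / (of_real t - z))) = (\<lambda>t. - Re ((1 / (of_real t - z))\<^sup>2))"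
    "deriv (\<lambda>t. Im (1 / (of_real t - z))) = (\<lambda>t. - Im ((1 / (of_real t - z))\<^sup>2))"
proof -
  have "((\<lambda>t. Re (1 / (of_real t - z))) has_real_derivative Re (- (1 / (of_real t - z))\<^sup>2)) (at t)"
    "((\<lambda>t. Im (1 / (of_real t - z))) has_real_derivative Im (- (1 / (of_real t - z))\<^sup>2)) (at t)" for t
    unfolding has_real_derivative_iff_has_vector_derivative
    using bounded_linear.has_vector_derivative[OF bounded_linear_Re kernel_vector_derivative[OF z]]
      bounded_linear.has_vector_derivative[OF bounded_linear_Im kernel_vector_derivative[OF z]] by auto
  then show "deriv (\<lambda>t. Re (1 / (of_real t - z))) = (\<lambda>t. - Re ((1 / (of_real t - z))\<^sup>2))"
    "deriv (\<lambda>t. Im (1 / (of_real t - z))) = (\<lambda>t. - Im ((1 / (of_real t - z))\<^sup>2))"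
    by (auto simp only: uminus_complex.sel intro!: ext DERIV_imp_deriv)
qed

text \<open>The t-derivative of the kernel is minus its square, and this sign cancels the one of
  integration by parts.\<close>

lemma weak_deriv_kernel:
  assumes f: "lp p f" and g: "lp p g" and p: "1 < p" and w: "weak_deriv_on_tests f g" and z: "Im z \<noteq> 0"
  shows "(\<integral>t. f t * (1 / (of_real t - z))\<^sup>2 \<partial>lborel) = (\<integral>t. g t * (1 / (of_real t - z)) \<partial>lborel)"
proof -
  define q where "q = conj_exp p"
  have q: "1 < q" "1 / p + 1 / q = 1" using conj_exp[OF p] by (auto simp: q_def)
  define k where "k = (\<lambda>t. 1 / (complex_of_real t - z))"
  have k1: "lp q k" unfolding k_def by (rule lp_kernel[OF z q(1)])
  have k2: "lp q (\<lambda>t. (k t)\<^sup>2)" using lp_kernel_power[OF z q(1), of 1] by (simp add: k_def power2_eq_square)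
  have ReIm: "lp q (\<lambda>t. of_real (Re (K t)))" "lp q (\<lambda>t. of_real (Im (K t)))" if K: "lp q K" for K
  proof -
    note [measurable] = lp_measurable[OF K]
    show "lp q (\<lambda>t. of_real (Re (K t)))" by (rule lp_mono[OF K]) (use q abs_Re_le_cmod in auto)
    show "lp q (\<lambda>t. of_real (Im (K t)))" by (rule lp_mono[OF K]) (use q abs_Im_le_cmod in auto)
  qed
  have split: "(\<integral>t. F t * K t \<partial>lborel) = (\<integral>t. F t * of_real (Re (K t)) \<partial>lborel) + \<i> * (\<integral>t. F t * of_real (Im (K t)) \<partial>lborel)"
    if F: "lp p F" and K: "lp q K" for F K
  proof -
    have "F t * K t = F t * of_real (Re (K t)) + \<i> * (F t * of_real (Im (K t)))" for t
      by (subst complex_eq[of "K t"]) (simp add: algebra_simps)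
    then show ?thesis
      using lp_mult_integrable[OF F ReIm(1)[OF K] p q] lp_mult_integrable[OF F ReIm(2)[OF K] p q] by simp
  qed
  have R: "(\<integral>t. f t * of_real (Re ((k t)\<^sup>2)) \<partial>lborel) = (\<integral>t. g t * of_real (Re (k t)) \<partial>lborel)"
    using weak_deriv_smooth_lp[OF f g p w kernel_smooth(1)[OF z]] ReIm(1)[OF k1] lp_minus[OF ReIm(1)[OF k2]]
    unfolding kernel_deriv[OF z] q_def k_def by simp
  have I: "(\<integral>t. f t * of_real (Im ((k t)\<^sup>2)) \<partial>lborel) = (\<integral>t. g t * of_real (Im (k t)) \<partial>lborel)"
    using weak_deriv_smooth_lp[OF f g p w kernel_smooth(2)[OF z]] ReIm(2)[OF k1] lp_minus[OF ReIm(2)[OF k2]]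
    unfolding kernel_deriv[OF z] q_def k_def by simp
  have "(\<integral>t. f t * (k t)\<^sup>2 \<partial>lborel) = (\<integral>t. g t * k t \<partial>lborel)"
    unfolding split[OF f k2] split[OF g k1] R I ..
  then show ?thesis by (simp add: k_def)
qed

text \<open>Differentiation in z squares the kernel, and \<open>weak_deriv_kernel\<close> trades the
  square for a weak derivative of f.\<close>

lemma cauchy_weak_deriv:
  assumes "lp p f" "lp p g" "1 < p" "weak_deriv_on_tests f g" "Im z \<noteq> 0"
  shows "(cauchy f has_field_derivative cauchy g z) (at z)"
  using cauchy_has_derivative[OF assms(1,3,5)] unfolding weak_deriv_kernel[OF assms] cauchy_def[of g] .

lemma test_function_differentiable:
  assumes "test_function \<phi>"
  shows "(\<phi> has_real_derivative deriv \<phi> x) (at x)" "(deriv \<phi> has_real_derivative deriv (deriv \<phi>) x) (at x)"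
proof -
  have "(deriv ^^ k) \<phi> differentiable (at x)" for k using assms by (simp add: test_function_def)
  from this[of 0] this[of 1] show "(\<phi> has_real_derivative deriv \<phi> x) (at x)" "(deriv \<phi> has_real_derivative deriv (deriv \<phi>) x) (at x)"
    by (simp_all add: DERIV_deriv_iff_real_differentiable)
qed

lemma test_function_support:
  assumes "test_function \<phi>"
  shows "\<exists>N>0. \<forall>x. N < \<bar>x\<bar> \<longrightarrow> \<phi> x = 0 \<and> deriv \<phi> x = 0"
proof -
  have "bounded {x. \<phi> x \<noteq> 0}"
    using assms compact_imp_bounded bounded_subset[OF _ closure_subset] by (auto simp: test_function_def)
  then obtain N where N: "0 < N" "\<And>x. \<phi> x \<noteq> 0 \<Longrightarrow> \<bar>x\<bar> \<le> N" by (auto simp: bounded_pos)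
  have z: "\<phi> x = 0" if "N < \<bar>x\<bar>" for x using N(2)[of x] that by fastforce
  have "deriv \<phi> x = 0" if x: "N < \<bar>x\<bar>" for x
  proof (rule DERIV_imp_deriv)
    have "open {x. N < \<bar>x\<bar>}" by (intro open_Collect_less continuous_intros)
    then have "\<forall>\<^sub>F t in nhds x. t \<in> {x. N < \<bar>x\<bar>}" using x by (intro eventually_nhds_in_open) auto
    then have "\<forall>\<^sub>F t in nhds x. 0 = \<phi> t" by eventually_elim (simp add: z)
    from DERIV_cong_ev[OF refl this refl, of 0] show "(\<phi> has_real_derivative 0) (at x)" by simp
  qed
  with N(1) z show ?thesis by blast
qed

lemma test_function_deriv:
  assumes "test_function \<phi>"
  shows "test_function (deriv \<phi>)"
  unfolding test_function_def
proof (intro conjI allI)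
  show "(deriv ^^ k) (deriv \<phi>) differentiable at x" for k x
  proof -
    have "(deriv ^^ Suc k) \<phi> differentiable at x" using assms unfolding test_function_def by blast
    then show ?thesis by (simp only: funpow_Suc_right o_apply)
  qed
  obtain N :: real where N: "0 < N" "\<And>x. N < \<bar>x\<bar> \<Longrightarrow> \<phi> x = 0" "\<And>x. N < \<bar>x\<bar> \<Longrightarrow> deriv \<phi> x = 0"
    using test_function_support[OF assms] by blast
  have "{x. deriv \<phi> x \<noteq> 0} \<subseteq> {- N..N}"
  proof
    fix x assume "x \<in> {x. deriv \<phi> x \<noteq> 0}"
    then have "\<not> N < \<bar>x\<bar>" using N(3)[of x] by auto
    then show "x \<in> {- N..N}" by auto
  qed
  then have "bounded {x. deriv \<phi> x \<noteq> 0}" by (rule bounded_subset[rotated]) (rule bounded_closed_interval)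
  then show "compact (closure {x. deriv \<phi> x \<noteq> 0})" by (simp add: compact_closure)
qed

lemma test_function_higher_deriv: "test_function \<phi> \<Longrightarrow> test_function ((deriv ^^ k) \<phi>)"
  by (induction k) (auto intro: test_function_deriv)

lemma test_function_continuous: "test_function \<phi> \<Longrightarrow> continuous_on A \<phi>"
  by (intro continuous_at_imp_continuous_on ballI DERIV_isCont[OF test_function_differentiable(1)])

lemma test_function_measurable: "test_function \<phi> \<Longrightarrow> \<phi> \<in> borel_measurable borel"
  by (intro borel_measurable_continuous_onI test_function_continuous)

lemma lp_test_function:
  assumes \<phi>: "test_function \<phi>" and q: "1 < q"
  shows "lp q (\<lambda>x. of_real (\<phi> x))"
proof -
  note [measurable] = test_function_measurable[OF \<phi>]
  obtain N :: real where N: "0 < N" "\<And>x. N < \<bar>x\<bar> \<Longrightarrow> \<phi> x = 0" "\<And>x. N < \<bar>x\<bar> \<Longrightarrow> deriv \<phi> x = 0"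
    using test_function_support[OF \<phi>] by blast
  have "bounded (\<phi> ` {- N..N})"
    by (intro compact_imp_bounded compact_continuous_image test_function_continuous[OF \<phi>]) auto
  then obtain B where B: "0 < B" "\<And>x. x \<in> {- N..N} \<Longrightarrow> \<bar>\<phi> x\<bar> \<le> B" by (auto simp: bounded_pos)
  show ?thesis
  proof (rule lp_decay[OF q, of _ "B * (1 + N)"])
    fix t
    show "norm (complex_of_real (\<phi> t)) \<le> B * (1 + N) / (1 + \<bar>t\<bar>)"
    proof (cases "\<bar>t\<bar> \<le> N")
      case True
      then have "\<bar>\<phi> t\<bar> * (1 + \<bar>t\<bar>) \<le> B * (1 + N)" using B(2)[of t] by (intro mult_mono) (auto simp: abs_le_iff)
      then show ?thesis by (simp add: pos_le_divide_eq)
    next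
      case False
      then show ?thesis using N B by simp
    qed
  qed measurable
qed

text \<open>Integration by parts is elementary at positive height, where the Poisson integrals are
  holomorphic. Then the height tends to 0, and both pairings converge by
  \<open>lp_weak_convergence\<close>.\<close>

lemma boundary_weak_deriv:
  assumes p: "1 < p" and h0: "lp p h0" and h1: "lp p h1"
    and D: "\<And>z. 0 < Im z \<Longrightarrow> (poisson h0 has_field_derivative poisson h1 z) (at z)"
    and hol: "poisson h1 holomorphic_on upper 0"
  shows "weak_deriv_on_tests h0 h1"
  unfolding weak_deriv_on_tests_def
proof (intro allI impI)
  fix \<phi> assume \<phi>: "test_function \<phi>"
  have hol0: "poisson h0 holomorphic_on upper 0"
    unfolding holomorphic_on_open[OF open_upper] using D by (auto simp: upper_def)
  obtain N where N: "0 < N" "\<And>x. N < \<bar>x\<bar> \<Longrightarrow> \<phi> x = 0" "\<And>x. N < \<bar>x\<bar> \<Longrightarrow> deriv \<phi> x = 0"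
    using test_function_support[OF \<phi>] by blast
  define e where "e = (\<lambda>n. inverse (real (Suc n)))"
  have e: "0 < e n" for n by (simp add: e_def)
  have q: "1 < conj_exp p" "1 / p + 1 / conj_exp p = 1" using conj_exp[OF p] by auto
  have lphi: "lp (conj_exp p) (\<lambda>x. of_real (\<phi> x))" "lp (conj_exp p) (\<lambda>x. of_real (deriv \<phi> x))"
    using lp_test_function q \<phi> test_function_deriv by auto
  have conv: "(\<lambda>n. \<integral>x. poisson h (Complex x (e n)) * k x \<partial>lborel) \<longlonglongrightarrow> (\<integral>x. h x * k x \<partial>lborel)"
    and lpP: "lp p (\<lambda>x. poisson h (Complex x (e n)))"
    if h: "lp p h" "poisson h holomorphic_on upper 0" and k: "lp (conj_exp p) k" for h k n
  proof -
    have m: "(\<lambda>x. poisson h (Complex x (e n))) \<in> borel_measurable borel" for n by (rule upper_line_measurable[OF h(2) e])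
    have c: "pnorm p (\<lambda>x. poisson h (Complex x (e n))) \<le> pnorm p h" for n by (rule poisson_contraction[OF h(1) p e])
    show "lp p (\<lambda>x. poisson h (Complex x (e n)))" for n
      unfolding lp_def using m[of n] le_less_trans[OF c[of n] lp_pnorm[OF h(1)]] by auto
    show "(\<lambda>n. \<integral>x. poisson h (Complex x (e n)) * k x \<partial>lborel) \<longlonglongrightarrow> (\<integral>x. h x * k x \<partial>lborel)"
    proof (rule lp_weak_convergence[OF p q m lp_measurable[OF h(1)] _ c lp_pnorm[OF h(1)] k])
      show "AE x in lborel. (\<lambda>n. poisson h (Complex x (e n))) \<longlonglongrightarrow> h x"
        using poisson_nontangential_AE[OF h(1) p]
      proof eventually_elim
        case (elim x)
        then show ?case unfolding e_def by (intro vertical_seq[OF nontangential_vertical inverse_Suc_at_right])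
      qed
    qed
  qed
  have parts: "(\<integral>x. poisson h0 (Complex x (e n)) * of_real (deriv \<phi> x) \<partial>lborel) = - (\<integral>x. poisson h1 (Complex x (e n)) * of_real (\<phi> x) \<partial>lborel)" for n
  proof -
    \<comment> \<open>One unit beyond N, so that \<phi> vanishes at the end points and the boundary
      terms drop out.\<close>
    define K where "K = N + 1"
    define W where "W = (\<lambda>x. poisson h0 (Complex x (e n)) * of_real (\<phi> x))"
    define W' where "W' = (\<lambda>x. poisson h0 (Complex x (e n)) * of_real (deriv \<phi> x) + poisson h1 (Complex x (e n)) * of_real (\<phi> x))"
    have cF: "continuous_on A (\<lambda>x. F (Complex x (e n)))" if "F holomorphic_on upper 0" for F A
      by (rule continuous_on_compose2[OF holomorphic_on_imp_continuous_on[OF that]])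
         (use e in \<open>auto simp: upper_def Complex_eq intro!: continuous_intros\<close>)
    have dW: "(W has_vector_derivative W' x) (at x)" for x
    proof -
      have 1: "((\<lambda>x. poisson h0 (Complex x (e n))) has_vector_derivative poisson h1 (Complex x (e n))) (at x)"
        by (rule horizontal_deriv[OF D]) (use e in auto)
      have 2: "((\<lambda>x. complex_of_real (\<phi> x)) has_vector_derivative of_real (deriv \<phi> x)) (at x)"
        using test_function_differentiable(1)[OF \<phi>, of x]
        by (auto simp: has_real_derivative_iff_has_vector_derivative intro: has_vector_derivative_of_real)
      show ?thesis unfolding W_def W'_def by (rule has_vector_derivative_mult[OF 1 2])
    qed
    have "(\<integral>x. indicator {- K..K} x *\<^sub>R W' x \<partial>lborel) = W K - W (- K)"
    proof (rule integral_FTC_Icc)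
      show "continuous_on {- K..K} W'" unfolding W'_def
        by (intro continuous_intros cF hol0 hol continuous_on_of_real test_function_continuous \<phi> test_function_deriv)
    qed (use N dW in \<open>auto simp: K_def intro: has_vector_derivative_at_within\<close>)
    also have "\<dots> = 0" using N by (simp add: W_def K_def)
    also have "(\<lambda>x. indicator {- K..K} x *\<^sub>R W' x) = W'"
    proof
      fix x
      show "indicator {- K..K} x *\<^sub>R W' x = W' x"
        using N(2)[of x] N(3)[of x] by (auto simp: indicator_def W'_def K_def abs_le_iff not_le)
    qed
    finally have "(\<integral>x. W' x \<partial>lborel) = 0" .
    moreover have "(\<integral>x. W' x \<partial>lborel) = (\<integral>x. poisson h0 (Complex x (e n)) * of_real (deriv \<phi> x) \<partial>lborel) + (\<integral>x. poisson h1 (Complex x (e n)) * of_real (\<phi> x) \<partial>lborel)"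
      unfolding W'_def
      by (intro Bochner_Integration.integral_add lp_mult_integrable[OF lpP[OF h0 hol0 lphi(1)] lphi(2) p q] lp_mult_integrable[OF lpP[OF h1 hol lphi(1)] lphi(1) p q])
    ultimately show ?thesis by (simp add: add_eq_0_iff2)
  qed
  have "(\<lambda>n. - (\<integral>x. poisson h1 (Complex x (e n)) * of_real (\<phi> x) \<partial>lborel)) \<longlonglongrightarrow> - (\<integral>x. h1 x * of_real (\<phi> x) \<partial>lborel)"
    by (intro tendsto_minus conv h1 hol lphi)
  moreover have "(\<lambda>n. \<integral>x. poisson h0 (Complex x (e n)) * of_real (deriv \<phi> x) \<partial>lborel) \<longlonglongrightarrow> (\<integral>x. h0 x * of_real (deriv \<phi> x) \<partial>lborel)"
    by (intro conv h0 hol0 lphi)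
  ultimately show "(\<integral>x. h0 x * of_real (deriv \<phi> x) \<partial>lborel) = - (\<integral>x. h1 x * of_real (\<phi> x) \<partial>lborel)"
    unfolding parts by (rule LIMSEQ_unique[rotated])
qed

section \<open>Pairing of Hardy functions\<close>

text \<open>The integrable case is applied to truncations, which are then removed one after the
  other; M. Riesz supplies the uniform bounds for weak convergence.\<close>

lemma cauchy_duality_lp:
  assumes p: "1 < p" and q: "1 < q" and pq: "1 / p + 1 / q = 1" and f: "lp p f" and g: "lp q g" and y: "0 < y"
  shows "(\<integral>x. cauchy f (Complex x y) * g x \<partial>lborel) = (\<integral>t. f t * cnj (cauchy (\<lambda>x. cnj (g x)) (Complex t y)) \<partial>lborel)"
proof -
  have qp: "1 / q + 1 / p = 1" using pq by simp
  \<comment> \<open>Stated for general conjugate exponents, because it is applied to f with (p, q)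
    and to g with (q, p).\<close>
  have cl: "(\<lambda>n. \<integral>x. cauchy (trunc n F) (Complex x y) * k x \<partial>lborel) \<longlonglongrightarrow> (\<integral>x. cauchy F (Complex x y) * k x \<partial>lborel)"
    and tl: "(\<lambda>n. \<integral>x. trunc n F x * k x \<partial>lborel) \<longlonglongrightarrow> (\<integral>x. F x * k x \<partial>lborel)"
    and lc: "lp r (\<lambda>x. cauchy F (Complex x y))"
    if r: "1 < r" "1 < s" "1 / r + 1 / s = 1" and F: "lp r F" and k: "lp s k" for r s F k
  proof -
    obtain A where A: "0 \<le> A" "\<And>f y. lp r f \<Longrightarrow> 0 < y \<Longrightarrow> pnorm r (\<lambda>x. cauchy f (Complex x y)) \<le> ennreal A * pnorm r f"
      using riesz[OF r(1)] by blast
    have fin: "ennreal A * pnorm r F < \<infinity>" using lp_pnorm[OF F] by (simp add: ennreal_mult_less_top)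
    have T: "lp r (trunc n F)" for n using F r by (intro lp_trunc) auto
    show "lp r (\<lambda>x. cauchy F (Complex x y))"
      unfolding lp_def using cauchy_line_measurable[OF F r(1) y] le_less_trans[OF A(2)[OF F y] fin] by auto
    show "(\<lambda>n. \<integral>x. cauchy (trunc n F) (Complex x y) * k x \<partial>lborel) \<longlonglongrightarrow> (\<integral>x. cauchy F (Complex x y) * k x \<partial>lborel)"
    proof (rule lp_weak_convergence[OF r cauchy_line_measurable[OF T r(1) y] cauchy_line_measurable[OF F r(1) y] _ _ fin k])
      show "AE x in lborel. (\<lambda>n. cauchy (trunc n F) (Complex x y)) \<longlonglongrightarrow> cauchy F (Complex x y)"
        using y by (intro AE_I2 cauchy_trunc_tendsto[OF F r(1)]) auto
      show "pnorm r (\<lambda>x. cauchy (trunc n F) (Complex x y)) \<le> ennreal A * pnorm r F" for n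
        using r by (intro order_trans[OF A(2)[OF T y] mult_left_mono[OF pnorm_trunc_le]]) auto
    qed
    show "(\<lambda>n. \<integral>x. trunc n F x * k x \<partial>lborel) \<longlonglongrightarrow> (\<integral>x. F x * k x \<partial>lborel)"
      by (rule lp_weak_convergence[OF r lp_measurable[OF T] lp_measurable[OF F] _ _ lp_pnorm[OF F] k])
         (use r in \<open>auto intro!: AE_I2 trunc_tendsto pnorm_trunc_le\<close>)
  qed
  have tc: "trunc n (\<lambda>x. cnj (h x)) = (\<lambda>x. cnj (trunc n h x))" for n h
    by (auto simp: trunc_def indicator_def fun_eq_iff)
  define C where "C = (\<lambda>h t. cnj (cauchy (\<lambda>x. cnj (h x)) (Complex t y)))"
  have lC: "lp q (C h)" if "lp q h" for h
    unfolding C_def using lc[OF q p qp lp_cnj[OF that] f] by (rule lp_cnj)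
  \<comment> \<open>The truncation of f is removed while g is still truncated and hence
    integrable.\<close>
  have step: "(\<integral>x. cauchy f (Complex x y) * trunc m g x \<partial>lborel) = (\<integral>t. f t * C (trunc m g) t \<partial>lborel)" for m
  proof (rule LIMSEQ_unique)
    have gm: "lp q (trunc m g)" using g q by (intro lp_trunc) auto
    have gi: "integrable lborel (trunc m g)" using compact_supp_integrable[OF gm _ compact_supp_trunc] q by simp
    show "(\<lambda>n. \<integral>x. cauchy (trunc n f) (Complex x y) * trunc m g x \<partial>lborel) \<longlonglongrightarrow> (\<integral>x. cauchy f (Complex x y) * trunc m g x \<partial>lborel)"
      by (rule cl[OF p q pq f gm])
    have "integrable lborel (trunc n f)" for n
      using compact_supp_integrable[OF lp_trunc[OF f] _ compact_supp_trunc] p by simp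
    then have "(\<integral>x. cauchy (trunc n f) (Complex x y) * trunc m g x \<partial>lborel) = (\<integral>t. trunc n f t * C (trunc m g) t \<partial>lborel)" for n
      unfolding C_def by (rule cauchy_duality[OF _ gi y])
    then show "(\<lambda>n. \<integral>x. cauchy (trunc n f) (Complex x y) * trunc m g x \<partial>lborel) \<longlonglongrightarrow> (\<integral>t. f t * C (trunc m g) t \<partial>lborel)"
      using tl[OF p q pq f lC[OF gm]] by simp
  qed
  have "(\<lambda>m. \<integral>x. trunc m g x * cauchy f (Complex x y) \<partial>lborel) \<longlonglongrightarrow> (\<integral>x. g x * cauchy f (Complex x y) \<partial>lborel)"
    by (rule tl[OF q p qp g lc[OF p q pq f g]])
  moreover have "(\<lambda>m. \<integral>t. cauchy (trunc m (\<lambda>x. cnj (g x))) (Complex t y) * cnj (f t) \<partial>lborel) \<longlonglongrightarrow> (\<integral>t. cauchy (\<lambda>x. cnj (g x)) (Complex t y) * cnj (f t) \<partial>lborel)"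
    by (rule cl[OF q p qp lp_cnj[OF g] lp_cnj[OF f]])
  then have "(\<lambda>m. cnj (\<integral>t. cauchy (trunc m (\<lambda>x. cnj (g x))) (Complex t y) * cnj (f t) \<partial>lborel)) \<longlonglongrightarrow> cnj (\<integral>t. cauchy (\<lambda>x. cnj (g x)) (Complex t y) * cnj (f t) \<partial>lborel)"
    by (rule tendsto_cnj)
  then have "(\<lambda>m. \<integral>t. f t * C (trunc m g) t \<partial>lborel) \<longlonglongrightarrow> (\<integral>t. f t * C g t \<partial>lborel)"
    unfolding Bochner_Integration.integral_cnj[symmetric] by (simp add: C_def tc mult.commute)
  ultimately show ?thesis
    using step LIMSEQ_unique by (fastforce simp: C_def mult.commute)
qed

text \<open>f is raised to height 1 / (n + 1) and the operator is moved to g by duality. What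
  appears is \<open>cauchy g\<close> on the lower half-plane, which is 0. Since
  \<open>cauchy f\<close> is the Poisson integral of f above, letting the height tend to 0 recovers
  f.\<close>

lemma hardy_pairing_zero:
  assumes p: "1 < p" and q: "1 < q" and pq: "1 / p + 1 / q = 1" and f: "lp p f" and g: "lp q g"
    and f0: "\<And>w. Im w < 0 \<Longrightarrow> cauchy f w = 0" and g0: "\<And>w. Im w < 0 \<Longrightarrow> cauchy g w = 0"
  shows "(\<integral>x. f x * g x \<partial>lborel) = 0"
proof -
  define e where "e = (\<lambda>n. inverse (real (Suc n)))"
  have e: "0 < e n" for n by (simp add: e_def)
  have P: "cauchy f z = poisson f z" if "0 < Im z" for z
    using poisson_cauchy[OF f p that] f0[of "cnj z"] that by simp
  have zero: "(\<integral>x. cauchy f (Complex x (e n)) * g x \<partial>lborel) = 0" for n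
  proof -
    have "cauchy (\<lambda>x. cnj (g x)) (Complex t (e n)) = 0" for t
      using e[of n] g0[of "cnj (Complex t (e n))"] by (simp add: cauchy_cnj)
    then show ?thesis unfolding cauchy_duality_lp[OF p q pq f g e] by simp
  qed
  have "(\<lambda>n. \<integral>x. cauchy f (Complex x (e n)) * g x \<partial>lborel) \<longlonglongrightarrow> (\<integral>x. f x * g x \<partial>lborel)"
  proof (rule lp_weak_convergence[OF p q pq cauchy_line_measurable[OF f p e] lp_measurable[OF f] _ _ lp_pnorm[OF f] g])
    show "AE x in lborel. (\<lambda>n. cauchy f (Complex x (e n))) \<longlonglongrightarrow> f x"
      using poisson_nontangential_AE[OF f p]
    proof eventually_elim
      case (elim x)
      have "(\<lambda>n. poisson f (Complex x (e n))) \<longlonglongrightarrow> f x"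
        unfolding e_def by (rule vertical_seq[OF nontangential_vertical[OF elim] inverse_Suc_at_right])
      then show ?case using P e by simp
    qed
    show "pnorm p (\<lambda>x. cauchy f (Complex x (e n))) \<le> pnorm p f" for n
      using poisson_contraction[OF f p e[of n]] P e by simp
  qed
  then show ?thesis unfolding zero by (simp add: LIMSEQ_const_iff)
qed

section \<open>Lebesgue measurable functions and their Borel representatives\<close>

lemma borel_representative:
  fixes f :: "real \<Rightarrow> complex"
  assumes "f \<in> borel_measurable lebesgue"
  obtains f' where "f' \<in> borel_measurable borel" "AE x in lborel. f x = f' x"
proof -
  have "(\<lambda>x. Re (f x)) \<in> borel_measurable lebesgue" "(\<lambda>x. Im (f x)) \<in> borel_measurable lebesgue"
    using assms by measurable
  from this[THEN completion_ex_borel_measurable_real]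
  obtain u v where uv: "u \<in> borel_measurable lborel" "AE x in lborel. Re (f x) = u x"
    "v \<in> borel_measurable lborel" "AE x in lborel. Im (f x) = v x" by blast
  show thesis
  proof
    show "(\<lambda>x. Complex (u x) (v x)) \<in> borel_measurable borel"
      using uv(1,3) unfolding Complex_eq by simp
    show "AE x in lborel. f x = Complex (u x) (v x)"
      using uv(2,4) by eventually_elim (simp add: complex_eq_iff)
  qed
qed

text \<open>Completeness of Lebesgue measure: preimages that differ by a null set are measurable
  together.\<close>

lemma lebesgue_measurable_AE:
  fixes f :: "real \<Rightarrow> 'a::topological_space"
  assumes "AE x in lborel. f x = g x" and [measurable]: "g \<in> borel_measurable borel"
  shows "f \<in> borel_measurable lebesgue"
proof (rule measurableI)
  fix A :: "'a set" assume [measurable]: "A \<in> sets borel"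
  have "AE x in lebesgue. f x = g x" using assms(1) by (rule AE_completion)
  then have "AE x in lebesgue. x \<in> g -` A \<longleftrightarrow> x \<in> f -` A" by eventually_elim simp
  moreover have "g -` A \<in> sets lebesgue"
    using measurable_sets[OF assms(2), of A] by (simp add: sets_completionI_sets)
  ultimately have "f -` A \<in> sets lebesgue" by (rule completion.in_sets_AE) simp
  then show "f -` A \<inter> space lebesgue \<in> sets lebesgue" by simp
qed simp

lemma lebesgue_integral_AE:
  fixes f g :: "real \<Rightarrow> 'a::{banach, second_countable_topology}"
  assumes "AE x in lborel. f x = g x" "g \<in> borel_measurable borel"
  shows "(LINT x|lebesgue. f x) = (\<integral>x. g x \<partial>lborel)"
    and "integrable lebesgue f \<longleftrightarrow> integrable lborel g"
proof -
  have f: "f \<in> borel_measurable lebesgue" by (rule lebesgue_measurable_AE[OF assms])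
  have g: "g \<in> borel_measurable lborel" using assms(2) by simp
  have g': "g \<in> borel_measurable lebesgue" using g by (rule measurable_completion)
  have ae: "AE x in lebesgue. f x = g x" using assms(1) by (rule AE_completion)
  have "(LINT x|lebesgue. f x) = (LINT x|lebesgue. g x)" by (rule integral_cong_AE[OF f g' ae])
  then show "(LINT x|lebesgue. f x) = (\<integral>x. g x \<partial>lborel)" by (simp add: integral_completion[OF g])
  have "integrable lebesgue f \<longleftrightarrow> integrable lebesgue g" by (rule integrable_cong_AE[OF f g' ae])
  then show "integrable lebesgue f \<longleftrightarrow> integrable lborel g" by (simp add: integrable_completion[OF g])
qed

lemma Lp_iff: "f \<in> Lp p \<longleftrightarrow> (\<exists>f'. lp p f' \<and> (AE x in lborel. f x = f' x))"
proof
  assume f: "f \<in> Lp p"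
  then obtain f' where f': "f' \<in> borel_measurable borel" "AE x in lborel. f x = f' x"
    using borel_representative[of f] by (auto simp: Lp_def)
  have "AE x in lborel. norm (f x) powr p = norm (f' x) powr p" using f'(2) by eventually_elim simp
  then have "integrable lborel (\<lambda>x. norm (f' x) powr p)"
    using f f'(1) by (subst lebesgue_integral_AE(2)[symmetric, of "\<lambda>x. norm (f x) powr p"]) (auto simp: Lp_def)
  then show "\<exists>f'. lp p f' \<and> (AE x in lborel. f x = f' x)" using f' by (auto simp: lp_integrable)
next
  assume "\<exists>f'. lp p f' \<and> (AE x in lborel. f x = f' x)"
  then obtain f' where f': "lp p f'" "AE x in lborel. f x = f' x" by blast
  have m[measurable]: "f' \<in> borel_measurable borel" using f'(1) by (rule lp_measurable)
  have "AE x in lborel. norm (f x) powr p = norm (f' x) powr p" using f'(2) by eventually_elim simp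
  then have "integrable lebesgue (\<lambda>x. norm (f x) powr p)"
    using f'(1) by (subst lebesgue_integral_AE(2)) (auto simp: lp_integrable)
  then show "f \<in> Lp p" using lebesgue_measurable_AE[OF f'(2) m] by (simp add: Lp_def)
qed

section \<open>Boundary functions characterised by the Cauchy integral\<close>

lemma half_plane_1: "half_plane 1 = upper 0"
  by (simp add: half_plane_def upper_def)

definition upper_hardy :: "real \<Rightarrow> (real \<Rightarrow> complex) \<Rightarrow> bool" where
  "upper_hardy p h \<longleftrightarrow> lp p h \<and> (\<forall>w. Im w < 0 \<longrightarrow> cauchy h w = 0)"

text \<open>For one direction, \<open>hardy_representation\<close> makes the Cauchy integral of a
  boundary function vanish below. For the other, this vanishing turns \<open>cauchy h\<close> into
  the Poisson integral of \<open>h\<close>, which is bounded by the norm of \<open>h\<close> on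
  every line and has \<open>h\<close> as nontangential limit.\<close>

lemma hardy_boundary_iff:
  assumes p: "1 < p"
  shows "f \<in> hardy_boundary 1 p \<longleftrightarrow> (\<exists>h. upper_hardy p h \<and> (AE x in lborel. f x = h x))"
proof
  assume "f \<in> hardy_boundary 1 p"
  then obtain F where f: "f \<in> Lp p" and F: "F \<in> hardy 1 p" and l: "AE x in lborel. has_nontangential_limit 1 F x (f x)"
    by (auto simp: hardy_boundary_def AE_completion_iff)
  obtain h where h: "lp p h" "AE x in lborel. f x = h x" using f by (auto simp: Lp_iff)
  have hol: "F holomorphic_on upper 0" using F by (simp add: hardy_def half_plane_1)
  define M where "M = (SUP y\<in>{0<..}. \<integral>\<^sup>+ x. ennreal (norm (F (Complex x (1 * y))) powr p) \<partial>lebesgue)"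
  have M: "M < \<infinity>" using F by (simp add: hardy_def M_def)
  have FM: "pnorm p (\<lambda>x. F (Complex x y)) \<le> M" if "0 < y" for y
  proof -
    have "(\<integral>\<^sup>+ x. ennreal (norm (F (Complex x (1 * y))) powr p) \<partial>lebesgue) \<le> M"
      unfolding M_def by (rule SUP_upper) (use that in simp)
    then show ?thesis by (simp add: pnorm_def nn_integral_completion)
  qed
  have lim: "AE x in lborel. ((\<lambda>y. F (Complex x y)) \<longlongrightarrow> h x) (at_right 0)"
    using l h(2) by eventually_elim (auto dest: nontangential_vertical)
  have "upper_hardy p h" unfolding upper_hardy_def
    using h(1) hardy_representation(2)[OF hol p FM M h(1) lim] by blast
  with h(2) show "\<exists>h. upper_hardy p h \<and> (AE x in lborel. f x = h x)" by blast
next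
  assume "\<exists>h. upper_hardy p h \<and> (AE x in lborel. f x = h x)"
  then obtain h where h: "lp p h" "\<And>w. Im w < 0 \<Longrightarrow> cauchy h w = 0" "AE x in lborel. f x = h x"
    by (auto simp: upper_hardy_def)
  have P: "poisson h z = cauchy h z" if "0 < Im z" for z
    using poisson_cauchy[OF h(1) p that] h(2)[of "cnj z"] that by simp
  have "cauchy h \<in> hardy 1 p"
  proof -
    have "(SUP y\<in>{0<..}. \<integral>\<^sup>+ x. ennreal (norm (cauchy h (Complex x (1 * y))) powr p) \<partial>lebesgue) \<le> pnorm p h"
    proof (rule SUP_least)
      fix y :: real assume "y \<in> {0<..}"
      then have "pnorm p (\<lambda>x. cauchy h (Complex x y)) \<le> pnorm p h"
        using poisson_contraction[OF h(1) p, of y] P by simp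
      then show "(\<integral>\<^sup>+ x. ennreal (norm (cauchy h (Complex x (1 * y))) powr p) \<partial>lebesgue) \<le> pnorm p h"
        by (simp add: pnorm_def nn_integral_completion)
    qed
    also have "\<dots> < \<infinity>" using h(1) by (rule lp_pnorm)
    finally show ?thesis using cauchy_holomorphic[OF h(1) p] by (simp add: hardy_def half_plane_1)
  qed
  moreover have "AE x in lborel. has_nontangential_limit 1 (cauchy h) x (f x)"
    using poisson_nontangential_AE[OF h(1) p] h(3)
  proof eventually_elim
    case (elim x)
    then show ?case using nontangential_cong[of 1 "poisson h" x "f x" "cauchy h"] P by (simp add: half_plane_1 upper_def)
  qed
  moreover have "f \<in> Lp p" using h by (auto simp: Lp_iff)
  ultimately show "f \<in> hardy_boundary 1 p" by (auto simp: hardy_boundary_def AE_completion_iff)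
qed

text \<open>Reflection: F is replaced by cnj (F (cnj z)), and the cones at x are reflected into each
  other. Stated for a general sign, so that it yields both directions of
  \<open>hardy_boundary_lower_iff\<close>.\<close>

lemma hardy_boundary_cnj_imp:
  assumes "f \<in> hardy_boundary s p"
  shows "(\<lambda>x. cnj (f x)) \<in> hardy_boundary (- s) p"
proof -
  obtain F where f: "f \<in> Lp p" and F: "F \<in> hardy s p" and l: "AE x in lebesgue. has_nontangential_limit s F x (f x)"
    using assms by (auto simp: hardy_boundary_def)
  define G where "G = (\<lambda>z. cnj (F (cnj z)))"
  have cm: "(\<lambda>x. cnj (f x)) \<in> borel_measurable lebesgue"
    using f by (intro borel_measurable_continuous_on[of cnj f]) (auto simp: Lp_def intro: continuous_intros)
  have hp: "cnj ` half_plane (- s) = half_plane s" and op: "open (half_plane r)" for r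
  proof -
    have "z \<in> cnj ` half_plane (- s)" if "z \<in> half_plane s" for z
      using that by (intro image_eqI[of _ _ "cnj z"]) (auto simp: half_plane_def)
    then show "cnj ` half_plane (- s) = half_plane s" by (auto simp: half_plane_def)
    show "open (half_plane r)" unfolding half_plane_def by (intro open_Collect_less continuous_intros)
  qed
  have "cnj \<circ> F \<circ> cnj holomorphic_on half_plane (- s)"
    using F by (intro holomorphic_on_compose_cnj_cnj op) (simp add: hp hardy_def)
  then have "G holomorphic_on half_plane (- s)" by (simp add: G_def o_def)
  moreover have "norm (G (Complex x (- s * y))) = norm (F (Complex x (s * y)))" for x y
    unfolding G_def complex_mod_cnj by (simp add: complex_cnj)
  ultimately have "G \<in> hardy (- s) p" using F by (simp add: hardy_def)
  moreover have "has_nontangential_limit (- s) G x (cnj (f x))" if l: "has_nontangential_limit s F x (f x)" for x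
    unfolding has_nontangential_limit_def
  proof (intro allI impI)
    fix \<alpha> :: real assume "0 < \<alpha>"
    then have F: "(F \<longlongrightarrow> f x) (at (complex_of_real x) within stolz_cone s \<alpha> x)"
      using l by (simp add: has_nontangential_limit_def)
    have "filterlim cnj (at (complex_of_real x) within stolz_cone s \<alpha> x) (at (complex_of_real x) within stolz_cone (- s) \<alpha> x)"
      unfolding filterlim_at
    proof
      have "(cnj \<longlongrightarrow> cnj (complex_of_real x)) (at (complex_of_real x) within stolz_cone (- s) \<alpha> x)"
        by (intro tendsto_intros)
      then show "(cnj \<longlongrightarrow> complex_of_real x) (at (complex_of_real x) within stolz_cone (- s) \<alpha> x)" by simp
      show "\<forall>\<^sub>F z in at (complex_of_real x) within stolz_cone (- s) \<alpha> x. cnj z \<in> stolz_cone s \<alpha> x \<and> cnj z \<noteq> complex_of_real x"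
        by (auto simp: eventually_at_filter stolz_cone_def half_plane_def complex_eq_iff)
    qed
    from tendsto_cnj[OF filterlim_compose[OF F this]]
    show "(G \<longlongrightarrow> cnj (f x)) (at (complex_of_real x) within stolz_cone (- s) \<alpha> x)" by (simp add: G_def)
  qed
  then have "AE x in lebesgue. has_nontangential_limit (- s) G x (cnj (f x))" using l by (auto elim: eventually_mono)
  moreover have "(\<lambda>x. cnj (f x)) \<in> Lp p" using f cm by (simp add: Lp_def)
  ultimately show ?thesis by (auto simp: hardy_boundary_def)
qed

lemma hardy_boundary_lower_iff: "f \<in> hardy_boundary (- 1) p \<longleftrightarrow> (\<lambda>x. cnj (f x)) \<in> hardy_boundary 1 p"
  using hardy_boundary_cnj_imp[of f "- 1" p] hardy_boundary_cnj_imp[of "\<lambda>x. cnj (f x)" 1 p] by auto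

section \<open>Sobolev spaces\<close>

text \<open>The integral identity alone, for Borel representatives; for L^p functions
  \<open>Lp_locally_integrable\<close> supplies the rest of \<open>has_weak_deriv\<close>.\<close>

definition weak_deriv_lborel :: "nat \<Rightarrow> (real \<Rightarrow> complex) \<Rightarrow> (real \<Rightarrow> complex) \<Rightarrow> bool" where
  "weak_deriv_lborel k f g \<longleftrightarrow> (\<forall>\<phi>. test_function \<phi> \<longrightarrow>
     (\<integral>x. f x * of_real ((deriv ^^ k) \<phi> x) \<partial>lborel) = (-1) ^ k * (\<integral>x. g x * of_real (\<phi> x) \<partial>lborel))"

lemma Lp_locally_integrable:
  assumes f: "f \<in> Lp p" and p: "1 \<le> p"
  shows "locally_integrable f"
  unfolding locally_integrable_def set_integrable_def
proof (intro allI impI)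
  fix K :: "real set" assume K: "compact K"
  have [measurable]: "K \<in> sets borel" using K by (simp add: compact_imp_closed)
  obtain f' where f': "lp p f'" "AE x in lborel. f x = f' x" using f by (auto simp: Lp_iff)
  have [measurable]: "f' \<in> borel_measurable borel" using f'(1) by (rule lp_measurable)
  have "integrable lborel (\<lambda>x. indicator K x *\<^sub>R f' x)"
  proof (rule Bochner_Integration.integrable_bound)
    show "integrable lborel (\<lambda>x. indicator K x + norm (f' x) powr p)"
      using f'(1) emeasure_compact_finite[OF K] by (auto simp: lp_integrable)
    show "AE x in lborel. norm (indicator K x *\<^sub>R f' x) \<le> norm (indicator K x + norm (f' x) powr p)"
      using le_one_plus_powr[OF norm_ge_zero p] by (intro AE_I2) (auto simp: indicator_def)
  qed measurable
  moreover have "AE x in lborel. indicator K x *\<^sub>R f x = indicator K x *\<^sub>R f' x"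
    using f'(2) by eventually_elim simp
  ultimately show "integrable lebesgue (\<lambda>x. indicator K x *\<^sub>R f x)"
    by (subst lebesgue_integral_AE(2)) auto
qed

lemma has_weak_deriv_iff:
  assumes p: "1 \<le> p" and f: "lp p f'" "AE x in lborel. f x = f' x" and g: "lp p g'" "AE x in lborel. g x = g' x"
  shows "has_weak_deriv k f g \<longleftrightarrow> weak_deriv_lborel k f' g'"
proof -
  have "f \<in> Lp p" "g \<in> Lp p" using f g by (auto simp: Lp_iff)
  then have li: "locally_integrable f" "locally_integrable g" using p by (auto intro: Lp_locally_integrable)
  have e: "(LINT x|lebesgue. h x * of_real (\<phi> x)) = (\<integral>x. h' x * of_real (\<phi> x) \<partial>lborel)"
    if "lp p h'" "AE x in lborel. h x = h' x" "test_function \<phi>" for h h' \<phi>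
  proof (rule lebesgue_integral_AE)
    note [measurable] = lp_measurable[OF that(1)] test_function_measurable[OF that(3)]
    show "(\<lambda>x. h' x * of_real (\<phi> x)) \<in> borel_measurable borel" by measurable
    show "AE x in lborel. h x * of_real (\<phi> x) = h' x * of_real (\<phi> x)" using that(2) by eventually_elim simp
  qed
  show ?thesis unfolding has_weak_deriv_def weak_deriv_lborel_def
    using li e[OF f test_function_higher_deriv] e[OF g] by simp
qed

lemma locally_integrable_test:
  assumes g: "locally_integrable g" and \<phi>: "test_function \<phi>"
  shows "integrable lebesgue (\<lambda>x. g x * of_real (\<phi> x))"
proof -
  obtain N :: real where N: "0 < N" "\<forall>x. N < \<bar>x\<bar> \<longrightarrow> \<phi> x = 0 \<and> deriv \<phi> x = 0"
    using test_function_support[OF \<phi>] by blast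
  have "bounded (\<phi> ` {- N..N})"
    by (intro compact_imp_bounded compact_continuous_image test_function_continuous[OF \<phi>]) auto
  then obtain B where B: "0 < B" "\<And>x. x \<in> {- N..N} \<Longrightarrow> \<bar>\<phi> x\<bar> \<le> B" by (auto simp: bounded_pos)
  have i: "integrable lebesgue (\<lambda>x. indicator {- N..N} x *\<^sub>R g x)"
    using g by (auto simp: locally_integrable_def set_integrable_def)
  have \<phi>m: "\<phi> \<in> borel_measurable lebesgue"
    using test_function_measurable[OF \<phi>] by (intro measurable_completion) simp
  have e: "g x * of_real (\<phi> x) = (indicator {- N..N} x *\<^sub>R g x) * of_real (\<phi> x)" for x
    using N(2)[rule_format, of x] by (auto simp: indicator_def abs_le_iff not_le)
  show ?thesis
  proof (rule Bochner_Integration.integrable_bound)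
    show "integrable lebesgue (\<lambda>x. B *\<^sub>R (indicator {- N..N} x *\<^sub>R g x))" using i by (rule integrable_scaleR_right)
    show "(\<lambda>x. g x * of_real (\<phi> x)) \<in> borel_measurable lebesgue"
      unfolding e using borel_measurable_integrable[OF i] \<phi>m by measurable
    show "AE x in lebesgue. norm (g x * of_real (\<phi> x)) \<le> norm (B *\<^sub>R (indicator {- N..N} x *\<^sub>R g x))"
    proof (intro AE_I2)
      fix x
      show "norm (g x * of_real (\<phi> x)) \<le> norm (B *\<^sub>R (indicator {- N..N} x *\<^sub>R g x))"
      proof (cases "x \<in> {- N..N}")
        case True
        then show ?thesis using mult_left_mono[OF B(2)[OF True] norm_ge_zero[of "g x"]] B(1) by (simp add: norm_mult mult.commute)
      next
        case False
        then show ?thesis unfolding e by simp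
      qed
    qed
  qed
qed

section \<open>Uniqueness of weak derivatives\<close>

text \<open>Where |t - x| < d, the quantity (t - x)^2 + d^2 is at most 2 d^2, so 2 pi d times the
  kernel is at least 1 and thus exceeds the bump.\<close>

lemma bump_le_poisson_ker: "0 < d \<Longrightarrow> bump x d t \<le> 2 * pi * d * poisson_ker (Complex x d) t"
proof -
  assume d: "0 < d"
  show ?thesis
  proof (cases "d \<le> \<bar>t - x\<bar>")
    case True
    then show ?thesis using bump_eq_0[OF d True] d poisson_ker_nonneg[of "Complex x d" t] by simp
  next
    case False
    then have "(t - x)\<^sup>2 \<le> d\<^sup>2" using d by (intro abs_le_square_iff[THEN iffD1]) auto
    moreover have "0 < (t - x)\<^sup>2 + d\<^sup>2" using d by (intro add_nonneg_pos) auto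
    ultimately have "1 \<le> 2 * d\<^sup>2 / ((t - x)\<^sup>2 + d\<^sup>2)" by (simp add: pos_le_divide_eq)
    also have "\<dots> = 2 * pi * d * poisson_ker (Complex x d) t" by (simp add: poisson_ker_Complex power2_eq_square)
    finally show ?thesis using bump_le_1[of x d t] by linarith
  qed
qed

text \<open>Within half the radius the argument of \<open>flat_exp\<close> is at least 3/4, hence
  the constant exp (-4/3).\<close>

lemma bump_ge: "0 < d \<Longrightarrow> exp (- (4 / 3)) * indicator {x - d / 2..x + d / 2} t \<le> bump x d t"
proof -
  assume d: "0 < d"
  show ?thesis
  proof (cases "t \<in> {x - d / 2..x + d / 2}")
    case True
    then have "\<bar>t - x\<bar> \<le> d / 2" unfolding atLeastAtMost_iff abs_le_iff by linarith
    then have "\<bar>(t - x) / d\<bar> \<le> \<bar>1 / 2\<bar>" using d by (simp add: abs_divide)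
    then have "((t - x) / d)\<^sup>2 \<le> (1 / 2)\<^sup>2" by (rule abs_le_square_iff[THEN iffD1])
    then have "((t - x) / d)\<^sup>2 \<le> 1 / 4" by (simp add: power2_eq_square)
    then have s: "3 / 4 \<le> 1 - ((t - x) / d)\<^sup>2" by simp
    then have "1 / (1 - ((t - x) / d)\<^sup>2) \<le> 1 / (3 / 4)" by (intro divide_left_mono) auto
    moreover have "0 < 1 - ((t - x) / d)\<^sup>2" using s by linarith
    ultimately show ?thesis using True by (simp add: bump_def flat_exp_def)
  next
    case False
    then show ?thesis using bump_nonneg[of x d t] by simp
  qed
qed

lemma bump_integral:
  assumes d: "0 < d"
  shows "integrable lborel (bump x d)" "exp (- (4 / 3)) * d \<le> (\<integral>t. bump x d t \<partial>lborel)"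
proof -
  show i: "integrable lborel (bump x d)"
  proof (rule Bochner_Integration.integrable_bound)
    show "integrable lborel (\<lambda>t. 2 * pi * d * poisson_ker (Complex x d) t)" using poisson_ker_integrable[of "Complex x d"] d by simp
    show "AE t in lborel. norm (bump x d t) \<le> norm (2 * pi * d * poisson_ker (Complex x d) t)"
      using bump_le_poisson_ker[OF d] bump_nonneg by (intro AE_I2) (simp add: order_trans[OF _ abs_ge_self])
  qed (use smooth_measurable[OF bump_smooth] in simp)
  have "exp (- (4 / 3)) * d = (\<integral>t. exp (- (4 / 3)) * indicator {x - d / 2..x + d / 2} t \<partial>lborel)"
    using d by simp
  also have "\<dots> \<le> (\<integral>t. bump x d t \<partial>lborel)"
    using d by (intro integral_mono i bump_ge) auto
  finally show "exp (- (4 / 3)) * d \<le> (\<integral>t. bump x d t \<partial>lborel)" .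
qed

text \<open>A bump of width \<open>d\<close> is at most a multiple of the Poisson kernel at height \<open>d\<close>, so Lebesgue points suffice.\<close>

lemma vanishing_on_bumps:
  assumes h: "integrable lborel h" and z: "\<And>x d. 0 < d \<Longrightarrow> \<bar>x\<bar> + d < N \<Longrightarrow> (\<integral>t. h t * of_real (bump x d t) \<partial>lborel) = 0"
  shows "AE x in lborel. \<bar>x\<bar> < N \<longrightarrow> h x = (0 :: complex)"
proof -
  have hm[measurable]: "h \<in> borel_measurable borel" using borel_measurable_integrable[OF h] by simp
  have "lp 1 h" unfolding lp_integrable using h by (auto simp: powr_one)
  then have "AE x in lborel. (poisson_osc h x \<longlongrightarrow> 0) (at_right 0)" by (rule poisson_osc_tendsto_AE) simp
  then show ?thesis
  proof eventually_elim
    fix x assume o: "(poisson_osc h x \<longlongrightarrow> 0) (at_right 0)"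
    show "\<bar>x\<bar> < N \<longrightarrow> h x = 0"
    proof
      assume x: "\<bar>x\<bar> < N"
      define c where "c = exp (- (4 / 3) :: real)"
      have c: "0 < c" by (simp add: c_def)
      have bd: "ennreal (norm (h x) * c) \<le> ennreal (2 * pi) * poisson_osc h x d" if d: "0 < d" "\<bar>x\<bar> + d < N" for d
      proof -
        note [measurable] = smooth_measurable[OF bump_smooth[of x d]]
        note b = bump_integral[OF d(1), of x]
        have bi: "integrable lborel (\<lambda>t. h x * of_real (bump x d t))" using b(1) by (intro integrable_mult_right integrable_of_real)
        have hb: "integrable lborel (\<lambda>t. h t * of_real (bump x d t))"
        proof (rule Bochner_Integration.integrable_bound[OF h])
          show "AE t in lborel. norm (h t * of_real (bump x d t)) \<le> norm (h t)"
            using bump_le_1[of x d] bump_nonneg[of x d] by (intro AE_I2) (simp add: norm_mult mult_left_le)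
        qed measurable
        have "(\<integral>t. (h t - h x) * of_real (bump x d t) \<partial>lborel) = (\<integral>t. h t * of_real (bump x d t) \<partial>lborel) - h x * of_real (\<integral>t. bump x d t \<partial>lborel)"
          using hb bi by (simp add: left_diff_distrib)
        also have "\<dots> = - (h x * of_real (\<integral>t. bump x d t \<partial>lborel))" using z[OF d] by simp
        finally have e: "(\<integral>t. (h t - h x) * of_real (bump x d t) \<partial>lborel) = - (h x * of_real (\<integral>t. bump x d t \<partial>lborel))" .
        have b0: "0 \<le> c * d" using c d by simp
        then have "norm (h x) * (c * d) \<le> norm (\<integral>t. (h t - h x) * of_real (bump x d t) \<partial>lborel)"
          unfolding e norm_minus_cancel norm_mult norm_of_real using b(2) by (intro mult_left_mono) (auto simp: c_def)
        then have "ennreal (norm (h x) * (c * d)) \<le> ennreal (norm (\<integral>t. (h t - h x) * of_real (bump x d t) \<partial>lborel))" by (rule ennreal_leI)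
        also have "\<dots> \<le> (\<integral>\<^sup>+t. ennreal (norm ((h t - h x) * of_real (bump x d t))) \<partial>lborel)"
          using hb bi by (intro integral_norm_bound_ennreal) (simp add: left_diff_distrib)
        also have "\<dots> \<le> (\<integral>\<^sup>+t. ennreal (2 * pi * d) * (ennreal (norm (h t - h x)) * ennreal (poisson_ker (Complex x d) t)) \<partial>lborel)"
        proof (intro nn_integral_mono)
          fix t
          have p0: "0 \<le> poisson_ker (Complex x d) t" using d by (intro poisson_ker_nonneg) simp
          have "norm ((h t - h x) * of_real (bump x d t)) \<le> norm (h t - h x) * (2 * pi * d * poisson_ker (Complex x d) t)"
            unfolding norm_mult norm_of_real using bump_le_poisson_ker[OF d(1), of x t] bump_nonneg[of x d t] by (intro mult_left_mono) auto
          also have "\<dots> = 2 * pi * d * (norm (h t - h x) * poisson_ker (Complex x d) t)" by simp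
          finally have "ennreal (norm ((h t - h x) * of_real (bump x d t))) \<le> ennreal (2 * pi * d * (norm (h t - h x) * poisson_ker (Complex x d) t))" by (rule ennreal_leI)
          also have "\<dots> = ennreal (2 * pi * d) * (ennreal (norm (h t - h x)) * ennreal (poisson_ker (Complex x d) t))"
            using d p0 by (subst ennreal_mult, simp, simp, subst ennreal_mult) auto
          finally show "ennreal (norm ((h t - h x) * of_real (bump x d t))) \<le> ennreal (2 * pi * d) * (ennreal (norm (h t - h x)) * ennreal (poisson_ker (Complex x d) t))" .
        qed
        also have "\<dots> = ennreal (2 * pi * d) * poisson_osc h x d" unfolding poisson_osc_def by (rule nn_integral_cmult) measurable
        \<comment> \<open>The mass of the bump, at least c d, and the Poisson bound with its factor
          2 pi d both scale with d. Division by d leaves a bound by the oscillation alone, which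
          tends to 0.\<close>
        finally have "ennreal (1 / d) * ennreal (norm (h x) * (c * d)) \<le> ennreal (1 / d) * (ennreal (2 * pi * d) * poisson_osc h x d)"
          by (rule mult_left_mono) simp
        moreover have "ennreal (1 / d) * ennreal (norm (h x) * (c * d)) = ennreal (norm (h x) * c)"
          using d c by (subst ennreal_mult[symmetric]) auto
        moreover have "ennreal (1 / d) * (ennreal (2 * pi * d) * poisson_osc h x d) = ennreal (2 * pi) * poisson_osc h x d"
          using d by (subst mult.assoc[symmetric], subst ennreal_mult[symmetric]) auto
        ultimately show ?thesis by simp
      qed
      have "ennreal (norm (h x) * c) \<le> ennreal (2 * pi) * 0"
      proof (rule tendsto_lowerbound)
        show "((\<lambda>d. ennreal (2 * pi) * poisson_osc h x d) \<longlongrightarrow> ennreal (2 * pi) * 0) (at_right 0)"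
          by (rule ennreal_tendsto_cmult[OF _ o]) simp
        have "0 < N - \<bar>x\<bar>" using x by simp
        from eventually_at_right_real[OF this]
        show "\<forall>\<^sub>F d in at_right 0. ennreal (norm (h x) * c) \<le> ennreal (2 * pi) * poisson_osc h x d"
          by eventually_elim (rule bd, auto)
      qed simp
      then show "h x = 0" using c by (simp add: ennreal_le_iff mult_le_0_iff ennreal_eq_0_iff)
    qed
  qed
qed

text \<open>The difference of two weak derivatives annihilates all test functions, in particular all
  bumps. This makes the choice in \<open>weak_deriv\<close> harmless.\<close>

lemma weak_deriv_unique:
  assumes "has_weak_deriv k f g1" "has_weak_deriv k f g2"
  shows "AE x in lborel. g1 x = g2 x"
proof -
  have li: "locally_integrable g1" "locally_integrable g2" using assms by (auto simp: has_weak_deriv_def)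
  have eq: "(LINT x|lebesgue. (g1 x - g2 x) * of_real (\<phi> x)) = 0" if \<phi>: "test_function \<phi>" for \<phi>
  proof -
    have "(-1) ^ k * (LINT x|lebesgue. g1 x * of_real (\<phi> x)) = (-1) ^ k * (LINT x|lebesgue. g2 x * of_real (\<phi> x))"
    proof -
      have "(LINT x|lebesgue. f x * of_real ((deriv ^^ k) \<phi> x)) = (-1) ^ k * (LINT x|lebesgue. g1 x * of_real (\<phi> x))"
        using assms(1) \<phi> by (simp only: has_weak_deriv_def)
      moreover have "(LINT x|lebesgue. f x * of_real ((deriv ^^ k) \<phi> x)) = (-1) ^ k * (LINT x|lebesgue. g2 x * of_real (\<phi> x))"
        using assms(2) \<phi> by (simp only: has_weak_deriv_def)
      ultimately show ?thesis by (simp only:)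
    qed
    then show ?thesis using locally_integrable_test[OF li(1) \<phi>] locally_integrable_test[OF li(2) \<phi>]
      by (simp add: left_diff_distrib)
  qed
  have main: "AE x in lborel. \<bar>x\<bar> < real N \<longrightarrow> g1 x = g2 x" for N :: nat
  proof -
    \<comment> \<open>The difference is only locally integrable, so it is cut off to [-N, N]; bumps
      supported inside do not notice the cutoff.\<close>
    define h where "h = (\<lambda>x. indicator {- real N..real N} x *\<^sub>R (g1 x - g2 x))"
    have hi: "integrable lebesgue h"
      using li by (auto simp: h_def locally_integrable_def set_integrable_def scaleR_diff_right)
    obtain h' where h': "h' \<in> borel_measurable borel" "AE x in lborel. h x = h' x"
      using borel_representative[OF borel_measurable_integrable[OF hi]] by blast
    have "integrable lborel h'" using lebesgue_integral_AE(2)[OF h'(2,1)] hi by simp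
    then have "AE x in lborel. \<bar>x\<bar> < real N \<longrightarrow> h' x = 0"
    proof (rule vanishing_on_bumps)
      fix x d :: real assume d: "0 < d" "\<bar>x\<bar> + d < real N"
      note [measurable] = h'(1) smooth_measurable[OF bump_smooth[of x d]]
      have "(\<integral>t. h' t * of_real (bump x d t) \<partial>lborel) = (LINT t|lebesgue. h t * of_real (bump x d t))"
        by (rule lebesgue_integral_AE(1)[symmetric]) (use h'(2) in \<open>auto elim: eventually_mono\<close>)
      also have "\<dots> = (LINT t|lebesgue. (g1 t - g2 t) * of_real (bump x d t))"
      proof (intro Bochner_Integration.integral_cong refl)
        fix t
        show "h t * of_real (bump x d t) = (g1 t - g2 t) * of_real (bump x d t)"
        proof (cases "t \<in> {- real N..real N}")
          case False
          then have "bump x d t = 0" using d by (intro bump_eq_0) auto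
          then show ?thesis by simp
        qed (simp add: h_def)
      qed
      also have "\<dots> = 0" by (rule eq[OF bump_test[OF d(1)]])
      finally show "(\<integral>t. h' t * of_real (bump x d t) \<partial>lborel) = 0" .
    qed
    with h'(2) show ?thesis by eventually_elim (auto simp: h_def indicator_def abs_less_iff)
  qed
  have "AE x in lborel. \<forall>N::nat. \<bar>x\<bar> < real N \<longrightarrow> g1 x = g2 x"
    using main by (subst AE_all_countable) blast
  then show ?thesis
  proof eventually_elim
    fix x assume *: "\<forall>N::nat. \<bar>x\<bar> < real N \<longrightarrow> g1 x = g2 x"
    obtain N :: nat where "\<bar>x\<bar> < real N" using reals_Archimedean2 by blast
    with * show "g1 x = g2 x" by blast
  qed
qed

section \<open>Towers of weak derivatives\<close>

text \<open>Borel representatives of a function and its derivatives, fixed once and for all, with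
  \<open>G 0\<close> standing for the function. Projection and conjugation then act on all
  derivatives together.\<close>

definition sobolev_tower :: "nat \<Rightarrow> real \<Rightarrow> (nat \<Rightarrow> real \<Rightarrow> complex) \<Rightarrow> bool" where
  "sobolev_tower n p G \<longleftrightarrow> (\<forall>k\<le>n. lp p (G k)) \<and> (\<forall>k\<in>{1..n}. weak_deriv_lborel k (G 0) (G k))"

lemma sobolev_iff:
  assumes p: "1 < p"
  shows "f \<in> sobolev n p \<longleftrightarrow> (\<exists>G. sobolev_tower n p G \<and> (AE x in lborel. f x = G 0 x))"
proof
  assume f: "f \<in> sobolev n p"
  then obtain f' where f': "lp p f'" "AE x in lborel. f x = f' x" by (auto simp: sobolev_def Lp_iff)
  have "\<forall>k. \<exists>g. k \<in> {1..n} \<longrightarrow> lp p g \<and> weak_deriv_lborel k f' g"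
  proof (intro allI)
    fix k
    show "\<exists>g. k \<in> {1..n} \<longrightarrow> lp p g \<and> weak_deriv_lborel k f' g"
    proof (cases "k \<in> {1..n}")
      case True
      then obtain g where g: "g \<in> Lp p" "has_weak_deriv k f g" using f unfolding sobolev_def by blast
      then obtain g' where g': "lp p g'" "AE x in lborel. g x = g' x" by (auto simp: Lp_iff)
      have "weak_deriv_lborel k f' g'" using has_weak_deriv_iff[OF _ f' g'] g(2) p by auto
      with g'(1) show ?thesis by blast
    qed blast
  qed
  from choice[OF this] obtain g where g: "\<forall>k. k \<in> {1..n} \<longrightarrow> lp p (g k) \<and> weak_deriv_lborel k f' (g k)" by blast
  have "sobolev_tower n p (\<lambda>k. if k = 0 then f' else g k)"
    using f' g by (auto simp: sobolev_tower_def)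
  with f'(2) show "\<exists>G. sobolev_tower n p G \<and> (AE x in lborel. f x = G 0 x)"
    by (intro exI[of _ "\<lambda>k. if k = 0 then f' else g k"]) simp
next
  assume "\<exists>G. sobolev_tower n p G \<and> (AE x in lborel. f x = G 0 x)"
  then obtain G where G: "sobolev_tower n p G" and f: "AE x in lborel. f x = G 0 x" by blast
  have lG: "lp p (G k)" if "k \<le> n" for k using G that by (simp add: sobolev_tower_def)
  have "\<exists>g\<in>Lp p. has_weak_deriv k f g" if k: "k \<in> {1..n}" for k
  proof
    show "G k \<in> Lp p" using lG[of k] k by (auto simp: Lp_iff)
    show "has_weak_deriv k f (G k)"
      using has_weak_deriv_iff[OF _ lG[of 0] f lG[of k], of "G k"] p k G by (auto simp: sobolev_tower_def)
  qed
  moreover have "f \<in> Lp p" using lG[of 0] f by (auto simp: Lp_iff)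
  ultimately show "f \<in> sobolev n p" by (simp add: sobolev_def)
qed

lemma test_mult_integrable:
  "lp p f \<Longrightarrow> 1 < p \<Longrightarrow> test_function \<phi> \<Longrightarrow> integrable lborel (\<lambda>x. f x * of_real (\<phi> x))"
  using conj_exp[of p] lp_mult_integrable lp_test_function by blast

lemma sobolev_tower_add:
  assumes p: "1 < p" and F: "sobolev_tower n p F" and G: "sobolev_tower n p G"
  shows "sobolev_tower n p (\<lambda>k x. F k x + G k x)"
proof -
  have l: "lp p (F k)" "lp p (G k)" if "k \<le> n" for k using F G that by (auto simp: sobolev_tower_def)
  have "weak_deriv_lborel k (\<lambda>x. F 0 x + G 0 x) (\<lambda>x. F k x + G k x)" if k: "k \<in> {1..n}" for k
    unfolding weak_deriv_lborel_def
  proof (intro allI impI)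
    fix \<phi> assume \<phi>: "test_function \<phi>"
    note i = test_mult_integrable[OF l(1) p] test_mult_integrable[OF l(2) p]
    have "(\<integral>x. F 0 x * of_real ((deriv ^^ k) \<phi> x) \<partial>lborel) = (-1) ^ k * (\<integral>x. F k x * of_real (\<phi> x) \<partial>lborel)"
      "(\<integral>x. G 0 x * of_real ((deriv ^^ k) \<phi> x) \<partial>lborel) = (-1) ^ k * (\<integral>x. G k x * of_real (\<phi> x) \<partial>lborel)"
      using F G k \<phi> unfolding sobolev_tower_def weak_deriv_lborel_def by blast+
    then show "(\<integral>x. (F 0 x + G 0 x) * of_real ((deriv ^^ k) \<phi> x) \<partial>lborel) = (-1) ^ k * (\<integral>x. (F k x + G k x) * of_real (\<phi> x) \<partial>lborel)"
      using i(1)[OF _ test_function_higher_deriv[OF \<phi>], of 0] i(2)[OF _ test_function_higher_deriv[OF \<phi>], of 0] i(1)[OF _ \<phi>, of k] i(2)[OF _ \<phi>, of k] k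
      by (simp add: distrib_right distrib_left)
  qed
  then show ?thesis using l p by (auto simp: sobolev_tower_def intro: lp_add)
qed

lemma sobolev_tower_cmult:
  assumes F: "sobolev_tower n p F"
  shows "sobolev_tower n p (\<lambda>k x. c * F k x)"
  using F unfolding sobolev_tower_def weak_deriv_lborel_def by (auto simp: mult.assoc intro: lp_cmult)

lemma sobolev_tower_cnj:
  assumes F: "sobolev_tower n p F"
  shows "sobolev_tower n p (\<lambda>k x. cnj (F k x))"
proof -
  have e: "(\<integral>x. cnj (f x) * of_real (\<phi> x) \<partial>lborel) = cnj (\<integral>x. f x * of_real (\<phi> x) \<partial>lborel)" for f and \<phi> :: "real \<Rightarrow> real"
    by (subst Bochner_Integration.integral_cnj[symmetric]) simp
  show ?thesis using F unfolding sobolev_tower_def weak_deriv_lborel_def e by (auto intro: lp_cnj)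
qed

text \<open>The identity of order k tested with deriv \<phi> and the identity of order k + 1 tested
  with \<phi> have the same left side.\<close>

lemma sobolev_tower_step:
  assumes G: "sobolev_tower n p G" and k: "k < n"
  shows "weak_deriv_on_tests (G k) (G (Suc k))"
  unfolding weak_deriv_on_tests_def
proof (intro allI impI)
  fix \<phi> assume \<phi>: "test_function \<phi>"
  have w: "(\<integral>x. G 0 x * of_real ((deriv ^^ j) \<psi> x) \<partial>lborel) = (-1) ^ j * (\<integral>x. G j x * of_real (\<psi> x) \<partial>lborel)"
    if "j \<le> n" "test_function \<psi>" for j \<psi>
  proof (cases "j = 0")
    case False
    then show ?thesis using G that by (auto simp: sobolev_tower_def weak_deriv_lborel_def)
  qed simp
  have "(-1) ^ k * (\<integral>x. G k x * of_real (deriv \<phi> x) \<partial>lborel) = (-1) ^ Suc k * (\<integral>x. G (Suc k) x * of_real (\<phi> x) \<partial>lborel)"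
    using w[of k "deriv \<phi>"] w[of "Suc k" \<phi>] k \<phi> test_function_deriv[OF \<phi>]
    by (simp add: funpow_Suc_right del: funpow.simps)
  then have "(-1) ^ k * (\<integral>x. G k x * of_real (deriv \<phi> x) \<partial>lborel) = (-1) ^ k * - (\<integral>x. G (Suc k) x * of_real (\<phi> x) \<partial>lborel)"
    by simp
  then show "(\<integral>x. G k x * of_real (deriv \<phi> x) \<partial>lborel) = - (\<integral>x. G (Suc k) x * of_real (\<phi> x) \<partial>lborel)"
    by (subst (asm) mult_left_cancel) auto
qed

text \<open>Induction on the order, with the induction hypothesis tested on deriv \<phi>. Together
  with \<open>sobolev_tower_step\<close> it identifies towers with chains of first
  derivatives.\<close>

lemma sobolev_tower_of_steps:
  assumes l: "\<And>k. k \<le> n \<Longrightarrow> lp p (H k)" and w: "\<And>k. k < n \<Longrightarrow> weak_deriv_on_tests (H k) (H (Suc k))"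
  shows "sobolev_tower n p H"
proof -
  have "k \<le> n \<Longrightarrow> weak_deriv_lborel k (H 0) (H k)" for k
  proof (induction k)
    case 0
    show ?case by (simp add: weak_deriv_lborel_def)
  next
    case (Suc k)
    show ?case unfolding weak_deriv_lborel_def
    proof (intro allI impI)
      fix \<phi> assume \<phi>: "test_function \<phi>"
      have "(\<integral>x. H 0 x * of_real ((deriv ^^ k) (deriv \<phi>) x) \<partial>lborel) = (-1) ^ k * (\<integral>x. H k x * of_real (deriv \<phi> x) \<partial>lborel)"
        using Suc test_function_deriv[OF \<phi>] by (simp add: weak_deriv_lborel_def)
      also have "(\<integral>x. H k x * of_real (deriv \<phi> x) \<partial>lborel) = - (\<integral>x. H (Suc k) x * of_real (\<phi> x) \<partial>lborel)"
        using w[of k] Suc.prems \<phi> by (simp add: weak_deriv_on_tests_def)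
      finally show "(\<integral>x. H 0 x * of_real ((deriv ^^ Suc k) \<phi> x) \<partial>lborel) = (-1) ^ Suc k * (\<integral>x. H (Suc k) x * of_real (\<phi> x) \<partial>lborel)"
        by (simp add: funpow_Suc_right del: funpow.simps)
    qed
  qed
  then show ?thesis using l by (auto simp: sobolev_tower_def)
qed

text \<open>Each derivative receives its own boundary function from \<open>cauchy_boundary\<close>.
  That these are again derivatives of one another is seen inside the half-plane, where the Cauchy
  integral commutes with differentiation, and is carried to the line by
  \<open>boundary_weak_deriv\<close>.\<close>

lemma sobolev_projection:
  assumes p: "1 < p" and G: "sobolev_tower n p G"
  obtains H where "sobolev_tower n p H" "upper_hardy p (H 0)" "\<And>z. 0 < Im z \<Longrightarrow> cauchy (G 0) z = poisson (H 0) z"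
proof -
  have lG: "lp p (G k)" if "k \<le> n" for k using G that by (simp add: sobolev_tower_def)
  have "\<forall>k. \<exists>h. k \<le> n \<longrightarrow> lp p h \<and> (\<forall>z. 0 < Im z \<longrightarrow> cauchy (G k) z = poisson h z)"
    using cauchy_boundary[OF lG p] by metis
  from choice[OF this] obtain H where H: "\<forall>k. k \<le> n \<longrightarrow> lp p (H k) \<and> (\<forall>z. 0 < Im z \<longrightarrow> cauchy (G k) z = poisson (H k) z)"
    by blast
  have lH: "lp p (H k)" and HG: "\<And>z. 0 < Im z \<Longrightarrow> cauchy (G k) z = poisson (H k) z" if "k \<le> n" for k
    using H that by auto
  have hol: "poisson (H k) holomorphic_on upper 0" if k: "k \<le> n" for k
    using cauchy_holomorphic[OF lG[OF k] p] by (rule holomorphic_transform) (use HG[OF k] in \<open>auto simp: upper_def\<close>)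
  have step: "weak_deriv_on_tests (H k) (H (Suc k))" if k: "k < n" for k
  proof (rule boundary_weak_deriv[OF p])
    fix z :: complex assume z: "0 < Im z"
    have "(cauchy (G k) has_field_derivative cauchy (G (Suc k)) z) (at z)"
      using k z by (intro cauchy_weak_deriv[OF lG lG p sobolev_tower_step[OF G k]]) auto
    then have "(poisson (H k) has_field_derivative cauchy (G (Suc k)) z) (at z)"
      by (rule has_field_derivative_transform_within_open[OF _ open_upper[of 0]])
         (use k z HG[of k] in \<open>auto simp: upper_def\<close>)
    then show "(poisson (H k) has_field_derivative poisson (H (Suc k)) z) (at z)"
      using HG[of "Suc k" z] k z by simp
  qed (use k in \<open>auto intro: lH hol\<close>)
  \<comment> \<open>\<open>poisson (H 0)\<close> agrees with a Cauchy integral and is therefore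
    holomorphic. So it is a Hardy function with boundary values \<open>H 0\<close>, and
    \<open>hardy_representation\<close> applies.\<close>
  have "upper_hardy p (H 0)"
    unfolding upper_hardy_def
  proof (intro conjI allI impI)
    show l0: "lp p (H 0)" by (rule lH) simp
    have hol0: "poisson (H 0) holomorphic_on upper 0" by (rule hol) simp
    have lim: "AE x in lborel. ((\<lambda>y. poisson (H 0) (Complex x y)) \<longlongrightarrow> H 0 x) (at_right 0)"
      using poisson_nontangential_AE[OF l0 p] by eventually_elim (rule nontangential_vertical)
    fix w :: complex assume "Im w < 0"
    moreover have "pnorm p (\<lambda>x. poisson (H 0) (Complex x y)) \<le> pnorm p (H 0)" if "0 < y" for y
      by (rule poisson_contraction[OF l0 p that])
    ultimately show "cauchy (H 0) w = 0"
      using hardy_representation(2)[OF hol0 p _ lp_pnorm[OF l0] l0 lim] by blast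
  qed
  moreover have "sobolev_tower n p H" by (rule sobolev_tower_of_steps) (use lH step in auto)
  ultimately show thesis using HG[of 0] by (intro that) auto
qed

text \<open>A Cauchy integral that vanishes on the lower half-plane has vanishing derivatives there,
  and these are the Cauchy integrals of the weak derivatives. The statement about cnj f serves the
  lower Hardy space.\<close>

lemma weak_deriv_upper_hardy:
  assumes p: "1 < p" and f: "f \<in> hardy_sobolev 1 n p" and k: "k \<le> n"
  obtains g where "upper_hardy p g" "AE x in lborel. weak_deriv k f x = g x" "AE x in lborel. weak_deriv k (\<lambda>x. cnj (f x)) x = cnj (g x)"
proof -
  obtain G where G: "sobolev_tower n p G" "AE x in lborel. f x = G 0 x"
    using f sobolev_iff[OF p] by (auto simp: hardy_sobolev_def)
  obtain h where h: "upper_hardy p h" "AE x in lborel. f x = h x"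
    using f hardy_boundary_iff[OF p] by (auto simp: hardy_sobolev_def)
  have lG: "lp p (G j)" if "j \<le> n" for j using G(1) that by (simp add: sobolev_tower_def)
  have "AE x in lborel. G 0 x = h x" using G(2) h(2) by eventually_elim simp
  then have "cauchy (G 0) w = cauchy h w" for w
    using lG[of 0] h(1) by (intro cauchy_cong_AE) (auto simp: upper_hardy_def lp_def)
  then have G0: "cauchy (G 0) w = 0" if "Im w < 0" for w using h(1) that by (simp add: upper_hardy_def)
  have low: "j \<le> n \<Longrightarrow> Im w < 0 \<Longrightarrow> cauchy (G j) w = 0" for j w
  proof (induction j arbitrary: w)
    case 0
    then show ?case by (intro G0)
  next
    case (Suc j)
    have "(cauchy (G j) has_field_derivative cauchy (G (Suc j)) w) (at w)"
      using Suc.prems by (intro cauchy_weak_deriv[OF lG lG p sobolev_tower_step[OF G(1)]]) auto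
    moreover have "((\<lambda>_. 0) has_field_derivative 0) (at w)" by simp
    then have "(cauchy (G j) has_field_derivative 0) (at w)"
      by (rule has_field_derivative_transform_within_open[where S = "{z. Im z < 0}"])
         (use Suc in \<open>auto simp: open_halfspace_Im_lt\<close>)
    ultimately show ?case by (rule DERIV_unique)
  qed
  \<comment> \<open>\<open>weak_deriv\<close> is a choice, so it matches a given tower only almost
    everywhere, by uniqueness; for k = 0 it is the function itself by definition.\<close>
  have wd: "AE x in lborel. weak_deriv k F x = T k x"
    if T: "sobolev_tower n p T" and F: "AE x in lborel. F x = T 0 x" for F T
  proof (cases "k = 0")
    case False
    have lT: "lp p (T j)" if "j \<le> n" for j using T that by (simp add: sobolev_tower_def)
    have "has_weak_deriv k F (T k)"
      using has_weak_deriv_iff[OF _ lT[of 0] F lT[of k], of "T k"] p k T False by (auto simp: sobolev_tower_def)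
    moreover from this have "has_weak_deriv k F (weak_deriv k F)"
      using False someI[of "has_weak_deriv k F" "T k"] by (simp add: weak_deriv_def)
    ultimately show ?thesis by (intro weak_deriv_unique)
  qed (use F in \<open>simp add: weak_deriv_def\<close>)
  show thesis
  proof
    show "upper_hardy p (G k)" using lG[OF k] low[OF k] by (simp add: upper_hardy_def)
    show "AE x in lborel. weak_deriv k f x = G k x" by (rule wd[OF G])
    show "AE x in lborel. weak_deriv k (\<lambda>x. cnj (f x)) x = cnj (G k x)"
      by (rule wd[OF sobolev_tower_cnj[OF G(1)]]) (use G(2) in \<open>auto elim: eventually_mono\<close>)
  qed
qed

section \<open>Subspaces and the decomposition\<close>

lemma fun_subspace_iff:
  "fun_subspace S \<longleftrightarrow> (\<lambda>x. 0) \<in> S \<and> (\<forall>f\<in>S. \<forall>g\<in>S. (\<lambda>x. f x + g x) \<in> S) \<and> (\<forall>c. \<forall>f\<in>S. (\<lambda>x. c * f x) \<in> S)"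
  by (simp add: fun_space.subspace_def zero_fun_def plus_fun_def fun_scale_def)

lemma lp_zero: "lp p (\<lambda>x. 0)"
  by (simp add: lp_def pnorm_def)

lemma upper_hardy_zero: "upper_hardy p (\<lambda>x. 0)"
  by (simp add: upper_hardy_def lp_zero cauchy_def)

lemma sobolev_tower_zero: "sobolev_tower n p (\<lambda>k x. 0)"
  by (simp add: sobolev_tower_def lp_zero weak_deriv_lborel_def)

lemma subspace_hardy_boundary:
  assumes p: "1 < p"
  shows "fun_subspace (hardy_boundary 1 p)" "fun_subspace (hardy_boundary (- 1) p)"
proof -
  show up: "fun_subspace (hardy_boundary 1 p)"
    unfolding fun_subspace_iff
  proof (intro conjI ballI allI)
    show "(\<lambda>x. 0) \<in> hardy_boundary 1 p"
      unfolding hardy_boundary_iff[OF p] using upper_hardy_zero by (intro exI[of _ "\<lambda>x. 0"]) auto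
  next
    fix f g assume "f \<in> hardy_boundary 1 p" "g \<in> hardy_boundary 1 p"
    then obtain u v where "upper_hardy p u" "AE x in lborel. f x = u x" "upper_hardy p v" "AE x in lborel. g x = v x"
      unfolding hardy_boundary_iff[OF p] by blast
    then show "(\<lambda>x. f x + g x) \<in> hardy_boundary 1 p"
      unfolding hardy_boundary_iff[OF p] using p
      by (intro exI[of _ "\<lambda>x. u x + v x"]) (auto simp: upper_hardy_def cauchy_add[of p] intro: lp_add)
  next
    fix c f assume "f \<in> hardy_boundary 1 p"
    then obtain u where "upper_hardy p u" "AE x in lborel. f x = u x"
      unfolding hardy_boundary_iff[OF p] by blast
    then show "(\<lambda>x. c * f x) \<in> hardy_boundary 1 p"
      unfolding hardy_boundary_iff[OF p]
      by (intro exI[of _ "\<lambda>x. c * u x"]) (auto simp: upper_hardy_def cauchy_cmult intro: lp_cmult elim: eventually_mono)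
  qed
  then show "fun_subspace (hardy_boundary (- 1) p)"
    unfolding fun_subspace_iff Ball_def hardy_boundary_lower_iff by simp
qed

lemma subspace_sobolev:
  assumes p: "1 < p"
  shows "fun_subspace (sobolev n p)"
  unfolding fun_subspace_iff
proof (intro conjI ballI allI)
  show "(\<lambda>x. 0) \<in> sobolev n p"
    unfolding sobolev_iff[OF p] using sobolev_tower_zero by (intro exI[of _ "\<lambda>k x. 0"]) auto
next
  fix f g assume "f \<in> sobolev n p" "g \<in> sobolev n p"
  then obtain F G where "sobolev_tower n p F" "AE x in lborel. f x = F 0 x" "sobolev_tower n p G" "AE x in lborel. g x = G 0 x"
    unfolding sobolev_iff[OF p] by blast
  then show "(\<lambda>x. f x + g x) \<in> sobolev n p"
    unfolding sobolev_iff[OF p] by (intro exI[of _ "\<lambda>k x. F k x + G k x"]) (auto intro: sobolev_tower_add[OF p])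
next
  fix c f assume "f \<in> sobolev n p"
  then obtain F where "sobolev_tower n p F" "AE x in lborel. f x = F 0 x"
    unfolding sobolev_iff[OF p] by blast
  then show "(\<lambda>x. c * f x) \<in> sobolev n p"
    unfolding sobolev_iff[OF p] by (intro exI[of _ "\<lambda>k x. c * F k x"]) (auto intro: sobolev_tower_cmult elim: eventually_mono)
qed

text \<open>The Cauchy integral of the common boundary function vanishes on both half-planes, hence
  so does its Poisson integral, whose vertical limits are f almost everywhere.\<close>

lemma hardy_boundary_Int:
  assumes p: "1 < p" and f: "f \<in> hardy_boundary 1 p" "f \<in> hardy_boundary (- 1) p"
  shows "AE x in lborel. f x = 0"
proof -
  obtain u where u: "lp p u" "\<And>w. Im w < 0 \<Longrightarrow> cauchy u w = 0" "AE x in lborel. f x = u x"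
    using f(1) unfolding hardy_boundary_iff[OF p] upper_hardy_def by blast
  obtain v where v: "lp p v" "\<And>w. Im w < 0 \<Longrightarrow> cauchy v w = 0" "AE x in lborel. cnj (f x) = v x"
    using f(2) unfolding hardy_boundary_lower_iff hardy_boundary_iff[OF p] upper_hardy_def by blast
  have "AE x in lborel. cnj (u x) = v x" using u(3) v(3) by eventually_elim simp
  then have cv: "cauchy (\<lambda>x. cnj (u x)) w = cauchy v w" for w
    using lp_measurable[OF lp_cnj[OF u(1)]] lp_measurable[OF v(1)] by (rule cauchy_cong_AE)
  have P: "poisson u z = 0" if z: "0 < Im z" for z
  proof -
    have "cnj (cauchy u z) = 0" using cauchy_cnj[of u "cnj z"] cv[of "cnj z"] v(2)[of "cnj z"] z by simp
    then show ?thesis using poisson_cauchy[OF u(1) p z] u(2)[of "cnj z"] z by simp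
  qed
  show ?thesis
    using poisson_nontangential_AE[OF u(1) p] u(3)
  proof eventually_elim
    case (elim x)
    have "\<forall>\<^sub>F y in at_right 0. poisson u (Complex x y) = 0"
      using eventually_at_right_less[of 0] by eventually_elim (simp add: P)
    then have "((\<lambda>y. poisson u (Complex x y)) \<longlongrightarrow> 0) (at_right 0)" by (rule tendsto_eventually)
    from tendsto_unique[OF _ nontangential_vertical[OF elim(1)] this] elim(2) show ?case by simp
  qed
qed

theorem theorem3p7:
  fixes p :: real and n :: nat
  assumes "1 < p"
  shows "ae_direct_sum (sobolev n p) (hardy_sobolev 1 n p) (hardy_sobolev (-1) n p) \<and>
    (p = 2 \<longrightarrow> (\<forall>f \<in> hardy_sobolev 1 n p. \<forall>g \<in> hardy_sobolev (-1) n p.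
      sobolev_inner n f g = 0))"
proof (intro conjI impI ballI)
  note p = assms
  have sub: "fun_subspace (hardy_sobolev s n p)" if "s = 1 \<or> s = - 1" for s
    unfolding hardy_sobolev_def using that subspace_hardy_boundary[OF p] subspace_sobolev[OF p]
    by (auto intro!: fun_space.subspace_inter)
  have add: "(\<lambda>x. f x + g x) \<in> sobolev n p" "(\<lambda>x. c * f x) \<in> sobolev n p"
    if "f \<in> sobolev n p" "g \<in> sobolev n p" for f g c
    using subspace_sobolev[OF p, of n] that unfolding fun_subspace_iff by blast+
  have "sobolev n p \<subseteq> hardy_sobolev 1 n p + hardy_sobolev (- 1) n p"
  proof
    fix f assume f: "f \<in> sobolev n p"
    then obtain G where G: "sobolev_tower n p G" "AE x in lborel. f x = G 0 x"
      unfolding sobolev_iff[OF p] by blast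
    obtain H where H: "sobolev_tower n p H" "upper_hardy p (H 0)" "\<And>z. 0 < Im z \<Longrightarrow> cauchy (G 0) z = poisson (H 0) z"
      using sobolev_projection[OF p G(1)] by blast
    obtain K where K: "sobolev_tower n p K" "upper_hardy p (K 0)" "\<And>z. 0 < Im z \<Longrightarrow> cauchy (\<lambda>x. cnj (G 0 x)) z = poisson (K 0) z"
      using sobolev_projection[OF p sobolev_tower_cnj[OF G(1)]] by blast
    have "lp p (G 0)" using G(1) by (simp add: sobolev_tower_def)
    then have "AE x in lborel. G 0 x = H 0 x + cnj (K 0 x)"
      using H(2) K(2) by (intro cauchy_decomposition[OF _ p _ H(3) _ K(3)]) (auto simp: upper_hardy_def)
    with G(2) have KA: "AE x in lborel. cnj (f x - H 0 x) = K 0 x" by eventually_elim simp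
    have Hs: "H 0 \<in> sobolev n p" unfolding sobolev_iff[OF p] using H(1) by auto
    then have "H 0 \<in> hardy_sobolev 1 n p"
      unfolding hardy_sobolev_def hardy_boundary_iff[OF p] Int_iff using H(2) by auto
    \<comment> \<open>\<open>ae_direct_sum\<close> demands an equality of sets of functions, so the
      second summand is the exact difference; the conjugate of \<open>K 0\<close> equals it only
      almost everywhere.\<close>
    moreover have "(\<lambda>x. f x - H 0 x) \<in> hardy_sobolev (- 1) n p"
    proof -
      have "(\<lambda>x. f x + (- 1) * H 0 x) \<in> sobolev n p" by (intro add[OF f] add(2)[OF Hs Hs])
      moreover have "(\<lambda>x. f x - H 0 x) \<in> hardy_boundary (- 1) p"
        unfolding hardy_boundary_lower_iff hardy_boundary_iff[OF p] using KA K(2) by blast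
      ultimately show ?thesis by (simp add: hardy_sobolev_def)
    qed
    ultimately show "f \<in> hardy_sobolev 1 n p + hardy_sobolev (- 1) n p"
      unfolding set_plus_def by (auto simp: fun_eq_iff intro!: bexI)
  qed
  moreover have "hardy_sobolev 1 n p + hardy_sobolev (- 1) n p \<subseteq> sobolev n p"
    unfolding set_plus_def using add(1) by (auto simp: hardy_sobolev_def plus_fun_def)
  moreover have "hardy_sobolev 1 n p \<inter> hardy_sobolev (- 1) n p \<subseteq> ae_zero"
    using hardy_boundary_Int[OF p] by (auto simp: hardy_sobolev_def ae_zero_def AE_completion_iff)
  moreover have "ae_zero \<subseteq> hardy_sobolev 1 n p \<inter> hardy_sobolev (- 1) n p"
  proof
    fix f assume "f \<in> ae_zero"
    then have f: "AE x in lborel. f x = 0" by (simp add: ae_zero_def AE_completion_iff)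
    have "f \<in> sobolev n p" unfolding sobolev_iff[OF p] using f sobolev_tower_zero by (intro exI[of _ "\<lambda>k x. 0"]) auto
    moreover have "f \<in> hardy_boundary 1 p"
      unfolding hardy_boundary_iff[OF p] using f upper_hardy_zero by (intro exI[of _ "\<lambda>x. 0"]) auto
    moreover have "f \<in> hardy_boundary (- 1) p"
      unfolding hardy_boundary_lower_iff hardy_boundary_iff[OF p] using f upper_hardy_zero
      by (intro exI[of _ "\<lambda>x. 0"]) (auto elim: eventually_mono)
    ultimately show "f \<in> hardy_sobolev 1 n p \<inter> hardy_sobolev (- 1) n p" by (simp add: hardy_sobolev_def)
  qed
  ultimately show "ae_direct_sum (sobolev n p) (hardy_sobolev 1 n p) (hardy_sobolev (- 1) n p)"
    unfolding ae_direct_sum_def using sub by auto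
next
  fix f g assume p2: "p = 2" and f: "f \<in> hardy_sobolev 1 n p" and g: "g \<in> hardy_sobolev (- 1) n p"
  note p = assms
  have gs: "(\<lambda>x. cnj (g x)) \<in> sobolev n p"
  proof -
    obtain G where "sobolev_tower n p G" "AE x in lborel. g x = G 0 x"
      using g unfolding hardy_sobolev_def Int_iff sobolev_iff[OF p] by blast
    then show ?thesis unfolding sobolev_iff[OF p]
      by (intro exI[of _ "\<lambda>k x. cnj (G k x)"]) (auto intro: sobolev_tower_cnj elim: eventually_mono)
  qed
  have g': "(\<lambda>x. cnj (g x)) \<in> hardy_sobolev 1 n p"
    using g gs by (auto simp: hardy_sobolev_def hardy_boundary_lower_iff)
  have "(LINT x|lebesgue. weak_deriv k f x * cnj (weak_deriv k g x)) = 0" if k: "k \<le> n" for k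
  proof -
    obtain u where u: "upper_hardy p u" "AE x in lborel. weak_deriv k f x = u x"
      using weak_deriv_upper_hardy[OF p f k] by blast
    obtain v where v: "upper_hardy p v" "AE x in lborel. weak_deriv k g x = cnj (v x)"
      using weak_deriv_upper_hardy[OF p g' k] by auto
    note [measurable] = lp_measurable[of p u] lp_measurable[of p v]
    have "(\<lambda>x. u x * v x) \<in> borel_measurable borel" using u(1) v(1) by (simp add: upper_hardy_def)
    moreover have "AE x in lborel. weak_deriv k f x * cnj (weak_deriv k g x) = u x * v x"
      using u(2) v(2) by eventually_elim simp
    ultimately have "(LINT x|lebesgue. weak_deriv k f x * cnj (weak_deriv k g x)) = (\<integral>x. u x * v x \<partial>lborel)"
      by (intro lebesgue_integral_AE)
    \<comment> \<open>The derivative of g is the conjugate of \<open>v\<close>, so the sesquilinear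
      product has become the bilinear pairing of two upper Hardy functions, with the conjugate
      exponents 2 and 2.\<close>
    also have "\<dots> = 0"
      using u(1) v(1) p2 by (intro hardy_pairing_zero[of 2 2]) (auto simp: upper_hardy_def)
    finally show ?thesis .
  qed
  then show "sobolev_inner n f g = 0" unfolding sobolev_inner_def by (intro sum.neutral) auto
qed

end
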